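(* Suppose that, for any $i\neq j$, the function $a^{\mathbb Q}_{i,j}$ is continuously differentiable in $(0,T)$ and satisfies $$0<\inf_{s\in[0,T]}|a^{\mathbb Q}_{i,j}(s)|\le \sup_{s\in[0,T]}|a^{\mathbb Q}_{i,j}(s)|<\infty\quad\text{and}\quad \sup_{s\in(0,T)}\left|\frac{d a^{\mathbb Q}_{i,j}(s)}{ds}\right|<\infty .$$ Then the pre-default dynamics (i.e. the dynamics up to the default time $\tau$, including the jump at default) of the defaultable bond price $p(t,T)$ under the historical measure $\mathbb P$ are $$dp(t,T)=p(t^-,T)\left\{\left[r_t+h_t(L_t-1)+D(t)\right]dt+\frac{\langle\psi(t),dM^{\mathbb P}(t)\rangle}{\langle\psi(t),X_{t^-}\rangle}-d\xi^{\mathbb P}_t\right\},$$ where $M^{\mathbb P}(t)=X_t-X_0-\int_0^tA'(s)X_s\,ds$ is an $N$-dimensional $(\mathbb F,\mathbb P)$-martingale, $\xi^{\mathbb P}_t=H(t)-\int_0^t(1-H(u^-))h_u\,du$ is a $(\mathbb G,\mathbb P)$-martingale, $\psi(t)=(\psi_1(t),\dots,\psi_N(t))'$ with $\psi_i(t)=\mathbb E^{\mathbb Q}\big[e^{-\int_t^T(r_s+h_sL_s)ds}\,\big|\,X_t=e_i\big]$, and $D(t):=\langle(D_1(t),\dots,D_N(t))',X_t\rangle$ with $$D_i(t):=\sum_{j=1}^N\left(a_{i,j}(t)-a^{\mathbb Q}_{i,j}(t)\right)\frac{\psi_j(t)}{\psi_i(t)}=\sum_{j\ne i}\left(a_{i,j}(t)-a^{\mathbb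 Q}_{i,j}(t)\right)\left(\frac{\psi_j(t)}{\psi_i(t)}-1\right).$$
   Context: Setting. $\langle\cdot,\cdot\rangle$ is the standard inner product of $\mathbb R^N$ and $'$ denotes transpose. $(\Omega,\mathcal G,\mathbb G,\mathbb P)$ is a complete filtered probability space ($\mathbb P$ is the historical measure). $\mathbb F=(\mathcal F_t)$ is a filtration satisfying the usual hypotheses, $\mathcal F_\infty=\bigvee_{s\ge0}\mathcal F_s$. On $(\Omega,\mathcal G,\mathbb F,\mathbb P)$ there are a standard Brownian motion $W$ and, independent of it, a continuous-time Markov process $X$ with state space the canonical basis $\{e_1,\dots,e_N\}$ of $\mathbb R^N$ and (possibly time-dependent) generator $A(t)=[a_{i,j}(t)]$, where $a_{i,j}(t)=\lim_{h\to0}(p_{i,j}(t,t+h)-\delta_{i,j})/h$, $p_{i,j}(t,s)=\mathbb P(X_s=e_j|X_t=e_i)$, and $a_{i,i}(t)=-\sum_{j\ne i}a_{i,j}(t)$. For constant vectors $r=(r_1,\dots,r_N)'$ and $h=(h_1,\dots,h_N)'$ with positive entries and $L=(L_1,\dots,L_N)'\in\mathbb R^N$, put $r_t=\langle r,X_t\rangle$ (short rate), $h_t=\langle h,X_t\rangle$ (default intensity), $L_t=\langle L,X_t\rangle$ (loss rate). Default time: $\tau=\inf\{t\ge0:\int_0^th_u\,du\ge\chi\}$, with $\chi$ an exponential random variable independent of $X$, the construction being such that $\mathbb P(\tau\le u|\mathcal F_\infty)=1-e^{-\int_0^uh_sds}$ for all $u\ge0$. $H(t)=\mathbf 1_{\{\tau\le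 t\}}$, $(\mathcal H_t)$ is the filtration generated by $H$ (completed and made right-continuous), and $\mathcal G_t=\mathcal F_t\vee\mathcal H_t$. Risk-neutral measure: for $i\ne j$ let $\kappa_{i,j}:\mathbb R_+\to(-1,\infty)$ be bounded measurable, $\kappa_{i,i}=0$, $a^{\mathbb Q}_{i,j}(t)=a_{i,j}(t)(1+\kappa_{i,j}(t))$ for $i\neq j$, $a^{\mathbb Q}_{i,i}(t)=-\sum_{k\ne i}a^{\mathbb Q}_{i,k}(t)$, $A^{\mathbb Q}=[a^{\mathbb Q}_{i,j}]$. With $H^i_t=\mathbf 1_{\{X_t=e_i\}}$, $H^{i,j}_t=\sum_{0<u\le t}\mathbf 1_{\{X_{u^-}=e_i\}}\mathbf 1_{\{X_u=e_j\}}$ and $M^{i,j}_t=H^{i,j}_t-\int_0^ta_{i,j}(u)H^i_udu$ ($i\ne j$), $\mathbb Q$ is the probability on $\mathbb G$ with density process $\eta_t=1+\int_{(0,t]}\sum_{i,j}\eta_{u^-}\kappa_{i,j}(u)dM^{i,j}_u$ with respect to $\mathbb P$. Under $\mathbb Q$, $X$ is a Markov process with generator $A^{\mathbb Q}(t)$, and $W$ is a Wiener process independent of $X$. Defaultable bond of maturity $T>0$ (recovery of market value): $p(t,T)=\mathbb E^{\mathbb Q}\big[\int_t^Te^{-\int_t^ur_sds}z_u\,dH(u)+e^{-\int_t^Tr_sds}(1-H(T))\,\big|\,\mathcal G_t\big]$ with $z_t=(1-L_t)p(t^-,T)$; it is known that this equals $p(t,T)=\mathbf 1_{\{\tau>t\}}\mathbb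 E^{\mathbb Q}\big[e^{-\int_t^T(r_s+h_sL_s)ds}\,\big|\,\mathcal F_t\big]$. *)

theory Defs
  imports "HOL-Probability.Probability"
begin

section \<open>Processes, filtrations, martingales\<close>

text \<open>
  Processes are functions \<open>real \<Rightarrow> 'a \<Rightarrow> 'b\<close>; a time set \<open>I\<close> is \<open>{0..}\<close> or \<open>{0..T}\<close>, and values at
  times outside of it never matter. Sub-sigma-algebras are represented by measures of which only
  \<open>space\<close> and \<open>sets\<close> are used.
\<close>

definition left_lim :: "(real \<Rightarrow> 'b::t2_space) \<Rightarrow> real \<Rightarrow> 'b" where
  "left_lim f t = Lim (at_left t) f"

definition cadlag_on :: "real set \<Rightarrow> (real \<Rightarrow> 'b::topological_space) \<Rightarrow> bool" where
  "cadlag_on I f \<longleftrightarrow>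
     (\<forall>t\<in>I. continuous (at t within (I \<inter> {t..})) f \<and>
            (\<exists>l. (f \<longlongrightarrow> l) (at t within (I \<inter> {..<t}))))"

definition process_sigma :: "'a measure \<Rightarrow> real set \<Rightarrow> (real \<Rightarrow> 'a \<Rightarrow> 'b::topological_space) \<Rightarrow> 'a measure" where
  "process_sigma M I Y =
     sigma (space M) {Y t -` B \<inter> space M | t B. t \<in> I \<and> B \<in> sets borel}"

definition adapted_on :: "real set \<Rightarrow> (real \<Rightarrow> 'a measure) \<Rightarrow> (real \<Rightarrow> 'a \<Rightarrow> 'b::topological_space) \<Rightarrow> bool" where
  "adapted_on I F Y \<longleftrightarrow> (\<forall>t\<in>I. Y t \<in> borel_measurable (F t))"

definition usual_filtration :: "'a measure \<Rightarrow> (real \<Rightarrow> 'a measure) \<Rightarrow> bool" where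
  "usual_filtration M F \<longleftrightarrow>
     (\<forall>t\<ge>0. subalgebra M (F t)) \<and>
     (\<forall>s t. 0 \<le> s \<longrightarrow> s \<le> t \<longrightarrow> sets (F s) \<subseteq> sets (F t)) \<and>
     null_sets M \<subseteq> sets (F 0) \<and>
     (\<forall>t\<ge>0. sets (F t) = (\<Inter>s\<in>{t<..}. sets (F s)))"

definition filtration_infinity :: "'a measure \<Rightarrow> (real \<Rightarrow> 'a measure) \<Rightarrow> 'a measure" where
  "filtration_infinity M F = sigma (space M) (\<Union>s\<in>{0..}. sets (F s))"

definition martingale :: "'a measure \<Rightarrow> (real \<Rightarrow> 'a measure) \<Rightarrow> (real \<Rightarrow> 'a \<Rightarrow> real) \<Rightarrow> bool" where
  "martingale M F Y \<longleftrightarrow>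
     adapted_on {0..} F Y \<and> (\<forall>t\<ge>0. integrable M (Y t)) \<and>
     (\<forall>s t. 0 \<le> s \<longrightarrow> s \<le> t \<longrightarrow> (AE \<omega> in M. real_cond_exp M (F s) (Y t) \<omega> = Y s \<omega>))"

definition brownian_motion :: "'a measure \<Rightarrow> (real \<Rightarrow> 'a measure) \<Rightarrow> real set \<Rightarrow> (real \<Rightarrow> 'a \<Rightarrow> real) \<Rightarrow> bool" where
  "brownian_motion M F I W \<longleftrightarrow>
     adapted_on I F W \<and>
     (\<forall>\<omega>\<in>space M. continuous_on I (\<lambda>t. W t \<omega>)) \<and>
     (AE \<omega> in M. W 0 \<omega> = 0) \<and>
     (\<forall>s\<in>I. \<forall>t\<in>I. s < t \<longrightarrow>
        distributed M lborel (\<lambda>\<omega>. W t \<omega> - W s \<omega>) (\<lambda>x. ennreal (normal_density 0 (sqrt (t - s)) x)) \<and>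
        prob_space.indep_set M (sets (F s))
          (sets (vimage_algebra (space M) (\<lambda>\<omega>. W t \<omega> - W s \<omega>) borel)))"


section \<open>Pathwise Lebesgue--Stieltjes integrals\<close>

text \<open>
  The Lebesgue--Stieltjes integral of \<open>f\<close> over \<open>(a, b]\<close> with respect to a right-continuous integrator
  \<open>g\<close> of bounded variation, expressed through a decomposition of \<open>g\<close> on \<open>[a, b]\<close> as a difference of
  nondecreasing right-continuous functions. The value does not depend on the decomposition.
  All integrators below (counting processes, their compensators, and the chain itself) have paths
  of locally bounded variation, so this is the stochastic integral.
\<close>

definition has_ls_integral :: "(real \<Rightarrow> real) \<Rightarrow> (real \<Rightarrow> real) \<Rightarrow> real \<Rightarrow> real \<Rightarrow> real \<Rightarrow> bool" where
  "has_ls_integral f g y a b \<longleftrightarrow>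
     (\<exists>g1 g2. mono g1 \<and> mono g2 \<and>
        (\<forall>u. continuous (at_right u) g1) \<and> (\<forall>u. continuous (at_right u) g2) \<and>
        (\<forall>u\<in>{a..b}. g u = g1 u - g2 u) \<and>
        set_integrable (interval_measure g1) {a<..b} f \<and>
        set_integrable (interval_measure g2) {a<..b} f \<and>
        y = (LINT u:{a<..b}|interval_measure g1. f u) - (LINT u:{a<..b}|interval_measure g2. f u))"

definition ls_integral :: "(real \<Rightarrow> real) \<Rightarrow> (real \<Rightarrow> real) \<Rightarrow> real \<Rightarrow> real \<Rightarrow> real" where
  "ls_integral f g a b = (THE y. has_ls_integral f g y a b)"

text \<open>Vector integrator: the integral of \<open>\<langle>f, dg\<rangle>\<close> over \<open>(a, b]\<close>.\<close>

definition has_inner_ls_integral ::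
    "(real \<Rightarrow> real^'n) \<Rightarrow> (real \<Rightarrow> real^'n) \<Rightarrow> real \<Rightarrow> real \<Rightarrow> real \<Rightarrow> bool" where
  "has_inner_ls_integral f g y a b \<longleftrightarrow>
     (\<exists>c :: 'n \<Rightarrow> real.
        (\<forall>i. has_ls_integral (\<lambda>u. f u $ i) (\<lambda>u. g u $ i) (c i) a b) \<and> y = (\<Sum>i\<in>UNIV. c i))"


section \<open>Markov chains on the canonical basis\<close>

abbreviation state :: "'n \<Rightarrow> real^'n" where
  "state i \<equiv> axis i 1"

text \<open>\<open>p\<^sub>i\<^sub>j(s,t)\<close>; meaningful when \<open>X\<^sub>s = e\<^sub>i\<close> has positive probability.\<close>

definition trans_prob ::
    "'a measure \<Rightarrow> (real \<Rightarrow> 'a \<Rightarrow> real^'n) \<Rightarrow> 'n \<Rightarrow> 'n \<Rightarrow> real \<Rightarrow> real \<Rightarrow> real" where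
  "trans_prob M X i j s t = \<P>(\<omega> in M. X t \<omega> = state j \<bar> X s \<omega> = state i)"

text \<open>
  The last clause is the usual standardness (continuity) of the transition probabilities: it excludes
  jumps at deterministic times, which the generator, being a limit from the right, cannot detect.
\<close>

definition markov_chain_on ::
    "'a measure \<Rightarrow> (real \<Rightarrow> 'a measure) \<Rightarrow> real set \<Rightarrow> (real \<Rightarrow> 'a \<Rightarrow> real^'n) \<Rightarrow> bool" where
  "markov_chain_on M F I X \<longleftrightarrow>
     adapted_on I F X \<and>
     (\<forall>\<omega>\<in>space M. (\<forall>t\<in>I. X t \<omega> \<in> range state) \<and> cadlag_on I (\<lambda>t. X t \<omega>)) \<and>
     (\<forall>s\<in>I. \<forall>t\<in>I. s \<le> t \<longrightarrow> (\<forall>i j. AE \<omega> in M. X s \<omega> = state i \<longrightarrow>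
        real_cond_exp M (F s) (indicator {\<omega>\<in>space M. X t \<omega> = state j}) \<omega> = trans_prob M X i j s t)) \<and>
     (\<forall>t\<in>I. ((\<lambda>s. \<P>(\<omega> in M. X s \<omega> \<noteq> X t \<omega>)) \<longlongrightarrow> 0) (at t within I))"

definition has_generator_at ::
    "'a measure \<Rightarrow> (real \<Rightarrow> 'a \<Rightarrow> real^'n) \<Rightarrow> (real \<Rightarrow> real^'n^'n) \<Rightarrow> real \<Rightarrow> bool" where
  "has_generator_at M X A t \<longleftrightarrow>
     (\<forall>i j. \<P>(\<omega> in M. X t \<omega> = state i) > 0 \<longrightarrow>
        ((\<lambda>\<epsilon>. (trans_prob M X i j t (t + \<epsilon>) - (if i = j then 1 else 0)) / \<epsilon>) \<longlongrightarrow> A t $ i $ j)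
          (at_right 0))"

text \<open>Local integrability is what makes the compensators of the jumps of the chain finite.\<close>

definition generator_matrices :: "(real \<Rightarrow> real^'n^'n) \<Rightarrow> bool" where
  "generator_matrices A \<longleftrightarrow>
     (\<forall>t\<ge>0. \<forall>i. (\<forall>j. j \<noteq> i \<longrightarrow> A t $ i $ j \<ge> 0) \<and> A t $ i $ i = - (\<Sum>j\<in>UNIV - {i}. A t $ i $ j)) \<and>
     (\<forall>i j. \<forall>t\<ge>0. set_integrable lborel {0..t} (\<lambda>u. A u $ i $ j))"

definition state_ind :: "(real \<Rightarrow> 'a \<Rightarrow> real^'n) \<Rightarrow> 'n \<Rightarrow> real \<Rightarrow> 'a \<Rightarrow> real" where
  "state_ind X i t \<omega> = (if X t \<omega> = state i then 1 else 0)"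

definition jump_count :: "(real \<Rightarrow> 'a \<Rightarrow> real^'n) \<Rightarrow> 'n \<Rightarrow> 'n \<Rightarrow> real \<Rightarrow> 'a \<Rightarrow> real" where
  "jump_count X i j t \<omega> =
     real (card {u. 0 < u \<and> u \<le> t \<and> left_lim (\<lambda>v. X v \<omega>) u = state i \<and> X u \<omega> = state j})"

definition jump_mart ::
    "(real \<Rightarrow> 'a \<Rightarrow> real^'n) \<Rightarrow> (real \<Rightarrow> real^'n^'n) \<Rightarrow> 'n \<Rightarrow> 'n \<Rightarrow> real \<Rightarrow> 'a \<Rightarrow> real" where
  "jump_mart X A i j t \<omega> =
     jump_count X i j t \<omega> - (LBINT u:{0..t}. A u $ i $ j * state_ind X i u \<omega>)"

definition chain_mart ::
    "(real \<Rightarrow> 'a \<Rightarrow> real^'n) \<Rightarrow> (real \<Rightarrow> real^'n^'n) \<Rightarrow> real \<Rightarrow> 'a \<Rightarrow> real^'n" where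
  "chain_mart X A t \<omega> = X t \<omega> - X 0 \<omega> - (LBINT s:{0..t}. transpose (A s) *v X s \<omega>)"


section \<open>Historical market, default time\<close>

definition historical_market ::
    "'a measure \<Rightarrow> (real \<Rightarrow> 'a measure) \<Rightarrow> (real \<Rightarrow> 'a \<Rightarrow> real) \<Rightarrow> (real \<Rightarrow> 'a \<Rightarrow> real^'n) \<Rightarrow>
     (real \<Rightarrow> real^'n^'n) \<Rightarrow> bool" where
  "historical_market P F W X A \<longleftrightarrow>
     prob_space P \<and> complete_measure P \<and> usual_filtration P F \<and>
     brownian_motion P F {0..} W \<and>
     markov_chain_on P F {0..} X \<and>
     prob_space.indep_set P (sets (process_sigma P {0..} W)) (sets (process_sigma P {0..} X)) \<and>
     generator_matrices A \<and> (\<forall>t\<ge>0. has_generator_at P X A t)"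

definition default_time :: "real^'n \<Rightarrow> (real \<Rightarrow> 'a \<Rightarrow> real^'n) \<Rightarrow> ('a \<Rightarrow> real) \<Rightarrow> 'a \<Rightarrow> real" where
  "default_time h X Z \<omega> = Inf {t. 0 \<le> t \<and> Z \<omega> \<le> (LBINT u:{0..t}. h \<bullet> X u \<omega>)}"

definition default_ind :: "('a \<Rightarrow> real) \<Rightarrow> real \<Rightarrow> 'a \<Rightarrow> real" where
  "default_ind \<tau> t \<omega> = (if \<tau> \<omega> \<le> t then 1 else 0)"

definition default_construction ::
    "'a measure \<Rightarrow> (real \<Rightarrow> 'a measure) \<Rightarrow> (real \<Rightarrow> 'a \<Rightarrow> real^'n) \<Rightarrow> real^'n \<Rightarrow> ('a \<Rightarrow> real) \<Rightarrow> bool" where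
  "default_construction P F X h Z \<longleftrightarrow>
     distributed P lborel Z (\<lambda>x. ennreal (exponential_density 1 x)) \<and>
     prob_space.indep_set P (sets (vimage_algebra (space P) Z borel)) (sets (process_sigma P {0..} X)) \<and>
     (\<forall>u\<ge>0. AE \<omega> in P.
        real_cond_exp P (filtration_infinity P F) (indicator {\<omega>\<in>space P. default_time h X Z \<omega> \<le> u}) \<omega>
          = 1 - exp (- (LBINT s:{0..u}. h \<bullet> X s \<omega>)))"

text \<open>The filtration generated by \<open>H\<close>, first completed, then made right-continuous.\<close>

definition default_filtration :: "'a measure \<Rightarrow> (real \<Rightarrow> 'a \<Rightarrow> real) \<Rightarrow> real \<Rightarrow> 'a measure" where
  "default_filtration P H t =
     sigma (space P) (\<Inter>s\<in>{t<..}.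
       sets (sigma (space P) (sets (process_sigma P {0..s} H) \<union> null_sets P)))"

definition enlarged_filtration ::
    "'a measure \<Rightarrow> (real \<Rightarrow> 'a measure) \<Rightarrow> (real \<Rightarrow> 'a \<Rightarrow> real) \<Rightarrow> real \<Rightarrow> 'a measure" where
  "enlarged_filtration P F H t =
     sigma (space P) (sets (F t) \<union> sets (default_filtration P H t))"

definition default_mart ::
    "real^'n \<Rightarrow> (real \<Rightarrow> 'a \<Rightarrow> real^'n) \<Rightarrow> (real \<Rightarrow> 'a \<Rightarrow> real) \<Rightarrow> real \<Rightarrow> 'a \<Rightarrow> real" where
  "default_mart h X H t \<omega> =
     H t \<omega> - (LBINT u:{0..t}. (1 - left_lim (\<lambda>v. H v \<omega>) u) * (h \<bullet> X u \<omega>))"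


section \<open>Risk-neutral measure\<close>

definition kappa_admissible :: "(real \<Rightarrow> real^'n^'n) \<Rightarrow> bool" where
  "kappa_admissible \<kappa> \<longleftrightarrow>
     (\<forall>i j. set_borel_measurable borel {0..} (\<lambda>t. \<kappa> t $ i $ j) \<and>
            bounded ((\<lambda>t. \<kappa> t $ i $ j) ` {0..}) \<and> (\<forall>t\<ge>0. \<kappa> t $ i $ j > -1)) \<and>
     (\<forall>i. \<forall>t\<ge>0. \<kappa> t $ i $ i = 0)"

definition rn_generator :: "(real \<Rightarrow> real^'n^'n) \<Rightarrow> (real \<Rightarrow> real^'n^'n) \<Rightarrow> real \<Rightarrow> real^'n^'n" where
  "rn_generator A \<kappa> t =
     (\<chi> i j. if i = j then - (\<Sum>k\<in>UNIV - {i}. A t $ i $ k * (1 + \<kappa> t $ i $ k))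
             else A t $ i $ j * (1 + \<kappa> t $ i $ j))"

definition density_process ::
    "'a measure \<Rightarrow> (real \<Rightarrow> 'a measure) \<Rightarrow> (real \<Rightarrow> 'a \<Rightarrow> real^'n) \<Rightarrow> (real \<Rightarrow> real^'n^'n) \<Rightarrow>
     (real \<Rightarrow> real^'n^'n) \<Rightarrow> (real \<Rightarrow> 'a \<Rightarrow> real) \<Rightarrow> bool" where
  "density_process P F X A \<kappa> \<eta> \<longleftrightarrow>
     adapted_on {0..} F \<eta> \<and> (\<forall>\<omega>\<in>space P. cadlag_on {0..} (\<lambda>t. \<eta> t \<omega>)) \<and>
     (AE \<omega> in P. \<forall>t\<ge>0. \<exists>c.
        (\<forall>i j. i \<noteq> j \<longrightarrow> has_ls_integral (\<lambda>u. left_lim (\<lambda>v. \<eta> v \<omega>) u * \<kappa> u $ i $ j)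
                          (\<lambda>u. jump_mart X A i j u \<omega>) (c i j) 0 t) \<and>
        \<eta> t \<omega> = 1 + (\<Sum>i\<in>UNIV. \<Sum>j\<in>UNIV - {i}. c i j))"

text \<open>
  \<open>Q\<close> is required to have density process \<open>\<eta>\<close> on the horizon \<open>[0, T]\<close> of the bond only: on
  \<open>[0, \<infinity>)\<close>, with a completed \<open>F\<^sub>0\<close>, such a \<open>Q\<close> exists only if \<open>\<eta>\<close> is uniformly integrable,
  which typically fails, e.g. for constant \<open>\<kappa> \<noteq> 0\<close>.
  As \<open>\<kappa>\<close> is merely measurable, the limit defining the generator under \<open>Q\<close> is claimed only where the
  matrix function \<open>A\<^sup>Q\<close> is right-continuous.
\<close>

definition risk_neutral ::
    "'a measure \<Rightarrow> 'a measure \<Rightarrow> (real \<Rightarrow> 'a measure) \<Rightarrow> (real \<Rightarrow> 'a measure) \<Rightarrow> (real \<Rightarrow> 'a \<Rightarrow> real) \<Rightarrow>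
     (real \<Rightarrow> 'a \<Rightarrow> real^'n) \<Rightarrow> (real \<Rightarrow> real^'n^'n) \<Rightarrow> (real \<Rightarrow> 'a \<Rightarrow> real) \<Rightarrow> real \<Rightarrow> bool" where
  "risk_neutral P Q F G W X AQ \<eta> T \<longleftrightarrow>
     prob_space Q \<and> sets Q = sets P \<and>
     (\<forall>t\<in>{0..T}. restr_to_subalg Q (G t) = density (restr_to_subalg P (G t)) (\<lambda>\<omega>. ennreal (\<eta> t \<omega>))) \<and>
     markov_chain_on Q F {0..T} X \<and>
     (\<forall>t\<in>{0..<T}. continuous (at_right t) AQ \<longrightarrow> has_generator_at Q X AQ t) \<and>
     brownian_motion Q F {0..T} W \<and>
     prob_space.indep_set Q (sets (process_sigma Q {0..T} W)) (sets (process_sigma Q {0..T} X))"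


section \<open>Defaultable bond\<close>

text \<open>Discounted payments over \<open>(t, T]\<close>, seen from \<open>t\<close>, under recovery of market value.\<close>

definition bond_payoff ::
    "real^'n \<Rightarrow> real^'n \<Rightarrow> (real \<Rightarrow> 'a \<Rightarrow> real^'n) \<Rightarrow> (real \<Rightarrow> 'a \<Rightarrow> real) \<Rightarrow> (real \<Rightarrow> 'a \<Rightarrow> real) \<Rightarrow>
     real \<Rightarrow> real \<Rightarrow> 'a \<Rightarrow> real" where
  "bond_payoff r L X H p T t \<omega> =
     ls_integral (\<lambda>u. exp (- (LBINT s:{t..u}. r \<bullet> X s \<omega>)) *
                      ((1 - L \<bullet> X u \<omega>) * left_lim (\<lambda>v. p v \<omega>) u)) (\<lambda>u. H u \<omega>) t T
     + exp (- (LBINT s:{t..T}. r \<bullet> X s \<omega>)) * (1 - H T \<omega>)"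

definition rmv_discount ::
    "real^'n \<Rightarrow> real^'n \<Rightarrow> real^'n \<Rightarrow> (real \<Rightarrow> 'a \<Rightarrow> real^'n) \<Rightarrow> real \<Rightarrow> real \<Rightarrow> 'a \<Rightarrow> real" where
  "rmv_discount r h L X T t \<omega> =
     exp (- (LBINT s:{t..T}. r \<bullet> X s \<omega> + (h \<bullet> X s \<omega>) * (L \<bullet> X s \<omega>)))"

text \<open>
  The pricing equation is implicit, since the recovery depends on \<open>p\<close> itself. The last clause is the
  known representation of the solution through the pre-default price.
\<close>

definition bond_price ::
    "'a measure \<Rightarrow> (real \<Rightarrow> 'a measure) \<Rightarrow> (real \<Rightarrow> 'a measure) \<Rightarrow> real^'n \<Rightarrow> real^'n \<Rightarrow> real^'n \<Rightarrow>
     (real \<Rightarrow> 'a \<Rightarrow> real^'n) \<Rightarrow> (real \<Rightarrow> 'a \<Rightarrow> real) \<Rightarrow> real \<Rightarrow> (real \<Rightarrow> 'a \<Rightarrow> real) \<Rightarrow> bool" where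
  "bond_price Q F G r h L X H T p \<longleftrightarrow>
     adapted_on {0..T} G p \<and> (\<forall>\<omega>\<in>space Q. cadlag_on {0..T} (\<lambda>t. p t \<omega>)) \<and>
     (\<forall>t\<in>{0..T}. integrable Q (bond_payoff r L X H p T t) \<and>
        (AE \<omega> in Q. p t \<omega> = real_cond_exp Q (G t) (bond_payoff r L X H p T t) \<omega>)) \<and>
     (\<forall>t\<in>{0..T}. AE \<omega> in Q.
        p t \<omega> = (1 - H t \<omega>) * real_cond_exp Q (F t) (rmv_discount r h L X T t) \<omega>)"

definition cond_exp_event :: "'a measure \<Rightarrow> ('a \<Rightarrow> real) \<Rightarrow> 'a set \<Rightarrow> real" where
  "cond_exp_event M Z B = (LINT \<omega>:B|M. Z \<omega>) / measure M B"

text \<open>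
  \<open>\<psi>\<^sub>i(t)\<close>; meaningful when \<open>X\<^sub>t = e\<^sub>i\<close> has positive \<open>Q\<close>-probability, which can fail at \<open>t = 0\<close>.
\<close>

definition psi ::
    "'a measure \<Rightarrow> real^'n \<Rightarrow> real^'n \<Rightarrow> real^'n \<Rightarrow> (real \<Rightarrow> 'a \<Rightarrow> real^'n) \<Rightarrow> real \<Rightarrow> real \<Rightarrow> real^'n" where
  "psi Q r h L X T t =
     (\<chi> i. cond_exp_event Q (rmv_discount r h L X T t) {\<omega>\<in>space Q. X t \<omega> = state i})"

definition drift_correction ::
    "(real \<Rightarrow> real^'n^'n) \<Rightarrow> (real \<Rightarrow> real^'n^'n) \<Rightarrow> (real \<Rightarrow> real^'n) \<Rightarrow> real \<Rightarrow> real^'n" where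
  "drift_correction A AQ \<psi> t =
     (\<chi> i. \<Sum>j\<in>UNIV. (A t $ i $ j - AQ t $ i $ j) * (\<psi> t $ j / \<psi> t $ i))"

end

theory Submission
  imports Defs
begin

text \<open>
  For an event \<open>B\<close> known at time \<open>s\<close> the discounted masses \<open>E[1\<^sub>B exp (- \<integral> c \<bullet> X); X\<^sub>u = e\<^sub>j]\<close> solve the
  forward equation of the chain; only right derivatives in \<open>u\<close> are available, but a continuous function
  with an integrable right derivative is its integral. Pairing the masses with the solution \<open>\<phi>\<close> of the
  backward terminal value problem gives a constant, which is the Feynman-Kac formula, so \<open>\<psi> = \<phi>\<close> and
  \<open>p\<^sub>t = (1 - H\<^sub>t) (\<phi> t \<bullet> X\<^sub>t)\<close> almost surely under \<open>Q\<close>. The density process is strictly positive, so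
  this transfers to \<open>P\<close>. The dynamics follow path by path: on a path with finitely many jumps, integrate
  the absolutely continuous function \<open>\<phi>\<close> by parts against the step function \<open>X\<close>, stopped at default. Here
  one uses that almost surely \<open>X\<close> does not jump at \<open>\<tau>\<close>, as \<open>\<tau>\<close> has a bounded density conditionally on \<open>X\<close>.
\<close>

section \<open>Integrals and one-sided derivatives\<close>

text \<open>For the dynamics, probability only has to produce a null set: every integrator has
  locally bounded variation, so off that set the claim is an identity between Lebesgue-Stieltjes
  integrals of single paths. Classical calculus is out of reach, since the generator is a limit from
  the right and \<open>A\<close> is merely locally integrable in time; hence the one-sided
  fundamental theorem of calculus. The two-sided bounds on \<open>AQ\<close> enter in two ways. The
  upper ones make the backward problem solvable on the closed interval. The lower ones give every
  state positive \<open>Q\<close>-probability at every positive time, so that \<open>psi\<close> is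
  there a genuine conditional expectation, equal to the solution and positive. A common jump of
  chain and default would be fatal: at \<tau> the chain integral would add \<phi> times the jump of
  \<open>X\<close>, while the default integral removes only \<phi> times the left limit of
  \<open>X\<close>, and the jump term would remain instead of the price \<open>0\<close>.\<close>

lemma set_integrable_bounded_mult:
  fixes f g :: "real \<Rightarrow> real"
  assumes f: "set_borel_measurable borel S f" and b: "\<And>x. x \<in> S \<Longrightarrow> \<bar>f x\<bar> \<le> C" and g: "set_integrable lborel S g"
  shows "set_integrable lborel S (\<lambda>x. f x * g x)"
proof -
  have "(\<lambda>x. indicator S x *\<^sub>R g x) \<in> borel_measurable borel"
    using g by (auto simp: set_integrable_def dest: borel_measurable_integrable)
  with f have m: "(\<lambda>x. (indicator S x *\<^sub>R f x) * (indicator S x *\<^sub>R g x)) \<in> borel_measurable borel"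
    unfolding set_borel_measurable_def by (rule borel_measurable_times)
  have "integrable lborel (\<lambda>x. C * (indicator S x *\<^sub>R g x))"
    using g unfolding set_integrable_def by (rule integrable_mult_right)
  then have "integrable lborel (\<lambda>x. (indicator S x *\<^sub>R f x) * (indicator S x *\<^sub>R g x))"
  proof (rule Bochner_Integration.integrable_bound)
    show "AE x in lborel. norm ((indicator S x *\<^sub>R f x) * (indicator S x *\<^sub>R g x)) \<le> norm (C * (indicator S x *\<^sub>R g x))"
    proof (rule AE_I2)
      fix x
      have "\<bar>f x\<bar> * \<bar>g x\<bar> \<le> \<bar>C\<bar> * \<bar>g x\<bar>" if "x \<in> S" using b[OF that] by (intro mult_right_mono) auto
      then show "norm ((indicator S x *\<^sub>R f x) * (indicator S x *\<^sub>R g x)) \<le> norm (C * (indicator S x *\<^sub>R g x))"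
        by (cases "x \<in> S") (auto simp: abs_mult)
    qed
  qed (use m in simp)
  then show ?thesis unfolding set_integrable_def
    by (rule Bochner_Integration.integrable_cong[THEN iffD1, rotated 2]) (auto simp: indicator_def)
qed

lemma set_integral_Icc_split:
  fixes f :: "real \<Rightarrow> real"
  assumes f: "set_integrable lborel {a..c} f" and "a \<le> b" "b \<le> c"
  shows "(LBINT u:{a..c}. f u) = (LBINT u:{a..b}. f u) + (LBINT u:{b..c}. f u)"
proof -
  have *: "(LBINT u:{x..y}. f u) = integral {x..y} f" "f integrable_on {x..y}" if "a \<le> x" "y \<le> c" for x y
    using set_borel_integral_eq_integral[OF set_integrable_subset[OF f, of "{x..y}"]] that by auto
  have "integral {a..b} f + integral {b..c} f = integral {a..c} f"
    using assms * by (intro Henstock_Kurzweil_Integration.integral_combine) auto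
  then show ?thesis using assms * by simp
qed

lemma set_integral_finite_sum:
  fixes f :: "'b \<Rightarrow> 'a \<Rightarrow> real"
  assumes "\<And>i. i \<in> I \<Longrightarrow> set_integrable M S (f i)"
  shows "set_integrable M S (\<lambda>x. \<Sum>i\<in>I. f i x)" "(LINT x:S|M. \<Sum>i\<in>I. f i x) = (\<Sum>i\<in>I. LINT x:S|M. f i x)"
  using assms unfolding set_integrable_def set_lebesgue_integral_def
  by (auto simp: scaleR_sum_right sum_distrib_left)

text \<open>Used to trade left limits for values and to discard time \<open>0\<close> and the jump
  times. Nothing is assumed measurable, so integrability itself passes from one integrand to the
  other.\<close>

lemma lborel_integral_cong_off_finite:
  fixes f g :: "real \<Rightarrow> real"
  assumes S: "finite S" and eq: "\<And>x. x \<notin> S \<Longrightarrow> f x = g x"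
  shows "integral\<^sup>L lborel f = integral\<^sup>L lborel g" "integrable lborel f \<longleftrightarrow> integrable lborel g"
proof -
  have "countable S" using S by (rule countable_finite)
  then show "integral\<^sup>L lborel f = integral\<^sup>L lborel g"
    by (rule integral_discrete_difference) (use eq in auto)
  show "integrable lborel f \<longleftrightarrow> integrable lborel g"
    by (rule integrable_discrete_difference[OF \<open>countable S\<close>]) (use eq in auto)
qed

lemma set_integral_Ioc_Icc:
  fixes f :: "real \<Rightarrow> real"
  shows "(LBINT u:{a<..b}. f u) = (LBINT u:{a..b}. f u)" "set_integrable lborel {a<..b} f \<longleftrightarrow> set_integrable lborel {a..b} f"
  unfolding set_lebesgue_integral_def set_integrable_def
  by (rule lborel_integral_cong_off_finite[of "{a}"]; simp add: indicator_def)+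

text \<open>
  A one-sided form of the Vitali-Caratheodory theorem: a function that dominates \<open>f x\<close> immediately to
  the right of every \<open>x\<close> suffices when only right derivatives are known.
\<close>

lemma right_majorant:
  fixes f :: "real \<Rightarrow> real"
  assumes ab: "a \<le> b" and f[measurable]: "f \<in> borel_measurable borel" and f0: "\<And>x. f x \<ge> 0"
    and fi: "integrable lborel (\<lambda>x. indicator {a..b} x * f x)" and e: "e > 0"
  obtains g where "integrable lborel g" "\<And>x. g x \<ge> 0"
    "(\<integral>x. g x \<partial>lborel) \<le> (\<integral>x. indicator {a..b} x * f x \<partial>lborel) + e"
    "\<And>x. x \<in> {a..b} \<Longrightarrow> \<exists>d>0. AE y in lborel. y \<in> {x..x+d} \<longrightarrow> f x \<le> g y"
proof -
  \<comment> \<open>Rounding \<open>f\<close> up to multiples of \<delta> costs at most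
    \<open>\<delta> * (b - a)\<close>, kept below \<open>e/2\<close>; the other half of
    \<open>e\<close> is spent on the open sets.\<close>
  define \<delta> where "\<delta> = e / (2 * (b - a) + 2)"
  have \<delta>: "\<delta> > 0" using ab e by (simp add: \<delta>_def)
  have \<delta>ab: "\<delta> * (b - a) \<le> e / 2"
  proof -
    have "\<delta> * (2 * (b - a) + 2) = e" using ab by (simp add: \<delta>_def)
    then show ?thesis using \<delta> by (simp add: algebra_simps)
  qed
  define N where "N x = nat \<lfloor>f x / \<delta>\<rfloor>" for x
  have N1: "real (N x) * \<delta> \<le> f x" "f x \<le> (real (N x) + 1) * \<delta>" for x
  proof -
    have "real (N x) = of_int \<lfloor>f x / \<delta>\<rfloor>" using f0[of x] \<delta> by (simp add: N_def)
    then show "real (N x) * \<delta> \<le> f x" "f x \<le> (real (N x) + 1) * \<delta>"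
      using \<delta> of_int_floor_le[of "f x / \<delta>"] real_of_int_floor_add_one_ge[of "f x / \<delta>"]
      by (simp_all only: pos_le_divide_eq pos_divide_le_eq)
  qed
  have N[measurable]: "N \<in> measurable borel (count_space UNIV)" unfolding N_def by measurable
  define E where "E n = {a..b} \<inter> {x. N x = n}" for n
  have E[measurable]: "E n \<in> sets borel" for n unfolding E_def by measurable
  \<comment> \<open>Weighted by the height \<open>Suc n * \<delta>\<close> that \<open>U n\<close>
    will carry, the excess measures sum to \<open>e/2\<close>.\<close>
  define \<epsilon> where "\<epsilon> n = e / 2 * (1/2)^(Suc n) / (real (Suc n) * \<delta>)" for n
  have \<epsilon>: "\<epsilon> n > 0" for n using e \<delta> by (simp add: \<epsilon>_def)
  have "\<exists>U. open U \<and> E n \<subseteq> U \<and> emeasure lborel (U - E n) \<le> \<epsilon> n" for n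
    by (rule outer_regular_lborel_le[OF E[of n] \<epsilon>[of n]]) blast
  then obtain U where U: "\<And>n. open (U n)" "\<And>n. E n \<subseteq> U n" "\<And>n. emeasure lborel (U n - E n) \<le> \<epsilon> n"
    by metis
  have Um[measurable]: "U n \<in> sets borel" for n using U(1) by simp
  \<comment> \<open>Openness of \<open>U n\<close> is the point: in a whole neighbourhood of a point
    of level \<open>n\<close> the sum keeps the summand \<open>Suc n * \<delta>\<close>, which is at
    least the value of \<open>f\<close> at that point.\<close>
  define G where "G x = (\<Sum>n. ennreal (real (Suc n) * \<delta>) * indicator (U n) x)" for x
  have Gm[measurable]: "G \<in> borel_measurable borel" unfolding G_def by measurable
  have GE: "ennreal (real (Suc (N x)) * \<delta>) * indicator (U (N x)) x \<le> G x" for x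
    unfolding G_def by (rule order_trans[OF _ sum_le_suminf[of _ "{N x}"]]) (simp_all del: sum_mult_indicator)
  have sumE: "(\<Sum>n. ennreal (real (Suc n) * \<delta>) * indicator (E n) x) \<le> ennreal (indicator {a..b} x * (f x + \<delta>))" for x
  proof -
    have "(\<Sum>n. ennreal (real (Suc n) * \<delta>) * indicator (E n) x) =
        (\<Sum>n\<in>{N x}. ennreal (real (Suc n) * \<delta>) * indicator (E n) x)"
      by (rule suminf_finite) (auto simp: E_def)
    also have "\<dots> \<le> ennreal (indicator {a..b} x * (f x + \<delta>))"
    proof (cases "x \<in> {a..b}")
      case True
      then have "x \<in> E (N x)" by (simp add: E_def)
      then show ?thesis using N1[of x] True \<delta> by (auto simp: algebra_simps intro!: ennreal_leI simp del: ennreal_plus)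
    qed (auto simp: E_def)
    finally show ?thesis .
  qed
  have eps: "(\<Sum>n. ennreal (e / 2 * (1/2)^(Suc n))) = ennreal (e / 2)"
  proof (rule suminf_ennreal_eq)
    show "0 \<le> e / 2 * (1 / 2) ^ Suc n" for n using e by simp
    show "(\<lambda>n. e / 2 * (1 / 2) ^ Suc n) sums (e / 2)"
      using sums_mult[OF power_half_series, of "e/2"] by simp
  qed
  have fd: "integrable lborel (\<lambda>x. indicator {a..b} x * (f x + \<delta>))"
    using fi ab by (simp add: distrib_left)
  have "(\<integral>\<^sup>+x. G x \<partial>lborel) = (\<Sum>n. ennreal (real (Suc n) * \<delta>) * emeasure lborel (U n))"
    unfolding G_def by (subst nn_integral_suminf) (auto simp: nn_integral_cmult_indicator)
  also have "\<dots> \<le> (\<Sum>n. ennreal (real (Suc n) * \<delta>) * emeasure lborel (E n) + ennreal (e / 2 * (1/2)^(Suc n)))"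
  proof (rule suminf_le)
    fix n
    have "emeasure lborel (U n) \<le> emeasure lborel (E n) + emeasure lborel (U n - E n)"
      by (rule order_trans[OF _ emeasure_subadditive]) (auto intro!: emeasure_mono)
    also have "\<dots> \<le> emeasure lborel (E n) + ennreal (\<epsilon> n)" using U(3) by (intro add_left_mono)
    finally have "ennreal (real (Suc n) * \<delta>) * emeasure lborel (U n) \<le>
      ennreal (real (Suc n) * \<delta>) * (emeasure lborel (E n) + ennreal (\<epsilon> n))" by (rule mult_left_mono) simp
    also have "\<dots> = ennreal (real (Suc n) * \<delta>) * emeasure lborel (E n) + ennreal (real (Suc n) * \<delta> * \<epsilon> n)"
      using \<delta> \<epsilon>[of n] by (simp add: distrib_left ennreal_mult' del: of_nat_Suc)
    also have "real (Suc n) * \<delta> * \<epsilon> n = e / 2 * (1/2)^(Suc n)"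
      using \<delta> by (simp add: \<epsilon>_def del: of_nat_Suc)
    finally show "ennreal (real (Suc n) * \<delta>) * emeasure lborel (U n) \<le>
      ennreal (real (Suc n) * \<delta>) * emeasure lborel (E n) + ennreal (e / 2 * (1/2)^(Suc n))" .
  qed auto
  also have "\<dots> = (\<Sum>n. ennreal (real (Suc n) * \<delta>) * emeasure lborel (E n)) + ennreal (e / 2)"
    by (subst suminf_add[symmetric]) (simp_all add: eps[simplified])
  also have "(\<Sum>n. ennreal (real (Suc n) * \<delta>) * emeasure lborel (E n)) =
      (\<integral>\<^sup>+x. (\<Sum>n. ennreal (real (Suc n) * \<delta>) * indicator (E n) x) \<partial>lborel)"
    by (subst nn_integral_suminf) (auto simp: nn_integral_cmult_indicator)
  also have "\<dots> \<le> (\<integral>\<^sup>+x. ennreal (indicator {a..b} x * (f x + \<delta>)) \<partial>lborel)"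
    by (intro nn_integral_mono sumE)
  also have "\<dots> = ennreal (\<integral>x. indicator {a..b} x * (f x + \<delta>) \<partial>lborel)"
    using fd f0 \<delta> by (intro nn_integral_eq_integral) (auto intro!: AE_I2 mult_nonneg_nonneg add_nonneg_nonneg simp: less_imp_le)
  also have "(\<integral>x. indicator {a..b} x * (f x + \<delta>) \<partial>lborel) = (\<integral>x. indicator {a..b} x * f x \<partial>lborel) + \<delta> * (b - a)"
    using fi ab by (simp add: distrib_left)
  finally have "(\<integral>\<^sup>+x. G x \<partial>lborel) \<le> ennreal ((\<integral>x. indicator {a..b} x * f x \<partial>lborel) + \<delta> * (b - a)) + ennreal (e/2)"
    by simp
  also have "\<dots> = ennreal ((\<integral>x. indicator {a..b} x * f x \<partial>lborel) + \<delta> * (b - a) + e/2)"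
    using e \<delta> ab f0 by (intro ennreal_plus[symmetric] add_nonneg_nonneg integral_nonneg_AE) auto
  finally have G1: "(\<integral>\<^sup>+x. G x \<partial>lborel) \<le> ennreal ((\<integral>x. indicator {a..b} x * f x \<partial>lborel) + e)"
    using \<delta>ab by (elim order_trans) (intro ennreal_leI, simp)
  \<comment> \<open>\<open>G\<close> may be infinite on a null set, where \<open>enn2real\<close>
    yields \<open>0\<close>; this is why domination holds only almost everywhere.\<close>
  define g where "g x = enn2real (G x)" for x
  have gm[measurable]: "g \<in> borel_measurable borel" unfolding g_def by measurable
  have "AE x in lborel. G x \<noteq> \<infinity>"
    using G1 by (intro nn_integral_noteq_infinite) (auto simp: top_unique)
  then have AEg: "AE x in lborel. ennreal (g x) = G x"
    by eventually_elim (simp add: g_def less_top)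
  have nng: "(\<integral>\<^sup>+x. ennreal (g x) \<partial>lborel) = (\<integral>\<^sup>+x. G x \<partial>lborel)"
    using AEg by (intro nn_integral_cong_AE)
  have int0: "0 \<le> (\<integral>x. indicator {a..b} x * f x \<partial>lborel)" using f0 by (intro integral_nonneg_AE) auto
  show ?thesis
  proof (rule that[of g])
    show gi: "integrable lborel g"
    proof (rule integrableI_nonneg)
      show "(\<integral>\<^sup>+x. ennreal (g x) \<partial>lborel) < \<infinity>"
        unfolding nng by (rule le_less_trans[OF G1]) simp
    qed (simp_all add: g_def)
    show g0: "g x \<ge> 0" for x by (simp add: g_def)
    have "ennreal (\<integral>x. g x \<partial>lborel) = (\<integral>\<^sup>+x. ennreal (g x) \<partial>lborel)"
      using gi g0 by (intro nn_integral_eq_integral[symmetric]) auto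
    then have "ennreal (\<integral>x. g x \<partial>lborel) \<le> ennreal ((\<integral>x. indicator {a..b} x * f x \<partial>lborel) + e)"
      using G1 nng by simp
    then show "(\<integral>x. g x \<partial>lborel) \<le> (\<integral>x. indicator {a..b} x * f x \<partial>lborel) + e"
      using int0 e by (subst (asm) ennreal_le_iff) auto
    fix x assume x: "x \<in> {a..b}"
    have "x \<in> U (N x)" using x U(2)[of "N x"] by (auto simp: E_def)
    then obtain d where d: "d > 0" "ball x d \<subseteq> U (N x)" using U(1) openE by blast
    show "\<exists>d>0. AE y in lborel. y \<in> {x..x+d} \<longrightarrow> f x \<le> g y"
    proof (intro exI[of _ "d/2"] conjI)
      show "AE y in lborel. y \<in> {x..x+d/2} \<longrightarrow> f x \<le> g y"
        using AEg
      proof eventually_elim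
        fix y assume y: "ennreal (g y) = G y"
        show "y \<in> {x..x+d/2} \<longrightarrow> f x \<le> g y"
        proof
          assume "y \<in> {x..x+d/2}"
          then have "y \<in> U (N x)" using d by (auto simp: dist_real_def subset_iff)
          then have "ennreal (real (Suc (N x)) * \<delta>) \<le> G y"
            unfolding G_def by (intro order_trans[OF _ sum_le_suminf[of _ "{N x}"]]) auto
          then have "ennreal (real (Suc (N x)) * \<delta>) \<le> ennreal (g y)" by (simp only: y)
          then have "real (Suc (N x)) * \<delta> \<le> g y" by (simp only: ennreal_le_iff[OF g0])
          then show "f x \<le> g y" using N1(2)[of x] by (simp add: add.commute)
        qed
      qed
    qed (use d in simp)
  qed
qed

text \<open>Compare \<open>F\<close> with the integral of a right majorant \<open>k\<close> of
  \<open>f\<close>, plus a small slope and a small initial height. The difference \<Phi> cannot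
  become negative: at the last point of \<open>\<Phi> \<ge> 0\<close> the integral of
  \<open>k\<close> would outgrow \<open>F\<close> immediately to the right. The initial height keeps
  that point away from \<open>a\<close>, where no derivative is given.\<close>

lemma right_deriv_le_integral:
  fixes F f :: "real \<Rightarrow> real"
  assumes ab: "a \<le> b" and F: "continuous_on {a..b} F" and f: "set_integrable lborel {a..b} f"
    and D: "\<And>x. a < x \<Longrightarrow> x < b \<Longrightarrow> \<exists>D\<le>f x. (F has_real_derivative D) (at_right x)"
  shows "F b - F a \<le> (LBINT x:{a..b}. f x)"
proof (rule field_le_epsilon)
  fix e :: real assume e: "e > 0"
  define f' where "f' x = indicator {a..b} x * f x" for x
  have f'i: "integrable lborel f'" using f by (simp add: set_integrable_def f'_def[abs_def])
  then have f'[measurable]: "f' \<in> borel_measurable borel" by (auto dest: borel_measurable_integrable)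
  have If: "(LBINT x:{a..b}. f x) = (\<integral>x. f' x \<partial>lborel)" by (simp add: set_lebesgue_integral_def f'_def)
  \<comment> \<open>Majorants are available for nonnegative functions only, so \<open>f\<close> is
    cut off at \<open>-n\<close> and shifted up by \<open>n\<close>; for large \<open>n\<close> the
    cut changes the integral by less than \<open>e/4\<close>.\<close>
  have "(\<lambda>n. \<integral>x. indicator {a..b} x * max (f' x) (- real n) \<partial>lborel) \<longlonglongrightarrow> (\<integral>x. f' x \<partial>lborel)"
  proof (rule integral_dominated_convergence[where w="\<lambda>x. \<bar>f' x\<bar>"])
    show "AE x in lborel. (\<lambda>n. indicator {a..b} x * max (f' x) (- real n)) \<longlonglongrightarrow> f' x"
    proof (rule AE_I2)
      fix x
      have "eventually (\<lambda>n. - real n \<le> f' x) sequentially"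
        using eventually_ge_at_top[of "nat \<lceil>\<bar>f' x\<bar>\<rceil>"] by eventually_elim linarith
      then have "eventually (\<lambda>n. indicator {a..b} x * max (f' x) (- real n) = f' x) sequentially"
        by eventually_elim (auto simp: f'_def indicator_def)
      then show "(\<lambda>n. indicator {a..b} x * max (f' x) (- real n)) \<longlonglongrightarrow> f' x"
        by (rule tendsto_eventually)
    qed
    show "AE x in lborel. norm (indicator {a..b} x * max (f' x) (- real n)) \<le> \<bar>f' x\<bar>" for n
      by (rule AE_I2) (auto simp: indicator_def)
  qed (use f'i in auto)
  then have "eventually (\<lambda>n. (\<integral>x. indicator {a..b} x * max (f' x) (- real n) \<partial>lborel) < (\<integral>x. f' x \<partial>lborel) + e/4) sequentially"
    using e by (intro order_tendstoD) auto
  then obtain n :: nat where n: "(\<integral>x. indicator {a..b} x * max (f' x) (- real n) \<partial>lborel) < (\<integral>x. f' x \<partial>lborel) + e/4"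
    by (auto simp: eventually_sequentially)
  define m where "m x = max (f' x) (- real n) + real n" for x
  have mi0: "integrable lborel (\<lambda>x. indicator {a..b} x * max (f' x) (- real n))"
    by (rule Bochner_Integration.integrable_bound[OF f'i]) (auto simp: indicator_def)
  have mi: "integrable lborel (\<lambda>x. indicator {a..b} x * m x)"
  proof -
    have "integrable lborel (\<lambda>x. indicator {a..b} x * max (f' x) (- real n) + indicator {a..b} x * real n)"
      using mi0 ab by (intro Bochner_Integration.integrable_add) simp_all
    then show ?thesis by (simp add: m_def distrib_left)
  qed
  have Im: "(\<integral>x. indicator {a..b} x * m x \<partial>lborel) = (\<integral>x. indicator {a..b} x * max (f' x) (- real n) \<partial>lborel) + real n * (b - a)"
  proof -
    have "(\<integral>x. indicator {a..b} x * m x \<partial>lborel) = (\<integral>x. indicator {a..b} x * max (f' x) (- real n) + indicator {a..b} x * real n \<partial>lborel)"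
      by (simp add: m_def distrib_left)
    also have "\<dots> = (\<integral>x. indicator {a..b} x * max (f' x) (- real n) \<partial>lborel) + real n * (b - a)"
      using mi0 ab by (subst Bochner_Integration.integral_add) simp_all
    finally show ?thesis .
  qed
  obtain g where g: "integrable lborel g" "\<And>x. g x \<ge> 0"
    "(\<integral>x. g x \<partial>lborel) \<le> (\<integral>x. indicator {a..b} x * m x \<partial>lborel) + e/4"
    "\<And>x. x \<in> {a..b} \<Longrightarrow> \<exists>d>0. AE y in lborel. y \<in> {x..x+d} \<longrightarrow> m x \<le> g y"
    by (rule right_majorant[OF ab _ _ mi, of "e/4"]) (use e in \<open>auto simp: m_def\<close>)
  \<comment> \<open>The shift is undone. Right of every point \<open>k\<close> dominates
    \<open>f\<close> at that point, and its integral exceeds that of \<open>f\<close> by at most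
    \<open>e/2\<close>, a quarter each for the cut-off and for the majorant.\<close>
  define k where "k x = g x - real n" for x
  have gS: "set_integrable lborel {x..y} g" for x y
    unfolding set_integrable_def using integrable_mult_indicator[of "{x..y}" lborel g] g(1) by simp
  have cS: "set_integrable lborel {x..y} (\<lambda>_. c :: real)" for c and x y :: real
    by (rule borel_integrable_atLeastAtMost') (rule continuous_on_const)
  have ki: "set_integrable lborel S k" if "S = {x..y}" for S x y
    unfolding k_def that by (intro set_integral_diff gS cS)
  have kHK: "(LBINT x:{x..y}. k x) = integral {x..y} k" "k integrable_on {x..y}" for x y
    using set_borel_integral_eq_integral[OF ki[OF refl], of x y] by auto
  have Ik: "(LBINT x:{a..b}. k x) \<le> (\<integral>x. f' x \<partial>lborel) + e/2"
  proof -
    have "(LBINT x:{a..b}. k x) = (LBINT x:{a..b}. g x) - (LBINT x:{a..b}. real n)"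
      unfolding k_def by (intro set_integral_diff gS cS)
    also have "(LBINT x:{a..b}. real n) = real n * (b - a)" using ab by (simp add: set_lebesgue_integral_def)
    also have "(LBINT x:{a..b}. g x) \<le> (\<integral>x. g x \<partial>lborel)"
      unfolding set_lebesgue_integral_def using gS[unfolded set_integrable_def] g(1,2)
      by (intro integral_mono) (auto simp: indicator_def)
    finally show ?thesis using g(3) Im n by simp
  qed
  \<comment> \<open>One constant serves both as added slope and as initial height; together they
    cost exactly \<open>e/2\<close> over \<open>[a, b]\<close>.\<close>
  define \<eta> where "\<eta> = e / (2 * (b - a + 1))"
  have \<eta>: "\<eta> > 0" using e ab by (simp add: \<eta>_def)
  have \<eta>b: "\<eta> * (b - a) + \<eta> = e / 2"
  proof -
    have "\<eta> * (2 * (b - a + 1)) = e" using ab by (simp add: \<eta>_def)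
    then show ?thesis by (simp add: algebra_simps)
  qed
  define \<Phi> where "\<Phi> x = integral {a..x} k - F x + F a + \<eta> * (x - a) + \<eta>" for x
  have \<Phi>c: "continuous_on {a..b} \<Phi>"
    unfolding \<Phi>_def by (intro continuous_intros F indefinite_integral_continuous_1 kHK)
  have "\<Phi> b \<ge> 0"
  proof (rule ccontr)
    assume "\<not> \<Phi> b \<ge> 0"
    then have b: "\<Phi> b < 0" by simp
    have a: "\<Phi> a = \<eta>" by (simp add: \<Phi>_def)
    \<comment> \<open>\<open>S\<close> is compact and thus has a last point \<open>x\<close>. By the
      intermediate value theorem \<Phi> vanishes there, so \<open>x\<close> is not \<open>a\<close>,
      and it is not \<open>b\<close> as \<open>\<Phi> b < 0\<close>.\<close>
    define S where "S = {a..b} \<inter> \<Phi> -` {0..}"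
    have "closed S" unfolding S_def using \<Phi>c by (intro continuous_closed_preimage) auto
    moreover have "S \<subseteq> {a..b}" by (auto simp: S_def)
    ultimately have "compact S" using compact_Int_closed[of "{a..b}" S] by (simp add: Int_absorb1)
    moreover have "a \<in> S" using ab a \<eta> by (auto simp: S_def)
    ultimately obtain x where x: "x \<in> S" "\<And>y. y \<in> S \<Longrightarrow> y \<le> x"
      using compact_attains_sup[of S] by auto
    have xb: "x < b" using x(1) b by (cases "x = b") (auto simp: S_def)
    have xa: "a \<le> x" "\<Phi> x \<ge> 0" using x(1) by (auto simp: S_def)
    have x0: "\<Phi> x \<le> 0"
    proof (rule ccontr)
      assume "\<not> \<Phi> x \<le> 0"
      then have "0 \<le> \<Phi> x" "\<Phi> b \<le> 0" using b by auto
      then obtain y where y: "x \<le> y" "y \<le> b" "\<Phi> y = 0"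
        using IVT2'[of \<Phi> b 0 x] continuous_on_subset[OF \<Phi>c, of "{x..b}"] xa xb by auto
      then have "y \<in> S" using xa by (auto simp: S_def)
      then have "y = x" using x(2) y by force
      then show False using y \<open>\<not> \<Phi> x \<le> 0\<close> by simp
    qed
    then have "x \<noteq> a" using a \<eta> by auto
    then have ax: "a < x" using xa by simp
    obtain D where D': "D \<le> f x" "(F has_real_derivative D) (at_right x)" using D[OF ax xb] by blast
    obtain d where d: "d > 0" "AE y in lborel. y \<in> {x..x+d} \<longrightarrow> m x \<le> g y" using g(4)[of x] xa xb by auto
    have "((\<lambda>y. (F y - F x) / (y - x)) \<longlongrightarrow> D) (at_right x)"
      using D'(2) by (simp add: has_field_derivative_iff)
    then have "eventually (\<lambda>y. (F y - F x) / (y - x) < D + \<eta>) (at_right x)"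
      using \<eta> by (intro order_tendstoD) auto
    moreover have "eventually (\<lambda>y. x < y \<and> y < min b (x + d)) (at_right x)"
      using xb d by (auto simp: eventually_at_right intro!: exI[of _ "min b (x+d)"])
    ultimately have "eventually (\<lambda>y. (F y - F x) / (y - x) < D + \<eta> \<and> x < y \<and> y < min b (x + d)) (at_right x)"
      by eventually_elim auto
    then obtain y where y: "(F y - F x) / (y - x) < D + \<eta>" "x < y" "y < b" "y < x + d"
      using eventually_happens[of _ "at_right x"] by (auto simp: trivial_limit_at_right_real)
    have "F y - F x \<le> (D + \<eta>) * (y - x)" using y by (simp add: pos_divide_less_eq)
    also have "\<dots> \<le> (f x + \<eta>) * (y - x)" using D' y by (intro mult_right_mono) auto
    finally have F1: "F y - F x \<le> f x * (y - x) + \<eta> * (y - x)" by (simp add: distrib_right)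
    have "f x * (y - x) = (LBINT u:{x..y}. f x)" using y by (simp add: set_lebesgue_integral_def)
    also have "\<dots> \<le> (LBINT u:{x..y}. k u)"
    proof (rule set_integral_mono_AE)
      show "set_integrable lborel {x..y} (\<lambda>x'. f x)" by (rule cS)
      show "set_integrable lborel {x..y} k" by (rule ki[OF refl])
      show "AE u\<in>{x..y} in lborel. f x \<le> k u"
        using d(2)
      proof eventually_elim
        case (elim u)
        then show ?case using y xa xb by (auto simp: k_def m_def f'_def max_def split: if_splits)
      qed
    qed
    also have "\<dots> = integral {x..y} k" by (rule kHK(1))
    finally have k1: "f x * (y - x) \<le> integral {x..y} k" .
    have "integral {a..x} k + integral {x..y} k = integral {a..y} k"
      using ax y kHK by (intro Henstock_Kurzweil_Integration.integral_combine) auto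
    then have "\<Phi> y \<ge> \<Phi> x" using k1 F1 by (simp add: \<Phi>_def algebra_simps)
    then have "y \<in> S" using xa y by (auto simp: S_def)
    then show False using x(2) y by force
  qed
  then have "F b - F a \<le> (LBINT x:{a..b}. k x) + e/2" using \<eta>b by (simp add: \<Phi>_def kHK)
  then show "F b - F a \<le> (LBINT x:{a..b}. f x) + e" using Ik If by simp
qed

text \<open>The fundamental theorem of calculus in the form that generators allow; the two
  inequalities come from \<open>F\<close> and \<open>- F\<close>. Continuity of \<open>F\<close>
  rules out step functions, whose right derivative vanishes everywhere.\<close>

lemma right_deriv_eq_integral:
  fixes F f :: "real \<Rightarrow> real"
  assumes ab: "a \<le> b" and F: "continuous_on {a..b} F" and f: "set_integrable lborel {a..b} f"
    and D: "\<And>x. a < x \<Longrightarrow> x < b \<Longrightarrow> (F has_real_derivative f x) (at_right x)"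
  shows "F b - F a = (LBINT x:{a..b}. f x)"
proof (rule antisym)
  show "F b - F a \<le> (LBINT x:{a..b}. f x)" using assms by (intro right_deriv_le_integral) auto
  have "- F b - (- F a) \<le> (LBINT x:{a..b}. - f x)"
    using ab D F f by (intro right_deriv_le_integral continuous_intros) (auto intro: DERIV_minus simp: set_integrable_def)
  then show "(LBINT x:{a..b}. f x) \<le> F b - F a" by (simp add: set_lebesgue_integral_def)
qed

section \<open>Lebesgue-Stieltjes integrals\<close>

lemma borel_measure_eq_Ioc:
  assumes M: "sets M = sets borel" "sets N = sets borel"
    and eq: "\<And>a b :: real. emeasure M {a<..b} = emeasure N {a<..b}" and fin: "\<And>a b. emeasure M {a<..b} \<noteq> \<infinity>"
  shows "M = N"
proof (rule measure_eqI_generator_eq)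
  let ?E = "range (\<lambda>(a, b). {a<..b :: real})"
  show "Int_stable ?E"
    by (auto simp: Int_stable_def)
  show "?E \<subseteq> Pow UNIV" by auto
  show "sets M = sigma_sets UNIV ?E" "sets N = sigma_sets UNIV ?E"
    using M by (simp_all add: borel_sigma_sets_Ioc)
  show "range (\<lambda>n. {- real n<..real n}) \<subseteq> ?E" by auto
  show "(\<Union>n. {- real n<..real n}) = UNIV"
  proof (intro set_eqI iffI UNIV_I)
    fix x :: real
    obtain n where "\<bar>x\<bar> < real n" using reals_Archimedean2 by blast
    then show "x \<in> (\<Union>n. {- real n<..real n})" by (auto intro!: exI[of _ n])
  qed
qed (use eq fin in auto)

lemma interval_measure_eqI:
  fixes g :: "real \<Rightarrow> real"
  assumes g: "mono g" "\<And>u. continuous (at_right u) g" and M: "sets M = sets borel"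
    and eq: "\<And>x y. x \<le> y \<Longrightarrow> emeasure M {x<..y} = ennreal (g y - g x)"
  shows "interval_measure g = M"
proof (rule borel_measure_eq_Ioc[OF _ M])
  show "emeasure (interval_measure g) {a<..b} = emeasure M {a<..b}" for a b
  proof (cases "a \<le> b")
    case True
    then show ?thesis using g eq[OF True] by (simp add: emeasure_interval_measure_Ioc monoD)
  qed simp
  show "emeasure (interval_measure g) {a<..b} \<noteq> \<infinity>" for a b
    using g by (simp add: emeasure_interval_measure_Ioc_eq monoD)
qed simp

text \<open>Induction over nonnegative measurable functions. It serves the Stieltjes measure of a
  sum of two integrators.\<close>

lemma nn_integral_add_measure:
  assumes s: "sets M1 = sets M" "sets M2 = sets M"
    and add: "\<And>A. A \<in> sets M \<Longrightarrow> emeasure M A = emeasure M1 A + emeasure M2 A"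
    and f: "f \<in> borel_measurable M"
  shows "(\<integral>\<^sup>+x. f x \<partial>M) = (\<integral>\<^sup>+x. f x \<partial>M1) + (\<integral>\<^sup>+x. f x \<partial>M2)"
  using f
proof (induction rule: borel_measurable_induct)
  case (cong f g)
  then show ?case
    using s nn_integral_cong[of M f g] nn_integral_cong[of M1 f g] nn_integral_cong[of M2 f g]
    by (simp add: sets_eq_imp_space_eq[OF s(1)] sets_eq_imp_space_eq[OF s(2)])
next
  case (set A)
  then show ?case using s add by simp
next
  case (mult u c)
  have "u \<in> borel_measurable M1" "u \<in> borel_measurable M2"
    using mult(2) s by (simp_all cong: measurable_cong_sets)
  then show ?case using mult by (simp add: nn_integral_cmult distrib_left)
next
  case (add u v)
  have "u \<in> borel_measurable M1" "u \<in> borel_measurable M2" "v \<in> borel_measurable M1" "v \<in> borel_measurable M2"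
    using add(1,3) add.hyps s by (simp_all cong: measurable_cong_sets)
  then show ?case using add by (simp add: nn_integral_add ac_simps)
next
  case (seq U)
  have m: "U i \<in> borel_measurable M1" "U i \<in> borel_measurable M2" for i
    using seq s by (simp_all cong: measurable_cong_sets)
  have "(\<integral>\<^sup>+x. (SUP i. U i x) \<partial>M) = (SUP i. \<integral>\<^sup>+x. U i x \<partial>M)"
    using seq by (intro nn_integral_monotone_convergence_SUP) auto
  also have "\<dots> = (SUP i. (\<integral>\<^sup>+x. U i x \<partial>M1) + (\<integral>\<^sup>+x. U i x \<partial>M2))" using seq by simp
  also have "\<dots> = (SUP i. \<integral>\<^sup>+x. U i x \<partial>M1) + (SUP i. \<integral>\<^sup>+x. U i x \<partial>M2)"
    using seq by (intro ennreal_SUP_add) (auto simp: incseq_def le_fun_def intro!: nn_integral_mono)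
  also have "(SUP i. \<integral>\<^sup>+x. U i x \<partial>M1) = (\<integral>\<^sup>+x. (SUP i. U i x) \<partial>M1)"
    using seq m by (intro nn_integral_monotone_convergence_SUP[symmetric]) auto
  also have "(SUP i. \<integral>\<^sup>+x. U i x \<partial>M2) = (\<integral>\<^sup>+x. (SUP i. U i x) \<partial>M2)"
    using seq m by (intro nn_integral_monotone_convergence_SUP[symmetric]) auto
  finally show ?case by (simp add: image_comp comp_def SUP_apply)
qed

lemma integral_add_measure:
  fixes f :: "'a \<Rightarrow> real"
  assumes s: "sets M1 = sets M" "sets M2 = sets M"
    and add: "\<And>A. A \<in> sets M \<Longrightarrow> emeasure M A = emeasure M1 A + emeasure M2 A"
    and f: "integrable M1 f" "integrable M2 f"
  shows "integrable M f" "integral\<^sup>L M f = integral\<^sup>L M1 f + integral\<^sup>L M2 f"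
proof -
  have fm: "f \<in> borel_measurable M" using f(1) s by (metis borel_measurable_integrable measurable_cong_sets)
  note nn = nn_integral_add_measure[OF s add]
  have p: "(\<integral>\<^sup>+x. ennreal (f x) \<partial>M) = (\<integral>\<^sup>+x. ennreal (f x) \<partial>M1) + (\<integral>\<^sup>+x. ennreal (f x) \<partial>M2)"
    "(\<integral>\<^sup>+x. ennreal (- f x) \<partial>M) = (\<integral>\<^sup>+x. ennreal (- f x) \<partial>M1) + (\<integral>\<^sup>+x. ennreal (- f x) \<partial>M2)"
    using fm by (auto intro!: nn)
  show fi: "integrable M f"
    using f p fm by (auto simp: real_integrable_def ennreal_add_eq_top)
  show "integral\<^sup>L M f = integral\<^sup>L M1 f + integral\<^sup>L M2 f"
    using f p unfolding real_lebesgue_integral_def[OF fi] real_lebesgue_integral_def[OF f(1)] real_lebesgue_integral_def[OF f(2)]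
    by (simp add: enn2real_plus real_integrable_def less_top)
qed

text \<open>Measures that agree on half-open intervals coincide; the sum of the two Stieltjes
  measures first has to be built as a measure \<open>M\<close>.\<close>

lemma emeasure_interval_measure_add:
  fixes g1 g2 :: "real \<Rightarrow> real"
  assumes g1: "mono g1" "\<And>u. continuous (at_right u) g1" and g2: "mono g2" "\<And>u. continuous (at_right u) g2"
    and A: "A \<in> sets borel"
  shows "emeasure (interval_measure (\<lambda>u. g1 u + g2 u)) A = emeasure (interval_measure g1) A + emeasure (interval_measure g2) A"
proof -
  define M where "M = measure_of UNIV (sets borel) (\<lambda>A. emeasure (interval_measure g1) A + emeasure (interval_measure g2) A)"
  have sM: "sets M = sets borel" unfolding M_def by (metis sets.sets_measure_of_eq space_borel)
  have eM: "emeasure M A = emeasure (interval_measure g1) A + emeasure (interval_measure g2) A" if "A \<in> sets borel" for A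
  proof (rule emeasure_measure_of[OF M_def])
    show "positive (sets M) (\<lambda>A. emeasure (interval_measure g1) A + emeasure (interval_measure g2) A)"
      by (simp add: positive_def)
    show "countably_additive (sets M) (\<lambda>A. emeasure (interval_measure g1) A + emeasure (interval_measure g2) A)"
    proof (rule countably_additiveI)
      fix B :: "nat \<Rightarrow> real set" assume B: "range B \<subseteq> sets M" "disjoint_family B" "\<Union> (range B) \<in> sets M"
      then show "(\<Sum>i. emeasure (interval_measure g1) (B i) + emeasure (interval_measure g2) (B i)) =
        emeasure (interval_measure g1) (\<Union> (range B)) + emeasure (interval_measure g2) (\<Union> (range B))"
        by (subst suminf_add[symmetric]) (auto simp: sM suminf_emeasure)
    qed
  qed (use that sM in auto)
  have "interval_measure (\<lambda>u. g1 u + g2 u) = M"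
  proof (rule interval_measure_eqI[OF _ _ sM])
    show "mono (\<lambda>u. g1 u + g2 u)" using g1(1) g2(1) by (auto simp: mono_def intro: add_mono)
    show "continuous (at_right u) (\<lambda>u. g1 u + g2 u)" for u using g1(2) g2(2) by (intro continuous_add)
    fix x y :: real assume "x \<le> y"
    then show "emeasure M {x<..y} = ennreal (g1 y + g2 y - (g1 x + g2 x))"
      using monoD[OF g1(1) \<open>x \<le> y\<close>] monoD[OF g2(1) \<open>x \<le> y\<close>] g1 g2
      by (simp add: eM emeasure_interval_measure_Ioc monoD ennreal_plus[symmetric] del: ennreal_plus) (simp add: algebra_simps)
  qed
  then show ?thesis using eM A by simp
qed

lemma interval_measure_integral_add:
  fixes f :: "real \<Rightarrow> real"
  assumes g1: "mono g1" "\<And>u. continuous (at_right u) g1" and g2: "mono g2" "\<And>u. continuous (at_right u) g2"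
    and f: "set_integrable (interval_measure g1) S f" "set_integrable (interval_measure g2) S f"
  shows "set_integrable (interval_measure (\<lambda>u. g1 u + g2 u)) S f"
    "(LINT u:S|interval_measure (\<lambda>u. g1 u + g2 u). f u) = (LINT u:S|interval_measure g1. f u) + (LINT u:S|interval_measure g2. f u)"
  unfolding set_integrable_def set_lebesgue_integral_def
  using integral_add_measure[of "interval_measure g1" "interval_measure (\<lambda>u. g1 u + g2 u)" "interval_measure g2" "\<lambda>x. indicator S x *\<^sub>R f x"]
    emeasure_interval_measure_add[OF g1 g2] f unfolding set_integrable_def by auto

text \<open>The mass of a subinterval of \<open>{a<..b}\<close> is a difference of values on
  \<open>{a..b}\<close>. Restriction to \<open>{a<..b}\<close> is expressed as a density, so that
  the two restricted measures can be compared on all half-open intervals.\<close>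

lemma interval_measure_cong_on:
  fixes f :: "real \<Rightarrow> real"
  assumes g: "mono g" "\<And>u. continuous (at_right u) g" and k: "mono k" "\<And>u. continuous (at_right u) k"
    and eq: "\<And>u. u \<in> {a..b} \<Longrightarrow> g u = k u"
    and f: "set_integrable (interval_measure g) {a<..b} f"
  shows "(LINT u:{a<..b}|interval_measure g. f u) = (LINT u:{a<..b}|interval_measure k. f u)"
proof -
  have *: "density (interval_measure g) (indicator {a<..b}) = density (interval_measure k) (indicator {a<..b})"
  proof (rule borel_measure_eq_Ioc)
    have e: "emeasure (density (interval_measure h) (indicator {a<..b})) {x<..y} =
      (if max a x \<le> min b y then ennreal (h (min b y) - h (max a x)) else 0)"
      if h: "mono h" "\<And>u. continuous (at_right u) h" for h x y
    proof -
      have "emeasure (density (interval_measure h) (indicator {a<..b})) {x<..y} = emeasure (interval_measure h) ({a<..b} \<inter> {x<..y})"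
        by (subst emeasure_density) (auto simp: indicator_inter_arith[symmetric])
      also have "{a<..b} \<inter> {x<..y} = {max a x<..min b y}" by auto
      also have "emeasure (interval_measure h) \<dots> = (if max a x \<le> min b y then ennreal (h (min b y) - h (max a x)) else 0)"
        using h by (subst emeasure_interval_measure_Ioc_eq) (auto simp: monoD)
      finally show ?thesis .
    qed
    show "emeasure (density (interval_measure g) (indicator {a<..b})) {x<..y} = emeasure (density (interval_measure k) (indicator {a<..b})) {x<..y}" for x y
      unfolding e[OF g] e[OF k] using eq[of "min b y"] eq[of "max a x"] by (auto split: if_splits)
    show "emeasure (density (interval_measure g) (indicator {a<..b})) {x<..y} \<noteq> \<infinity>" for x y
      unfolding e[OF g] by simp
  qed simp_all
  have r: "(LINT u:{a<..b}|interval_measure h. f u) = integral\<^sup>L (density (interval_measure h) (indicator {a<..b})) (\<lambda>x. indicator {a<..b} x *\<^sub>R f x)" for h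
  proof -
    have m: "(\<lambda>x. indicator {a<..b} x *\<^sub>R f x) \<in> borel_measurable (interval_measure h)"
      using f unfolding set_integrable_def by (auto dest!: borel_measurable_integrable)
    have "density (interval_measure h) (indicator {a<..b}) = density (interval_measure h) (\<lambda>x. ennreal (indicator {a<..b} x))"
      by (intro density_cong) (auto simp: indicator_def)
    then have "integral\<^sup>L (density (interval_measure h) (indicator {a<..b})) (\<lambda>x. indicator {a<..b} x *\<^sub>R f x) =
      integral\<^sup>L (interval_measure h) (\<lambda>x. indicator {a<..b} x *\<^sub>R indicator {a<..b} x *\<^sub>R f x)"
      using m by (simp add: integral_density)
    also have "\<dots> = (LINT u:{a<..b}|interval_measure h. f u)"
      unfolding set_lebesgue_integral_def by (intro Bochner_Integration.integral_cong) (auto simp: indicator_def)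
    finally show ?thesis by simp
  qed
  show ?thesis unfolding r * ..
qed

text \<open>If \<open>g1 - g2 = k1 - k2\<close> on \<open>{a..b}\<close>, then
  \<open>g1 + k2\<close> and \<open>k1 + g2\<close> are monotone integrators that agree there, and
  additivity in the integrator concludes. This allows integrals known only to exist, as in the
  density equation, to be evaluated through an explicit decomposition.\<close>

lemma has_ls_integral_unique:
  assumes "has_ls_integral f g y a b" "has_ls_integral f g y' a b"
  shows "y = y'"
proof -
  obtain g1 g2 where g: "mono g1" "mono g2" "\<And>u. continuous (at_right u) g1" "\<And>u. continuous (at_right u) g2"
    "\<And>u. u \<in> {a..b} \<Longrightarrow> g u = g1 u - g2 u"
    "set_integrable (interval_measure g1) {a<..b} f" "set_integrable (interval_measure g2) {a<..b} f"
    "y = (LINT u:{a<..b}|interval_measure g1. f u) - (LINT u:{a<..b}|interval_measure g2. f u)"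
    using assms(1) unfolding has_ls_integral_def by blast
  obtain k1 k2 where k: "mono k1" "mono k2" "\<And>u. continuous (at_right u) k1" "\<And>u. continuous (at_right u) k2"
    "\<And>u. u \<in> {a..b} \<Longrightarrow> g u = k1 u - k2 u"
    "set_integrable (interval_measure k1) {a<..b} f" "set_integrable (interval_measure k2) {a<..b} f"
    "y' = (LINT u:{a<..b}|interval_measure k1. f u) - (LINT u:{a<..b}|interval_measure k2. f u)"
    using assms(2) unfolding has_ls_integral_def by blast
  have "(LINT u:{a<..b}|interval_measure (\<lambda>u. g1 u + k2 u). f u) = (LINT u:{a<..b}|interval_measure (\<lambda>u. k1 u + g2 u). f u)"
  proof (rule interval_measure_cong_on)
    show "mono (\<lambda>u. g1 u + k2 u)" "mono (\<lambda>u. k1 u + g2 u)"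
      using g k by (auto simp: mono_def intro: add_mono)
    show "continuous (at_right u) (\<lambda>u. g1 u + k2 u)" "continuous (at_right u) (\<lambda>u. k1 u + g2 u)" for u
      using g k by (auto intro: continuous_add)
    show "g1 u + k2 u = k1 u + g2 u" if "u \<in> {a..b}" for u using g(5)[OF that] k(5)[OF that] by simp
    show "set_integrable (interval_measure (\<lambda>u. g1 u + k2 u)) {a<..b} f"
      using g k by (intro interval_measure_integral_add)
  qed
  then show ?thesis
    using g k by (simp add: interval_measure_integral_add)
qed

text \<open>The integrator matters at \<open>a\<close> as well, because masses are increments from
  there; the integrand matters only on the half-open interval of integration.\<close>

lemma has_ls_integral_cong:
  assumes "has_ls_integral f g y a b" "\<And>u. u \<in> {a..b} \<Longrightarrow> g u = g' u" "\<And>u. u \<in> {a<..b} \<Longrightarrow> f u = f' u"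
  shows "has_ls_integral f' g' y a b"
proof -
  have "set_integrable M {a<..b} f \<longleftrightarrow> set_integrable M {a<..b} f'" "(LINT u:{a<..b}|M. f u) = (LINT u:{a<..b}|M. f' u)" for M :: "real measure"
    using assms(3) unfolding set_integrable_def set_lebesgue_integral_def
    by (auto intro!: Bochner_Integration.integrable_cong Bochner_Integration.integral_cong simp: indicator_def)
  then show ?thesis using assms(1,2) unfolding has_ls_integral_def by simp
qed

lemma has_ls_integral_minus:
  assumes "has_ls_integral f g y a b"
  shows "has_ls_integral f (\<lambda>u. - g u) (- y) a b"
  using assms unfolding has_ls_integral_def by (elim exE conjE) (rule exI, rule exI, intro conjI; (assumption | simp))

lemma has_ls_integral_add:
  assumes "has_ls_integral f g y a b" "has_ls_integral f k z a b"
  shows "has_ls_integral f (\<lambda>u. g u + k u) (y + z) a b"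
proof -
  obtain g1 g2 where g: "mono g1" "mono g2" "\<And>u. continuous (at_right u) g1" "\<And>u. continuous (at_right u) g2"
    "\<And>u. u \<in> {a..b} \<Longrightarrow> g u = g1 u - g2 u"
    "set_integrable (interval_measure g1) {a<..b} f" "set_integrable (interval_measure g2) {a<..b} f"
    "y = (LINT u:{a<..b}|interval_measure g1. f u) - (LINT u:{a<..b}|interval_measure g2. f u)"
    using assms(1) unfolding has_ls_integral_def by blast
  obtain k1 k2 where k: "mono k1" "mono k2" "\<And>u. continuous (at_right u) k1" "\<And>u. continuous (at_right u) k2"
    "\<And>u. u \<in> {a..b} \<Longrightarrow> k u = k1 u - k2 u"
    "set_integrable (interval_measure k1) {a<..b} f" "set_integrable (interval_measure k2) {a<..b} f"
    "z = (LINT u:{a<..b}|interval_measure k1. f u) - (LINT u:{a<..b}|interval_measure k2. f u)"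
    using assms(2) unfolding has_ls_integral_def by blast
  show ?thesis unfolding has_ls_integral_def
  proof (intro exI conjI ballI allI)
    show "mono (\<lambda>u. g1 u + k1 u)" "mono (\<lambda>u. g2 u + k2 u)"
      using g k by (auto simp: mono_def intro: add_mono)
    show "continuous (at_right u) (\<lambda>u. g1 u + k1 u)" "continuous (at_right u) (\<lambda>u. g2 u + k2 u)" for u
      using g k by (auto intro: continuous_add)
    show "g u + k u = g1 u + k1 u - (g2 u + k2 u)" if "u \<in> {a..b}" for u using g(5)[OF that] k(5)[OF that] by simp
    show "set_integrable (interval_measure (\<lambda>u. g1 u + k1 u)) {a<..b} f"
      "set_integrable (interval_measure (\<lambda>u. g2 u + k2 u)) {a<..b} f"
      using g k by (auto intro!: interval_measure_integral_add)
  qed (use g k in \<open>simp add: interval_measure_integral_add\<close>)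
qed

lemma has_ls_integral_const:
  assumes "set_borel_measurable borel {a<..b} f"
  shows "has_ls_integral f (\<lambda>u. c) 0 a b"
proof -
  have z: "interval_measure (\<lambda>u. d) = null_measure borel" for d :: real
    by (rule interval_measure_eqI) auto
  have "set_integrable (null_measure borel) {a<..b} f"
    unfolding set_integrable_def using assms
    by (intro integrableI_bounded) (simp_all add: set_borel_measurable_def nn_integral_null_measure)
  then show ?thesis unfolding has_ls_integral_def
    by (intro exI[of _ "\<lambda>u. c"] exI[of _ "\<lambda>u. 0"]) (auto simp: mono_def z)
qed

lemma has_ls_integral_mono:
  assumes g: "mono g" "\<And>u. continuous (at_right u) g" and f: "set_integrable (interval_measure g) {a<..b} f"
  shows "has_ls_integral f g (LINT u:{a<..b}|interval_measure g. f u) a b"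
proof -
  have z: "interval_measure (\<lambda>u. 0) = null_measure borel"
    by (rule interval_measure_eqI) auto
  have "set_integrable (null_measure borel) {a<..b} f"
    using f unfolding set_integrable_def
    by (intro integrableI_bounded) (auto simp: nn_integral_null_measure dest: borel_measurable_integrable)
  then show ?thesis unfolding has_ls_integral_def
    by (intro exI[of _ g] exI[of _ "\<lambda>u. 0"]) (use g f in \<open>auto simp: mono_def[of "\<lambda>_. 0"] z set_lebesgue_integral_def\<close>)
qed

lemma has_ls_integral_sum:
  assumes "finite S" "set_borel_measurable borel {a<..b} f" "\<And>s. s \<in> S \<Longrightarrow> has_ls_integral f (g s) (y s) a b"
  shows "has_ls_integral f (\<lambda>u. \<Sum>s\<in>S. g s u) (\<Sum>s\<in>S. y s) a b"
  using assms(1,3)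
proof (induction S)
  case empty
  then show ?case using assms(2) by (simp add: has_ls_integral_const)
next
  case (insert s S)
  then show ?case by (auto intro!: has_ls_integral_add)
qed

lemma continuous_at_right_step: "continuous (at_right u) (\<lambda>u :: real. if s \<le> u then c else d :: real)"
proof (cases "s \<le> u")
  case True
  have "eventually (\<lambda>v. (if s \<le> v then c else d) = c) (at_right u)"
    by (rule eventually_at_rightI[of u "u+1"]) (use True in auto)
  then have "((\<lambda>v. if s \<le> v then c else d) \<longlongrightarrow> c) (at_right u)" by (rule tendsto_eventually)
  then show ?thesis by (simp only: continuous_within if_True True)
next
  case False
  have "eventually (\<lambda>v. (if s \<le> v then c else d) = d) (at_right u)"
    by (rule eventually_at_rightI[of u s]) (use False in auto)
  then have "((\<lambda>v. if s \<le> v then c else d) \<longlongrightarrow> d) (at_right u)" by (rule tendsto_eventually)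
  then show ?thesis by (simp only: continuous_within if_False False)
qed

text \<open>The Stieltjes measure of an upward step is \<open>c\<close> times the point mass at
  \<open>s\<close>.\<close>

lemma has_ls_integral_jump_nonneg:
  assumes f: "set_borel_measurable borel {a<..b} f" and s: "s \<in> {a<..b}" and c: "c \<ge> 0"
  shows "has_ls_integral f (\<lambda>u. if s \<le> u then c else 0) (f s * c) a b"
proof -
  have fm: "(\<lambda>x. indicator {a<..b} x *\<^sub>R f x) \<in> borel_measurable borel" using f by (simp add: set_borel_measurable_def)
  have j: "interval_measure (\<lambda>u. if s \<le> u then c else 0) = density (return borel s) (\<lambda>_. ennreal c)"
    using c by (intro interval_measure_eqI) (auto simp: mono_def continuous_at_right_step emeasure_density nn_integral_return indicator_def)
  have i: "integrable (density (return borel s) (\<lambda>_. ennreal c)) (\<lambda>x. indicator {a<..b} x *\<^sub>R f x)"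
    using c fm by (subst integrable_density)
      (auto intro!: integrableI_bounded simp: nn_integral_return less_top[symmetric] ennreal_mult_eq_top_iff)
  have v: "integral\<^sup>L (density (return borel s) (\<lambda>_. ennreal c)) (\<lambda>x. indicator {a<..b} x *\<^sub>R f x) = f s * c"
    using c fm s by (subst integral_density) (auto simp: integral_return)
  show ?thesis
    using has_ls_integral_mono[of "\<lambda>u. if s \<le> u then c else 0" a b f] i v c
    by (simp add: mono_def continuous_at_right_step j set_integrable_def set_lebesgue_integral_def)
qed

lemma has_ls_integral_jump:
  assumes f: "set_borel_measurable borel {a<..b} f" and s: "s \<in> {a<..b}"
  shows "has_ls_integral f (\<lambda>u. if s \<le> u then c else 0) (f s * c) a b"
proof (cases "c \<ge> 0")
  case False
  then have "has_ls_integral f (\<lambda>u. - (if s \<le> u then - c else 0)) (- (f s * (- c))) a b"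
    using assms by (intro has_ls_integral_minus has_ls_integral_jump_nonneg) auto
  then show ?thesis by (rule has_ls_integral_cong[THEN back_subst[of "\<lambda>y. has_ls_integral _ _ y _ _"]]) auto
qed (use assms in \<open>simp add: has_ls_integral_jump_nonneg\<close>)

text \<open>The Stieltjes measure of a primitive of \<open>w\<close> has density \<open>w\<close>
  with respect to Lebesgue measure.\<close>

lemma has_ls_integral_AC_nonneg:
  assumes ab: "a \<le> b" and w: "set_integrable lborel {a..b} w" "\<And>u. w u \<ge> 0"
    and f: "set_borel_measurable borel {a<..b} f" and fw: "set_integrable lborel {a<..b} (\<lambda>u. f u * w u)"
  shows "has_ls_integral f (\<lambda>u. LBINT s:{a..u}. w s) (LBINT u:{a<..b}. f u * w u) a b"
proof -
  \<comment> \<open>Cutting \<open>w\<close> off outside \<open>{a..b}\<close> makes its primitive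
    monotone and right-continuous on the whole line, as \<open>interval_measure\<close>
    demands.\<close>
  define w' where "w' x = indicator {a..b} x * w x" for x
  have w'i: "integrable lborel w'" using w(1) by (simp add: set_integrable_def w'_def[abs_def])
  then have w'm[measurable]: "w' \<in> borel_measurable borel" by (auto dest: borel_measurable_integrable)
  have w'0: "w' x \<ge> 0" for x using w(2) by (simp add: w'_def)
  have fm: "(\<lambda>x. indicator {a<..b} x *\<^sub>R f x) \<in> borel_measurable borel" using f by (simp add: set_borel_measurable_def)
  define g where "g u = (LBINT s:{a..u}. w' s)" for u
  have sI: "set_integrable lborel S w'" if "S \<in> sets borel" for S
    unfolding set_integrable_def using that w'i integrable_mult_indicator[of S lborel w'] by simp
  have gd: "g y - g x = (LBINT s:{x<..y}. w' s)" if "x \<le> y" for x y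
  proof (cases "a \<le> x")
    case True
    then have "{a..y} = {a..x} \<union> {x<..y}" using that by auto
    then have "g y = g x + (LBINT s:{x<..y}. w' s)" unfolding g_def
      by (simp only:) (intro set_integral_Un sI; auto)
    then show ?thesis by simp
  next
    case False
    then have "g x = 0" by (simp add: g_def set_lebesgue_integral_def)
    moreover have "g y = (LBINT s:{x<..y}. w' s)"
      unfolding g_def set_lebesgue_integral_def using False
      by (intro Bochner_Integration.integral_cong) (auto simp: w'_def indicator_def)
    ultimately show ?thesis by simp
  qed
  have mono: "mono g"
  proof (rule monoI)
    fix x y :: real assume "x \<le> y"
    then have "g y - g x = (LBINT s:{x<..y}. w' s)" by (rule gd)
    also have "\<dots> \<ge> 0" unfolding set_lebesgue_integral_def using w'0 by (intro integral_nonneg_AE) auto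
    finally show "g x \<le> g y" by simp
  qed
  have cont: "continuous (at_right u) g" for u
  proof -
    have "g x = integral {a..x} w'" for x
      unfolding g_def by (rule set_borel_integral_eq_integral) (simp add: sI)
    then have ge: "g = (\<lambda>x. integral {a..x} w')" by auto
    have c: "continuous_on {a..max a u + 1} g"
      unfolding ge by (intro indefinite_integral_continuous_1 set_borel_integral_eq_integral sI) auto
    show ?thesis
    proof (cases "a \<le> u")
      case True
      then have "continuous (at u within {a..max a u + 1}) g" using c by (auto simp: continuous_on_eq_continuous_within)
      then have "continuous (at u within {u..u+1}) g" by (rule continuous_within_subset) (use True in auto)
      then show ?thesis by (simp add: continuous_within at_within_Icc_at_right)
    next
      case False
      have "eventually (\<lambda>v. g v = g u) (at_right u)"
        by (rule eventually_at_rightI[of u a]) (use False in \<open>auto simp: g_def\<close>)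
      then show ?thesis by (simp add: continuous_within tendsto_eventually)
    qed
  qed
  have im: "interval_measure g = density lborel (\<lambda>x. ennreal (w' x))"
  proof (rule interval_measure_eqI[OF mono cont])
    fix x y :: real assume xy: "x \<le> y"
    have "emeasure (density lborel (\<lambda>x. ennreal (w' x))) {x<..y} = (\<integral>\<^sup>+s. ennreal (indicator {x<..y} s *\<^sub>R w' s) \<partial>lborel)"
      by (subst emeasure_density) (auto intro!: nn_integral_cong simp: indicator_def)
    also have "\<dots> = ennreal (LBINT s:{x<..y}. w' s)"
      unfolding set_lebesgue_integral_def using sI[of "{x<..y}"] w'0
      by (intro nn_integral_eq_integral) (auto simp: set_integrable_def)
    finally show "emeasure (density lborel (\<lambda>x. ennreal (w' x))) {x<..y} = ennreal (g y - g x)" by (simp add: gd[OF xy])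
  qed simp
  have fwi: "integrable lborel (\<lambda>x. w' x * (indicator {a<..b} x * f x))"
  proof -
    show ?thesis using fw unfolding set_integrable_def
      by (rule Bochner_Integration.integrable_cong[THEN iffD1, rotated 2]) (auto simp: w'_def indicator_def)
  qed
  have i: "set_integrable (interval_measure g) {a<..b} f"
    unfolding im set_integrable_def using fwi fm w'0 by (subst integrable_density) auto
  have "(LINT u:{a<..b}|interval_measure g. f u) = (\<integral>x. w' x * (indicator {a<..b} x * f x) \<partial>lborel)"
    unfolding im set_lebesgue_integral_def using fm w'0 by (subst integral_density) auto
  also have "\<dots> = (LBINT u:{a<..b}. f u * w u)"
    unfolding set_lebesgue_integral_def
    by (rule Bochner_Integration.integral_cong) (auto simp: w'_def indicator_def)
  finally have v: "(LINT u:{a<..b}|interval_measure g. f u) = (LBINT u:{a<..b}. f u * w u)" .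
  have "has_ls_integral f g (LBINT u:{a<..b}. f u * w u) a b"
    unfolding v[symmetric] by (rule has_ls_integral_mono[OF mono cont i])
  then show ?thesis
  proof (rule has_ls_integral_cong)
    fix u assume "u \<in> {a..b}"
    then show "g u = (LBINT s:{a..u}. w s)"
      unfolding g_def set_lebesgue_integral_def
      by (intro Bochner_Integration.integral_cong) (auto simp: w'_def indicator_def)
  qed simp
qed

lemma has_ls_integral_AC:
  assumes ab: "a \<le> b" and w: "set_integrable lborel {a..b} w"
    and f: "set_borel_measurable borel {a<..b} f" and fw: "set_integrable lborel {a<..b} (\<lambda>u. f u * w u)"
  shows "has_ls_integral f (\<lambda>u. LBINT s:{a..u}. w s) (LBINT u:{a<..b}. f u * w u) a b"
proof -
  define w' where "w' x = indicator {a..b} x * w x" for x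
  have w'i: "integrable lborel w'" using w by (simp add: set_integrable_def w'_def[abs_def])
  then have [measurable]: "w' \<in> borel_measurable borel" by (auto dest: borel_measurable_integrable)
  define f' where "f' x = indicator {a<..b} x * f x" for x
  have [measurable]: "f' \<in> borel_measurable borel" using f by (simp add: set_borel_measurable_def f'_def[abs_def])
  have fw': "integrable lborel (\<lambda>x. f' x * w' x)" using fw unfolding set_integrable_def
      by (rule Bochner_Integration.integrable_cong[THEN iffD1, rotated 2]) (auto simp: f'_def w'_def indicator_def)
  have "integrable lborel (\<lambda>u. max 0 (w' u))" "integrable lborel (\<lambda>u. max 0 (- w' u))"
    using w'i by (auto intro: Bochner_Integration.integrable_bound)
  then have wp: "set_integrable lborel {a..b} (\<lambda>u. max 0 (w u))" "set_integrable lborel {a..b} (\<lambda>u. max 0 (- w u))"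
    unfolding set_integrable_def
    by (elim Bochner_Integration.integrable_cong[THEN iffD1, rotated 2]; simp add: w'_def indicator_def)+
  have "integrable lborel (\<lambda>u. f' u * max 0 (w' u))" "integrable lborel (\<lambda>u. f' u * max 0 (- w' u))"
    by (rule Bochner_Integration.integrable_bound[OF fw'], simp, simp add: abs_mult mult_left_mono)+
  then have fwp: "set_integrable lborel {a<..b} (\<lambda>u. f u * max 0 (w u))" "set_integrable lborel {a<..b} (\<lambda>u. f u * max 0 (- w u))"
    unfolding set_integrable_def
    by (elim Bochner_Integration.integrable_cong[THEN iffD1, rotated 2]; simp add: f'_def w'_def indicator_def)+
  have "has_ls_integral f (\<lambda>u. (LBINT s:{a..u}. max 0 (w s)) + - (LBINT s:{a..u}. max 0 (- w s)))
      ((LBINT u:{a<..b}. f u * max 0 (w u)) + - (LBINT u:{a<..b}. f u * max 0 (- w u))) a b"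
    using ab wp fwp f by (intro has_ls_integral_add has_ls_integral_minus has_ls_integral_AC_nonneg) auto
  moreover have "(LBINT u:{a<..b}. f u * max 0 (w u)) + - (LBINT u:{a<..b}. f u * max 0 (- w u)) = (LBINT u:{a<..b}. f u * w u)"
  proof -
    have "(LBINT u:{a<..b}. f u * max 0 (w u)) - (LBINT u:{a<..b}. f u * max 0 (- w u)) =
      (LBINT u:{a<..b}. f u * max 0 (w u) - f u * max 0 (- w u))" using fwp by (simp add: set_integral_diff)
    also have "\<dots> = (LBINT u:{a<..b}. f u * w u)"
      by (intro set_lebesgue_integral_cong) (auto simp: max_def algebra_simps)
    finally show ?thesis by simp
  qed
  ultimately show ?thesis
  proof (elim subst, elim has_ls_integral_cong)
    fix u assume u: "u \<in> {a..b}"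
    have s: "set_integrable lborel {a..u} (\<lambda>u. max 0 (w u))" "set_integrable lborel {a..u} (\<lambda>u. max 0 (- w u))"
      using u by (auto intro: set_integrable_subset[OF wp(1)] set_integrable_subset[OF wp(2)])
    have "(LBINT s:{a..u}. max 0 (w s)) - (LBINT s:{a..u}. max 0 (- w s)) = (LBINT s:{a..u}. max 0 (w s) - max 0 (- w s))"
      using s by (simp add: set_integral_diff)
    also have "\<dots> = (LBINT s:{a..u}. w s)"
      by (intro set_lebesgue_integral_cong) (auto simp: max_def)
    finally show "(LBINT s:{a..u}. max 0 (w s)) + - (LBINT s:{a..u}. max 0 (- w s)) = (LBINT s:{a..u}. w s)" by simp
  qed simp
qed

text \<open>On a path all integrators of the theorem have this shape: coordinates of the chain
  martingale, compensated jump counts, and the compensated default indicator. The test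
  \<open>s \<le> u\<close> makes each jump right-continuous.\<close>

lemma has_ls_integral_AC_jumps:
  assumes ab: "a \<le> b" and w: "set_integrable lborel {a..b} w"
    and f: "set_borel_measurable borel {a<..b} f" and fw: "set_integrable lborel {a<..b} (\<lambda>u. f u * w u)"
    and J: "finite J" "J \<subseteq> {a<..b}"
    and g: "\<And>u. u \<in> {a..b} \<Longrightarrow> g u = C + (LBINT s:{a..u}. w s) + (\<Sum>s\<in>J. if s \<le> u then c s else 0)"
  shows "has_ls_integral f g ((LBINT u:{a<..b}. f u * w u) + (\<Sum>s\<in>J. f s * c s)) a b"
proof -
  have "has_ls_integral f (\<lambda>u. C + (LBINT s:{a..u}. w s) + (\<Sum>s\<in>J. if s \<le> u then c s else 0))
     (0 + (LBINT u:{a<..b}. f u * w u) + (\<Sum>s\<in>J. f s * c s)) a b"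
    using ab w f fw J
    by (intro has_ls_integral_add has_ls_integral_sum has_ls_integral_jump has_ls_integral_const has_ls_integral_AC) auto
  then show ?thesis by (simp, elim has_ls_integral_cong) (auto simp: g)
qed

section \<open>Paths of the chain\<close>

lemma cadlag_on_subset:
  assumes "cadlag_on I f" "K \<subseteq> I" shows "cadlag_on K f"
  unfolding cadlag_on_def
proof (intro ballI conjI)
  fix t assume t: "t \<in> K"
  then have *: "continuous (at t within (I \<inter> {t..})) f" "\<exists>l. (f \<longlongrightarrow> l) (at t within (I \<inter> {..<t}))"
    using assms by (auto simp: cadlag_on_def)
  show "continuous (at t within (K \<inter> {t..})) f"
    by (rule continuous_within_subset[OF *(1)]) (use assms in auto)
  show "\<exists>l. (f \<longlongrightarrow> l) (at t within (K \<inter> {..<t}))"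
    using *(2) assms(2) by (auto intro!: tendsto_within_subset[where S="I \<inter> {..<t}"])
qed

lemma cadlag_on_left_lim:
  fixes f :: "real \<Rightarrow> 'b::t2_space"
  assumes f: "cadlag_on {a..b} f" and t: "a < t" "t \<le> b"
  shows "(f \<longlongrightarrow> left_lim f t) (at_left t)"
proof -
  obtain l where l: "(f \<longlongrightarrow> l) (at t within ({a..b} \<inter> {..<t}))"
    using f t unfolding cadlag_on_def by force
  have "at t within ({a..b} \<inter> {..<t}) = at_left t"
    by (rule at_within_nhd[of t "{a<..}"]) (use t in auto)
  with l have "(f \<longlongrightarrow> l) (at_left t)" by simp
  moreover from this have "left_lim f t = l" unfolding left_lim_def by (intro tendsto_Lim) auto
  ultimately show ?thesis by simp
qed

lemma cadlag_on_right:
  fixes f :: "real \<Rightarrow> 'b::t2_space"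
  assumes f: "cadlag_on {a..b} f" and t: "a \<le> t" "t < b"
  shows "(f \<longlongrightarrow> f t) (at_right t)"
proof -
  have "(f \<longlongrightarrow> f t) (at t within ({a..b} \<inter> {t..}))"
    using f t unfolding cadlag_on_def continuous_within by force
  moreover have "at t within ({a..b} \<inter> {t..}) = at_right t"
    by (rule at_within_nhd[of t "{..<b}"]) (use t in auto)
  ultimately show ?thesis by simp
qed

lemma left_lim_eqI:
  fixes f :: "real \<Rightarrow> 'b::t2_space"
  assumes "a < t" "\<And>s. a < s \<Longrightarrow> s < t \<Longrightarrow> f s = y"
  shows "left_lim f t = y"
proof -
  have "eventually (\<lambda>s. f s = y) (at_left t)"
    by (rule eventually_at_leftI[of a]) (use assms in auto)
  then have "(f \<longlongrightarrow> y) (at_left t)" by (rule tendsto_eventually)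
  then show ?thesis unfolding left_lim_def by (intro tendsto_Lim) auto
qed

lemma left_lim_cong:
  fixes f :: "real \<Rightarrow> 'b::t2_space"
  assumes "(g \<longlongrightarrow> y) (at_left t)" "a < t" "\<And>s. a < s \<Longrightarrow> s < t \<Longrightarrow> f s = g s"
  shows "left_lim f t = y"
proof -
  have "eventually (\<lambda>s. g s = f s) (at_left t)"
    by (rule eventually_at_leftI[of a]) (use assms in auto)
  then have "(f \<longlongrightarrow> y) (at_left t)" using assms(1) by (rule Lim_transform_eventually[rotated])
  then show ?thesis unfolding left_lim_def by (intro tendsto_Lim) auto
qed

text \<open>One-sided limits in a form fit for bisection over a compact interval. The left value
  \<open>l\<close> is only asserted to exist, since at the left end of \<open>I\<close> it is
  arbitrary.\<close>

lemma cadlag_on_local: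
  fixes f :: "real \<Rightarrow> 'b::metric_space"
  assumes f: "cadlag_on I f" and t: "t \<in> I" and e: "e > 0"
  shows "\<exists>l d. d > 0 \<and> (\<forall>s. s \<in> I \<longrightarrow> t \<le> s \<longrightarrow> s < t + d \<longrightarrow> dist (f s) (f t) < e) \<and>
    (\<forall>s. s \<in> I \<longrightarrow> t - d < s \<longrightarrow> s < t \<longrightarrow> dist (f s) l < e)"
proof -
  have "(f \<longlongrightarrow> f t) (at t within (I \<inter> {t..}))"
    using f t unfolding cadlag_on_def continuous_within by force
  then have "eventually (\<lambda>s. dist (f s) (f t) < e) (at t within (I \<inter> {t..}))" using e by (rule tendstoD)
  then obtain d1 where d1: "d1 > 0" "\<And>s. s \<in> I \<inter> {t..} \<Longrightarrow> s \<noteq> t \<and> dist s t < d1 \<Longrightarrow> dist (f s) (f t) < e"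
    unfolding eventually_at by blast
  obtain l where "(f \<longlongrightarrow> l) (at t within (I \<inter> {..<t}))"
    using f t unfolding cadlag_on_def by force
  then have "eventually (\<lambda>s. dist (f s) l < e) (at t within (I \<inter> {..<t}))" using e by (rule tendstoD)
  then obtain d2 where d2: "d2 > 0" "\<And>s. s \<in> I \<inter> {..<t} \<Longrightarrow> s \<noteq> t \<and> dist s t < d2 \<Longrightarrow> dist (f s) l < e"
    unfolding eventually_at by blast
  show ?thesis
  proof (intro exI[of _ l] exI[of _ "min d1 d2"] conjI allI impI)
    fix s assume s: "s \<in> I" "t \<le> s" "s < t + min d1 d2"
    show "dist (f s) (f t) < e"
      using d1(2)[of s] s e by (cases "s = t") (auto simp: dist_real_def)
  next
    fix s assume s: "s \<in> I" "t - min d1 d2 < s" "s < t"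
    show "dist (f s) l < e"
      using d2(2)[of s] s by (auto simp: dist_real_def)
  qed (use d1 d2 in auto)
qed

text \<open>Near each time the values stay within distance \<open>1\<close> of the value there or of
  the left value; bisection makes the bound global.\<close>

lemma cadlag_on_bounded:
  fixes f :: "real \<Rightarrow> real"
  assumes f: "cadlag_on {a..b} f" and ab: "a \<le> b"
  obtains B where "B > 0" "\<And>t. t \<in> {a..b} \<Longrightarrow> \<bar>f t\<bar> \<le> B"
proof -
  define P where "P = (\<lambda>(u, v). \<exists>B. \<forall>t\<in>{u..v} \<inter> {a..b}. \<bar>f t\<bar> \<le> B)"
  have "P (a, b)"
  proof (rule Bolzano[OF ab, of "\<lambda>u v. P (u, v)"])
    fix u v w assume uvw: "P (u, v)" "P (v, w)" "u \<le> v" "v \<le> w"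
    then obtain B1 B2 where "\<forall>t\<in>{u..v} \<inter> {a..b}. \<bar>f t\<bar> \<le> B1" "\<forall>t\<in>{v..w} \<inter> {a..b}. \<bar>f t\<bar> \<le> B2"
      by (auto simp: P_def)
    then have "\<forall>t\<in>{u..w} \<inter> {a..b}. \<bar>f t\<bar> \<le> max B1 B2"
      by (metis IntE IntI atLeastAtMost_iff le_max_iff_disj linear)
    then show "P (u, w)" by (auto simp: P_def)
  next
    fix x assume x: "a \<le> x" "x \<le> b"
    then obtain l d where d: "d > 0" "\<And>s. s \<in> {a..b} \<Longrightarrow> x \<le> s \<Longrightarrow> s < x + d \<Longrightarrow> dist (f s) (f x) < 1"
      "\<And>s. s \<in> {a..b} \<Longrightarrow> x - d < s \<Longrightarrow> s < x \<Longrightarrow> dist (f s) l < 1"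
      using cadlag_on_local[OF f, of x 1] by (metis atLeastAtMost_iff zero_less_one)
    have "P (u, v)" if uv: "u \<le> x" "x \<le> v" "v - u < d" for u v
      unfolding P_def split_conv
    proof (intro exI ballI)
      fix t assume t: "t \<in> {u..v} \<inter> {a..b}"
      show "\<bar>f t\<bar> \<le> \<bar>f x\<bar> + \<bar>l\<bar> + 1"
        using d(2)[of t] d(3)[of t] t uv by (cases "x \<le> t") (auto simp: dist_real_def)
    qed
    then show "\<exists>d>0. \<forall>u v. u \<le> x \<and> x \<le> v \<and> v - u < d \<longrightarrow> P (u, v)" using d(1) by blast
  qed
  then obtain B where "\<forall>t\<in>{a..b}. \<bar>f t\<bar> \<le> B" by (auto simp: P_def)
  then show ?thesis by (intro that[of "max 1 B"]) (auto simp: le_max_iff_disj)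
qed

text \<open>Distinct basis vectors differ by \<open>1\<close> in some coordinate. This discreteness
  turns the cadlag paths of the chain into step functions.\<close>

lemma state_dist:
  fixes x y :: "real^'n"
  assumes "x \<in> range state" "y \<in> range state" "dist x y < 1"
  shows "x = y"
proof (rule ccontr)
  assume ne: "x \<noteq> y"
  obtain i j where ij: "x = axis i 1" "y = axis j 1" using assms by auto
  have "\<bar>(x - y) $ i\<bar> \<le> norm (x - y)" by (rule component_le_norm_cart)
  moreover have "(x - y) $ i = 1" using ij ne by (auto simp: axis_def)
  ultimately show False using assms(3) by (simp add: dist_norm)
qed

text \<open>With radius \<open>1/2\<close> any two values shortly before \<open>t\<close> are closer
  than \<open>1\<close> to each other and hence equal, and likewise on the right with
  \<open>x t\<close>. The common value on the left is then the left limit.\<close>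

lemma state_path_local:
  fixes x :: "real \<Rightarrow> real^'n"
  assumes c: "cadlag_on {a..b} x" and r: "\<And>t. t \<in> {a..b} \<Longrightarrow> x t \<in> range state" and t: "t \<in> {a..b}"
  obtains d where "d > 0" "\<And>s. s \<in> {a..b} \<Longrightarrow> t \<le> s \<Longrightarrow> s < t + d \<Longrightarrow> x s = x t"
    "\<And>s. s \<in> {a..b} \<Longrightarrow> t - d < s \<Longrightarrow> s < t \<Longrightarrow> x s = left_lim x t"
proof -
  obtain l d where d: "d > 0" "\<And>s. s \<in> {a..b} \<Longrightarrow> t \<le> s \<Longrightarrow> s < t + d \<Longrightarrow> dist (x s) (x t) < 1/2"
    "\<And>s. s \<in> {a..b} \<Longrightarrow> t - d < s \<Longrightarrow> s < t \<Longrightarrow> dist (x s) l < 1/2"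
    using cadlag_on_local[OF c t, of "1/2"] by (metis half_gt_zero_iff zero_less_one)
  show ?thesis
  proof (rule that[OF d(1)])
    fix s assume s: "s \<in> {a..b}" "t \<le> s" "s < t + d"
    then show "x s = x t" using d(2)[OF s] r t by (intro state_dist) auto
  next
    fix s assume s: "s \<in> {a..b}" "t - d < s" "s < t"
    have "left_lim x t = x s"
    proof (rule left_lim_eqI[of "max a (t - d)"])
      fix s' assume s': "max a (t - d) < s'" "s' < t"
      then have "dist (x s') l < 1/2" "dist (x s) l < 1/2" using d(3) s t by auto
      then have "dist (x s') (x s) < 1" by (metis dist_triangle_half_l)
      then show "x s' = x s" using r s s' t by (intro state_dist) auto
    qed (use s in auto)
    then show "x s = left_lim x t" by simp
  qed
qed

text \<open>Time \<open>0\<close> is left out, because a left limit there would look at times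
  outside the time set.\<close>

definition jump_times :: "(real \<Rightarrow> real^'n) \<Rightarrow> real \<Rightarrow> real set" where
  "jump_times x T = {s\<in>{0<..T}. left_lim x s \<noteq> x s}"

context
  fixes x :: "real \<Rightarrow> real^'n" and T :: real
  assumes c: "cadlag_on {0..T} x" and r: "\<And>t. t \<in> {0..T} \<Longrightarrow> x t \<in> range state" and T: "T > 0"
begin

text \<open>By local constancy every time has a neighbourhood in which it is the only possible jump
  time; bisection turns this into finiteness on \<open>{0..T}\<close>.\<close>

lemma finite_jump_times: "finite (jump_times x T)"
proof -
  have "finite (jump_times x T \<inter> {0..T})"
  proof (rule Bolzano[of 0 T "\<lambda>u v. finite (jump_times x T \<inter> {u..v})"])
    fix u v w :: real assume uvw: "finite (jump_times x T \<inter> {u..v})" "finite (jump_times x T \<inter> {v..w})" "u \<le> v" "v \<le> w"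
    then have "jump_times x T \<inter> {u..w} = jump_times x T \<inter> {u..v} \<union> jump_times x T \<inter> {v..w}" by auto
    then show "finite (jump_times x T \<inter> {u..w})" using uvw by simp
  next
    fix t :: real assume t: "0 \<le> t" "t \<le> T"
    then have t': "t \<in> {0..T}" by simp
    obtain d where d: "d > 0" "\<And>s. s \<in> {0..T} \<Longrightarrow> t \<le> s \<Longrightarrow> s < t + d \<Longrightarrow> x s = x t"
      "\<And>s. s \<in> {0..T} \<Longrightarrow> t - d < s \<Longrightarrow> s < t \<Longrightarrow> x s = left_lim x t"
      using state_path_local[OF c r t'] by metis
    have "jump_times x T \<inter> {u..v} \<subseteq> {t}" if "u \<le> t" "t \<le> v" "v - u < d" for u v
    proof
      fix s assume s: "s \<in> jump_times x T \<inter> {u..v}"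
      then have s': "0 < s" "s \<le> T" "left_lim x s \<noteq> x s" "u \<le> s" "s \<le> v" by (auto simp: jump_times_def)
      show "s \<in> {t}"
      proof (rule ccontr)
        assume "s \<notin> {t}"
        then consider "s < t" | "t < s" by force
        then have "left_lim x s = x s"
        proof cases
          case 1
          have "left_lim x s = left_lim x t"
            by (rule left_lim_eqI[of "max 0 (t - d)"]) (use 1 s' that t d in auto)
          moreover have "x s = left_lim x t" using 1 s' that t by (intro d(3)) auto
          ultimately show ?thesis by simp
        next
          case 2
          have "left_lim x s = x t"
            by (rule left_lim_eqI[of t]) (use 2 s' that t in \<open>auto intro!: d(2)\<close>)
          moreover have "x s = x t" using 2 s' that t by (intro d(2)) auto
          ultimately show ?thesis by simp
        qed
        then show False using s' by simp
      qed
    qed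
    then show "\<exists>d>0. \<forall>u v. u \<le> t \<and> t \<le> v \<and> v - u < d \<longrightarrow> finite (jump_times x T \<inter> {u..v})"
      using d(1) finite_subset[of _ "{t}"] by (intro exI[of _ d]) auto
  qed (use T in auto)
  moreover have "jump_times x T \<inter> {0..T} = jump_times x T" by (auto simp: jump_times_def)
  ultimately show ?thesis by simp
qed

lemma state_path_eq_sum_jumps:
  assumes u: "u \<in> {0..T}"
  shows "x u = x 0 + (\<Sum>s\<in>jump_times x T. if s \<le> u then x s - left_lim x s else 0)"
proof -
  \<comment> \<open>Freed of its jumps the path is constant on both sides of every time, hence
    constant by bisection.\<close>
  define y where "y u = x u - (\<Sum>s\<in>jump_times x T. if s \<le> u then x s - left_lim x s else 0)" for u
  have "0 \<le> (0::real) \<longrightarrow> u \<le> T \<longrightarrow> y 0 = y u"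
  proof (rule Bolzano[of 0 u "\<lambda>v w. 0 \<le> v \<longrightarrow> w \<le> T \<longrightarrow> y v = y w"])
    fix t :: real assume "0 \<le> t" "t \<le> u"
    then have t: "t \<in> {0..T}" using u by simp
    obtain d where d: "d > 0" "\<And>s. s \<in> {0..T} \<Longrightarrow> t \<le> s \<Longrightarrow> s < t + d \<Longrightarrow> x s = x t"
      "\<And>s. s \<in> {0..T} \<Longrightarrow> t - d < s \<Longrightarrow> s < t \<Longrightarrow> x s = left_lim x t"
      using state_path_local[OF c r t] by metis
    obtain d' where d': "d' > 0" "\<And>s. s \<in> jump_times x T \<Longrightarrow> s \<noteq> t \<Longrightarrow> d' \<le> dist t s"
      using finite_set_avoid[OF finite_jump_times, of t] by metis
    have right: "y v = y t" if v: "t \<le> v" "v < t + min d d'" "v \<le> T" for v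
    proof -
      have "s \<le> v \<longleftrightarrow> s \<le> t" if "s \<in> jump_times x T" for s
        using d'(2)[OF that] v by (cases "s = t") (auto simp: dist_real_def)
      then show ?thesis using d(2)[of v] v t by (simp add: y_def cong: sum.cong)
    qed
    have left: "y v = y t" if v: "v < t" "t - min d d' < v" "0 \<le> v" for v
    proof -
      have xv: "x v = left_lim x t" using v t by (intro d(3)) auto
      have "(\<Sum>s\<in>jump_times x T. if s \<le> t then x s - left_lim x s else 0) - (\<Sum>s\<in>jump_times x T. if s \<le> v then x s - left_lim x s else 0)
         = (\<Sum>s\<in>jump_times x T. if s = t then x t - left_lim x t else 0)"
        unfolding sum_subtractf[symmetric]
      proof (rule sum.cong[OF refl])
        fix s assume s: "s \<in> jump_times x T"
        show "(if s \<le> t then x s - left_lim x s else 0) - (if s \<le> v then x s - left_lim x s else 0) = (if s = t then x t - left_lim x t else 0)"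
          using d'(2)[OF s] v by (cases "s = t") (auto simp: dist_real_def)
      qed
      also have "\<dots> = x t - left_lim x t"
        using finite_jump_times t v by (simp add: sum.delta) (auto simp: jump_times_def)
      finally show ?thesis using xv by (simp add: y_def algebra_simps)
    qed
    show "\<exists>d>0. \<forall>v w. v \<le> t \<and> t \<le> w \<and> w - v < d \<longrightarrow> 0 \<le> v \<longrightarrow> w \<le> T \<longrightarrow> y v = y w"
    proof (rule exI[of _ "min d d'"], intro conjI allI impI)
      fix v w assume *: "v \<le> t \<and> t \<le> w \<and> w - v < min d d'" "0 \<le> v" "w \<le> T"
      have "y w = y t" using * by (intro right) auto
      moreover have "y v = y t" using * by (cases "v = t") (auto intro!: left)
      ultimately show "y v = y w" by simp
    qed (use d d' in auto)
  qed (use u in auto)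
  moreover have "(\<Sum>s\<in>jump_times x T. if s \<le> 0 then x s - left_lim x s else 0) = 0"
    by (rule sum.neutral) (auto simp: jump_times_def)
  ultimately show ?thesis using u by (simp add: y_def algebra_simps)
qed

lemma state_path_left_lim_range: "s \<in> {0<..T} \<Longrightarrow> left_lim x s \<in> range state"
proof -
  assume s: "s \<in> {0<..T}"
  then have s': "s \<in> {0..T}" by simp
  obtain d where d: "d > 0" "\<And>v. v \<in> {0..T} \<Longrightarrow> s - d < v \<Longrightarrow> v < s \<Longrightarrow> x v = left_lim x s"
    using state_path_local[OF c r s'] by metis
  have "x (max (s/2) (s - d/2)) = left_lim x s" using s d(1) by (intro d(2)) (auto simp: max_def)
  then show ?thesis using r[of "max (s/2) (s - d/2)"] s d(1) by (auto simp: max_def split: if_splits)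
qed

text \<open>The jump representation is a finite sum of steps and thus visibly measurable; nothing is
  known of \<open>x\<close> outside \<open>{0..T}\<close>, hence the indicator.\<close>

lemma borel_measurable_state_path:
  "(\<lambda>u. indicator {0..T} u *\<^sub>R x u) \<in> borel_measurable borel"
proof -
  have "(\<lambda>u. indicator {0..T} u *\<^sub>R (x 0 + (\<Sum>s\<in>jump_times x T. if s \<le> u then x s - left_lim x s else 0))) \<in> borel_measurable borel"
    by measurable
  also have "(\<lambda>u. indicator {0..T} u *\<^sub>R (x 0 + (\<Sum>s\<in>jump_times x T. if s \<le> u then x s - left_lim x s else 0))) = (\<lambda>u. indicator {0..T} u *\<^sub>R x u)"
  proof (rule ext)
    fix u
    show "indicator {0..T} u *\<^sub>R (x 0 + (\<Sum>s\<in>jump_times x T. if s \<le> u then x s - left_lim x s else 0)) = indicator {0..T} u *\<^sub>R x u"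
    proof (cases "u \<in> {0..T}")
      case True
      then show ?thesis by (simp only: state_path_eq_sum_jumps[symmetric])
    qed (auto simp: indicator_def)
  qed
  finally show ?thesis .
qed

end

text \<open>
  Since the jump factors \<open>1 + k s\<close> are positive, the left limit of \<open>E\<close> vanishes at the first point
  where \<open>E \<le> 0\<close>; a
  Gronwall estimate running backwards from there excludes this.
\<close>

lemma linear_equation_positive:
  fixes E :: "real \<Rightarrow> real"
  assumes E: "cadlag_on {0..T} E" and J: "finite J" "J \<subseteq> {0<..T}" and k: "\<And>s. s \<in> J \<Longrightarrow> k s > -1"
    and w: "set_integrable lborel {0..T} w" "\<And>u. u \<in> {0..T} \<Longrightarrow> 0 \<le> w u"
    and v: "set_integrable lborel {0..T} v" "\<And>u. u \<in> {0<..T} \<Longrightarrow> \<bar>v u\<bar> \<le> \<bar>left_lim E u\<bar> * w u"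
    and eq: "\<And>t. t \<in> {0..T} \<Longrightarrow> E t = 1 + (\<Sum>s\<in>J. if s \<le> t then left_lim E s * k s else 0) - (LBINT u:{0..t}. v u)"
    and t: "t \<in> {0..T}"
  shows "E t > 0"
proof (rule ccontr)
  assume neg: "\<not> E t > 0"
  define S where "S = {t\<in>{0..T}. E t \<le> 0}"
  \<comment> \<open>The first time at which \<open>E\<close> fails to be positive; right-continuity
    puts \<open>z\<close> itself among those times.\<close>
  define z where "z = Inf S"
  have S: "t \<in> S" "bdd_below S" using neg t by (auto simp: S_def intro!: bdd_belowI[of _ 0])
  have E0: "E 0 = 1"
  proof -
    have "(\<Sum>s\<in>J. if s \<le> 0 then left_lim E s * k s else 0) = 0"
      using J by (intro sum.neutral) auto
    moreover have "(LBINT u:{0..0}. v u) = integral {0..0} v"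
      using t by (intro set_borel_integral_eq_integral set_integrable_subset[OF v(1)]) auto
    ultimately show ?thesis using eq[of 0] t by simp
  qed
  have zT: "0 \<le> z" "z \<le> t" using S by (auto simp: z_def S_def intro!: cInf_greatest cInf_lower)
  have before: "E s > 0" if "0 \<le> s" "s < z" for s
  proof (rule ccontr)
    assume "\<not> E s > 0"
    then have "s \<in> S" using that zT t by (auto simp: S_def)
    then have "z \<le> s" using S by (auto simp: z_def intro!: cInf_lower)
    then show False using that by simp
  qed
  have Ez: "E z \<le> 0"
  proof (rule ccontr)
    assume p: "\<not> E z \<le> 0"
    have zT0: "z \<in> {0..T}" "E z > 0" using zT t p by auto
    obtain d where d: "d > 0" "\<And>s. s \<in> {0..T} \<Longrightarrow> z \<le> s \<Longrightarrow> s < z + d \<Longrightarrow> dist (E s) (E z) < E z"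
      using cadlag_on_local[OF E zT0] by blast
    have "z + d \<le> Inf S"
    proof (rule cInf_greatest)
      show "S \<noteq> {}" using S by auto
      fix s assume s: "s \<in> S"
      then have "z \<le> s" using S by (auto simp: z_def intro!: cInf_lower)
      show "z + d \<le> s"
      proof (rule ccontr)
        assume "\<not> z + d \<le> s"
        then have "dist (E s) (E z) < E z" using s \<open>z \<le> s\<close> by (intro d) (auto simp: S_def)
        then show False using s by (auto simp: S_def dist_real_def)
      qed
    qed
    then show False using d(1) by (simp add: z_def)
  qed
  then have z0: "0 < z" using E0 zT by (cases "z = 0") auto
  have zT': "z \<in> {0<..T}" using z0 zT t by auto
  define l where "l = left_lim E z"
  have l: "(E \<longlongrightarrow> l) (at_left z)" unfolding l_def using zT' by (intro cadlag_on_left_lim[OF E]) auto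
  have ev: "eventually (\<lambda>s. a < s \<and> s < z) (at_left z)" if "a < z" for a
    by (rule eventually_at_leftI[of a]) (use that in auto)
  have l0: "l \<ge> 0"
    by (rule tendsto_lowerbound[OF l eventually_mono[OF ev[OF z0]]]) (use before in \<open>auto simp: less_imp_le\<close>)
  obtain d' where d': "d' > 0" "\<And>s. s \<in> J \<Longrightarrow> s \<noteq> z \<Longrightarrow> d' \<le> dist z s"
    using finite_set_avoid[OF J(1), of z] by metis
  have vi: "set_integrable lborel {x..y} v" "set_integrable lborel {x..y} w" if "0 \<le> x" "y \<le> T" for x y
    using that by (auto intro: set_integrable_subset[OF v(1)] set_integrable_subset[OF w(1)])
  have vHK: "(LBINT u:{0..y}. v u) = integral {0..y} v" "(LBINT u:{0..y}. w u) = integral {0..y} w" if "y \<le> T" for y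
    using that by (auto intro!: set_borel_integral_eq_integral vi)
  have VW: "continuous_on {0..T} (\<lambda>y. integral {0..y} v)" "continuous_on {0..T} (\<lambda>y. integral {0..y} w)"
    using set_borel_integral_eq_integral[OF v(1)] set_borel_integral_eq_integral[OF w(1)]
    by (auto intro: indefinite_integral_continuous_1)
  have lim: "((\<lambda>y. integral {0..y} f) \<longlongrightarrow> integral {0..z} f) (at_left z)" if "continuous_on {0..T} (\<lambda>y. integral {0..y} f)" for f :: "real \<Rightarrow> real"
  proof -
    have "((\<lambda>y. integral {0..y} f) \<longlongrightarrow> integral {0..z} f) (at z within {0..z})"
      using continuous_on_subset[OF that, of "{0..z}"] zT' by (auto simp: continuous_on)
    then show ?thesis using z0 by (simp add: at_within_Icc_at_left)
  qed
  have near: "s \<le> y \<longleftrightarrow> s \<le> y'" if "s \<in> J" "z - d' < y" "y \<le> y'" "y' < z" for s y y'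
    using d'(2)[OF that(1)] that by (cases "s = z") (auto simp: dist_real_def)
  \<comment> \<open>The integral term is continuous, so between the left limit and the value at
    \<open>z\<close> only a jump intervenes. As the factor \<open>1 + k z\<close> is positive,
    \<open>E z \<le> 0\<close> then forces the left limit to be \<open>0\<close>.\<close>
  have "E z = l + (if z \<in> J then l * k z else 0)"
  proof -
    define R where "R = E z - (if z \<in> J then l * k z else 0)"
    have "max 0 (z - d') < z" using z0 d' by auto
    from ev[OF this]
    have "eventually (\<lambda>y. R + (integral {0..z} v - integral {0..y} v) = E y) (at_left z)"
    proof eventually_elim
      case y: (elim y)
      have "(\<Sum>s\<in>J. if s \<le> z then left_lim E s * k s else 0) - (\<Sum>s\<in>J. if s \<le> y then left_lim E s * k s else 0)
        = (\<Sum>s\<in>J. if s = z then l * k z else 0)"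
        unfolding sum_subtractf[symmetric]
      proof (rule sum.cong[OF refl])
        fix s assume s: "s \<in> J"
        show "(if s \<le> z then left_lim E s * k s else 0) - (if s \<le> y then left_lim E s * k s else 0) = (if s = z then l * k z else 0)"
          using d'(2)[OF s] y by (cases "s = z") (auto simp: dist_real_def l_def)
      qed
      also have "\<dots> = (if z \<in> J then l * k z else 0)" using J by (simp add: sum.delta)
      finally show ?case using eq[of z] eq[of y] y zT' vHK(1)[of y] vHK(1)[of z] by (simp add: R_def)
    qed
    moreover have "((\<lambda>y. R + (integral {0..z} v - integral {0..y} v)) \<longlongrightarrow> R + (integral {0..z} v - integral {0..z} v)) (at_left z)"
      by (intro tendsto_intros lim VW)
    ultimately have "(E \<longlongrightarrow> R) (at_left z)" by (auto intro: Lim_transform_eventually)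
    then have "R = l" using l by (intro tendsto_unique[OF _ _ l]) auto
    then show ?thesis by (simp add: R_def)
  qed
  also have "\<dots> = l * (1 + (if z \<in> J then k z else 0))" by (simp add: algebra_simps)
  finally have "l * (1 + (if z \<in> J then k z else 0)) \<le> 0" using Ez by simp
  moreover have "1 + (if z \<in> J then k z else 0) > 0" using k[of z] by auto
  ultimately have l_eq: "l = 0" using l0 by (auto simp: mult_le_0_iff)
  \<comment> \<open>The threshold \<open>1/2\<close> provides the contraction: the
    \<open>w\<close>-mass of the last stretch before \<open>z\<close> stays below one half.\<close>
  have "eventually (\<lambda>y. integral {0..z} w - 1/2 < integral {0..y} w) (at_left z)"
    by (rule order_tendstoD(1)[OF lim[OF VW(2)]]) simp
  then obtain b where b: "b < z" "\<And>y. b < y \<Longrightarrow> y < z \<Longrightarrow> integral {0..z} w - 1/2 < integral {0..y} w"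
    using z0 unfolding eventually_at_left[OF z0] by auto
  define m where "m = Max {0, b, z - d'}"
  have m: "0 \<le> m" "b \<le> m" "z - d' \<le> m" "m < z" using b d' z0 by (auto simp: m_def)
  define A where "A = E ` {m<..<z}"
  have "0 \<le> T" using t by simp
  then obtain B where B: "\<And>s. s \<in> {0..T} \<Longrightarrow> \<bar>E s\<bar> \<le> B" by (rule cadlag_on_bounded[OF E]) blast
  have "bdd_above A" unfolding A_def
  proof (rule bdd_aboveI2)
    fix s assume "s \<in> {m<..<z}"
    then show "E s \<le> B" using B[of s] m zT' by auto
  qed
  moreover have "A \<noteq> {}" using dense[OF m(4)] by (auto simp: A_def)
  ultimately have A: "A \<noteq> {}" "bdd_above A" by auto
  define M where "M = Sup A"
  have EM: "E s \<le> M" if "m < s" "s < z" for s unfolding M_def using that A by (intro cSup_upper) (auto simp: A_def)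
  \<comment> \<open>Between \<open>m\<close> and \<open>z\<close> lies no point of \<open>J\<close>,
    so \<open>E\<close> moves only through the integral of \<open>v\<close>, by at most
    \<open>M / 2\<close>. As \<open>E\<close> tends to \<open>0\<close> at \<open>z\<close>, this
    bounds \<open>E s\<close> itself, and the supremum \<open>M > 0\<close> would satisfy
    \<open>M \<le> M / 2\<close>.\<close>
  have "E s \<le> M / 2" if s: "m < s" "s < z" for s
  proof -
    have "\<bar>E y - E s\<bar> \<le> M / 2" if y: "s < y" "y < z" for y
    proof -
      have "E y - E s = - ((LBINT u:{0..y}. v u) - (LBINT u:{0..s}. v u))"
        using eq[of y] eq[of s] near[of _ s y] y s m zT' by (simp cong: sum.cong)
      also have "{0..y} = {0..s} \<union> {s<..y}" using y s m by auto
      also have "(LBINT u:({0..s} \<union> {s<..y}). v u) = (LBINT u:{0..s}. v u) + (LBINT u:{s<..y}. v u)"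
        using s y m zT' by (intro set_integral_Un set_integrable_subset[OF v(1)]) auto
      finally have "\<bar>E y - E s\<bar> = \<bar>LBINT u:{s<..y}. v u\<bar>" by simp
      also have "\<dots> \<le> (LBINT u:{s<..y}. \<bar>v u\<bar>)"
      proof -
        have "set_integrable lborel {s<..y} v"
          using s y m zT' by (intro set_integrable_subset[OF v(1)]) auto
        from set_integral_norm_bound[OF this] show ?thesis by simp
      qed
      also have "\<dots> \<le> (LBINT u:{s<..y}. M * w u)"
      proof (rule set_integral_mono)
        show "set_integrable lborel {s<..y} (\<lambda>u. \<bar>v u\<bar>)" "set_integrable lborel {s<..y} (\<lambda>u. M * w u)"
          using s y m zT' by (auto intro!: set_integrable_mult_right set_integrable_abs set_integrable_subset[OF v(1)] set_integrable_subset[OF w(1)])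
        fix u assume u: "u \<in> {s<..y}"
        then have uT: "u \<in> {0<..T}" using s y m zT' by auto
        have lim': "(E \<longlongrightarrow> left_lim E u) (at_left u)" using uT by (intro cadlag_on_left_lim[OF E]) auto
        have ev': "eventually (\<lambda>q. m < q \<and> q < u) (at_left u)"
          by (rule eventually_at_leftI[of m]) (use u s in auto)
        have "left_lim E u \<le> M"
          by (rule tendsto_upperbound[OF lim' eventually_mono[OF ev']]) (use u y EM in auto)
        moreover have "left_lim E u \<ge> 0"
          by (rule tendsto_lowerbound[OF lim' eventually_mono[OF ev']]) (use u y m before in \<open>auto simp: less_imp_le\<close>)
        ultimately show "\<bar>v u\<bar> \<le> M * w u"
          using v(2)[OF uT] w(2)[of u] uT by (smt (verit) mult_right_mono greaterThanAtMost_iff atLeastAtMost_iff)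
      qed
      also have "\<dots> = M * (LBINT u:{s<..y}. w u)" by simp
      also have "(LBINT u:{s<..y}. w u) = (LBINT u:{0..y}. w u) - (LBINT u:{0..s}. w u)"
      proof -
        have "{0..y} = {0..s} \<union> {s<..y}" using y s m by auto
        then have "(LBINT u:{0..y}. w u) = (LBINT u:{0..s}. w u) + (LBINT u:{s<..y}. w u)"
          using s y m zT' by (simp only:) (intro set_integral_Un set_integrable_subset[OF w(1)]; auto)
        then show ?thesis by simp
      qed
      also have "\<dots> \<le> 1/2"
      proof -
        have "integral {0..y} w \<le> integral {0..z} w"
          using y s m zT' w by (intro integral_subset_le) (auto intro!: set_borel_integral_eq_integral vi)
        then show ?thesis using b(2)[of s] s m y zT' by (simp add: vHK)
      qed
      finally have "\<bar>E y - E s\<bar> \<le> M * (1/2)"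
        using EM[OF s] before[of s] s m by (auto simp: mult_left_mono)
      then show ?thesis by simp
    qed
    then have "eventually (\<lambda>y. \<bar>E y - E s\<bar> \<le> M / 2) (at_left z)"
      using ev[OF s(2)] by (auto elim: eventually_mono)
    moreover have "((\<lambda>y. \<bar>E y - E s\<bar>) \<longlongrightarrow> \<bar>l - E s\<bar>) (at_left z)" by (intro tendsto_intros l)
    ultimately have "\<bar>l - E s\<bar> \<le> M / 2" by (intro tendsto_upperbound) auto
    then show ?thesis using l_eq by simp
  qed
  then have "M \<le> M / 2" unfolding M_def using A(1) by (intro cSup_least) (auto simp: A_def)
  moreover have "M > 0" using EM[of "(m+z)/2"] before[of "(m+z)/2"] m by auto
  ultimately show False by simp
qed

section \<open>Forward equation\<close>

text \<open>Progressive measurability. Evaluated at the next grid point to the right, the process is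
  a countable case distinction, and right-continuity gives the limit. Only times up to
  \<open>t\<close> are evaluated, so \<open>N\<close> may be the sigma-algebra at time
  \<open>t\<close>.\<close>

lemma measurable_right_continuous_process:
  fixes Y :: "real \<Rightarrow> 'a \<Rightarrow> real"
  assumes Y: "\<And>u. u \<in> {0..t} \<Longrightarrow> Y u \<in> borel_measurable N" and t: "0 \<le> t"
    and rc: "\<And>\<omega> u. \<omega> \<in> space N \<Longrightarrow> 0 \<le> u \<Longrightarrow> u < t \<Longrightarrow> ((\<lambda>v. Y v \<omega>) \<longlongrightarrow> Y u \<omega>) (at_right u)"
  shows "(\<lambda>(\<omega>, u). indicator {0..t} u * Y u \<omega>) \<in> borel_measurable (N \<Otimes>\<^sub>M lborel)"
proof -
  \<comment> \<open>Floor plus one lies strictly to the right of \<open>u\<close>, as a limit from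
    the right demands; the minimum stays within the horizon and returns \<open>t\<close> itself at
    \<open>u = t\<close>.\<close>
  define \<rho> where "\<rho> n k = max 0 (min t ((real_of_int k + 1) / real (Suc n)))" for n k
  define Z where "Z n = (\<lambda>(\<omega>, u). indicator {0..t} u * Y (\<rho> n \<lfloor>real (Suc n) * u\<rfloor>) \<omega>)" for n
  have \<rho>: "\<rho> n k \<in> {0..t}" for n k using t by (auto simp: \<rho>_def)
  have "Z n \<in> borel_measurable (N \<Otimes>\<^sub>M lborel)" for n
  proof -
    have [measurable]: "Y (\<rho> n k) \<in> borel_measurable N" for k using Y[OF \<rho>] .
    have "(\<lambda>p. Y (\<rho> n \<lfloor>real (Suc n) * snd p\<rfloor>) (fst p)) \<in> borel_measurable (N \<Otimes>\<^sub>M lborel)"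
      by (rule measurable_compose_countable[where f="\<lambda>k p. Y (\<rho> n k) (fst p)"]) measurable
    then have "(\<lambda>p. indicator {0..t} (snd p) * Y (\<rho> n \<lfloor>real (Suc n) * snd p\<rfloor>) (fst p)) \<in> borel_measurable (N \<Otimes>\<^sub>M lborel)"
      by measurable
    then show ?thesis by (simp add: Z_def case_prod_beta')
  qed
  then show ?thesis
  proof (rule borel_measurable_LIMSEQ_real[rotated])
    fix p :: "'a \<times> real" assume "p \<in> space (N \<Otimes>\<^sub>M lborel)"
    then obtain \<omega> u where p: "p = (\<omega>, u)" "\<omega> \<in> space N" by (auto simp: space_pair_measure)
    have "(\<lambda>n. Y (\<rho> n \<lfloor>real (Suc n) * u\<rfloor>) \<omega>) \<longlonglongrightarrow> Y u \<omega>" if u: "0 \<le> u" "u < t"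
    proof -
      have gt: "u < \<rho> n \<lfloor>real (Suc n) * u\<rfloor>" for n
      proof -
        have "real (Suc n) * u < of_int \<lfloor>real (Suc n) * u\<rfloor> + 1" by linarith
        then have "u < (of_int \<lfloor>real (Suc n) * u\<rfloor> + 1) / real (Suc n)" by (simp add: pos_less_divide_eq mult.commute)
        then show ?thesis using u by (auto simp: \<rho>_def)
      qed
      have le: "\<rho> n \<lfloor>real (Suc n) * u\<rfloor> \<le> u + 1 / real (Suc n)" for n
      proof -
        have "of_int \<lfloor>real (Suc n) * u\<rfloor> + 1 \<le> real (Suc n) * u + 1" by linarith
        then have "(of_int \<lfloor>real (Suc n) * u\<rfloor> + 1) / real (Suc n) \<le> (real (Suc n) * u + 1) / real (Suc n)"
          by (intro divide_right_mono) auto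
        also have "\<dots> = u + 1 / real (Suc n)" by (simp add: add_divide_distrib)
        finally show ?thesis using u by (auto simp: \<rho>_def)
      qed
      have "(\<lambda>n. \<rho> n \<lfloor>real (Suc n) * u\<rfloor>) \<longlonglongrightarrow> u"
      proof (rule tendsto_sandwich[where f="\<lambda>_. u" and h="\<lambda>n. u + 1 / real (Suc n)"])
        show "(\<lambda>n. u + 1 / real (Suc n)) \<longlonglongrightarrow> u"
          using tendsto_add[OF tendsto_const LIMSEQ_inverse_real_of_nat, of u] by (simp add: inverse_eq_divide)
      qed (use gt le in \<open>auto simp: less_imp_le\<close>)
      then have "filterlim (\<lambda>n. \<rho> n \<lfloor>real (Suc n) * u\<rfloor>) (at_right u) sequentially"
        using gt by (simp add: filterlim_at less_imp_neq[symmetric])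
      then show ?thesis using rc[OF p(2) u] by (rule filterlim_compose[rotated])
    qed
    moreover have "Y (\<rho> n \<lfloor>real (Suc n) * t\<rfloor>) \<omega> = Y t \<omega>" for n
    proof -
      have "real (Suc n) * t < of_int \<lfloor>real (Suc n) * t\<rfloor> + 1" by linarith
      then have "t < (of_int \<lfloor>real (Suc n) * t\<rfloor> + 1) / real (Suc n)" by (simp add: pos_less_divide_eq mult.commute)
      then show ?thesis using t by (simp add: \<rho>_def)
    qed
    ultimately have "(\<lambda>n. indicator {0..t} u * Y (\<rho> n \<lfloor>real (Suc n) * u\<rfloor>) \<omega>) \<longlonglongrightarrow> indicator {0..t} u * Y u \<omega>"
      by (cases "u = t"; cases "u \<in> {0..t}") (auto intro!: tendsto_mult)
    then show "(\<lambda>n. Z n p) \<longlonglongrightarrow> (case p of (\<omega>, u) \<Rightarrow> indicator {0..t} u * Y u \<omega>)"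
      by (simp add: p Z_def)
  qed
qed

text \<open>Three families are treated at once: coordinates of the chain, the same before default,
  and the same discounted by the hazard. \<open>N\<close> is either the full sigma-algebra or one of
  a filtration at time \<open>t\<close>.\<close>

locale bounded_right_continuous_process =
  fixes N :: "'a measure" and Y :: "real \<Rightarrow> 'a \<Rightarrow> real" and t :: real
  assumes Y: "\<And>u. u \<in> {0..t} \<Longrightarrow> Y u \<in> borel_measurable N" and t: "0 \<le> t"
    and rc: "\<And>\<omega> u. \<omega> \<in> space N \<Longrightarrow> 0 \<le> u \<Longrightarrow> u < t \<Longrightarrow> ((\<lambda>v. Y v \<omega>) \<longlongrightarrow> Y u \<omega>) (at_right u)"
    and bnd: "\<And>\<omega> u. \<omega> \<in> space N \<Longrightarrow> u \<in> {0..t} \<Longrightarrow> \<bar>Y u \<omega>\<bar> \<le> 1"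
begin

lemma pair_measurable:
  fixes f :: "real \<Rightarrow> real"
  assumes f: "set_borel_measurable borel {a..b} f" and ab: "0 \<le> a" "b \<le> t"
  shows "(\<lambda>(\<omega>, u). indicator {a..b} u *\<^sub>R (f u * Y u \<omega>)) \<in> borel_measurable (N \<Otimes>\<^sub>M lborel)"
proof -
  have [measurable]: "(\<lambda>u. indicator {a..b} u *\<^sub>R f u) \<in> borel_measurable borel" using f by (simp add: set_borel_measurable_def)
  note [measurable] = measurable_right_continuous_process[OF Y t rc]
  have "(\<lambda>p. (indicator {a..b} (snd p) *\<^sub>R f (snd p)) * (case p of (\<omega>, u) \<Rightarrow> indicator {0..t} u * Y u \<omega>)) \<in> borel_measurable (N \<Otimes>\<^sub>M lborel)"
    by measurable
  also have "(\<lambda>p. (indicator {a..b} (snd p) *\<^sub>R f (snd p)) * (case p of (\<omega>, u) \<Rightarrow> indicator {0..t} u * Y u \<omega>)) =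
    (\<lambda>(\<omega>, u). indicator {a..b} u *\<^sub>R (f u * Y u \<omega>))"
    using ab by (auto simp: fun_eq_iff indicator_def)
  finally show ?thesis .
qed

lemma measurable_time_integral:
  assumes f: "set_borel_measurable borel {a..b} f" and ab: "0 \<le> a" "b \<le> t"
  shows "(\<lambda>\<omega>. LBINT u:{a..b}. f u * Y u \<omega>) \<in> borel_measurable N"
  unfolding set_lebesgue_integral_def
  using pair_measurable[OF f ab] by (rule lborel.borel_measurable_lebesgue_integral)

lemma path_measurable:
  assumes f: "set_borel_measurable borel {a..b} f" and ab: "0 \<le> a" "b \<le> t" and \<omega>: "\<omega> \<in> space N"
  shows "(\<lambda>u. indicator {a..b} u *\<^sub>R (f u * Y u \<omega>)) \<in> borel_measurable borel"
  using measurable_Pair2[OF pair_measurable[OF f ab] \<omega>] by simp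

lemma path_integrable:
  assumes f: "set_integrable lborel {a..b} f" and ab: "0 \<le> a" "b \<le> t" and \<omega>: "\<omega> \<in> space N"
  shows "set_integrable lborel {a..b} (\<lambda>u. f u * Y u \<omega>)"
proof -
  have "set_borel_measurable borel {a..b} (\<lambda>u. Y u \<omega>)"
    using path_measurable[of a b "\<lambda>_. 1"] ab \<omega> by (simp add: set_borel_measurable_def)
  then have "set_integrable lborel {a..b} (\<lambda>u. Y u \<omega> * f u)"
    using bnd[OF \<omega>] ab by (intro set_integrable_bounded_mult[where C=1, OF _ _ f]) auto
  then show ?thesis by (simp add: mult.commute)
qed

text \<open>\<open>K * \<bar>f u\<bar>\<close> dominates on the product space. The weight
  \<open>V\<close> will be a bounded test variable, by which conditional statements become equations
  between expectations.\<close>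

lemma Fubini_time_integral:
  assumes "prob_space N"
    and f: "set_integrable lborel {a..b} f" and ab: "0 \<le> a" "b \<le> t"
    and V: "V \<in> borel_measurable N" "\<And>\<omega>. \<omega> \<in> space N \<Longrightarrow> \<bar>V \<omega>\<bar> \<le> K"
  shows "integrable N (\<lambda>\<omega>. V \<omega> * (LBINT u:{a..b}. f u * Y u \<omega>))"
    "set_integrable lborel {a..b} (\<lambda>u. f u * (\<integral>\<omega>. V \<omega> * Y u \<omega> \<partial>N))"
    "(\<integral>\<omega>. V \<omega> * (LBINT u:{a..b}. f u * Y u \<omega>) \<partial>N) = (LBINT u:{a..b}. f u * (\<integral>\<omega>. V \<omega> * Y u \<omega> \<partial>N))"
proof -
  interpret N: prob_space N by fact
  interpret P: pair_sigma_finite N lborel by unfold_locales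
  note [measurable] = V(1)
  have fm: "set_borel_measurable borel {a..b} f"
    using f by (auto simp: set_integrable_def set_borel_measurable_def dest: borel_measurable_integrable)
  note [measurable] = pair_measurable[OF fm ab] measurable_time_integral[OF fm ab]
  obtain \<omega>0 where "\<omega>0 \<in> space N" using N.not_empty by blast
  then have K: "K \<ge> 0" using V(2)[of \<omega>0] by simp
  define h where "h = (\<lambda>(\<omega>, u). V \<omega> * (indicator {a..b} u *\<^sub>R (f u * Y u \<omega>)))"
  have hm: "h \<in> borel_measurable (N \<Otimes>\<^sub>M lborel)"
  proof -
    have "(\<lambda>p. V (fst p) * (case p of (\<omega>, u) \<Rightarrow> indicator {a..b} u *\<^sub>R (f u * Y u \<omega>))) \<in> borel_measurable (N \<Otimes>\<^sub>M lborel)"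
      by measurable
    then show ?thesis by (simp add: h_def case_prod_beta')
  qed
  have dom: "integrable (N \<Otimes>\<^sub>M lborel) (\<lambda>(\<omega>, u). K * \<bar>indicator {a..b} u *\<^sub>R f u\<bar>)"
  proof -
    have "integrable lborel (\<lambda>u. K * \<bar>indicator {a..b} u *\<^sub>R f u\<bar>)" using f by (simp add: set_integrable_def)
    moreover have [measurable]: "(\<lambda>u. indicator {a..b} u *\<^sub>R f u) \<in> borel_measurable borel" using fm by (simp add: set_borel_measurable_def)
    have "(\<lambda>(\<omega>, u). K * \<bar>indicator {a..b} u *\<^sub>R f u\<bar>) \<in> borel_measurable (N \<Otimes>\<^sub>M lborel)"
      by measurable
    ultimately show ?thesis using K by (intro P.Fubini_integrable) auto
  qed
  have hi: "integrable (N \<Otimes>\<^sub>M lborel) h"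
  proof (rule Bochner_Integration.integrable_bound[OF dom hm])
    show "AE p in N \<Otimes>\<^sub>M lborel. norm (h p) \<le> norm (case p of (\<omega>, u) \<Rightarrow> K * \<bar>indicator {a..b} u *\<^sub>R f u\<bar>)"
    proof (rule AE_I2)
      fix p :: "'a \<times> real" assume "p \<in> space (N \<Otimes>\<^sub>M lborel)"
      then obtain \<omega> u where p: "p = (\<omega>, u)" "\<omega> \<in> space N" by (auto simp: space_pair_measure)
      have "\<bar>V \<omega>\<bar> * \<bar>f u * Y u \<omega>\<bar> \<le> K * \<bar>f u\<bar>" if "u \<in> {a..b}"
        using bnd[OF p(2), of u] V(2)[OF p(2)] that ab by (intro mult_mono) (auto simp: abs_mult mult_left_le)
      then show "norm (h p) \<le> norm (case p of (\<omega>, u) \<Rightarrow> K * \<bar>indicator {a..b} u *\<^sub>R f u\<bar>)"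
        using K by (cases "u \<in> {a..b}") (auto simp: p h_def abs_mult)
    qed
  qed
  have in1: "(\<integral>u. h (\<omega>, u) \<partial>lborel) = V \<omega> * (LBINT u:{a..b}. f u * Y u \<omega>)" for \<omega>
    by (simp add: h_def set_lebesgue_integral_def)
  have in2: "(\<integral>\<omega>. h (\<omega>, u) \<partial>N) = indicator {a..b} u *\<^sub>R (f u * (\<integral>\<omega>. V \<omega> * Y u \<omega> \<partial>N))" for u
  proof -
    have "(\<integral>\<omega>. h (\<omega>, u) \<partial>N) = (\<integral>\<omega>. (indicator {a..b} u * f u) * (V \<omega> * Y u \<omega>) \<partial>N)"
      by (intro Bochner_Integration.integral_cong) (auto simp: h_def)
    then show ?thesis by simp
  qed
  show "integrable N (\<lambda>\<omega>. V \<omega> * (LBINT u:{a..b}. f u * Y u \<omega>))"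
    using P.integrable_fst'[OF hi] by (simp add: in1)
  show "set_integrable lborel {a..b} (\<lambda>u. f u * (\<integral>\<omega>. V \<omega> * Y u \<omega> \<partial>N))"
    using P.integrable_snd[of "\<lambda>\<omega> u. h (\<omega>, u)"] hi by (simp add: in2 set_integrable_def)
  show "(\<integral>\<omega>. V \<omega> * (LBINT u:{a..b}. f u * Y u \<omega>) \<partial>N) = (LBINT u:{a..b}. f u * (\<integral>\<omega>. V \<omega> * Y u \<omega> \<partial>N))"
    using P.Fubini_integral[of "\<lambda>\<omega> u. h (\<omega>, u)"] hi by (simp add: in1 in2 set_lebesgue_integral_def)
qed

end

text \<open>Source of the uniform bound on difference quotients of the discount factor, hence of the
  dominating constant in the forward equation.\<close>

lemma abs_exp_minus_one_le: "\<bar>exp z - 1\<bar> \<le> \<bar>z\<bar> * exp \<bar>z\<bar>" for z :: real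
proof -
  have "z \<le> exp z - 1" using exp_ge_add_one_self[of z] by linarith
  moreover have "exp z - 1 \<le> z * exp z"
    using mult_right_mono[OF exp_ge_add_one_self[of "- z"], of "exp z"] by (simp add: algebra_simps exp_minus)
  moreover have "z * exp z \<le> \<bar>z\<bar> * exp \<bar>z\<bar>" by (intro mult_mono) auto
  moreover have "- z \<le> \<bar>z\<bar> * exp \<bar>z\<bar>"
    using mult_mono[of "\<bar>z\<bar>" "\<bar>z\<bar>" 1 "exp \<bar>z\<bar>"] by auto
  ultimately show ?thesis by auto
qed

text \<open>One locale for both measures: under \<open>Q\<close> the horizon is the maturity, under
  \<open>P\<close> it is any positive time.\<close>

locale markov_chain = prob_space M for M :: "'a measure" +
  fixes F :: "real \<Rightarrow> 'a measure" and X :: "real \<Rightarrow> 'a \<Rightarrow> real^'n" and T :: real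
  assumes T: "T > 0" and sub: "\<And>t. t \<in> {0..T} \<Longrightarrow> subalgebra M (F t)"
    and mono: "\<And>s t. 0 \<le> s \<Longrightarrow> s \<le> t \<Longrightarrow> t \<le> T \<Longrightarrow> sets (F s) \<subseteq> sets (F t)"
    and mc: "markov_chain_on M F {0..T} X"
begin

lemma space_F: "t \<in> {0..T} \<Longrightarrow> space (F t) = space M"
  using sub by (auto simp: subalgebra_def)

lemma measurable_F_mono: "f \<in> borel_measurable (F s) \<Longrightarrow> 0 \<le> s \<Longrightarrow> s \<le> t \<Longrightarrow> t \<le> T \<Longrightarrow> f \<in> borel_measurable (F t)"
  using space_F[of s] space_F[of t] mono[of s t] by (intro measurable_from_subalg[of "F t" "F s"]) (auto simp: subalgebra_def)

lemma measurable_F_M: "f \<in> borel_measurable (F s) \<Longrightarrow> s \<in> {0..T} \<Longrightarrow> f \<in> borel_measurable M"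
  using sub measurable_from_subalg by blast

lemma X_range: "\<omega> \<in> space M \<Longrightarrow> t \<in> {0..T} \<Longrightarrow> X t \<omega> \<in> range state"
  and X_cadlag: "\<omega> \<in> space M \<Longrightarrow> cadlag_on {0..T} (\<lambda>t. X t \<omega>)"
  using mc by (auto simp: markov_chain_on_def)

lemma X_meas: "t \<in> {0..T} \<Longrightarrow> X t \<in> borel_measurable (F t)"
  using mc by (auto simp: markov_chain_on_def adapted_on_def)

lemma X_nth_meas: "t \<in> {0..T} \<Longrightarrow> (\<lambda>\<omega>. X t \<omega> $ i) \<in> borel_measurable (F t)"
  by (intro borel_measurable_continuous_on[OF _ X_meas] continuous_intros)

lemma X_nth: "\<omega> \<in> space M \<Longrightarrow> t \<in> {0..T} \<Longrightarrow> X t \<omega> $ i = (if X t \<omega> = state i then 1 else 0)"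
proof -
  assume "\<omega> \<in> space M" "t \<in> {0..T}"
  then obtain j where j: "X t \<omega> = axis j 1" using X_range by blast
  have "X t \<omega> $ i = (if i = j then 1 else 0)" by (simp add: j axis_def)
  moreover have "X t \<omega> = state i \<longleftrightarrow> i = j" by (auto simp: j axis_eq_axis)
  ultimately show ?thesis by simp
qed

lemma X_nth_bound: "\<omega> \<in> space M \<Longrightarrow> t \<in> {0..T} \<Longrightarrow> \<bar>X t \<omega> $ i\<bar> \<le> 1"
  by (simp add: X_nth)

lemma sum_X_nth: "\<omega> \<in> space M \<Longrightarrow> t \<in> {0..T} \<Longrightarrow> (\<Sum>i\<in>UNIV. X t \<omega> $ i) = 1"
  using X_range[of \<omega> t] by (auto simp: axis_def)

lemma X_nth_rc: "\<omega> \<in> space M \<Longrightarrow> 0 \<le> u \<Longrightarrow> u < T \<Longrightarrow> ((\<lambda>v. X v \<omega> $ i) \<longlongrightarrow> X u \<omega> $ i) (at_right u)"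
  by (intro tendsto_vec_nth cadlag_on_right[OF X_cadlag]) auto

lemma brcp: "t \<in> {0..T} \<Longrightarrow> bounded_right_continuous_process (F t) (\<lambda>u \<omega>. X u \<omega> $ i) t"
  by unfold_locales (auto simp: space_F intro!: X_nth_rc X_nth_bound measurable_F_mono[OF X_nth_meas])

lemma brcp_M: "t \<in> {0..T} \<Longrightarrow> bounded_right_continuous_process M (\<lambda>u \<omega>. X u \<omega> $ i) t"
  by unfold_locales (auto intro!: X_nth_rc X_nth_bound measurable_F_M[OF X_nth_meas])

lemma prob_state_eq: "t \<in> {0..T} \<Longrightarrow> \<P>(\<omega> in M. X t \<omega> = state i) = expectation (\<lambda>\<omega>. X t \<omega> $ i)"
proof -
  assume t: "t \<in> {0..T}"
  have "{\<omega>\<in>space M. X t \<omega> = state i} \<in> sets M"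
    using measurable_F_M[OF X_nth_meas[OF t] t, of i] X_nth[of _ t i] t
    by (subst Collect_cong[of _ "\<lambda>\<omega>. \<omega> \<in> space M \<and> X t \<omega> $ i = 1"]) (auto split: if_splits)
  then have "\<P>(\<omega> in M. X t \<omega> = state i) = expectation (indicator {\<omega>\<in>space M. X t \<omega> = state i})" by simp
  also have "\<dots> = expectation (\<lambda>\<omega>. X t \<omega> $ i)"
    using t by (intro Bochner_Integration.integral_cong) (auto simp: X_nth)
  finally show ?thesis .
qed

lemma integrable_bounded:
  fixes K :: real
  assumes "V \<in> borel_measurable M" "\<And>\<omega>. \<omega> \<in> space M \<Longrightarrow> \<bar>V \<omega>\<bar> \<le> K"
  shows "integrable M V"
  by (rule integrable_const_bound[of _ K]) (use assms in \<open>auto intro!: AE_I2\<close>)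

lemma integrable_bounded_mult_X:
  fixes K :: real
  assumes "V \<in> borel_measurable M" "\<And>\<omega>. \<omega> \<in> space M \<Longrightarrow> \<bar>V \<omega>\<bar> \<le> K" and t: "t \<in> {0..T}"
  shows "integrable M (\<lambda>\<omega>. V \<omega> * X t \<omega> $ i)"
proof (rule integrable_bounded[of _ K])
  show "(\<lambda>\<omega>. V \<omega> * X t \<omega> $ i) \<in> borel_measurable M"
    using assms measurable_F_M[OF X_nth_meas[OF t] t] by measurable
  show "\<bar>V \<omega> * X t \<omega> $ i\<bar> \<le> K" if "\<omega> \<in> space M" for \<omega>
    using assms(2)[OF that] that t by (auto simp: X_nth)
qed

text \<open>The factor \<open>X s \<omega> $ i\<close> confines the Markov property to the event
  that the chain is in state \<open>i\<close> at time \<open>s\<close>, the only place where it is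
  postulated with this transition probability.\<close>

lemma markov_expectation:
  fixes K :: real
  assumes st: "0 \<le> s" "s \<le> t" "t \<le> T" and V: "V \<in> borel_measurable (F s)" "\<And>\<omega>. \<omega> \<in> space M \<Longrightarrow> \<bar>V \<omega>\<bar> \<le> K"
  shows "expectation (\<lambda>\<omega>. V \<omega> * X s \<omega> $ i * X t \<omega> $ j) = trans_prob M X i j s t * expectation (\<lambda>\<omega>. V \<omega> * X s \<omega> $ i)"
proof -
  have s: "s \<in> {0..T}" and t: "t \<in> {0..T}" using st by auto
  interpret finite_measure_subalgebra M "F s" by unfold_locales (rule sub[OF s])
  define g where "g = (indicator {\<omega>\<in>space M. X t \<omega> = state j} :: 'a \<Rightarrow> real)"
  have Xm[measurable]: "(\<lambda>\<omega>. X t \<omega> $ j) \<in> borel_measurable M" using measurable_F_M[OF X_nth_meas[OF t] t] .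
  have g: "g \<omega> = X t \<omega> $ j" if "\<omega> \<in> space M" for \<omega> using that t by (auto simp: g_def X_nth)
  have gm: "g \<in> borel_measurable M" using Xm by (rule measurable_cong[THEN iffD2, rotated]) (simp add: g)
  have Vs: "(\<lambda>\<omega>. V \<omega> * X s \<omega> $ i) \<in> borel_measurable (F s)" using V(1) X_nth_meas[OF s] by measurable
  have VsM: "V \<in> borel_measurable M" using measurable_F_M[OF V(1) s] .
  have "integrable M (\<lambda>\<omega>. (V \<omega> * X s \<omega> $ i) * X t \<omega> $ j)"
  proof (rule integrable_bounded_mult_X[of _ K, OF measurable_F_M[OF Vs s] _ t])
    show "\<bar>V \<omega> * X s \<omega> $ i\<bar> \<le> K" if "\<omega> \<in> space M" for \<omega> using V(2)[OF that] that s by (auto simp: X_nth)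
  qed
  then have i: "integrable M (\<lambda>\<omega>. (V \<omega> * X s \<omega> $ i) * g \<omega>)"
    by (rule Bochner_Integration.integrable_cong[THEN iffD1, rotated 2]) (simp_all add: g)
  have "expectation (\<lambda>\<omega>. V \<omega> * X s \<omega> $ i * X t \<omega> $ j) = expectation (\<lambda>\<omega>. (V \<omega> * X s \<omega> $ i) * g \<omega>)"
    by (intro Bochner_Integration.integral_cong) (simp_all add: g)
  also have "\<dots> = expectation (\<lambda>\<omega>. (V \<omega> * X s \<omega> $ i) * real_cond_exp M (F s) g \<omega>)"
    using real_cond_exp_intg(2)[OF i Vs gm] by simp
  also have "\<dots> = expectation (\<lambda>\<omega>. trans_prob M X i j s t * (V \<omega> * X s \<omega> $ i))"
  proof (rule integral_cong_AE)
    have "AE \<omega> in M. X s \<omega> = state i \<longrightarrow> real_cond_exp M (F s) g \<omega> = trans_prob M X i j s t"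
      using mc s t st unfolding markov_chain_on_def g_def by blast
    then show "AE \<omega> in M. (V \<omega> * X s \<omega> $ i) * real_cond_exp M (F s) g \<omega> = trans_prob M X i j s t * (V \<omega> * X s \<omega> $ i)"
      using AE_space by eventually_elim (use s in \<open>auto simp: X_nth\<close>)
  qed (use measurable_F_M[OF Vs s] borel_measurable_cond_exp2 in measurable)
  finally show ?thesis by simp
qed

end

section \<open>Discount factors along the chain, and the forward equation for discounted
  masses\<close>

context markov_chain
begin

lemma inner_X_bound: "\<omega> \<in> space M \<Longrightarrow> t \<in> {0..T} \<Longrightarrow> \<bar>c \<bullet> X t \<omega>\<bar> \<le> norm c"
  using X_range[of \<omega> t] Cauchy_Schwarz_ineq2[of c "X t \<omega>"] by (auto simp: norm_axis_1)

lemma inner_X_mult: "\<omega> \<in> space M \<Longrightarrow> t \<in> {0..T} \<Longrightarrow> c \<bullet> X t \<omega> * X t \<omega> $ j = c $ j * X t \<omega> $ j"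
  using X_range[of \<omega> t] by (auto simp: X_nth inner_axis axis_eq_axis)

lemma const_path_integrable: "set_integrable lborel {a..b} (\<lambda>_. c :: real)" for a b :: real
  by (rule borel_integrable_atLeastAtMost') (rule continuous_on_const)

lemma inner_path_integrable:
  assumes "\<omega> \<in> space M" "0 \<le> a" "b \<le> T"
  shows "set_integrable lborel {a..b} (\<lambda>u. c \<bullet> X u \<omega>)"
proof -
  interpret bounded_right_continuous_process M "\<lambda>u \<omega>. X u \<omega> $ i" T for i
    by (rule brcp_M) (use T in simp)
  have "set_integrable lborel {a..b} (\<lambda>u. \<Sum>i\<in>UNIV. c $ i * X u \<omega> $ i)"
    using assms by (intro set_integral_finite_sum path_integrable const_path_integrable) auto
  then show ?thesis by (simp add: inner_vec_def)
qed

lemma inner_integral_eq: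
  assumes "\<omega> \<in> space M" "0 \<le> a" "b \<le> T"
  shows "(LBINT u:{a..b}. c \<bullet> X u \<omega>) = (\<Sum>i\<in>UNIV. LBINT u:{a..b}. c $ i * X u \<omega> $ i)"
proof -
  interpret bounded_right_continuous_process M "\<lambda>u \<omega>. X u \<omega> $ i" T for i
    by (rule brcp_M) (use T in simp)
  have "(LBINT u:{a..b}. \<Sum>i\<in>UNIV. c $ i * X u \<omega> $ i) = (\<Sum>i\<in>UNIV. LBINT u:{a..b}. c $ i * X u \<omega> $ i)"
    using assms by (intro set_integral_finite_sum path_integrable const_path_integrable) auto
  then show ?thesis by (simp add: inner_vec_def)
qed

definition discount :: "real^'n \<Rightarrow> real \<Rightarrow> real \<Rightarrow> 'a \<Rightarrow> real" where
  "discount c s u \<omega> = exp (- (LBINT v:{s..u}. c \<bullet> X v \<omega>))"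

lemma inner_integral_measurable:
  assumes "0 \<le> s" "s \<le> u" "u \<le> T"
  shows "(\<lambda>\<omega>. LBINT v:{s..u}. c \<bullet> X v \<omega>) \<in> borel_measurable (F u)"
proof -
  have u: "u \<in> {0..T}" using assms by auto
  interpret bounded_right_continuous_process "F u" "\<lambda>u \<omega>. X u \<omega> $ i" u for i
    by (rule brcp[OF u])
  have "(\<lambda>\<omega>. \<Sum>i\<in>UNIV. LBINT v:{s..u}. c $ i * X v \<omega> $ i) \<in> borel_measurable (F u)"
    using assms by (intro borel_measurable_sum measurable_time_integral) (auto simp: set_borel_measurable_def)
  then show ?thesis
    by (rule measurable_cong[THEN iffD1, rotated]) (use assms u in \<open>simp add: space_F inner_integral_eq\<close>)
qed

lemma inner_integral_bound:
  assumes "\<omega> \<in> space M" "0 \<le> s" "s \<le> u" "u \<le> T"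
  shows "\<bar>LBINT v:{s..u}. c \<bullet> X v \<omega>\<bar> \<le> norm c * (u - s)"
proof -
  have i: "set_integrable lborel {s..u} (\<lambda>v. c \<bullet> X v \<omega>)" using assms by (intro inner_path_integrable) auto
  have "\<bar>LBINT v:{s..u}. c \<bullet> X v \<omega>\<bar> \<le> (LBINT v:{s..u}. \<bar>c \<bullet> X v \<omega>\<bar>)"
    using set_integral_norm_bound[OF i] by simp
  also have "\<dots> \<le> (LBINT v:{s..u}. norm c)"
    using i assms by (intro set_integral_mono set_integrable_abs const_path_integrable inner_X_bound) auto
  also have "\<dots> = norm c * (u - s)" using assms by (simp add: set_lebesgue_integral_def)
  finally show ?thesis .
qed

lemma discount_measurable: "0 \<le> s \<Longrightarrow> s \<le> u \<Longrightarrow> u \<le> T \<Longrightarrow> discount c s u \<in> borel_measurable (F u)"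
  unfolding discount_def using inner_integral_measurable by measurable

lemma inner_integral_split:
  assumes "\<omega> \<in> space M" "0 \<le> s" "s \<le> u" "u \<le> v" "v \<le> T"
  shows "(LBINT w:{s..v}. c \<bullet> X w \<omega>) = (LBINT w:{s..u}. c \<bullet> X w \<omega>) + (LBINT w:{u..v}. c \<bullet> X w \<omega>)"
  using assms by (intro set_integral_Icc_split inner_path_integrable)

lemma discount_pos: "discount c s u \<omega> > 0" by (simp add: discount_def)

lemma discount_bound:
  assumes "\<omega> \<in> space M" "0 \<le> s" "s \<le> u" "u \<le> T"
  shows "discount c s u \<omega> \<le> exp (norm c * T)" "discount c s u \<omega> \<ge> exp (- (norm c * T))"
proof -
  have "norm c * (u - s) \<le> norm c * T" using assms by (intro mult_left_mono) auto
  then show "discount c s u \<omega> \<le> exp (norm c * T)" "discount c s u \<omega> \<ge> exp (- (norm c * T))"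
    using inner_integral_bound[OF assms, of c] by (auto simp: discount_def)
qed

lemma discount_split:
  assumes "\<omega> \<in> space M" "0 \<le> s" "s \<le> u" "u \<le> v" "v \<le> T"
  shows "discount c s v \<omega> = discount c s u \<omega> * discount c u v \<omega>"
  by (simp add: discount_def inner_integral_split[OF assms] exp_add[symmetric])

lemma discount_minus_one:
  assumes "\<omega> \<in> space M" "0 \<le> s" "s \<le> u" "u \<le> T"
  shows "\<bar>discount c s u \<omega> - 1\<bar> \<le> (norm c * exp (norm c * T)) * (u - s)"
proof -
  have 1: "norm c * (u - s) \<le> norm c * T" using assms by (intro mult_left_mono) auto
  have "\<bar>discount c s u \<omega> - 1\<bar> \<le> \<bar>LBINT v:{s..u}. c \<bullet> X v \<omega>\<bar> * exp \<bar>LBINT v:{s..u}. c \<bullet> X v \<omega>\<bar>"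
    using abs_exp_minus_one_le[of "- (LBINT v:{s..u}. c \<bullet> X v \<omega>)"] by (simp add: discount_def)
  also have "\<dots> \<le> (norm c * (u - s)) * exp (norm c * T)"
    using inner_integral_bound[OF assms, of c] 1 assms by (intro mult_mono) auto
  finally show ?thesis by (simp add: mult_ac)
qed

lemma discount_self: "discount c s s \<omega> = 1" if "\<omega> \<in> space M" "0 \<le> s" "s \<le> T"
  using inner_integral_bound[of \<omega> s s c] that by (simp add: discount_def)

text \<open>Immediately to the right of \<open>u\<close> the path is constant, so the discount
  factor is an exponential in \<open>v - u\<close> there and the limit is its derivative at
  \<open>0\<close>.\<close>

lemma discount_quotient_tendsto:
  assumes \<omega>: "\<omega> \<in> space M" and u: "0 \<le> u" "u < T"
  shows "((\<lambda>v. (discount c u v \<omega> - 1) / (v - u) * X v \<omega> $ j) \<longlongrightarrow> - (c $ j * X u \<omega> $ j)) (at_right u)"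
proof -
  have u': "u \<in> {0..T}" using u by simp
  define y where "y = c \<bullet> X u \<omega>"
  obtain d where d: "d > 0" "\<And>s. s \<in> {0..T} \<Longrightarrow> u \<le> s \<Longrightarrow> s < u + d \<Longrightarrow> X s \<omega> = X u \<omega>"
    using state_path_local[OF X_cadlag[OF \<omega>] X_range[OF \<omega>] u'] by metis
  have "((\<lambda>z. exp (- (z * y))) has_real_derivative (- y) * exp (- (0 * y))) (at 0)"
    by (auto intro!: derivative_eq_intros)
  then have "((\<lambda>z. (exp (- (z * y)) - 1) / z) \<longlongrightarrow> - y) (at 0)"
    by (simp add: has_field_derivative_iff)
  then have "((\<lambda>z. (exp (- (z * y)) - 1) / z * X u \<omega> $ j) \<longlongrightarrow> - y * X u \<omega> $ j) (at_right 0)"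
    by (intro tendsto_mult tendsto_const) (rule filterlim_mono, auto simp: at_le)
  then have "((\<lambda>v. (exp (- ((v - u) * y)) - 1) / (v - u) * X u \<omega> $ j) \<longlongrightarrow> - y * X u \<omega> $ j) (at_right u)"
    by (subst filterlim_at_right_to_0) simp
  moreover have "eventually (\<lambda>v. (exp (- ((v - u) * y)) - 1) / (v - u) * X u \<omega> $ j = (discount c u v \<omega> - 1) / (v - u) * X v \<omega> $ j) (at_right u)"
  proof (rule eventually_at_rightI[of u "min T (u + d)"])
    fix v assume v: "v \<in> {u<..<min T (u + d)}"
    have "(LBINT w:{u..v}. c \<bullet> X w \<omega>) = (LBINT w:{u..v}. y)"
    proof (intro set_lebesgue_integral_cong allI impI)
      fix w assume "w \<in> {u..v}"
      then have "X w \<omega> = X u \<omega>" using v u by (intro d(2)) auto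
      then show "c \<bullet> X w \<omega> = y" by (simp only: y_def)
    qed simp
    also have "\<dots> = (v - u) * y" using v by (simp add: set_lebesgue_integral_def)
    finally have "discount c u v \<omega> = exp (- ((v - u) * y))" by (simp only: discount_def)
    moreover have "X v \<omega> = X u \<omega>" using v u by (intro d(2)) auto
    ultimately show "(exp (- ((v - u) * y)) - 1) / (v - u) * X u \<omega> $ j = (discount c u v \<omega> - 1) / (v - u) * X v \<omega> $ j"
      by (simp only:)
  qed (use u d in auto)
  ultimately have "((\<lambda>v. (discount c u v \<omega> - 1) / (v - u) * X v \<omega> $ j) \<longlongrightarrow> - y * X u \<omega> $ j) (at_right u)"
    by (auto intro: Lim_transform_eventually)
  then show ?thesis using inner_X_mult[OF \<omega> u', of c j] by (simp add: y_def)
qed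

text \<open>\<open>V\<close> is a test variable known at time \<open>s\<close>. For
  \<open>c = 0\<close> nothing is discounted: this case yields the martingale property of the
  compensated chain and, with \<open>V = 1\<close> and \<open>s = 0\<close>, the law of
  \<open>X u\<close>.\<close>

definition mass :: "real^'n \<Rightarrow> real \<Rightarrow> ('a \<Rightarrow> real) \<Rightarrow> 'n \<Rightarrow> real \<Rightarrow> real" where
  "mass c s V j u = expectation (\<lambda>\<omega>. V \<omega> * discount c s u \<omega> * X u \<omega> $ j)"

context
  fixes s K :: real and V :: "'a \<Rightarrow> real" and c :: "real^'n"
  assumes s: "0 \<le> s" "s \<le> T" and V: "V \<in> borel_measurable (F s)" "\<And>\<omega>. \<omega> \<in> space M \<Longrightarrow> \<bar>V \<omega>\<bar> \<le> K"
begin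

lemma K_nonneg: "K \<ge> 0"
  using V(2) not_empty by (metis abs_ge_zero all_not_in_conv order_trans)

lemma discounted_V:
  assumes "s \<le> u" "u \<le> T"
  shows "(\<lambda>\<omega>. V \<omega> * discount c s u \<omega>) \<in> borel_measurable (F u)"
    "\<omega> \<in> space M \<Longrightarrow> \<bar>V \<omega> * discount c s u \<omega>\<bar> \<le> K * exp (norm c * T)"
proof -
  have [measurable]: "V \<in> borel_measurable (F u)" using V(1) s assms by (rule_tac measurable_F_mono) auto
  show "(\<lambda>\<omega>. V \<omega> * discount c s u \<omega>) \<in> borel_measurable (F u)"
    using discount_measurable[of s u c] s assms by measurable
  show "\<bar>V \<omega> * discount c s u \<omega>\<bar> \<le> K * exp (norm c * T)" if "\<omega> \<in> space M"
    using V(2)[OF that] discount_bound[OF that s(1) assms, of c] discount_pos[of c s u \<omega>] K_nonneg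
    by (auto simp: abs_mult intro!: mult_mono)
qed

text \<open>Kolmogorov's forward equation with killing rate \<open>c\<close>. Over a short step the
  mass changes through the discount and through the movement of the chain; the Markov property at
  \<open>u\<close> handles the latter.\<close>

lemma mass_right_derivative:
  assumes u: "s \<le> u" "u < T" and gen: "has_generator_at M X A u"
  shows "(mass c s V j has_real_derivative (\<Sum>k\<in>UNIV. mass c s V k u * A u $ k $ j) - c $ j * mass c s V j u) (at_right u)"
proof -
  have u0: "0 \<le> u" and uT: "u \<in> {0..T}" using u s by auto
  define V' where "V' \<omega> = V \<omega> * discount c s u \<omega>" for \<omega>
  define K' where "K' = K * exp (norm c * T)"
  have V': "V' \<in> borel_measurable (F u)" "\<And>\<omega>. \<omega> \<in> space M \<Longrightarrow> \<bar>V' \<omega>\<bar> \<le> K'"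
    using discounted_V[of u] u s by (auto simp: V'_def[abs_def] K'_def)
  have V'M[measurable]: "V' \<in> borel_measurable M" using measurable_F_M[OF V'(1) uT] .
  have mass_u: "mass c s V k u = expectation (\<lambda>\<omega>. V' \<omega> * X u \<omega> $ k)" for k by (simp add: mass_def V'_def)
  \<comment> \<open>The share of the discount in the difference quotient, kept under the expectation
    for dominated convergence.\<close>
  define R where "R v = expectation (\<lambda>\<omega>. V' \<omega> * ((discount c u v \<omega> - 1) / (v - u) * X v \<omega> $ j))" for v
  have K'0: "K' \<ge> 0" using K_nonneg by (simp add: K'_def)
  have dm: "discount c u v \<in> borel_measurable M" if "u \<le> v" "v \<le> T" for v
    using measurable_F_M[OF discount_measurable[of u v c]] that u0 by auto
  have Xm: "(\<lambda>\<omega>. X v \<omega> $ k) \<in> borel_measurable M" if "u \<le> v" "v \<le> T" for v k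
    using measurable_F_M[OF X_nth_meas, of v k] that u0 by auto
  have quot: "(mass c s V j v - mass c s V j u) / (v - u) =
     R v + (\<Sum>k\<in>UNIV. mass c s V k u * ((trans_prob M X k j u v - (if k = j then 1 else 0)) / (v - u)))"
    if v: "u < v" "v < T" for v
  proof -
    have vT: "v \<in> {0..T}" and uv: "u \<le> v" "v \<le> T" using u0 v by auto
    note [measurable] = dm[OF uv] Xm[OF uv]
    have i1: "integrable M (\<lambda>\<omega>. V' \<omega> * (discount c u v \<omega> - 1) * X v \<omega> $ j)"
    proof (rule integrable_bounded_mult_X[OF _ _ vT])
      fix \<omega> assume \<omega>: "\<omega> \<in> space M"
      have "\<bar>V' \<omega>\<bar> * \<bar>discount c u v \<omega> - 1\<bar> \<le> K' * ((norm c * exp (norm c * T)) * (v - u))"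
        using discount_minus_one[OF \<omega> u0, of v c] v V'(2)[OF \<omega>] K'0 by (intro mult_mono) auto
      then show "\<bar>V' \<omega> * (discount c u v \<omega> - 1)\<bar> \<le> K' * ((norm c * exp (norm c * T)) * (v - u))"
        by (simp add: abs_mult)
    qed measurable
    have i2: "integrable M (\<lambda>\<omega>. V' \<omega> * X v \<omega> $ k)" "integrable M (\<lambda>\<omega>. V' \<omega> * X u \<omega> $ k)" for k
      using integrable_bounded_mult_X[OF V'M V'(2) vT] integrable_bounded_mult_X[OF V'M V'(2) uT] by auto
    have "mass c s V j v = expectation (\<lambda>\<omega>. V' \<omega> * (discount c u v \<omega> - 1) * X v \<omega> $ j + V' \<omega> * X v \<omega> $ j)"
      unfolding mass_def V'_def
      by (intro Bochner_Integration.integral_cong refl) (use u s v in \<open>simp add: discount_split[of _ s u v] algebra_simps\<close>)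
    also have "\<dots> = expectation (\<lambda>\<omega>. V' \<omega> * (discount c u v \<omega> - 1) * X v \<omega> $ j) + expectation (\<lambda>\<omega>. V' \<omega> * X v \<omega> $ j)"
      by (rule Bochner_Integration.integral_add[OF i1 i2(1)])
    also have "expectation (\<lambda>\<omega>. V' \<omega> * (discount c u v \<omega> - 1) * X v \<omega> $ j) = (v - u) * R v"
    proof -
      have "(v - u) * R v = expectation (\<lambda>\<omega>. (v - u) * (V' \<omega> * ((discount c u v \<omega> - 1) / (v - u) * X v \<omega> $ j)))"
        by (simp add: R_def)
      also have "\<dots> = expectation (\<lambda>\<omega>. V' \<omega> * (discount c u v \<omega> - 1) * X v \<omega> $ j)"
        by (intro Bochner_Integration.integral_cong refl) (use v in simp)
      finally show ?thesis by simp
    qed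
    also have "expectation (\<lambda>\<omega>. V' \<omega> * X v \<omega> $ j) = (\<Sum>k\<in>UNIV. trans_prob M X k j u v * mass c s V k u)"
    proof -
      \<comment> \<open>The coordinates of \<open>X u\<close> sum to \<open>1\<close>; inserting
        this partition makes the Markov property at \<open>u\<close> applicable summand by
        summand.\<close>
      have "expectation (\<lambda>\<omega>. V' \<omega> * X v \<omega> $ j) = expectation (\<lambda>\<omega>. \<Sum>k\<in>UNIV. V' \<omega> * X u \<omega> $ k * X v \<omega> $ j)"
        by (intro Bochner_Integration.integral_cong refl)
          (simp add: sum_distrib_right[symmetric] sum_distrib_left[symmetric] sum_X_nth[OF _ uT])
      also have "\<dots> = (\<Sum>k\<in>UNIV. expectation (\<lambda>\<omega>. V' \<omega> * X u \<omega> $ k * X v \<omega> $ j))"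
      proof (rule Bochner_Integration.integral_sum)
        show "integrable M (\<lambda>\<omega>. V' \<omega> * X u \<omega> $ k * X v \<omega> $ j)" for k
        proof (rule integrable_bounded_mult_X[OF _ _ vT])
          show "(\<lambda>\<omega>. V' \<omega> * X u \<omega> $ k) \<in> borel_measurable M" using Xm[of u k, OF order_refl less_imp_le[OF u(2)]] by measurable
          show "\<bar>V' \<omega> * X u \<omega> $ k\<bar> \<le> K'" if "\<omega> \<in> space M" for \<omega>
            using V'(2)[OF that] X_nth[OF that uT, of k] by (auto split: if_splits)
        qed
      qed
      also have "\<dots> = (\<Sum>k\<in>UNIV. trans_prob M X k j u v * mass c s V k u)"
        using markov_expectation[OF u0 uv V'] by (simp add: mass_u)
      finally show ?thesis .
    qed
    finally have mv: "mass c s V j v = (v - u) * R v + (\<Sum>k\<in>UNIV. trans_prob M X k j u v * mass c s V k u)" .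
    have mu: "mass c s V j u = (\<Sum>k\<in>UNIV. (if k = j then 1 else 0) * mass c s V k u)"
      by (simp add: if_distrib[of "\<lambda>x. x * _"] cong: if_cong)
    have "mass c s V j v - mass c s V j u =
       (v - u) * R v + (\<Sum>k\<in>UNIV. (trans_prob M X k j u v - (if k = j then 1 else 0)) * mass c s V k u)"
      unfolding mv by (subst mu) (simp only: sum_subtractf left_diff_distrib)
    then show ?thesis using v by (simp add: add_divide_distrib sum_divide_distrib mult.commute)
  qed
  have R: "(R \<longlongrightarrow> - (c $ j * mass c s V j u)) (at_right u)"
  proof (rule tendsto_at_right_sequentially[OF u(2)])
    fix S :: "nat \<Rightarrow> real" assume S: "\<And>n. u < S n" "\<And>n. S n < T" "S \<longlonglongrightarrow> u"
    have "filterlim S (at_right u) sequentially" using S by (simp add: filterlim_at less_imp_neq[symmetric])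
    then have lim: "(\<lambda>n. (discount c u (S n) \<omega> - 1) / (S n - u) * X (S n) \<omega> $ j) \<longlonglongrightarrow> - (c $ j * X u \<omega> $ j)" if "\<omega> \<in> space M" for \<omega>
      using discount_quotient_tendsto[OF that u0 u(2)] by (rule filterlim_compose[rotated])
    have "(\<lambda>n. R (S n)) \<longlonglongrightarrow> expectation (\<lambda>\<omega>. V' \<omega> * (- (c $ j * X u \<omega> $ j)))"
      unfolding R_def
    proof (rule integral_dominated_convergence[where w="\<lambda>_. K' * (norm c * exp (norm c * T))"])
      show "(\<lambda>\<omega>. V' \<omega> * (- (c $ j * X u \<omega> $ j))) \<in> borel_measurable M" using Xm[of u j, OF order_refl less_imp_le[OF u(2)]] by measurable
      show "(\<lambda>\<omega>. V' \<omega> * ((discount c u (S n) \<omega> - 1) / (S n - u) * X (S n) \<omega> $ j)) \<in> borel_measurable M" for n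
      proof -
        have Sn: "u \<le> S n" "S n \<le> T" using S(1,2)[of n] by auto
        note [measurable] = dm[OF Sn] Xm[OF Sn]
        show ?thesis by measurable
      qed
      show "AE \<omega> in M. (\<lambda>n. V' \<omega> * ((discount c u (S n) \<omega> - 1) / (S n - u) * X (S n) \<omega> $ j)) \<longlonglongrightarrow> V' \<omega> * (- (c $ j * X u \<omega> $ j))"
        using AE_space by eventually_elim (intro tendsto_mult tendsto_const lim)
      show "AE \<omega> in M. norm (V' \<omega> * ((discount c u (S n) \<omega> - 1) / (S n - u) * X (S n) \<omega> $ j)) \<le> K' * (norm c * exp (norm c * T))" for n
        using AE_space
      proof eventually_elim
        case (elim \<omega>)
        have Sn: "u < S n" "S n \<le> T" using S(1,2)[of n] by auto
        have "\<bar>discount c u (S n) \<omega> - 1\<bar> / (S n - u) \<le> norm c * exp (norm c * T)"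
          using discount_minus_one[OF elim u0, of "S n" c] Sn by (simp add: pos_divide_le_eq)
        then have "\<bar>(discount c u (S n) \<omega> - 1) / (S n - u)\<bar> * \<bar>X (S n) \<omega> $ j\<bar> \<le> (norm c * exp (norm c * T)) * 1"
          using X_nth_bound[OF elim, of "S n" j] Sn u0 by (intro mult_mono) auto
        then have "\<bar>V' \<omega>\<bar> * \<bar>(discount c u (S n) \<omega> - 1) / (S n - u) * X (S n) \<omega> $ j\<bar> \<le> K' * (norm c * exp (norm c * T))"
          using V'(2)[OF elim] K'0 by (intro mult_mono) (auto simp: abs_mult)
        then show ?case by (simp add: abs_mult)
      qed
    qed simp
    also have "expectation (\<lambda>\<omega>. V' \<omega> * (- (c $ j * X u \<omega> $ j))) = - (c $ j * mass c s V j u)"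
    proof -
      have "expectation (\<lambda>\<omega>. V' \<omega> * (- (c $ j * X u \<omega> $ j))) = expectation (\<lambda>\<omega>. (- c $ j) * (V' \<omega> * X u \<omega> $ j))"
        by (intro Bochner_Integration.integral_cong) auto
      then show ?thesis by (simp add: mass_u)
    qed
    finally show "(\<lambda>n. R (S n)) \<longlonglongrightarrow> - (c $ j * mass c s V j u)" .
  qed
  \<comment> \<open>For a state of probability zero at time \<open>u\<close> the generator clause is
    silent, but the mass of that state vanishes and so does the term.\<close>
  have gen': "((\<lambda>v. mass c s V k u * ((trans_prob M X k j u v - (if k = j then 1 else 0)) / (v - u))) \<longlongrightarrow> mass c s V k u * A u $ k $ j) (at_right u)" for k
  proof (cases "\<P>(\<omega> in M. X u \<omega> = state k) > 0")
    case True
    then have "((\<lambda>\<epsilon>. (trans_prob M X k j u (u + \<epsilon>) - (if k = j then 1 else 0)) / \<epsilon>) \<longlongrightarrow> A u $ k $ j) (at_right 0)"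
      using gen unfolding has_generator_at_def by blast
    then have "((\<lambda>v. (trans_prob M X k j u v - (if k = j then 1 else 0)) / (v - u)) \<longlongrightarrow> A u $ k $ j) (at_right u)"
      by (subst filterlim_at_right_to_0) (simp add: add.commute)
    then show ?thesis by (intro tendsto_mult tendsto_const)
  next
    case False
    then have "\<P>(\<omega> in M. X u \<omega> = state k) = 0" by (metis measure_nonneg order_less_le)
    then have e0: "expectation (\<lambda>\<omega>. X u \<omega> $ k) = 0" by (simp add: prob_state_eq[OF uT])
    have "\<bar>mass c s V k u\<bar> \<le> expectation (\<lambda>\<omega>. \<bar>V' \<omega> * X u \<omega> $ k\<bar>)" by (simp add: mass_u)
    also have "\<dots> \<le> expectation (\<lambda>\<omega>. K' * X u \<omega> $ k)"
    proof (rule integral_mono)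
      show "integrable M (\<lambda>\<omega>. \<bar>V' \<omega> * X u \<omega> $ k\<bar>)"
        using integrable_bounded_mult_X[OF V'M V'(2) uT] by (intro integrable_abs) auto
      show "integrable M (\<lambda>\<omega>. K' * X u \<omega> $ k)"
        by (rule integrable_bounded_mult_X[OF _ _ uT, of _ "\<bar>K'\<bar>"]) auto
      show "\<bar>V' \<omega> * X u \<omega> $ k\<bar> \<le> K' * X u \<omega> $ k" if "\<omega> \<in> space M" for \<omega>
        using V'(2)[OF that] X_nth[OF that uT, of k] by (auto split: if_splits)
    qed
    also have "\<dots> = 0" using e0 by simp
    finally have "mass c s V k u = 0" by simp
    then show ?thesis by simp
  qed
  have "((\<lambda>v. R v + (\<Sum>k\<in>UNIV. mass c s V k u * ((trans_prob M X k j u v - (if k = j then 1 else 0)) / (v - u))))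
     \<longlongrightarrow> - (c $ j * mass c s V j u) + (\<Sum>k\<in>UNIV. mass c s V k u * A u $ k $ j)) (at_right u)"
    by (intro tendsto_add R tendsto_sum gen')
  moreover have "eventually (\<lambda>v. R v + (\<Sum>k\<in>UNIV. mass c s V k u * ((trans_prob M X k j u v - (if k = j then 1 else 0)) / (v - u))) =
     (mass c s V j v - mass c s V j u) / (v - u)) (at_right u)"
    by (rule eventually_at_rightI[of u T]) (use u quot in auto)
  ultimately have "((\<lambda>v. (mass c s V j v - mass c s V j u) / (v - u)) \<longlongrightarrow> - (c $ j * mass c s V j u) + (\<Sum>k\<in>UNIV. mass c s V k u * A u $ k $ j)) (at_right u)"
    by (rule Lim_transform_eventually)
  then show ?thesis by (simp add: has_field_derivative_iff)
qed

text \<open>A jump from the left would be invisible to right derivatives. Two-sided continuity rests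
  on the last clause of \<open>markov_chain_on\<close>: between two times the mass changes only by
  discounting or on the event that the states at the two times differ.\<close>

lemma continuous_on_mass: "continuous_on {s..T} (mass c s V j)"
proof -
  define C where "C = norm c * exp (norm c * T)"
  define K' where "K' = K * exp (norm c * T)"
  have C: "C \<ge> 0" by (simp add: C_def)
  have K'0: "K' \<ge> 0" using K_nonneg by (simp add: K'_def)
  have Xm[measurable]: "(\<lambda>\<omega>. X v \<omega> $ k) \<in> borel_measurable M" if "v \<in> {0..T}" for v k
    using measurable_F_M[OF X_nth_meas, of v k] that by auto
  have est0: "\<bar>mass c s V j v - mass c s V j u\<bar> \<le> K' * C * (v - u) + K' * \<P>(\<omega> in M. X v \<omega> \<noteq> X u \<omega>)"
    if uv: "s \<le> u" "u \<le> v" "v \<le> T" for u v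
  proof -
    have uT: "u \<in> {0..T}" and vT: "v \<in> {0..T}" using uv s by auto
    have sets: "{\<omega>\<in>space M. X v \<omega> \<noteq> X u \<omega>} \<in> sets M"
    proof -
      have "{\<omega>\<in>space M. X v \<omega> \<noteq> X u \<omega>} = {\<omega>\<in>space M. \<exists>k. X v \<omega> $ k \<noteq> X u \<omega> $ k}" by (auto simp: vec_eq_iff)
      also have "\<dots> \<in> sets M" using Xm[OF uT] Xm[OF vT] by measurable
      finally show ?thesis .
    qed
    have m: "(\<lambda>\<omega>. V \<omega> * discount c s w \<omega>) \<in> borel_measurable M" if "w = u \<or> w = v" for w
      using measurable_F_M[OF discounted_V(1), of w] that uv s by auto
    have i: "integrable M (\<lambda>\<omega>. V \<omega> * discount c s w \<omega> * X w \<omega> $ j)" if w: "w = u \<or> w = v" for w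
      by (rule integrable_bounded_mult_X[OF m[OF w] discounted_V(2)]) (use uv s w in auto)
    have "\<bar>mass c s V j v - mass c s V j u\<bar> = \<bar>expectation (\<lambda>\<omega>. V \<omega> * discount c s v \<omega> * X v \<omega> $ j - V \<omega> * discount c s u \<omega> * X u \<omega> $ j)\<bar>"
      unfolding mass_def by (subst Bochner_Integration.integral_diff) (auto intro!: i)
    also have "\<dots> \<le> expectation (\<lambda>\<omega>. \<bar>V \<omega> * discount c s v \<omega> * X v \<omega> $ j - V \<omega> * discount c s u \<omega> * X u \<omega> $ j\<bar>)"
      by (rule integral_abs_bound)
    also have "\<dots> \<le> expectation (\<lambda>\<omega>. K' * C * (v - u) + K' * indicator {\<omega>\<in>space M. X v \<omega> \<noteq> X u \<omega>} \<omega>)"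
    proof (rule integral_mono)
      show "integrable M (\<lambda>\<omega>. \<bar>V \<omega> * discount c s v \<omega> * X v \<omega> $ j - V \<omega> * discount c s u \<omega> * X u \<omega> $ j\<bar>)"
        by (intro integrable_abs Bochner_Integration.integrable_diff i) auto
      show "integrable M (\<lambda>\<omega>. K' * C * (v - u) + K' * indicator {\<omega>\<in>space M. X v \<omega> \<noteq> X u \<omega>} \<omega>)"
        using sets by (auto simp: less_top[symmetric])
      fix \<omega> assume \<omega>: "\<omega> \<in> space M"
      define x where "x = V \<omega> * discount c s u \<omega>"
      have x: "\<bar>x\<bar> \<le> K'" using discounted_V(2)[of u \<omega>] uv \<omega> by (simp add: x_def K'_def)
      have dv: "V \<omega> * discount c s v \<omega> = x * discount c u v \<omega>"
        using discount_split[OF \<omega>, of s u v c] s uv by (simp add: x_def)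
      have "V \<omega> * discount c s v \<omega> * X v \<omega> $ j - x * X u \<omega> $ j = x * (discount c u v \<omega> - 1) * X v \<omega> $ j + x * (X v \<omega> $ j - X u \<omega> $ j)"
        by (simp add: dv algebra_simps)
      also have "\<bar>\<dots>\<bar> \<le> \<bar>x\<bar> * \<bar>discount c u v \<omega> - 1\<bar> * \<bar>X v \<omega> $ j\<bar> + \<bar>x\<bar> * \<bar>X v \<omega> $ j - X u \<omega> $ j\<bar>"
        by (rule order_trans[OF abs_triangle_ineq]) (simp add: abs_mult)
      also have "\<dots> \<le> (K' * (C * (v - u))) * 1 + K' * indicator {\<omega>\<in>space M. X v \<omega> \<noteq> X u \<omega>} \<omega>"
      proof (intro add_mono mult_mono)
        show "\<bar>discount c u v \<omega> - 1\<bar> \<le> C * (v - u)"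
          unfolding C_def using s uv by (intro discount_minus_one \<omega>) auto
        show "\<bar>X v \<omega> $ j - X u \<omega> $ j\<bar> \<le> indicator {\<omega>\<in>space M. X v \<omega> \<noteq> X u \<omega>} \<omega>"
          using X_nth[OF \<omega> uT, of j] X_nth[OF \<omega> vT, of j] \<omega> by (auto simp: indicator_def split: if_splits)
      qed (use x K'0 C uv X_nth_bound[OF \<omega> vT] in auto)
      finally show "\<bar>V \<omega> * discount c s v \<omega> * X v \<omega> $ j - V \<omega> * discount c s u \<omega> * X u \<omega> $ j\<bar>
        \<le> K' * C * (v - u) + K' * indicator {\<omega>\<in>space M. X v \<omega> \<noteq> X u \<omega>} \<omega>"
        by (simp add: x_def mult_ac)
    qed
    also have "\<dots> = K' * C * (v - u) + K' * \<P>(\<omega> in M. X v \<omega> \<noteq> X u \<omega>)"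
      using sets by (subst Bochner_Integration.integral_add) (auto simp: less_top[symmetric] prob_space)
    finally show ?thesis .
  qed
  have est: "\<bar>mass c s V j v - mass c s V j u\<bar> \<le> K' * C * \<bar>v - u\<bar> + K' * \<P>(\<omega> in M. X v \<omega> \<noteq> X u \<omega>)"
    if uv: "u \<in> {s..T}" "v \<in> {s..T}" for u v
  proof (cases "u \<le> v")
    case True
    then show ?thesis using est0[of u v] uv by simp
  next
    case False
    have "{\<omega>\<in>space M. X v \<omega> \<noteq> X u \<omega>} = {\<omega>\<in>space M. X u \<omega> \<noteq> X v \<omega>}" by auto
    then show ?thesis using est0[of v u] uv False by (simp add: abs_minus_commute)
  qed
  show ?thesis unfolding continuous_on_def
  proof (intro ballI)
    fix u assume u: "u \<in> {s..T}"
    then have "((\<lambda>v. \<P>(\<omega> in M. X v \<omega> \<noteq> X u \<omega>)) \<longlongrightarrow> 0) (at u within {0..T})"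
      using mc s unfolding markov_chain_on_def by auto
    then have P0: "((\<lambda>v. \<P>(\<omega> in M. X v \<omega> \<noteq> X u \<omega>)) \<longlongrightarrow> 0) (at u within {s..T})"
      by (rule tendsto_within_subset) (use s in auto)
    have "((\<lambda>v. K' * C * \<bar>v - u\<bar> + K' * \<P>(\<omega> in M. X v \<omega> \<noteq> X u \<omega>)) \<longlongrightarrow> K' * C * \<bar>u - u\<bar> + K' * 0) (at u within {s..T})"
      by (intro tendsto_intros P0)
    then have "((\<lambda>v. K' * C * \<bar>v - u\<bar> + K' * \<P>(\<omega> in M. X v \<omega> \<noteq> X u \<omega>)) \<longlongrightarrow> 0) (at u within {s..T})" by simp
    then have "((\<lambda>v. mass c s V j v - mass c s V j u) \<longlongrightarrow> 0) (at u within {s..T})"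
      by (rule Lim_null_comparison[rotated])
        (auto simp: eventually_at_filter intro!: always_eventually est u)
    then show "(mass c s V j \<longlongrightarrow> mass c s V j u) (at u within {s..T})" by (rule LIM_zero_cancel)
  qed
qed

end

end

section \<open>Backward equation and Feynman-Kac formula\<close>

lemma norm_matrix_vector_le:
  fixes A :: "real^'n^'n"
  assumes "\<And>i j. \<bar>A $ i $ j\<bar> \<le> K"
  shows "norm (A *v x) \<le> (real CARD('n) * real CARD('n) * K) * norm x"
proof -
  have "norm (A *v x) \<le> (\<Sum>i\<in>UNIV. \<bar>(A *v x) $ i\<bar>)" by (rule norm_le_l1_cart)
  also have "\<dots> \<le> (\<Sum>i\<in>(UNIV::'n set). \<Sum>j\<in>(UNIV::'n set). K * norm x)"
  proof (rule sum_mono)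
    fix i
    have "\<bar>(A *v x) $ i\<bar> \<le> (\<Sum>j\<in>UNIV. \<bar>A $ i $ j * x $ j\<bar>)"
      unfolding matrix_vector_mult_def by (simp add: sum_abs)
    also have "\<dots> \<le> (\<Sum>j\<in>(UNIV::'n set). K * norm x)"
      using assms[of i] component_le_norm_cart[of x] by (intro sum_mono) (auto simp: abs_mult intro!: mult_mono intro: order_trans[OF abs_ge_zero])
    finally show "\<bar>(A *v x) $ i\<bar> \<le> (\<Sum>j\<in>(UNIV::'n set). K * norm x)" .
  qed
  also have "\<dots> = (real CARD('n) * real CARD('n) * K) * norm x" by simp
  finally show ?thesis .
qed

text \<open>The coefficients are continuous inside the interval only; boundedness makes up for the
  end points.\<close>

lemma integrable_on_bounded_continuous_Ioo:
  fixes f :: "real \<Rightarrow> 'a::euclidean_space"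
  assumes "continuous_on {a<..<b} f" "\<And>x. x \<in> {a<..<b} \<Longrightarrow> norm (f x) \<le> C"
  shows "f integrable_on {a..b}"
proof -
  have "f \<in> borel_measurable (lebesgue_on {a<..<b})"
    by (rule continuous_imp_measurable_on_sets_lebesgue[OF assms(1)]) auto
  then have "f integrable_on {a<..<b}"
    by (rule measurable_bounded_by_integrable_imp_integrable[where g="\<lambda>_. C"])
      (use assms(2) in \<open>auto simp: integrable_on_Icc_iff_Ioo[symmetric]\<close>)
  then show ?thesis by (simp add: integrable_on_Icc_iff_Ioo)
qed

text \<open>
  Picard iteration for the solution \<open>\<phi>\<close>, in the unknown \<open>exp (- \<lambda> (T - t)) \<phi> t\<close>: for large \<open>\<lambda>\<close> the
  integral operator is a contraction for the supremum norm on the whole interval.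
\<close>

lemma linear_terminal_value_problem:
  fixes B :: "real \<Rightarrow> real^'n^'n" and w :: "real^'n"
  assumes T: "0 \<le> T" and Bc: "\<And>i j. continuous_on {0<..<T} (\<lambda>t. B t $ i $ j)"
    and Bb: "\<And>t i j. t \<in> {0<..<T} \<Longrightarrow> \<bar>B t $ i $ j\<bar> \<le> K"
  obtains \<phi> where "continuous_on {0..T} \<phi>" "\<phi> T = w"
    "\<And>t. t \<in> {0<..<T} \<Longrightarrow> (\<phi> has_vector_derivative - (B t *v \<phi> t)) (at t)"
proof -
  define C where "C = real CARD('n) * real CARD('n) * \<bar>K\<bar> + 1"
  have C: "C > 0" by (simp add: C_def add_nonneg_pos)
  have BC: "norm (B t *v x) \<le> C * norm x" if "t \<in> {0<..<T}" for t x
  proof -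
    have "norm (B t *v x) \<le> (real CARD('n) * real CARD('n) * \<bar>K\<bar>) * norm x"
      using Bb[OF that] by (intro norm_matrix_vector_le order_trans[OF _ abs_ge_self])
    also have "\<dots> \<le> C * norm x" by (intro mult_right_mono) (auto simp: C_def)
    finally show ?thesis .
  qed
  have Bm: "continuous_on {0<..<T} (\<lambda>t. B t *v f t)" if "continuous_on {0<..<T} f" for f :: "real \<Rightarrow> real^'n"
    unfolding matrix_vector_mult_def using that
    by (intro continuous_on_vec_lambda continuous_on_sum continuous_on_mult Bc continuous_on_component) auto
  \<comment> \<open>Twice the operator bound, so that the contraction factor comes out as
    \<open>C / l = 1/2\<close>.\<close>
  define l where "l = 2 * C"
  have l: "l > 0" using C by (simp add: l_def)
  \<comment> \<open>Clamping time to \<open>{0..T}\<close> extends all functions to bounded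
    continuous ones on the whole line, which form a complete space as a type.\<close>
  define cl where "cl t = max 0 (min T t)" for t :: real
  have cl: "cl t \<in> {0..T}" "continuous_on UNIV cl" for t using T by (auto simp: cl_def intro!: continuous_intros)
  define h where "h g u = exp (- l * u) *\<^sub>R (B u *v g u)" for g :: "real \<Rightarrow> real^'n" and u
  have hI: "h g integrable_on {a..b}" if g: "continuous_on UNIV g" "bounded (range g)" and ab: "0 \<le> a" "b \<le> T" for g a b
  proof -
    obtain G where G: "\<And>t. norm (g t) \<le> G" using g(2) by (auto simp: bounded_iff)
    have "h g integrable_on {0..T}"
    proof (rule integrable_on_bounded_continuous_Ioo)
      show "continuous_on {0<..<T} (h g)" unfolding h_def
        by (intro continuous_intros Bm continuous_on_subset[OF g(1)]) auto
      fix t assume t: "t \<in> {0<..<T}"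
      have "norm (h g t) \<le> 1 * (C * G)"
        unfolding h_def norm_scaleR using BC[OF t, of "g t"] G[of t] C l t
        by (intro mult_mono) (auto intro: order_trans mult_left_mono)
      then show "norm (h g t) \<le> C * G" by simp
    qed
    then show ?thesis by (rule integrable_on_subinterval) (use ab in auto)
  qed
  \<comment> \<open>The integral equation for \<phi>, whose right side is \<open>w\<close> plus the
    integral of \<open>B u *v \<phi> u\<close> over \<open>{t..T}\<close>, after the substitution
    \<open>\<phi> t = exp (l * (T - t)) *\<^sub>R g t\<close>.\<close>
  define Op where "Op g t = exp (- l * (T - cl t)) *\<^sub>R w + exp (l * cl t) *\<^sub>R integral {cl t..T} (h g)" for g t
  have Op: "Op g \<in> bcontfun" if g: "g \<in> bcontfun" for g
  proof -
    have "h g integrable_on {0..T}" using g by (intro hI) (auto simp: bcontfun_def)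
    then have "continuous_on {0..T} (\<lambda>t. integral {t..T} (h g))" by (rule indefinite_integral_continuous_1')
    then have 1: "continuous_on {0..T} (\<lambda>t. exp (- l * (T - t)) *\<^sub>R w + exp (l * t) *\<^sub>R integral {t..T} (h g))"
      by (intro continuous_intros)
    have "Op g = (\<lambda>t. exp (- l * (T - t)) *\<^sub>R w + exp (l * t) *\<^sub>R integral {t..T} (h g)) \<circ> cl"
      by (auto simp: Op_def)
    moreover have "continuous_on UNIV \<dots>"
      by (rule continuous_on_compose[OF cl(2)], rule continuous_on_subset[OF 1]) (use cl(1) in auto)
    moreover have "bounded (range ((\<lambda>t. exp (- l * (T - t)) *\<^sub>R w + exp (l * t) *\<^sub>R integral {t..T} (h g)) \<circ> cl))"
      by (rule bounded_subset[OF compact_imp_bounded[OF compact_continuous_image[OF 1]]]) (use cl(1) in auto)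
    ultimately show ?thesis by (simp add: bcontfun_def)
  qed
  define OpB where "OpB g = Bcontfun (Op (apply_bcontfun g))" for g
  have OpB: "apply_bcontfun (OpB g) t = Op (apply_bcontfun g) t" for g t
    unfolding OpB_def by (subst Bcontfun_inverse) (auto intro: Op apply_bcontfun)
  have bc: "continuous_on UNIV (apply_bcontfun g)" "bounded (range (apply_bcontfun g))" for g :: "real \<Rightarrow>\<^sub>C (real^'n)"
    using apply_bcontfun[of g] by (auto simp: bcontfun_def)
  have contr: "dist (OpB g) (OpB k) \<le> (1/2) * dist g k" for g k :: "real \<Rightarrow>\<^sub>C (real^'n)"
  proof (rule dist_bound)
    fix t
    define x where "x = cl t"
    have x: "0 \<le> x" "x \<le> T" using cl(1)[of t] by (auto simp: x_def)
    define d where "d = dist g k"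
    have hi: "h g integrable_on {x..T}" "h k integrable_on {x..T}" using x by (auto intro!: hI bc)
    have E1: "((\<lambda>u. C * d * exp (- l * u)) has_integral (C * d * (exp (- l * x) - exp (- l * T)) / l)) {x..T}"
    proof -
      have "((\<lambda>u. C * d * exp (- l * u)) has_integral (- C * d * exp (- l * T) / l - (- C * d * exp (- l * x) / l))) {x..T}"
        using x l by (intro fundamental_theorem_of_calculus)
          (auto intro!: derivative_eq_intros simp: has_real_derivative_iff_has_vector_derivative[symmetric])
      then show ?thesis by (simp add: diff_divide_distrib right_diff_distrib)
    qed
    have "dist (apply_bcontfun (OpB g) t) (apply_bcontfun (OpB k) t) = norm (exp (l * x) *\<^sub>R (integral {x..T} (h g) - integral {x..T} (h k)))"
      by (simp add: OpB Op_def x_def dist_norm scaleR_diff_right)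
    also have "integral {x..T} (h g) - integral {x..T} (h k) = integral {x..T} (\<lambda>u. h g u - h k u)"
      using hi by (simp add: Henstock_Kurzweil_Integration.integral_diff)
    also have "norm (exp (l * x) *\<^sub>R integral {x..T} (\<lambda>u. h g u - h k u)) = exp (l * x) * norm (integral {x<..<T} (\<lambda>u. h g u - h k u))"
      by (simp add: integral_open_interval_real)
    also have "norm (integral {x<..<T} (\<lambda>u. h g u - h k u)) \<le> integral {x<..<T} (\<lambda>u. C * d * exp (- l * u))"
    proof (rule integral_norm_bound_integral)
      show "(\<lambda>u. h g u - h k u) integrable_on {x<..<T}"
        using hi by (simp add: integrable_on_Icc_iff_Ioo[symmetric] Henstock_Kurzweil_Integration.integrable_diff)
      show "(\<lambda>u. C * d * exp (- l * u)) integrable_on {x<..<T}"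
        using has_integral_integrable[OF E1] by (simp only: integrable_on_Icc_iff_Ioo)
      fix u assume u: "u \<in> {x<..<T}"
      have "h g u - h k u = exp (- l * u) *\<^sub>R (B u *v (apply_bcontfun g u - apply_bcontfun k u))"
        by (simp add: h_def scaleR_diff_right matrix_vector_mult_diff_distrib)
      then have "norm (h g u - h k u) = exp (- l * u) * norm (B u *v (apply_bcontfun g u - apply_bcontfun k u))" by simp
      also have "\<dots> \<le> exp (- l * u) * (C * d)"
      proof (rule mult_left_mono)
        have "norm (B u *v (apply_bcontfun g u - apply_bcontfun k u)) \<le> C * norm (apply_bcontfun g u - apply_bcontfun k u)"
          using u x by (intro BC) auto
        also have "\<dots> \<le> C * d" using dist_bounded[of g u k] C by (simp add: d_def dist_norm)
        finally show "norm (B u *v (apply_bcontfun g u - apply_bcontfun k u)) \<le> C * d" .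
      qed simp
      finally show "norm (h g u - h k u) \<le> C * d * exp (- l * u)" by (simp add: mult_ac)
    qed
    also have "integral {x<..<T} (\<lambda>u. C * d * exp (- l * u)) = C * d * (exp (- l * x) - exp (- l * T)) / l"
      using integral_unique[OF E1] by (simp add: integral_open_interval_real)
    finally have "dist (apply_bcontfun (OpB g) t) (apply_bcontfun (OpB k) t) \<le> exp (l * x) * (C * d * (exp (- l * x) - exp (- l * T)) / l)"
      by simp
    also have "\<dots> \<le> exp (l * x) * (C * d * exp (- l * x) / l)"
      using C l by (intro mult_left_mono divide_right_mono) (auto simp: d_def)
    also have "\<dots> = (1/2) * d" using C by (simp add: l_def exp_minus field_simps)
    finally show "dist (apply_bcontfun (OpB g) t) (apply_bcontfun (OpB k) t) \<le> (1/2) * dist g k" by (simp add: d_def)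
  qed
  have "\<exists>!g. OpB g = g" by (rule banach_fix_type[of "1/2"]) (use contr in auto)
  then obtain g where g: "OpB g = g" by blast
  have gfix: "apply_bcontfun g t = exp (- l * (T - t)) *\<^sub>R w + exp (l * t) *\<^sub>R integral {t..T} (h g)" if "t \<in> {0..T}" for t
  proof -
    have "cl t = t" using that by (simp add: cl_def)
    then show ?thesis using OpB[of g t] by (simp add: g Op_def)
  qed
  define \<phi> where "\<phi> t = exp (l * (T - t)) *\<^sub>R apply_bcontfun g t" for t
  have hg: "h g integrable_on {0..T}" by (intro hI bc) auto
  define I where "I t = integral {0..t} (h g)" for t
  have \<phi>I: "\<phi> t = w + exp (l * T) *\<^sub>R (I T - I t)" if t: "t \<in> {0..T}" for t
  proof -
    have "I t + integral {t..T} (h g) = I T"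
      unfolding I_def using hg t by (intro Henstock_Kurzweil_Integration.integral_combine) auto
    then have "integral {t..T} (h g) = I T - I t" by (simp add: algebra_simps)
    moreover have "exp (l * (T - t)) * exp (- l * (T - t)) = 1" "exp (l * (T - t)) * exp (l * t) = exp (l * T)"
      by (simp_all add: exp_add[symmetric] algebra_simps)
    ultimately show ?thesis by (simp only: \<phi>_def gfix[OF t] scaleR_add_right scaleR_scaleR scaleR_one)
  qed
  show ?thesis
  proof (rule that[of \<phi>])
    show "continuous_on {0..T} \<phi>" unfolding \<phi>_def
      by (intro continuous_intros continuous_on_subset[OF bc(1)]) auto
    show "\<phi> T = w" using \<phi>I[of T] T by simp
    fix t assume t: "t \<in> {0<..<T}"
    have hc: "continuous_on {0<..<T} (h g)" unfolding h_def
      by (intro continuous_intros Bm continuous_on_subset[OF bc(1)]) auto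
    \<comment> \<open>The end points are declared exceptional, because \<open>h g\<close> is known
      to be continuous only between them.\<close>
    have S: "{0..T} - {0, T} = {0<..<T}" by auto
    have "(I has_vector_derivative h g t) (at t within {0..T} - {0, T})"
      unfolding I_def using hg t hc
      by (intro integral_has_vector_derivative_continuous_at) (auto simp: S continuous_on_eq_continuous_within)
    then have I': "(I has_vector_derivative h g t) (at t)" using t by (simp only: S at_within_open[OF t open_greaterThanLessThan])
    have "((\<lambda>t. w + exp (l * T) *\<^sub>R (I T - I t)) has_vector_derivative (0 + exp (l * T) *\<^sub>R (0 - h g t))) (at t)"
      by (intro has_vector_derivative_add has_vector_derivative_const has_vector_derivative_diff I'
          bounded_linear.has_vector_derivative[OF bounded_linear_scaleR_right])
    moreover have "(0 + exp (l * T) *\<^sub>R (0 - h g t)) = - (B t *v \<phi> t)"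
      by (simp add: h_def \<phi>_def exp_add[symmetric] algebra_simps matrix_vector_mult_scaleR)
    ultimately have "((\<lambda>t. w + exp (l * T) *\<^sub>R (I T - I t)) has_vector_derivative - (B t *v \<phi> t)) (at t)" by simp
    then show "(\<phi> has_vector_derivative - (B t *v \<phi> t)) (at t)"
      by (rule has_vector_derivative_transform_within_open[of _ _ _ "{0<..<T}"]) (use t in \<open>auto simp: \<phi>I\<close>)
  qed
qed

lemma set_integrable_continuous_mult:
  fixes f g :: "real \<Rightarrow> real"
  assumes f: "continuous_on {a..b} f" and g: "set_integrable lborel {a..b} g"
  shows "set_integrable lborel {a..b} (\<lambda>x. f x * g x)"
proof -
  have "compact (f ` {a..b})" by (rule compact_continuous_image[OF f]) simp
  then have "bounded (f ` {a..b})" by (rule compact_imp_bounded)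
  then obtain C where "\<forall>y\<in>f ` {a..b}. norm y \<le> C" by (metis bounded_iff)
  then show ?thesis
    using borel_measurable_continuous_on_indicator[OF _ f]
    by (intro set_integrable_bounded_mult[OF _ _ g, of _ C]) (auto simp: set_borel_measurable_def)
qed

section \<open>The Feynman-Kac formula and the positivity of state probabilities\<close>

context markov_chain
begin

lemma mass_start:
  assumes "0 \<le> s" "s \<le> T"
  shows "mass c s V k s = expectation (\<lambda>\<omega>. V \<omega> * X s \<omega> $ k)"
  unfolding mass_def by (intro Bochner_Integration.integral_cong refl) (use assms in \<open>simp add: discount_self\<close>)

text \<open>The pairing of the forward and the backward equation is constant.\<close>

lemma feynman_kac:
  fixes K :: real
  assumes gen: "\<And>u. 0 < u \<Longrightarrow> u < T \<Longrightarrow> has_generator_at M X A u"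
    and \<phi>: "continuous_on {0..T} \<phi>" "\<phi> T = (\<chi> i. 1)"
      "\<And>u i. 0 < u \<Longrightarrow> u < T \<Longrightarrow> ((\<lambda>t. \<phi> t $ i) has_real_derivative c $ i * \<phi> u $ i - (\<Sum>j\<in>UNIV. A u $ i $ j * \<phi> u $ j)) (at u)"
    and s: "0 \<le> s" "s \<le> T" and V: "V \<in> borel_measurable (F s)" "\<And>\<omega>. \<omega> \<in> space M \<Longrightarrow> \<bar>V \<omega>\<bar> \<le> K"
  shows "expectation (\<lambda>\<omega>. V \<omega> * discount c s T \<omega>) = expectation (\<lambda>\<omega>. V \<omega> * (\<phi> s \<bullet> X s \<omega>))"
proof -
  define \<Psi> where "\<Psi> u = (\<Sum>k\<in>UNIV. mass c s V k u * \<phi> u $ k)" for u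
  have VM: "V \<in> borel_measurable M" using measurable_F_M[OF V(1)] s by simp
  have "\<Psi> T - \<Psi> s = (LBINT x:{s..T}. 0)"
  proof (rule right_deriv_eq_integral[OF s(2)])
    have "continuous_on {s..T} \<phi>" by (rule continuous_on_subset[OF \<phi>(1)]) (use s in auto)
    then show "continuous_on {s..T} \<Psi>" unfolding \<Psi>_def
      by (intro continuous_on_sum continuous_on_mult continuous_on_mass[OF s V] continuous_on_component)
    fix u assume u: "s < u" "u < T"
    let ?m = "\<lambda>k. mass c s V k u"
    have m: "(mass c s V k has_real_derivative (\<Sum>l\<in>UNIV. ?m l * A u $ l $ k) - c $ k * ?m k) (at_right u)" for k
      using u s by (intro mass_right_derivative[OF s V] gen) auto
    have f: "((\<lambda>t. \<phi> t $ k) has_real_derivative c $ k * \<phi> u $ k - (\<Sum>j\<in>UNIV. A u $ k $ j * \<phi> u $ j)) (at_right u)" for k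
      by (rule DERIV_subset[OF \<phi>(3)]) (use u s in auto)
    have "(\<Psi> has_real_derivative (\<Sum>k\<in>UNIV. ((\<Sum>l\<in>UNIV. ?m l * A u $ l $ k) - c $ k * ?m k) * \<phi> u $ k
        + (c $ k * \<phi> u $ k - (\<Sum>j\<in>UNIV. A u $ k $ j * \<phi> u $ j)) * ?m k)) (at_right u)"
      unfolding \<Psi>_def by (intro DERIV_sum DERIV_mult m f)
    \<comment> \<open>The discount rates cancel. The generator acts on the masses from one side and
      on \<phi> from the other with opposite sign, so exchanging the two sums leaves zero.\<close>
    moreover have "(\<Sum>k\<in>UNIV. ((\<Sum>l\<in>UNIV. ?m l * A u $ l $ k) - c $ k * ?m k) * \<phi> u $ k
        + (c $ k * \<phi> u $ k - (\<Sum>j\<in>UNIV. A u $ k $ j * \<phi> u $ j)) * ?m k) = 0"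
    proof -
      have "(\<Sum>k\<in>UNIV. ((\<Sum>l\<in>UNIV. ?m l * A u $ l $ k) - c $ k * ?m k) * \<phi> u $ k
        + (c $ k * \<phi> u $ k - (\<Sum>j\<in>UNIV. A u $ k $ j * \<phi> u $ j)) * ?m k) =
        (\<Sum>k\<in>UNIV. (\<Sum>l\<in>UNIV. ?m l * A u $ l $ k * \<phi> u $ k) - (\<Sum>j\<in>UNIV. ?m k * A u $ k $ j * \<phi> u $ j))"
        by (intro sum.cong refl) (simp add: algebra_simps sum_distrib_left sum_distrib_right)
      also have "\<dots> = (\<Sum>k\<in>UNIV. \<Sum>l\<in>UNIV. ?m l * A u $ l $ k * \<phi> u $ k) - (\<Sum>k\<in>UNIV. \<Sum>j\<in>UNIV. ?m k * A u $ k $ j * \<phi> u $ j)"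
        by (rule sum_subtractf)
      also have "(\<Sum>k\<in>UNIV. \<Sum>l\<in>UNIV. ?m l * A u $ l $ k * \<phi> u $ k) = (\<Sum>k\<in>UNIV. \<Sum>j\<in>UNIV. ?m k * A u $ k $ j * \<phi> u $ j)"
        by (rule sum.swap)
      finally show ?thesis by simp
    qed
    ultimately show "(\<Psi> has_real_derivative 0) (at_right u)" by simp
  qed (simp add: set_integrable_def)
  then have eq: "\<Psi> T = \<Psi> s" by simp
  have sT: "s \<in> {0..T}" "T \<in> {0..T}" using s T by auto
  have i: "integrable M (\<lambda>\<omega>. V \<omega> * discount c s T \<omega> * X T \<omega> $ k)" for k
    by (rule integrable_bounded_mult_X[OF measurable_F_M[OF discounted_V(1)[OF s V]] discounted_V(2)[OF s V]]) (use s T in auto)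
  have i2: "integrable M (\<lambda>\<omega>. V \<omega> * X s \<omega> $ k)" for k
    using integrable_bounded_mult_X[OF VM V(2) sT(1)] by simp
  \<comment> \<open>At \<open>T\<close> the vector of ones adds the masses of all states, leaving
    the whole discount factor; at \<open>s\<close> nothing has been discounted yet.\<close>
  have "\<Psi> T = expectation (\<lambda>\<omega>. \<Sum>k\<in>UNIV. V \<omega> * discount c s T \<omega> * X T \<omega> $ k)"
    using i by (simp add: \<Psi>_def \<phi>(2) mass_def Bochner_Integration.integral_sum)
  also have "\<dots> = expectation (\<lambda>\<omega>. V \<omega> * discount c s T \<omega>)"
    by (intro Bochner_Integration.integral_cong refl) (simp add: sum_distrib_left[symmetric] sum_X_nth[OF _ sT(2)])
  finally have 1: "\<Psi> T = expectation (\<lambda>\<omega>. V \<omega> * discount c s T \<omega>)" .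
  have "\<Psi> s = (\<Sum>k\<in>UNIV. expectation (\<lambda>\<omega>. V \<omega> * X s \<omega> $ k * \<phi> s $ k))"
    using i2 by (simp add: \<Psi>_def mass_start[OF s])
  also have "\<dots> = expectation (\<lambda>\<omega>. \<Sum>k\<in>UNIV. V \<omega> * X s \<omega> $ k * \<phi> s $ k)"
    using i2 by (intro Bochner_Integration.integral_sum[symmetric]) simp
  also have "\<dots> = expectation (\<lambda>\<omega>. V \<omega> * (\<phi> s \<bullet> X s \<omega>))"
    by (intro Bochner_Integration.integral_cong refl) (simp add: inner_vec_def sum_distrib_left mult_ac)
  finally show ?thesis using 1 eq by simp
qed

text \<open>The probability \<open>q\<close> of state \<open>i\<close> has right derivative at least
  \<open>m * (1 - q) - C * q = m - r * q\<close> with \<open>r = m + C\<close>, so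
  \<open>(m / r - q) * exp (r * u)\<close> does not increase. Even if \<open>q\<close> starts at
  \<open>0\<close>, this makes it positive at every later time.\<close>

lemma state_prob_pos:
  assumes gen: "\<And>u. 0 < u \<Longrightarrow> u < T \<Longrightarrow> has_generator_at M X A u"
    and lo: "\<And>u i j. i \<noteq> j \<Longrightarrow> 0 < u \<Longrightarrow> u < T \<Longrightarrow> m \<le> A u $ i $ j" and m: "m > 0"
    and dg: "\<And>u i. 0 < u \<Longrightarrow> u < T \<Longrightarrow> - C \<le> A u $ i $ i" and C: "C \<ge> 0"
    and t: "0 < t" "t \<le> T"
  shows "\<P>(\<omega> in M. X t \<omega> = state i) > 0"
proof -
  define q where "q k u = mass 0 0 (\<lambda>_. 1) k u" for k u
  have q: "q k u = \<P>(\<omega> in M. X u \<omega> = state k)" if "u \<in> {0..T}" for k u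
    unfolding prob_state_eq[OF that] q_def mass_def discount_def by simp
  have q1: "(\<Sum>k\<in>UNIV. q k u) = 1" if u: "u \<in> {0..T}" for u
  proof -
    have "integrable M (\<lambda>\<omega>. 1 * X u \<omega> $ k)" for k by (rule integrable_bounded_mult_X[of _ 1]) (use u in auto)
    then have "(\<Sum>k\<in>UNIV. q k u) = expectation (\<lambda>\<omega>. \<Sum>k\<in>UNIV. X u \<omega> $ k)"
      by (simp add: q[OF u] prob_state_eq[OF u] Bochner_Integration.integral_sum)
    also have "\<dots> = expectation (\<lambda>\<omega>. 1)" by (intro Bochner_Integration.integral_cong refl) (simp add: sum_X_nth[OF _ u])
    finally show ?thesis by (simp add: prob_space)
  qed
  have s: "0 \<le> (0::real)" "0 \<le> T" using T by auto
  have V: "(\<lambda>_. 1::real) \<in> borel_measurable (F 0)" "\<And>\<omega>. \<omega> \<in> space M \<Longrightarrow> \<bar>1::real\<bar> \<le> 1" by auto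
  define r where "r = m + C"
  have r: "r > 0" using m C by (simp add: r_def)
  define G where "G u = (m / r - q i u) * exp (r * u)" for u
  have "G t - G 0 \<le> (LBINT x:{0..t}. 0)"
  proof (rule right_deriv_le_integral)
    show "continuous_on {0..t} G" unfolding G_def q_def
      by (intro continuous_intros continuous_on_subset[OF continuous_on_mass[OF s V]]) (use t in auto)
    fix u assume u: "0 < u" "u < t"
    let ?D = "(\<Sum>k\<in>UNIV. q k u * A u $ k $ i) - 0 $ i * q i u"
    have d: "(q i has_real_derivative ?D) (at_right u)"
      unfolding q_def using u t by (intro mass_right_derivative[OF s V] gen) auto
    have "(G has_real_derivative (0 - ?D) * exp (r * u) + exp (r * u) * (r * 1) * (m / r - q i u)) (at_right u)"
      unfolding G_def
      by (rule DERIV_mult[OF DERIV_diff[OF DERIV_const d]]) (auto intro!: derivative_eq_intros)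
    moreover have "(0 - ?D) * exp (r * u) + exp (r * u) * (r * 1) * (m / r - q i u) \<le> 0"
    proof -
      have uT: "u \<in> {0..T}" using u t by auto
      have q0: "q k u \<ge> 0" for k by (simp add: q[OF uT])
      have "m * (1 - q i u) - C * q i u \<le> (\<Sum>k\<in>UNIV. q k u * A u $ k $ i)"
      proof -
        have "(\<Sum>k\<in>UNIV. q k u * A u $ k $ i) = q i u * A u $ i $ i + (\<Sum>k\<in>UNIV - {i}. q k u * A u $ k $ i)"
          by (rule sum.remove) auto
        moreover have "(\<Sum>k\<in>UNIV - {i}. q k u * A u $ k $ i) \<ge> (\<Sum>k\<in>UNIV - {i}. q k u * m)"
          using lo u t q0 by (intro sum_mono mult_left_mono) auto
        moreover have "(\<Sum>k\<in>UNIV - {i}. q k u * m) = m * (1 - q i u)"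
          using q1[OF uT] sum.remove[of UNIV i "\<lambda>k. q k u"] by (simp add: sum_distrib_right[symmetric])
        moreover have "q i u * A u $ i $ i \<ge> q i u * (- C)" using dg[of u i] u t q0 by (intro mult_left_mono) auto
        ultimately show ?thesis by (simp add: mult.commute)
      qed
      then have "r * (m / r - q i u) \<le> ?D" using r by (simp add: right_diff_distrib) (simp add: r_def algebra_simps)
      then have "exp (r * u) * (r * (m / r - q i u)) \<le> exp (r * u) * ?D" by (intro mult_left_mono) auto
      moreover have "(0 - d) * e + e * (r * 1) * y = e * (r * y) - e * d" for d e y :: real by (simp add: algebra_simps)
      ultimately show ?thesis by (simp only: diff_le_0_iff_le)
    qed
    ultimately show "\<exists>D\<le>0. (G has_real_derivative D) (at_right u)" by blast
  qed (use t in \<open>auto simp: set_integrable_def\<close>)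
  then have "G t \<le> G 0" by simp
  also have "\<dots> \<le> m / r" using q[of 0 i] T by (simp add: G_def)
  finally have "(m / r - q i t) * exp (r * t) \<le> m / r" by (simp add: G_def)
  moreover have "(m / r) * exp (r * t) > (m / r) * 1"
    using m r t by (intro mult_strict_left_mono) auto
  ultimately have "q i t * exp (r * t) > 0" by (simp add: left_diff_distrib)
  then have "q i t > 0" by (simp add: zero_less_mult_iff)
  then show ?thesis using q[of t i] t by simp
qed

end

section \<open>The martingale of the chain\<close>

lemma martingaleI:
  assumes "prob_space M" and sub: "\<And>t. 0 \<le> t \<Longrightarrow> subalgebra M (F t)"
    and ad: "\<And>t. 0 \<le> t \<Longrightarrow> Y t \<in> borel_measurable (F t)" and int: "\<And>t. 0 \<le> t \<Longrightarrow> integrable M (Y t)"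
    and eq: "\<And>s t B. 0 \<le> s \<Longrightarrow> s \<le> t \<Longrightarrow> B \<in> sets (F s) \<Longrightarrow>
      (\<integral>\<omega>. indicator B \<omega> * Y t \<omega> \<partial>M) = (\<integral>\<omega>. indicator B \<omega> * Y s \<omega> \<partial>M)"
  shows "martingale M F Y"
  unfolding martingale_def adapted_on_def
proof (intro conjI ballI allI impI)
  interpret prob_space M by fact
  fix s t :: real assume st: "0 \<le> s" "s \<le> t"
  interpret finite_measure_subalgebra M "F s" by unfold_locales (rule sub[OF st(1)])
  show "AE \<omega> in M. real_cond_exp M (F s) (Y t) \<omega> = Y s \<omega>"
    by (rule real_cond_exp_charact) (use st in \<open>auto intro!: int ad eq simp: set_lebesgue_integral_def\<close>)
qed (auto intro: ad int)

lemma markov_chain_on_subset: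
  assumes "markov_chain_on M F I X" "K \<subseteq> I"
  shows "markov_chain_on M F K X"
proof -
  have "((\<lambda>s. \<P>(\<omega> in M. X s \<omega> \<noteq> X t \<omega>)) \<longlongrightarrow> 0) (at t within K)" if "t \<in> K" for t
    using assms that unfolding markov_chain_on_def by (intro tendsto_within_subset[OF _ assms(2)]) blast
  then show ?thesis
    using assms unfolding markov_chain_on_def adapted_on_def by (auto intro: cadlag_on_subset) blast+
qed

section \<open>The compensated chain in coordinates\<close>

context markov_chain
begin

lemma continuous_on_discount:
  assumes \<omega>: "\<omega> \<in> space M" and s: "0 \<le> s"
  shows "continuous_on {s..T} (\<lambda>u. discount c s u \<omega>)"
proof -
  have "(\<lambda>w. c \<bullet> X w \<omega>) integrable_on {s..T}"
    using set_borel_integral_eq_integral[OF inner_path_integrable[OF \<omega> s order_refl]] by auto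
  then have "continuous_on {s..T} (\<lambda>u. exp (- integral {s..u} (\<lambda>w. c \<bullet> X w \<omega>)))"
    by (intro continuous_intros indefinite_integral_continuous_1)
  also have "?this \<longleftrightarrow> continuous_on {s..T} (\<lambda>u. discount c s u \<omega>)"
    using set_borel_integral_eq_integral(2)[OF inner_path_integrable[OF \<omega> s]]
    by (intro continuous_on_cong refl) (simp add: discount_def)
  finally show ?thesis .
qed

text \<open>Local constancy to the right of \<open>u\<close> reduces the path to a single
  exponential, multiplied by the discount accumulated up to \<open>u\<close>.\<close>

lemma discount_right_derivative:
  assumes \<omega>: "\<omega> \<in> space M" and u: "0 \<le> s" "s \<le> u" "u < T"
  shows "((\<lambda>v. discount c s v \<omega>) has_real_derivative (- (c \<bullet> X u \<omega>) * discount c s u \<omega>)) (at_right u)"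
proof -
  have u': "u \<in> {0..T}" using u by simp
  define y where "y = c \<bullet> X u \<omega>"
  obtain d where d: "d > 0" "\<And>s. s \<in> {0..T} \<Longrightarrow> u \<le> s \<Longrightarrow> s < u + d \<Longrightarrow> X s \<omega> = X u \<omega>"
    using state_path_local[OF X_cadlag[OF \<omega>] X_range[OF \<omega>] u'] by metis
  have "((\<lambda>v. discount c s u \<omega> * exp (- ((v - u) * y))) has_real_derivative (- y * discount c s u \<omega>)) (at_right u)"
    by (auto intro!: derivative_eq_intros)
  then have "((\<lambda>v. (discount c s u \<omega> * exp (- ((v - u) * y)) - discount c s u \<omega>) / (v - u)) \<longlongrightarrow> - y * discount c s u \<omega>) (at_right u)"
    by (simp add: has_field_derivative_iff)
  moreover have "eventually (\<lambda>v. (discount c s u \<omega> * exp (- ((v - u) * y)) - discount c s u \<omega>) / (v - u)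
      = (discount c s v \<omega> - discount c s u \<omega>) / (v - u)) (at_right u)"
  proof (rule eventually_at_rightI[of u "min T (u + d)"])
    fix v assume v: "v \<in> {u<..<min T (u + d)}"
    have "(LBINT w:{u..v}. c \<bullet> X w \<omega>) = (LBINT w:{u..v}. y)"
    proof (intro set_lebesgue_integral_cong allI impI)
      fix w assume "w \<in> {u..v}"
      then have "X w \<omega> = X u \<omega>" using v u by (intro d(2)) auto
      then show "c \<bullet> X w \<omega> = y" by (simp only: y_def)
    qed simp
    also have "\<dots> = (v - u) * y" using v by (simp add: set_lebesgue_integral_def)
    finally have "discount c u v \<omega> = exp (- ((v - u) * y))" by (simp only: discount_def)
    moreover have "discount c s v \<omega> = discount c s u \<omega> * discount c u v \<omega>"
      using u v by (intro discount_split \<omega>) auto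
    ultimately show "(discount c s u \<omega> * exp (- ((v - u) * y)) - discount c s u \<omega>) / (v - u)
      = (discount c s v \<omega> - discount c s u \<omega>) / (v - u)" by (simp only:)
  qed (use u d in auto)
  ultimately have "((\<lambda>v. (discount c s v \<omega> - discount c s u \<omega>) / (v - u)) \<longlongrightarrow> - y * discount c s u \<omega>) (at_right u)"
    by (rule Lim_transform_eventually)
  then show ?thesis by (simp add: has_field_derivative_iff y_def)
qed

context
  fixes A :: "real \<Rightarrow> real^'n^'n"
  assumes Ai: "\<And>i j. set_integrable lborel {0..T} (\<lambda>u. A u $ i $ j)"
begin

lemma A_sub: "0 \<le> a \<Longrightarrow> b \<le> T \<Longrightarrow> set_integrable lborel {a..b} (\<lambda>u. A u $ i $ j)"
  by (rule set_integrable_subset[OF Ai]) auto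

lemma A_meas: "0 \<le> a \<Longrightarrow> b \<le> T \<Longrightarrow> set_borel_measurable borel {a..b} (\<lambda>u. A u $ i $ j)"
  using A_sub[of a b i j] by (auto simp: set_integrable_def set_borel_measurable_def dest: borel_measurable_integrable)

lemma chain_drift_integrable:
  assumes "t \<le> T" "\<omega> \<in> space M"
  shows "set_integrable lborel {0..t} (\<lambda>u. A u $ k $ i * X u \<omega> $ k)"
proof -
  interpret bounded_right_continuous_process M "\<lambda>u \<omega>. X u \<omega> $ k" T
    by (rule brcp_M) (use T in simp)
  show ?thesis by (rule path_integrable) (use assms A_sub in auto)
qed

text \<open>Coordinate \<open>i\<close> of the transposed generator applied to the state collects
  the rates into \<open>i\<close>. Coordinates may be taken under the vector integral only once the
  vector integrand is known to be integrable.\<close>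

lemma chain_mart_nth:
  assumes t: "t \<in> {0..T}" and \<omega>: "\<omega> \<in> space M"
  shows "chain_mart X A t \<omega> $ i = X t \<omega> $ i - X 0 \<omega> $ i - (\<Sum>k\<in>UNIV. LBINT u:{0..t}. A u $ k $ i * X u \<omega> $ k)"
proof -
  have i: "set_integrable lborel {0..t} (\<lambda>u. A u $ k $ i * X u \<omega> $ k)" for k i
    using t \<omega> by (intro chain_drift_integrable) auto
  have comp: "(transpose (A u) *v X u \<omega>) $ i = (\<Sum>k\<in>UNIV. A u $ k $ i * X u \<omega> $ k)" for u i
    unfolding matrix_vector_mult_def transpose_def by simp
  have comp': "(X u \<omega> v* A u) $ i = (\<Sum>k\<in>UNIV. A u $ k $ i * X u \<omega> $ k)" for u i
    using comp[of u i] by simp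
  \<comment> \<open>Integrability of the vector integrand is assembled from its coordinates along
    the basis vectors.\<close>
  have "integrable lborel (\<lambda>u. \<Sum>i\<in>UNIV. (indicator {0..t} u * (\<Sum>k\<in>UNIV. A u $ k $ i * X u \<omega> $ k)) *\<^sub>R axis i (1::real))"
    using set_integral_finite_sum(1)[where I=UNIV, OF i]
    by (intro Bochner_Integration.integrable_sum integrable_scaleR_left) (simp add: set_integrable_def)
  also have "(\<lambda>u. \<Sum>i\<in>UNIV. (indicator {0..t} u * (\<Sum>k\<in>UNIV. A u $ k $ i * X u \<omega> $ k)) *\<^sub>R axis i (1::real))
      = (\<lambda>u. indicator {0..t} u *\<^sub>R (transpose (A u) *v X u \<omega>))"
    by (simp add: fun_eq_iff vec_eq_iff comp' axis_def if_distrib[of "\<lambda>x. _ * x"] cong: if_cong)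
  finally have "(LBINT u:{0..t}. transpose (A u) *v X u \<omega>) $ i = (LBINT u. (indicator {0..t} u *\<^sub>R (transpose (A u) *v X u \<omega>)) $ i)"
    unfolding set_lebesgue_integral_def by (rule integral_bounded_linear[OF bounded_linear_vec_nth, symmetric])
  also have "\<dots> = (LBINT u:{0..t}. \<Sum>k\<in>UNIV. A u $ k $ i * X u \<omega> $ k)"
    by (simp add: set_lebesgue_integral_def comp')
  also have "\<dots> = (\<Sum>k\<in>UNIV. LBINT u:{0..t}. A u $ k $ i * X u \<omega> $ k)"
    using i by (rule set_integral_finite_sum)
  finally show ?thesis by (simp add: chain_mart_def)
qed

lemma chain_mart_measurable:
  assumes t: "t \<in> {0..T}"
  shows "(\<lambda>\<omega>. chain_mart X A t \<omega> $ i) \<in> borel_measurable (F t)"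
proof -
  interpret b: bounded_right_continuous_process "F t" "\<lambda>u \<omega>. X u \<omega> $ k" t for k
    by (rule brcp[OF t])
  have "(\<lambda>\<omega>. X 0 \<omega> $ i) \<in> borel_measurable (F t)" using measurable_F_mono[OF X_nth_meas, of 0 t] t by simp
  then have "(\<lambda>\<omega>. X t \<omega> $ i - X 0 \<omega> $ i - (\<Sum>k\<in>UNIV. LBINT u:{0..t}. A u $ k $ i * X u \<omega> $ k)) \<in> borel_measurable (F t)"
    using t by (intro borel_measurable_diff borel_measurable_sum b.measurable_time_integral A_meas X_nth_meas) auto
  then show ?thesis
    by (rule measurable_cong[THEN iffD1, rotated]) (simp only: space_F[OF t] chain_mart_nth[OF t])
qed

lemma expectation_chain_mart:
  fixes K :: real
  assumes t: "t \<in> {0..T}" and V: "V \<in> borel_measurable M" "\<And>\<omega>. \<omega> \<in> space M \<Longrightarrow> \<bar>V \<omega>\<bar> \<le> K"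
  shows "integrable M (\<lambda>\<omega>. V \<omega> * chain_mart X A t \<omega> $ i)"
    "expectation (\<lambda>\<omega>. V \<omega> * chain_mart X A t \<omega> $ i) = expectation (\<lambda>\<omega>. V \<omega> * X t \<omega> $ i) - expectation (\<lambda>\<omega>. V \<omega> * X 0 \<omega> $ i)
      - (\<Sum>k\<in>UNIV. LBINT u:{0..t}. A u $ k $ i * expectation (\<lambda>\<omega>. V \<omega> * X u \<omega> $ k))"
proof -
  interpret b: bounded_right_continuous_process M "\<lambda>u \<omega>. X u \<omega> $ k" t for k
    by (rule brcp_M[OF t])
  have t0: "0 \<in> {0..T}" using T by simp
  have At: "set_integrable lborel {0..t} (\<lambda>u. A u $ k $ i)" for k using t by (intro A_sub) auto
  note Fub = b.Fubini_time_integral[OF prob_space_axioms At order_refl order_refl V]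
  have iX: "integrable M (\<lambda>\<omega>. V \<omega> * X t \<omega> $ i)" "integrable M (\<lambda>\<omega>. V \<omega> * X 0 \<omega> $ i)"
    using integrable_bounded_mult_X[OF V t] integrable_bounded_mult_X[OF V t0] by auto
  have iS: "integrable M (\<lambda>\<omega>. \<Sum>k\<in>UNIV. V \<omega> * (LBINT u:{0..t}. A u $ k $ i * X u \<omega> $ k))"
    by (intro Bochner_Integration.integrable_sum Fub)
  have eq: "V \<omega> * chain_mart X A t \<omega> $ i = V \<omega> * X t \<omega> $ i - V \<omega> * X 0 \<omega> $ i - (\<Sum>k\<in>UNIV. V \<omega> * (LBINT u:{0..t}. A u $ k $ i * X u \<omega> $ k))"
    if "\<omega> \<in> space M" for \<omega>
    unfolding chain_mart_nth[OF t that] by (simp add: right_diff_distrib sum_distrib_left)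
  have "integrable M (\<lambda>\<omega>. V \<omega> * X t \<omega> $ i - V \<omega> * X 0 \<omega> $ i - (\<Sum>k\<in>UNIV. V \<omega> * (LBINT u:{0..t}. A u $ k $ i * X u \<omega> $ k)))"
    by (intro Bochner_Integration.integrable_diff iX iS)
  then show "integrable M (\<lambda>\<omega>. V \<omega> * chain_mart X A t \<omega> $ i)"
    by (rule Bochner_Integration.integrable_cong[THEN iffD2, rotated 2]) (simp_all add: eq)
  have "expectation (\<lambda>\<omega>. V \<omega> * chain_mart X A t \<omega> $ i) =
    expectation (\<lambda>\<omega>. V \<omega> * X t \<omega> $ i - V \<omega> * X 0 \<omega> $ i - (\<Sum>k\<in>UNIV. V \<omega> * (LBINT u:{0..t}. A u $ k $ i * X u \<omega> $ k)))"
    by (intro Bochner_Integration.integral_cong) (simp_all add: eq)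
  also have "\<dots> = expectation (\<lambda>\<omega>. V \<omega> * X t \<omega> $ i) - expectation (\<lambda>\<omega>. V \<omega> * X 0 \<omega> $ i)
     - expectation (\<lambda>\<omega>. \<Sum>k\<in>UNIV. V \<omega> * (LBINT u:{0..t}. A u $ k $ i * X u \<omega> $ k))"
    using iX iS by simp
  also have "expectation (\<lambda>\<omega>. \<Sum>k\<in>UNIV. V \<omega> * (LBINT u:{0..t}. A u $ k $ i * X u \<omega> $ k)) =
    (\<Sum>k\<in>UNIV. LBINT u:{0..t}. A u $ k $ i * expectation (\<lambda>\<omega>. V \<omega> * X u \<omega> $ k))"
    by (subst Bochner_Integration.integral_sum) (use Fub in auto)
  finally show "expectation (\<lambda>\<omega>. V \<omega> * chain_mart X A t \<omega> $ i) = expectation (\<lambda>\<omega>. V \<omega> * X t \<omega> $ i) - expectation (\<lambda>\<omega>. V \<omega> * X 0 \<omega> $ i)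
      - (\<Sum>k\<in>UNIV. LBINT u:{0..t}. A u $ k $ i * expectation (\<lambda>\<omega>. V \<omega> * X u \<omega> $ k))" .
qed

text \<open>For a test variable known at \<open>s\<close> the undiscounted masses obey the forward
  equation from \<open>s\<close> on, and its integrated right side is the mean increment of the
  compensator. Since \<open>A\<close> is only integrable in time, this relies on a fundamental
  theorem that accepts merely integrable right derivatives.\<close>

lemma expectation_chain_mart_increment:
  fixes K :: real
  assumes gen: "\<And>u. 0 < u \<Longrightarrow> u < T \<Longrightarrow> has_generator_at M X A u"
    and st: "0 \<le> s" "s \<le> t" "t \<le> T"
    and V: "V \<in> borel_measurable (F s)" "\<And>\<omega>. \<omega> \<in> space M \<Longrightarrow> \<bar>V \<omega>\<bar> \<le> K"
  shows "expectation (\<lambda>\<omega>. V \<omega> * chain_mart X A t \<omega> $ i) = expectation (\<lambda>\<omega>. V \<omega> * chain_mart X A s \<omega> $ i)"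
proof -
  have s: "0 \<le> s" "s \<le> T" and sT: "s \<in> {0..T}" and tT: "t \<in> {0..T}" using st by auto
  have VM: "V \<in> borel_measurable M" using measurable_F_M[OF V(1) sT] .
  interpret b: bounded_right_continuous_process M "\<lambda>u \<omega>. X u \<omega> $ k" t for k
    by (rule brcp_M[OF tT])
  define q where "q k u = expectation (\<lambda>\<omega>. V \<omega> * X u \<omega> $ k)" for k u
  have qm: "q k u = mass 0 s V k u" for k u by (simp add: q_def mass_def discount_def)
  have qi: "set_integrable lborel {a..b} (\<lambda>u. A u $ k $ i * q k u)" if "0 \<le> a" "b \<le> t" for a b k
    unfolding q_def using that st by (intro b.Fubini_time_integral[OF prob_space_axioms _ _ _ VM V(2)] A_sub) auto
  have qs: "(LBINT u:{0..t}. A u $ k $ i * q k u) - (LBINT u:{0..s}. A u $ k $ i * q k u) = (LBINT u:{s..t}. A u $ k $ i * q k u)" for k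
    using set_integral_Icc_split[OF qi[of 0 t k], of s] st by simp
  have "q i t - q i s = (LBINT u:{s..t}. \<Sum>k\<in>UNIV. A u $ k $ i * q k u)"
  proof (rule right_deriv_eq_integral[OF st(2)])
    show "continuous_on {s..t} (q i)" unfolding qm
      by (rule continuous_on_subset[OF continuous_on_mass[OF s V]]) (use st in auto)
    show "set_integrable lborel {s..t} (\<lambda>u. \<Sum>k\<in>UNIV. A u $ k $ i * q k u)"
      using st by (intro set_integral_finite_sum qi) auto
    fix u assume u: "s < u" "u < t"
    have "(mass 0 s V i has_real_derivative (\<Sum>k\<in>UNIV. mass 0 s V k u * A u $ k $ i) - 0 $ i * mass 0 s V i u) (at_right u)"
      using u st by (intro mass_right_derivative[OF s V] gen) auto
    then show "(q i has_real_derivative (\<Sum>k\<in>UNIV. A u $ k $ i * q k u)) (at_right u)"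
      unfolding qm by (simp add: mult.commute)
  qed
  also have "\<dots> = (\<Sum>k\<in>UNIV. LBINT u:{s..t}. A u $ k $ i * q k u)"
    using st by (intro set_integral_finite_sum qi) auto
  also have "\<dots> = (\<Sum>k\<in>UNIV. LBINT u:{0..t}. A u $ k $ i * q k u) - (\<Sum>k\<in>UNIV. LBINT u:{0..s}. A u $ k $ i * q k u)"
    unfolding qs[symmetric] by (rule sum_subtractf)
  finally show ?thesis
    using expectation_chain_mart(2)[OF tT VM V(2), of i] expectation_chain_mart(2)[OF sT VM V(2), of i]
    unfolding q_def by simp
qed

end

end

lemma markov_chain_restrict:
  assumes "prob_space P" "usual_filtration P F" "markov_chain_on P F {0..} X" "T > 0"
  shows "markov_chain P F X T"
proof -
  have "{0..T} \<subseteq> {0..}" by auto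
  note mc = markov_chain_on_subset[OF assms(3) this]
  have "\<forall>t\<ge>0. subalgebra P (F t)" "\<forall>s t. 0 \<le> s \<longrightarrow> s \<le> t \<longrightarrow> sets (F s) \<subseteq> sets (F t)"
    using assms(2)[unfolded usual_filtration_def] by (rule conjunct1) (rule conjunct1[OF conjunct2[OF assms(2)[unfolded usual_filtration_def]]])
  with assms(1,4) mc show ?thesis
    unfolding markov_chain_def markov_chain_axioms_def by auto
qed

lemma martingale_chain_mart:
  assumes P: "prob_space P" "usual_filtration P F" "markov_chain_on P F {0..} X"
    and A: "generator_matrices A" "\<And>t. 0 \<le> t \<Longrightarrow> has_generator_at P X A t"
  shows "martingale P F (\<lambda>t \<omega>. chain_mart X A t \<omega> $ i)"
proof (rule martingaleI[OF P(1)])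
  interpret prob_space P by fact
  \<comment> \<open>The horizon \<open>t + 1\<close> is positive also for
    \<open>t = 0\<close>.\<close>
  have mc: "markov_chain P F X (t + 1)" and Ai: "set_integrable lborel {0..t + 1} (\<lambda>u. A u $ i $ j)" if "t \<ge> 0" for t :: real and i j
    using that A(1) markov_chain_restrict[OF P, of "t+1"] by (auto simp: generator_matrices_def)
  fix t :: real assume t: "0 \<le> t"
  show "subalgebra P (F t)" using P(2) t by (auto simp: usual_filtration_def)
  show "(\<lambda>\<omega>. chain_mart X A t \<omega> $ i) \<in> borel_measurable (F t)"
    by (rule markov_chain.chain_mart_measurable[OF mc[OF t] Ai[OF t]]) (use t in auto)
  have "integrable P (\<lambda>\<omega>. 1 * chain_mart X A t \<omega> $ i)"
    by (rule markov_chain.expectation_chain_mart(1)[OF mc[OF t] Ai[OF t], where K=1]) (use t in auto)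
  then show "integrable P (\<lambda>\<omega>. chain_mart X A t \<omega> $ i)" by simp
next
  fix s t :: real and B assume st: "0 \<le> s" "s \<le> t" and B: "B \<in> sets (F s)"
  then have t: "0 \<le> t" by simp
  have mc: "markov_chain P F X (t + 1)" and Ai: "set_integrable lborel {0..t + 1} (\<lambda>u. A u $ i $ j)" for i j
    using t A(1) markov_chain_restrict[OF P, of "t+1"] by (auto simp: generator_matrices_def)
  show "(\<integral>\<omega>. indicator B \<omega> * chain_mart X A t \<omega> $ i \<partial>P) = (\<integral>\<omega>. indicator B \<omega> * chain_mart X A s \<omega> $ i \<partial>P)"
    by (rule markov_chain.expectation_chain_mart_increment[OF mc Ai, where K=1])
      (use st B A(2) in \<open>auto simp: indicator_def\<close>)
qed

section \<open>The martingale of the default time\<close>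

locale default_model = prob_space P for P :: "'a measure" +
  fixes F :: "real \<Rightarrow> 'a measure" and X :: "real \<Rightarrow> 'a \<Rightarrow> real^'n" and h :: "real^'n" and Z :: "'a \<Rightarrow> real"
  assumes filt: "usual_filtration P F" and chain: "markov_chain_on P F {0..} X"
    and h_pos: "\<And>i. h $ i > 0" and default: "default_construction P F X h Z"
begin

lemma mc: "T > 0 \<Longrightarrow> markov_chain P F X T"
  by (rule markov_chain_restrict[OF prob_space_axioms filt chain])

lemma sub_F: "0 \<le> t \<Longrightarrow> subalgebra P (F t)"
  using conjunct1[OF filt[unfolded usual_filtration_def]] by blast

lemma mono_F: "0 \<le> s \<Longrightarrow> s \<le> t \<Longrightarrow> sets (F s) \<subseteq> sets (F t)"
  using conjunct1[OF conjunct2[OF filt[unfolded usual_filtration_def]]] by blast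

lemma space_Ft: "0 \<le> t \<Longrightarrow> space (F t) = space P"
  using sub_F by (auto simp: subalgebra_def)

definition \<Lambda> :: "real \<Rightarrow> 'a \<Rightarrow> real" where "\<Lambda> t \<omega> = (LBINT u:{0..t}. h \<bullet> X u \<omega>)"

text \<open>A positive lower bound of the intensity: the hazard grows at least linearly, so it
  reaches every level and the default time is an infimum over a nonempty set.\<close>

definition hmin :: real where "hmin = Min (range (($) h))"

lemma hmin: "hmin > 0" "hmin \<le> h $ i"
  unfolding hmin_def using h_pos by (auto simp: Min_gr_iff)

lemma \<Lambda>_increment:
  assumes "\<omega> \<in> space P" "0 \<le> s" "s \<le> t"
  shows "\<Lambda> t \<omega> - \<Lambda> s \<omega> = (LBINT u:{s..t}. h \<bullet> X u \<omega>)"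
    "hmin * (t - s) \<le> \<Lambda> t \<omega> - \<Lambda> s \<omega>" "\<Lambda> t \<omega> - \<Lambda> s \<omega> \<le> norm h * (t - s)"
proof -
  interpret c: markov_chain P F X "t + 1" by (rule mc) (use assms in simp)
  show eq: "\<Lambda> t \<omega> - \<Lambda> s \<omega> = (LBINT u:{s..t}. h \<bullet> X u \<omega>)"
    using c.inner_integral_split[of \<omega> 0 s t h] assms by (simp add: \<Lambda>_def)
  show "\<Lambda> t \<omega> - \<Lambda> s \<omega> \<le> norm h * (t - s)"
    unfolding eq using c.inner_integral_bound[of \<omega> s t h] assms by auto
  have "hmin * (t - s) = (LBINT u:{s..t}. hmin)" using assms by (simp add: set_lebesgue_integral_def)
  also have "\<dots> \<le> (LBINT u:{s..t}. h \<bullet> X u \<omega>)"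
  proof (rule set_integral_mono)
    show "set_integrable lborel {s..t} (\<lambda>u. hmin)" by (rule c.const_path_integrable)
    show "set_integrable lborel {s..t} (\<lambda>u. h \<bullet> X u \<omega>)" using assms by (intro c.inner_path_integrable) auto
    fix u assume "u \<in> {s..t}"
    then obtain i where "X u \<omega> = axis i 1" using c.X_range[of \<omega> u] assms by auto
    then show "hmin \<le> h \<bullet> X u \<omega>" using hmin(2)[of i] by (simp add: inner_axis)
  qed
  finally show "hmin * (t - s) \<le> \<Lambda> t \<omega> - \<Lambda> s \<omega>" unfolding eq .
qed

lemma \<Lambda>_mono: "\<omega> \<in> space P \<Longrightarrow> 0 \<le> s \<Longrightarrow> s \<le> t \<Longrightarrow> \<Lambda> s \<omega> \<le> \<Lambda> t \<omega>"
  using \<Lambda>_increment(2)[of \<omega> s t] hmin(1) by (smt (verit) mult_nonneg_nonneg)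

lemma \<Lambda>_0: "\<Lambda> 0 \<omega> = 0" if "\<omega> \<in> space P"
  using markov_chain.inner_integral_bound[OF mc, of 1 \<omega> 0 0 h] that by (simp add: \<Lambda>_def)

lemma \<Lambda>_meas: "0 \<le> t \<Longrightarrow> \<Lambda> t \<in> borel_measurable (F t)"
  using markov_chain.inner_integral_measurable[OF mc, of "t + 1" 0 t h] by (simp add: \<Lambda>_def[abs_def])

lemma F_meas_P: "0 \<le> t \<Longrightarrow> f \<in> borel_measurable (F t) \<Longrightarrow> f \<in> borel_measurable P"
  using measurable_from_subalg[OF sub_F] by blast

lemma Z_meas: "Z \<in> borel_measurable P"
  using default by (auto simp: default_construction_def distributed_def)

abbreviation "\<tau> \<equiv> default_time h X Z"
abbreviation "H \<equiv> default_ind \<tau>"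
abbreviation "G \<equiv> enlarged_filtration P F H"

text \<open>Since the hazard is Lipschitz continuous, the infimum is attained; monotonicity then
  turns \<open>\<tau> \<omega> \<le> u\<close> into a comparison of \<open>Z\<close> with the
  hazard, which also makes the default event measurable.\<close>

lemma \<tau>_props:
  assumes \<omega>: "\<omega> \<in> space P"
  shows "0 \<le> \<tau> \<omega>" "0 \<le> u \<Longrightarrow> \<tau> \<omega> \<le> u \<longleftrightarrow> Z \<omega> \<le> \<Lambda> u \<omega>"
proof -
  define S where "S = {t. 0 \<le> t \<and> Z \<omega> \<le> \<Lambda> t \<omega>}"
  have \<tau>: "\<tau> \<omega> = Inf S" by (simp add: default_time_def S_def \<Lambda>_def)
  \<comment> \<open>The linear lower bound reaches \<open>Z \<omega>\<close> by time
    \<open>Z \<omega> / hmin\<close>; the maximum takes care of negative values.\<close>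
  have "max 0 (Z \<omega> / hmin) \<in> S"
  proof -
    have "Z \<omega> \<le> hmin * max 0 (Z \<omega> / hmin)" using hmin(1) by (auto simp: max_def field_simps zero_le_divide_iff)
    also have "\<dots> \<le> \<Lambda> (max 0 (Z \<omega> / hmin)) \<omega>"
      using \<Lambda>_increment(2)[OF \<omega>, of 0 "max 0 (Z \<omega> / hmin)"] \<Lambda>_0[OF \<omega>] by simp
    finally show ?thesis by (simp add: S_def)
  qed
  moreover have "bdd_below S" by (auto simp: S_def intro!: bdd_belowI[of _ 0])
  ultimately have S: "S \<noteq> {}" "bdd_below S" by blast+
  show \<tau>0: "0 \<le> \<tau> \<omega>" unfolding \<tau> using S by (intro cInf_greatest) (auto simp: S_def)
  have Z\<tau>: "Z \<omega> \<le> \<Lambda> (\<tau> \<omega>) \<omega>"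
  proof (rule field_le_epsilon)
    fix e :: real assume e: "e > 0"
    define d where "d = e / (norm h + 1)"
    have d: "d > 0" using e by (simp add: d_def add_nonneg_pos)
    then obtain t where t: "t \<in> S" "t < \<tau> \<omega> + d" using cInf_less_iff[OF S, of "\<tau> \<omega> + d"] \<tau> by auto
    have "\<tau> \<omega> \<le> t" unfolding \<tau> using S t by (intro cInf_lower) auto
    have "Z \<omega> \<le> \<Lambda> t \<omega>" using t by (simp add: S_def)
    also have "\<dots> \<le> \<Lambda> (\<tau> \<omega>) \<omega> + norm h * (t - \<tau> \<omega>)"
      using \<Lambda>_increment(3)[OF \<omega> \<tau>0 \<open>\<tau> \<omega> \<le> t\<close>] by simp
    also have "norm h * (t - \<tau> \<omega>) \<le> (norm h + 1) * d"
      using t \<open>\<tau> \<omega> \<le> t\<close> by (intro mult_mono) auto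
    also have "\<dots> = e" using norm_ge_zero[of h] by (simp add: d_def add_nonneg_eq_0_iff)
    finally show "Z \<omega> \<le> \<Lambda> (\<tau> \<omega>) \<omega> + e" by simp
  qed
  show "\<tau> \<omega> \<le> u \<longleftrightarrow> Z \<omega> \<le> \<Lambda> u \<omega>" if u: "0 \<le> u"
  proof
    assume "\<tau> \<omega> \<le> u"
    then show "Z \<omega> \<le> \<Lambda> u \<omega>" using Z\<tau> \<Lambda>_mono[OF \<omega> \<tau>0] by fastforce
  next
    assume "Z \<omega> \<le> \<Lambda> u \<omega>"
    then have "u \<in> S" using u by (simp add: S_def)
    then show "\<tau> \<omega> \<le> u" unfolding \<tau> using S by (intro cInf_lower) auto
  qed
qed

lemma \<tau>_set: "{\<omega>\<in>space P. \<tau> \<omega> \<le> u} \<in> sets P"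
proof (cases "0 \<le> u")
  case True
  note [measurable] = Z_meas F_meas_P[OF True \<Lambda>_meas[OF True]]
  have "{\<omega>\<in>space P. \<tau> \<omega> \<le> u} = {\<omega>\<in>space P. Z \<omega> \<le> \<Lambda> u \<omega>}" using \<tau>_props(2)[OF _ True] by auto
  also have "\<dots> \<in> sets P" by measurable
  finally show ?thesis .
next
  case False
  then have "{\<omega>\<in>space P. \<tau> \<omega> \<le> u} = {}" using \<tau>_props(1) by force
  then show ?thesis by (simp only: sets.empty_sets)
qed

lemma H_meas_P: "H u \<in> borel_measurable P"
proof -
  note [measurable] = \<tau>_set[of u]
  have "(indicator {\<omega>\<in>space P. \<tau> \<omega> \<le> u} :: 'a \<Rightarrow> real) \<in> borel_measurable P" by measurable
  then show ?thesis
    by (rule measurable_cong[THEN iffD1, rotated]) (auto simp: default_ind_def indicator_def)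
qed

lemma H_01: "H u \<omega> \<in> {0, 1}" by (simp add: default_ind_def)

lemma H_right: "((\<lambda>v. H v \<omega>) \<longlongrightarrow> H u \<omega>) (at_right u)"
  using continuous_at_right_step[of u "\<tau> \<omega>" 1 0] by (simp add: continuous_within default_ind_def)

lemma H_left_lim: "left_lim (\<lambda>v. H v \<omega>) u = (if \<tau> \<omega> < u then 1 else 0)"
proof (cases "\<tau> \<omega> < u")
  case True
  then show ?thesis by (auto intro!: left_lim_eqI[of "\<tau> \<omega>"] simp: default_ind_def)
next
  case False
  then show ?thesis by (auto intro!: left_lim_eqI[of "u - 1"] simp: default_ind_def)
qed

section \<open>The filtration enlarged by the default indicator\<close>

lemma sets_process_H: "sets (process_sigma P I H) \<subseteq> sets P"
proof -
  let ?E = "{H t -` B \<inter> space P |t B. t \<in> I \<and> B \<in> sets borel}"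
  have "sets (process_sigma P I H) = sigma_sets (space P) ?E"
    unfolding process_sigma_def by (rule sets_measure_of) auto
  also have "\<dots> \<subseteq> sets P"
    by (rule sets.sigma_sets_subset) (auto intro: measurable_sets[OF H_meas_P])
  finally show ?thesis .
qed

lemma sets_DF: "sets (default_filtration P H t) \<subseteq> sets (sigma (space P) (sets (process_sigma P {0..s} H) \<union> null_sets P))" if "t < s"
proof -
  let ?I = "\<Inter>s\<in>{t<..}. sets (sigma (space P) (sets (process_sigma P {0..s} H) \<union> null_sets P))"
  let ?S = "sigma (space P) (sets (process_sigma P {0..s} H) \<union> null_sets P)"
  have sp: "space ?S = space P" by (rule space_measure_of_conv)
  have I: "?I \<subseteq> sets ?S" by (rule INT_lower) (use that in simp)
  then have "?I \<subseteq> Pow (space P)" using sets.space_closed[of ?S] unfolding sp by (rule subset_trans)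
  then have "sets (default_filtration P H t) = sigma_sets (space P) ?I"
    unfolding default_filtration_def by (rule sets_measure_of)
  also have "\<dots> \<subseteq> sets ?S" using sets.sigma_sets_subset[OF I] unfolding sp .
  finally show ?thesis .
qed

lemma DF_generators: "(\<Inter>s\<in>{t<..}. sets (sigma (space P) (sets (process_sigma P {0..s} H) \<union> null_sets P))) \<subseteq> Pow (space P)"
proof -
  let ?S = "sigma (space P) (sets (process_sigma P {0..t+1} H) \<union> null_sets P)"
  have "(\<Inter>s\<in>{t<..}. sets (sigma (space P) (sets (process_sigma P {0..s} H) \<union> null_sets P))) \<subseteq> sets ?S"
    by (rule INT_lower) simp
  also have "\<dots> \<subseteq> Pow (space P)" using sets.space_closed[of ?S] unfolding space_measure_of_conv .
  finally show ?thesis .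
qed

lemma sets_PN: "sets (sigma (space P) (sets (process_sigma P I H) \<union> null_sets P)) = sigma_sets (space P) (sets (process_sigma P I H) \<union> null_sets P)"
  "sets (process_sigma P I H) \<union> null_sets P \<subseteq> sets P"
proof -
  show 1: "sets (process_sigma P I H) \<union> null_sets P \<subseteq> sets P" using sets_process_H by (auto simp: null_sets_def)
  show "sets (sigma (space P) (sets (process_sigma P I H) \<union> null_sets P)) = sigma_sets (space P) (sets (process_sigma P I H) \<union> null_sets P)"
    by (rule sets_measure_of) (use 1 sets.space_closed[of P] in blast)
qed

lemma sets_DF_P: "sets (default_filtration P H t) \<subseteq> sets P"
  using sets_DF[of t "t+1"] sets.sigma_sets_subset[OF sets_PN(2)[of "{0..t+1}"]] unfolding sets_PN(1) by auto

lemma sets_G: "0 \<le> t \<Longrightarrow> sets (G t) = sigma_sets (space P) (sets (F t) \<union> sets (default_filtration P H t))"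
  unfolding enlarged_filtration_def
  using sub_F[of t] sets_DF_P[of t] sets.space_closed[of P] by (intro sets_measure_of) (auto simp: subalgebra_def)

lemma space_G: "space (G t) = space P" by (simp add: enlarged_filtration_def space_measure_of_conv)

lemma sub_G: "0 \<le> t \<Longrightarrow> subalgebra P (G t)"
proof -
  assume t: "0 \<le> t"
  then have "sets (F t) \<union> sets (default_filtration P H t) \<subseteq> sets P"
    using sub_F[of t] sets_DF_P[of t] by (simp add: subalgebra_def)
  from sets.sigma_sets_subset[OF this] show ?thesis
    by (simp add: subalgebra_def sets_G[OF t] space_G)
qed

lemma F_sub_G: "0 \<le> t \<Longrightarrow> sets (F t) \<subseteq> sets (G t)" "0 \<le> t \<Longrightarrow> sets (default_filtration P H t) \<subseteq> sets (G t)"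
  by (auto simp: sets_G)

lemma F_meas_G: "0 \<le> s \<Longrightarrow> s \<le> t \<Longrightarrow> f \<in> borel_measurable (F s) \<Longrightarrow> f \<in> borel_measurable (G t)"
  using space_Ft[of s] F_sub_G(1)[of t] mono_F[of s t]
  by (intro measurable_from_subalg[of "G t" "F s"]) (auto simp: subalgebra_def space_G)

lemma H_meas_G:
  assumes t: "0 \<le> t" "u \<in> {0..t}"
  shows "H u \<in> borel_measurable (G t)"
proof (rule measurableI)
  fix B :: "real set" assume B: "B \<in> sets borel"
  have "H u -` B \<inter> space P \<in> sets (sigma (space P) (sets (process_sigma P {0..s} H) \<union> null_sets P))" if "t < s" for s
  proof -
    have "H u -` B \<inter> space P \<in> sets (process_sigma P {0..s} H)"
      unfolding process_sigma_def using that t B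
      by (auto simp: sets_measure_of_conv intro!: sigma_sets.Basic exI[of _ u] exI[of _ B])
    then show ?thesis unfolding sets_PN(1) by (intro sigma_sets.Basic) auto
  qed
  then have "H u -` B \<inter> space P \<in> (\<Inter>s\<in>{t<..}. sets (sigma (space P) (sets (process_sigma P {0..s} H) \<union> null_sets P)))" by auto
  then have "H u -` B \<inter> space P \<in> sets (default_filtration P H t)"
    unfolding default_filtration_def by (rule in_measure_of[OF DF_generators])
  then show "H u -` B \<inter> space (G t) \<in> sets (G t)" using F_sub_G(2)[OF t(1)] by (auto simp: space_G)
qed auto

text \<open>Before default the indicator is constantly \<open>0\<close>, so on
  \<open>s < \<tau> \<omega>\<close> its history decides nothing and every event is there trivial up
  to a null set. The strict inequality \<open>t < s\<close> is owed to the right-continuous version: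
  its events at \<open>t\<close> are known to be generated by the indicator only up to times later
  than \<open>t\<close>.\<close>

lemma DF_atom:
  assumes B: "B \<in> sets (default_filtration P H t)" and ts: "t < s"
  shows "\<exists>c::bool. AE \<omega> in P. s < \<tau> \<omega> \<longrightarrow> (\<omega> \<in> B \<longleftrightarrow> c)"
proof -
  \<comment> \<open>The property survives the operations of a sigma-algebra. This is used on two
    levels, for the completion and for the sigma-algebra of the process inside it.\<close>
  have proc: "\<exists>c::bool. AE \<omega> in P. s < \<tau> \<omega> \<longrightarrow> (\<omega> \<in> B \<longleftrightarrow> c)" if "B \<in> sigma_sets (space P) E"
    and E: "\<And>B. B \<in> E \<Longrightarrow> \<exists>c::bool. AE \<omega> in P. s < \<tau> \<omega> \<longrightarrow> (\<omega> \<in> B \<longleftrightarrow> c)" for B E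
    using that(1)
  proof induction
    case (Basic a)
    then show ?case by (rule E)
  next
    case Empty
    then show ?case by (intro exI[of _ False]) auto
  next
    case (Compl a)
    then obtain c where "AE \<omega> in P. s < \<tau> \<omega> \<longrightarrow> (\<omega> \<in> a \<longleftrightarrow> c)" by blast
    then have "AE \<omega> in P. s < \<tau> \<omega> \<longrightarrow> (\<omega> \<in> space P - a \<longleftrightarrow> \<not> c)" using AE_space by eventually_elim auto
    then show ?case by blast
  next
    case (Union a)
    then have "\<forall>i. \<exists>c. AE \<omega> in P. s < \<tau> \<omega> \<longrightarrow> (\<omega> \<in> a i \<longleftrightarrow> c)" by blast
    then obtain c where "\<And>i. AE \<omega> in P. s < \<tau> \<omega> \<longrightarrow> (\<omega> \<in> a i \<longleftrightarrow> c i)" by metis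
    then have "AE \<omega> in P. \<forall>i. s < \<tau> \<omega> \<longrightarrow> (\<omega> \<in> a i \<longleftrightarrow> c i)" by (subst AE_all_countable) blast
    then have "AE \<omega> in P. s < \<tau> \<omega> \<longrightarrow> (\<omega> \<in> (\<Union>i. a i) \<longleftrightarrow> (\<exists>i. c i))" by eventually_elim auto
    then show ?case by blast
  qed
  have "B \<in> sigma_sets (space P) (sets (process_sigma P {0..s} H) \<union> null_sets P)"
    using sets_DF[OF ts] B unfolding sets_PN(1) by auto
  then show ?thesis
  proof (rule proc)
    fix B assume "B \<in> sets (process_sigma P {0..s} H) \<union> null_sets P"
    then show "\<exists>c::bool. AE \<omega> in P. s < \<tau> \<omega> \<longrightarrow> (\<omega> \<in> B \<longleftrightarrow> c)"
    proof
      assume "B \<in> null_sets P"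
      then have "AE \<omega> in P. \<omega> \<notin> B" by (rule AE_not_in)
      then show ?thesis by (intro exI[of _ False]) (auto elim: eventually_mono)
    next
      assume "B \<in> sets (process_sigma P {0..s} H)"
      then have "B \<in> sigma_sets (space P) {H t -` B \<inter> space P |t B. t \<in> {0..s} \<and> B \<in> sets borel}"
        unfolding process_sigma_def by (subst (asm) sets_measure_of) auto
      then show ?thesis
      proof (rule proc)
        fix B assume "B \<in> {H t -` B \<inter> space P |t B. t \<in> {0..s} \<and> B \<in> sets borel}"
        then obtain u C where u: "B = H u -` C \<inter> space P" "u \<in> {0..s}" by auto
        have "AE \<omega> in P. s < \<tau> \<omega> \<longrightarrow> (\<omega> \<in> B \<longleftrightarrow> 0 \<in> C)"
          using AE_space by eventually_elim (use u in \<open>auto simp: default_ind_def\<close>)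
        then show "\<exists>c::bool. AE \<omega> in P. s < \<tau> \<omega> \<longrightarrow> (\<omega> \<in> B \<longleftrightarrow> c)" by blast
      qed
    qed
  qed
qed

lemma sub_Finf: "subalgebra P (filtration_infinity P F)" and F_sub_Finf: "0 \<le> t \<Longrightarrow> sets (F t) \<subseteq> sets (filtration_infinity P F)"
proof -
  have *: "(\<Union>s\<in>{0..}. sets (F s)) \<subseteq> sets P" using sub_F by (auto simp: subalgebra_def)
  have eq: "sets (filtration_infinity P F) = sigma_sets (space P) (\<Union>s\<in>{0..}. sets (F s))"
    unfolding filtration_infinity_def by (rule sets_measure_of) (use * sets.space_closed[of P] in blast)
  show "subalgebra P (filtration_infinity P F)"
    unfolding subalgebra_def eq using sets.sigma_sets_subset[OF *]
    by (simp add: filtration_infinity_def space_measure_of_conv)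
  show "sets (F t) \<subseteq> sets (filtration_infinity P F)" if "0 \<le> t" unfolding eq using that by auto
qed

text \<open>The conditional law of default is given relative to the whole future of
  \<open>F\<close>, so the test variable may be known only at a time \<open>v\<close> after
  \<open>u\<close>. That case is used when default is compared with later moves of the
  chain.\<close>

lemma expectation_H:
  fixes K :: real
  assumes u: "0 \<le> u" and v: "0 \<le> v" and V: "V \<in> borel_measurable (F v)" "\<And>\<omega>. \<omega> \<in> space P \<Longrightarrow> \<bar>V \<omega>\<bar> \<le> K"
  shows "expectation (\<lambda>\<omega>. V \<omega> * H u \<omega>) = expectation (\<lambda>\<omega>. V \<omega> * (1 - exp (- \<Lambda> u \<omega>)))"
proof -
  interpret f: finite_measure_subalgebra P "filtration_infinity P F"
    by unfold_locales (rule sub_Finf)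
  define g where "g = (indicator {\<omega>\<in>space P. \<tau> \<omega> \<le> u} :: 'a \<Rightarrow> real)"
  have gm[measurable]: "g \<in> borel_measurable P" unfolding g_def using \<tau>_set by measurable
  have gH: "g \<omega> = H u \<omega>" if "\<omega> \<in> space P" for \<omega> using that by (auto simp: g_def default_ind_def)
  have Vi: "V \<in> borel_measurable (filtration_infinity P F)"
    by (rule measurable_from_subalg[OF _ V(1)])
      (use F_sub_Finf[OF v] space_Ft[OF v] in \<open>simp add: subalgebra_def filtration_infinity_def space_measure_of_conv\<close>)
  have [measurable]: "V \<in> borel_measurable P" using F_meas_P[OF v V(1)] .
  have "\<bar>V \<omega> * g \<omega>\<bar> \<le> K" if "\<omega> \<in> space P" for \<omega>
    using V(2)[OF that] by (auto simp: g_def indicator_def)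
  then have i: "integrable P (\<lambda>\<omega>. V \<omega> * g \<omega>)"
    by (intro integrable_const_bound[of _ K] AE_I2) auto
  have "expectation (\<lambda>\<omega>. V \<omega> * H u \<omega>) = expectation (\<lambda>\<omega>. V \<omega> * g \<omega>)"
    by (intro Bochner_Integration.integral_cong) (simp_all add: gH)
  also have "\<dots> = expectation (\<lambda>\<omega>. V \<omega> * real_cond_exp P (filtration_infinity P F) g \<omega>)"
    using f.real_cond_exp_intg(2)[OF i Vi gm] by simp
  also have "\<dots> = expectation (\<lambda>\<omega>. V \<omega> * (1 - exp (- \<Lambda> u \<omega>)))"
  proof (rule integral_cong_AE)
    have "AE \<omega> in P. real_cond_exp P (filtration_infinity P F) g \<omega> = 1 - exp (- \<Lambda> u \<omega>)"
      using default u unfolding default_construction_def g_def \<Lambda>_def by blast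
    then show "AE \<omega> in P. V \<omega> * real_cond_exp P (filtration_infinity P F) g \<omega> = V \<omega> * (1 - exp (- \<Lambda> u \<omega>))"
      by eventually_elim simp
    note [measurable] = F_meas_P[OF u \<Lambda>_meas[OF u]]
    show "(\<lambda>\<omega>. V \<omega> * (1 - exp (- \<Lambda> u \<omega>))) \<in> borel_measurable P" by measurable
  qed (use borel_measurable_cond_exp2 in measurable)
  finally show ?thesis .
qed

lemma surviving_process:
  assumes t: "0 \<le> t" and N: "N = P \<or> N = G t"
  shows "bounded_right_continuous_process N (\<lambda>u \<omega>. (1 - H u \<omega>) * X u \<omega> $ i) t"
proof -
  interpret c: markov_chain P F X "t + 1" by (rule mc) (use t in simp)
  have sp: "space N = space P" using N by (auto simp: space_G)
  show ?thesis
  proof (unfold_locales)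
    fix u assume u: "u \<in> {0..t}"
    have "H u \<in> borel_measurable N" using N H_meas_P H_meas_G[OF t u] by auto
    moreover have "(\<lambda>\<omega>. X u \<omega> $ i) \<in> borel_measurable N"
      using N F_meas_P[of u] F_meas_G[of u t] c.X_nth_meas[of u i] u by auto
    ultimately show "(\<lambda>\<omega>. (1 - H u \<omega>) * X u \<omega> $ i) \<in> borel_measurable N" by measurable
  next
    fix \<omega> u assume "\<omega> \<in> space N" "0 \<le> u" "u < t"
    then show "((\<lambda>v. (1 - H v \<omega>) * X v \<omega> $ i) \<longlongrightarrow> (1 - H u \<omega>) * X u \<omega> $ i) (at_right u)"
      unfolding sp by (intro tendsto_intros H_right c.X_nth_rc) auto
  next
    fix \<omega> u assume "\<omega> \<in> space N" "u \<in> {0..t}"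
    then show "\<bar>(1 - H u \<omega>) * X u \<omega> $ i\<bar> \<le> 1"
      using H_01[of u \<omega>] c.X_nth_bound[of \<omega> u i] by (auto simp: sp)
  qed (use t in simp)
qed

lemma discounted_process:
  assumes t: "0 \<le> t"
  shows "bounded_right_continuous_process P (\<lambda>u \<omega>. exp (- \<Lambda> u \<omega>) * X u \<omega> $ i) t"
proof -
  interpret c: markov_chain P F X "t + 1" by (rule mc) (use t in simp)
  show ?thesis
  proof (unfold_locales)
    fix u assume u: "u \<in> {0..t}"
    then have [measurable]: "\<Lambda> u \<in> borel_measurable P" "(\<lambda>\<omega>. X u \<omega> $ i) \<in> borel_measurable P"
      using F_meas_P[of u] \<Lambda>_meas[of u] c.X_nth_meas[of u i] by auto
    show "(\<lambda>\<omega>. exp (- \<Lambda> u \<omega>) * X u \<omega> $ i) \<in> borel_measurable P" by measurable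
  next
    fix \<omega> u assume \<omega>: "\<omega> \<in> space P" and u: "0 \<le> u" "u < t"
    have "((\<lambda>v. c.discount h 0 v \<omega>) \<longlongrightarrow> c.discount h 0 u \<omega>) (at u within {0..t + 1})"
      using c.continuous_on_discount[OF \<omega> order_refl, of h] u by (simp add: continuous_on)
    then have "((\<lambda>v. c.discount h 0 v \<omega>) \<longlongrightarrow> c.discount h 0 u \<omega>) (at u within {u<..<t+1})"
      by (rule tendsto_within_subset) (use u in auto)
    moreover have "at u within {u<..<t+1} = at_right u"
      by (rule at_within_nhd[of u "{..<t+1}"]) (use u in auto)
    ultimately have "((\<lambda>v. exp (- \<Lambda> v \<omega>)) \<longlongrightarrow> exp (- \<Lambda> u \<omega>)) (at_right u)"
      by (simp add: c.discount_def \<Lambda>_def)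
    then show "((\<lambda>v. exp (- \<Lambda> v \<omega>) * X v \<omega> $ i) \<longlongrightarrow> exp (- \<Lambda> u \<omega>) * X u \<omega> $ i) (at_right u)"
      using \<omega> u by (intro tendsto_mult c.X_nth_rc) auto
  next
    fix \<omega> u assume \<omega>: "\<omega> \<in> space P" and u: "u \<in> {0..t}"
    have "\<Lambda> u \<omega> \<ge> 0" using \<Lambda>_mono[OF \<omega>, of 0 u] \<Lambda>_0[OF \<omega>] u by simp
    then show "\<bar>exp (- \<Lambda> u \<omega>) * X u \<omega> $ i\<bar> \<le> 1"
      using c.X_nth_bound[OF \<omega>, of u i] u by (auto simp: abs_mult intro!: mult_le_one)
  qed (use t in simp)
qed

text \<open>\<open>H u\<close> replaces the left limit; the two differ at the default time only, and
  this version is right-continuous, as the measurability of time integrals requires.\<close>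

definition comp :: "real \<Rightarrow> 'a \<Rightarrow> real" where
  "comp t \<omega> = (LBINT u:{0..t}. (1 - H u \<omega>) * (h \<bullet> X u \<omega>))"

lemma default_mart_eq: "default_mart h X H t \<omega> = H t \<omega> - comp t \<omega>"
proof -
  have "(\<lambda>u. indicator {0..t} u *\<^sub>R ((1 - left_lim (\<lambda>v. H v \<omega>) u) * (h \<bullet> X u \<omega>))) x = (\<lambda>u. indicator {0..t} u *\<^sub>R ((1 - H u \<omega>) * (h \<bullet> X u \<omega>))) x"
    if "x \<noteq> \<tau> \<omega>" for x
    using that by (simp only: H_left_lim) (auto simp: default_ind_def)
  then have "integral\<^sup>L lborel (\<lambda>u. indicator {0..t} u *\<^sub>R ((1 - left_lim (\<lambda>v. H v \<omega>) u) * (h \<bullet> X u \<omega>))) =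
    integral\<^sup>L lborel (\<lambda>u. indicator {0..t} u *\<^sub>R ((1 - H u \<omega>) * (h \<bullet> X u \<omega>)))"
    by (intro lborel_integral_cong_off_finite[of "{\<tau> \<omega>}"]) auto
  then show ?thesis by (simp add: default_mart_def comp_def set_lebesgue_integral_def)
qed

end

section \<open>The compensator of default and the martingale property\<close>

context default_model
begin

lemma comp_integrable:
  assumes "\<omega> \<in> space P" "0 \<le> s" "s \<le> t"
  shows "set_integrable lborel {s..t} (\<lambda>u. h $ i * ((1 - H u \<omega>) * X u \<omega> $ i))"
proof -
  interpret b: bounded_right_continuous_process P "\<lambda>u \<omega>. (1 - H u \<omega>) * X u \<omega> $ i" t
    by (rule surviving_process) (use assms in auto)
  show ?thesis
    by (rule b.path_integrable) (use assms borel_integrable_atLeastAtMost'[OF continuous_on_const] in auto)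
qed

lemma comp_integrand: "(1 - H u \<omega>) * (h \<bullet> X u \<omega>) = (\<Sum>i\<in>UNIV. h $ i * ((1 - H u \<omega>) * X u \<omega> $ i))"
  by (simp add: inner_vec_def sum_distrib_left mult_ac)

lemma comp_increment:
  assumes "\<omega> \<in> space P" "0 \<le> s" "s \<le> t"
  shows "comp t \<omega> - comp s \<omega> = (LBINT u:{s..t}. (1 - H u \<omega>) * (h \<bullet> X u \<omega>))"
    "comp t \<omega> - comp s \<omega> = (\<Sum>i\<in>UNIV. LBINT u:{s..t}. h $ i * ((1 - H u \<omega>) * X u \<omega> $ i))"
    "\<bar>comp t \<omega> - comp s \<omega>\<bar> \<le> norm h * (t - s)"
    "\<tau> \<omega> \<le> s \<Longrightarrow> comp t \<omega> = comp s \<omega>"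
proof -
  interpret c: markov_chain P F X "t + 1" by (rule mc) (use assms in simp)
  have i: "set_integrable lborel {a..t} (\<lambda>u. (1 - H u \<omega>) * (h \<bullet> X u \<omega>))" if "0 \<le> a" "a \<le> t" for a
    unfolding comp_integrand using assms that by (intro set_integral_finite_sum comp_integrable) auto
  show eq: "comp t \<omega> - comp s \<omega> = (LBINT u:{s..t}. (1 - H u \<omega>) * (h \<bullet> X u \<omega>))"
    using set_integral_Icc_split[OF i[of 0], of s] assms by (simp add: comp_def)
  also have "\<dots> = (\<Sum>i\<in>UNIV. LBINT u:{s..t}. h $ i * ((1 - H u \<omega>) * X u \<omega> $ i))"
    unfolding comp_integrand using assms by (intro set_integral_finite_sum comp_integrable) auto
  finally show "comp t \<omega> - comp s \<omega> = (\<Sum>i\<in>UNIV. LBINT u:{s..t}. h $ i * ((1 - H u \<omega>) * X u \<omega> $ i))" .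
  have "\<bar>comp t \<omega> - comp s \<omega>\<bar> \<le> (LBINT u:{s..t}. \<bar>(1 - H u \<omega>) * (h \<bullet> X u \<omega>)\<bar>)"
    unfolding eq using set_integral_norm_bound[OF i[of s]] assms by simp
  also have "\<dots> \<le> (LBINT u:{s..t}. norm h)"
  proof (rule set_integral_mono)
    fix u assume "u \<in> {s..t}"
    then show "\<bar>(1 - H u \<omega>) * (h \<bullet> X u \<omega>)\<bar> \<le> norm h"
      using H_01[of u \<omega>] c.inner_X_bound[OF assms(1), of u h] assms by (auto simp: abs_mult)
  qed (use i assms c.const_path_integrable in \<open>auto intro: set_integrable_abs\<close>)
  also have "\<dots> = norm h * (t - s)" using assms by (simp add: set_lebesgue_integral_def)
  finally show "\<bar>comp t \<omega> - comp s \<omega>\<bar> \<le> norm h * (t - s)" .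
  show "comp t \<omega> = comp s \<omega>" if "\<tau> \<omega> \<le> s"
  proof -
    have "(LBINT u:{s..t}. (1 - H u \<omega>) * (h \<bullet> X u \<omega>)) = (LBINT u:{s..t}. 0)"
      using that by (intro set_lebesgue_integral_cong) (auto simp: default_ind_def)
    then show ?thesis using eq by simp
  qed
qed

lemma comp_0: "\<omega> \<in> space P \<Longrightarrow> comp 0 \<omega> = 0"
proof -
  assume "\<omega> \<in> space P"
  have "comp 0 \<omega> = integral\<^sup>L lborel (\<lambda>u::real. 0)" unfolding comp_def set_lebesgue_integral_def
    by (rule lborel_integral_cong_off_finite[of "{0}"]) auto
  then show ?thesis by simp
qed

lemma comp_bound: "\<omega> \<in> space P \<Longrightarrow> 0 \<le> t \<Longrightarrow> \<bar>comp t \<omega>\<bar> \<le> norm h * t"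
  using comp_increment(3)[of \<omega> 0 t] comp_0 by simp

lemma comp_meas_G: "0 \<le> t \<Longrightarrow> comp t \<in> borel_measurable (G t)"
proof -
  assume t: "0 \<le> t"
  interpret b: bounded_right_continuous_process "G t" "\<lambda>u \<omega>. (1 - H u \<omega>) * X u \<omega> $ i" t for i
    by (rule surviving_process) (use t in auto)
  have "(\<lambda>\<omega>. \<Sum>i\<in>UNIV. LBINT u:{0..t}. h $ i * ((1 - H u \<omega>) * X u \<omega> $ i)) \<in> borel_measurable (G t)"
    by (intro borel_measurable_sum b.measurable_time_integral) (auto simp: set_borel_measurable_def)
  then show ?thesis
    by (rule measurable_cong[THEN iffD1, rotated])
      (use t comp_increment(2)[of _ 0 t] comp_0 in \<open>simp add: space_G\<close>)
qed

lemma G_meas_P: "0 \<le> t \<Longrightarrow> f \<in> borel_measurable (G t) \<Longrightarrow> f \<in> borel_measurable P"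
  using measurable_from_subalg[OF sub_G] by blast

text \<open>Along a path the integrand is minus the right derivative of
  \<open>exp (- \<Lambda> u \<omega>)\<close>.\<close>

lemma integral_intensity_exp:
  assumes \<omega>: "\<omega> \<in> space P" and st: "0 \<le> s" "s \<le> t"
  shows "(\<Sum>i\<in>UNIV. LBINT u:{s..t}. h $ i * (exp (- \<Lambda> u \<omega>) * X u \<omega> $ i)) = exp (- \<Lambda> s \<omega>) - exp (- \<Lambda> t \<omega>)"
proof -
  interpret c: markov_chain P F X "t + 1" by (rule mc) (use st in simp)
  interpret b: bounded_right_continuous_process P "\<lambda>u \<omega>. exp (- \<Lambda> u \<omega>) * X u \<omega> $ i" t for i
    by (rule discounted_process) (use st in auto)
  have D: "c.discount h 0 u \<omega> = exp (- \<Lambda> u \<omega>)" for u by (simp add: c.discount_def \<Lambda>_def)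
  have i: "set_integrable lborel {s..t} (\<lambda>u. h $ i * (exp (- \<Lambda> u \<omega>) * X u \<omega> $ i))" for i
    by (rule b.path_integrable) (use st \<omega> c.const_path_integrable in auto)
  have "- exp (- \<Lambda> t \<omega>) - (- exp (- \<Lambda> s \<omega>)) = (LBINT u:{s..t}. \<Sum>i\<in>UNIV. h $ i * (exp (- \<Lambda> u \<omega>) * X u \<omega> $ i))"
  proof (rule right_deriv_eq_integral[OF st(2)])
    show "continuous_on {s..t} (\<lambda>u. - exp (- \<Lambda> u \<omega>))"
      using continuous_on_subset[OF c.continuous_on_discount[OF \<omega> order_refl, of h], of "{s..t}"] st
      by (intro continuous_on_minus) (simp add: D)
    show "set_integrable lborel {s..t} (\<lambda>u. \<Sum>i\<in>UNIV. h $ i * (exp (- \<Lambda> u \<omega>) * X u \<omega> $ i))"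
      by (intro set_integral_finite_sum i)
    fix u assume u: "s < u" "u < t"
    have "((\<lambda>v. - c.discount h 0 v \<omega>) has_real_derivative - (- (h \<bullet> X u \<omega>) * c.discount h 0 u \<omega>)) (at_right u)"
      by (intro DERIV_minus c.discount_right_derivative \<omega>) (use u st in auto)
    then show "((\<lambda>u. - exp (- \<Lambda> u \<omega>)) has_real_derivative (\<Sum>i\<in>UNIV. h $ i * (exp (- \<Lambda> u \<omega>) * X u \<omega> $ i))) (at_right u)"
      unfolding D by (simp add: inner_vec_def sum_distrib_left sum_distrib_right mult_ac)
  qed
  also have "\<dots> = (\<Sum>i\<in>UNIV. LBINT u:{s..t}. h $ i * (exp (- \<Lambda> u \<omega>) * X u \<omega> $ i))"
    by (intro set_integral_finite_sum i)
  finally show ?thesis by simp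
qed

context
  fixes V :: "'a \<Rightarrow> real" and K s t :: real
  assumes st: "0 \<le> s" "s \<le> t" and V: "V \<in> borel_measurable (F s)" "\<And>\<omega>. \<omega> \<in> space P \<Longrightarrow> \<bar>V \<omega>\<bar> \<le> K"
begin

text \<open>Under the time integral survival at \<open>u\<close> may be replaced by its conditional
  probability \<open>exp (- \<Lambda> u \<omega>)\<close>, because \<open>V\<close> times the state
  at \<open>u\<close> is known in \<open>F u\<close>. The resulting integral is explicit.\<close>

lemma expectation_comp_increment:
  "expectation (\<lambda>\<omega>. V \<omega> * (comp t \<omega> - comp s \<omega>)) = expectation (\<lambda>\<omega>. V \<omega> * (exp (- \<Lambda> s \<omega>) - exp (- \<Lambda> t \<omega>)))"
proof -
  interpret c: markov_chain P F X "t + 1" by (rule mc) (use st in simp)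
  interpret b1: bounded_right_continuous_process P "\<lambda>u \<omega>. (1 - H u \<omega>) * X u \<omega> $ i" t for i
    by (rule surviving_process) (use st in auto)
  interpret b2: bounded_right_continuous_process P "\<lambda>u \<omega>. exp (- \<Lambda> u \<omega>) * X u \<omega> $ i" t for i
    by (rule discounted_process) (use st in auto)
  have VP: "V \<in> borel_measurable P" using F_meas_P[OF st(1) V(1)] .
  have hI: "set_integrable lborel {s..t} (\<lambda>_. h $ i)" for i by (rule c.const_path_integrable)
  note Fub1 = b1.Fubini_time_integral[OF prob_space_axioms hI st(1) order_refl VP V(2)]
  note Fub2 = b2.Fubini_time_integral[OF prob_space_axioms hI st(1) order_refl VP V(2)]
  have eq: "expectation (\<lambda>\<omega>. V \<omega> * ((1 - H u \<omega>) * X u \<omega> $ i)) = expectation (\<lambda>\<omega>. V \<omega> * (exp (- \<Lambda> u \<omega>) * X u \<omega> $ i))"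
    if u: "u \<in> {s..t}" for u i
  proof -
    have u0: "0 \<le> u" and uT: "u \<in> {0..t + 1}" using u st by auto
    define V' where "V' \<omega> = V \<omega> * X u \<omega> $ i" for \<omega>
    have V': "V' \<in> borel_measurable (F u)"
      unfolding V'_def[abs_def] using c.measurable_F_mono[OF V(1) st(1), of u] c.X_nth_meas[OF uT, of i] u by (intro borel_measurable_times) auto
    have V'b: "\<bar>V' \<omega>\<bar> \<le> K" if "\<omega> \<in> space P" for \<omega>
      using V(2)[OF that] c.X_nth[OF that uT, of i] by (auto simp: V'_def split: if_splits)
    have [measurable]: "V' \<in> borel_measurable P" "H u \<in> borel_measurable P" "\<Lambda> u \<in> borel_measurable P"
      using F_meas_P[OF u0 V'] F_meas_P[OF u0 \<Lambda>_meas[OF u0]] H_meas_P by auto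
    have i1: "integrable P V'" by (rule c.integrable_bounded[OF _ V'b]) auto
    have i2: "integrable P (\<lambda>\<omega>. V' \<omega> * H u \<omega>)"
    proof (rule c.integrable_bounded[of _ K])
      show "\<bar>V' \<omega> * H u \<omega>\<bar> \<le> K" if "\<omega> \<in> space P" for \<omega>
        using V'b[OF that] H_01[of u \<omega>] by auto
    qed measurable
    have i3: "integrable P (\<lambda>\<omega>. V' \<omega> * (1 - exp (- \<Lambda> u \<omega>)))"
    proof (rule c.integrable_bounded[of _ K])
      fix \<omega> assume \<omega>: "\<omega> \<in> space P"
      have "\<Lambda> u \<omega> \<ge> 0" using \<Lambda>_mono[OF \<omega>, of 0 u] \<Lambda>_0[OF \<omega>] u0 by simp
      then have "\<bar>1 - exp (- \<Lambda> u \<omega>)\<bar> \<le> 1" by (simp add: abs_le_iff)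
      then have "\<bar>V' \<omega>\<bar> * \<bar>1 - exp (- \<Lambda> u \<omega>)\<bar> \<le> K * 1" using V'b[OF \<omega>] by (intro mult_mono) auto
      then show "\<bar>V' \<omega> * (1 - exp (- \<Lambda> u \<omega>))\<bar> \<le> K" by (simp add: abs_mult)
    qed measurable
    have "expectation (\<lambda>\<omega>. V \<omega> * ((1 - H u \<omega>) * X u \<omega> $ i)) = expectation (\<lambda>\<omega>. V' \<omega> - V' \<omega> * H u \<omega>)"
      by (intro Bochner_Integration.integral_cong) (auto simp: V'_def algebra_simps)
    also have "\<dots> = expectation V' - expectation (\<lambda>\<omega>. V' \<omega> * H u \<omega>)" using i1 i2 by simp
    also have "expectation (\<lambda>\<omega>. V' \<omega> * H u \<omega>) = expectation (\<lambda>\<omega>. V' \<omega> * (1 - exp (- \<Lambda> u \<omega>)))"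
      by (rule expectation_H[OF u0 u0 V' V'b])
    also have "expectation V' - \<dots> = expectation (\<lambda>\<omega>. V' \<omega> - V' \<omega> * (1 - exp (- \<Lambda> u \<omega>)))" using i1 i3 by simp
    also have "\<dots> = expectation (\<lambda>\<omega>. V \<omega> * (exp (- \<Lambda> u \<omega>) * X u \<omega> $ i))"
      by (intro Bochner_Integration.integral_cong) (auto simp: V'_def algebra_simps)
    finally show ?thesis .
  qed
  have "expectation (\<lambda>\<omega>. V \<omega> * (comp t \<omega> - comp s \<omega>)) = expectation (\<lambda>\<omega>. \<Sum>i\<in>UNIV. V \<omega> * (LBINT u:{s..t}. h $ i * ((1 - H u \<omega>) * X u \<omega> $ i)))"
    by (intro Bochner_Integration.integral_cong refl) (simp only: comp_increment(2)[OF _ st] sum_distrib_left)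
  also have "\<dots> = (\<Sum>i\<in>UNIV. LBINT u:{s..t}. h $ i * expectation (\<lambda>\<omega>. V \<omega> * ((1 - H u \<omega>) * X u \<omega> $ i)))"
    by (subst Bochner_Integration.integral_sum) (use Fub1 in auto)
  also have "\<dots> = (\<Sum>i\<in>UNIV. LBINT u:{s..t}. h $ i * expectation (\<lambda>\<omega>. V \<omega> * (exp (- \<Lambda> u \<omega>) * X u \<omega> $ i)))"
    by (intro sum.cong refl set_lebesgue_integral_cong) (simp_all add: eq)
  also have "\<dots> = expectation (\<lambda>\<omega>. \<Sum>i\<in>UNIV. V \<omega> * (LBINT u:{s..t}. h $ i * (exp (- \<Lambda> u \<omega>) * X u \<omega> $ i)))"
    by (subst Bochner_Integration.integral_sum) (use Fub2 in auto)
  also have "\<dots> = expectation (\<lambda>\<omega>. V \<omega> * (exp (- \<Lambda> s \<omega>) - exp (- \<Lambda> t \<omega>)))"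
    by (intro Bochner_Integration.integral_cong refl) (simp only: integral_intensity_exp[OF _ st, symmetric] sum_distrib_left)
  finally show ?thesis .
qed

text \<open>Indicator and compensator have the same weighted mean increment, that of
  \<open>1 - exp (- \<Lambda> u \<omega>)\<close> from \<open>s\<close> to \<open>t\<close>. The
  tests come from \<open>F s\<close> only; default information is added afterwards.\<close>

lemma expectation_default_mart_increment:
  "expectation (\<lambda>\<omega>. V \<omega> * (default_mart h X H t \<omega> - default_mart h X H s \<omega>)) = 0"
proof -
  interpret c: markov_chain P F X "t + 1" by (rule mc) (use st in simp)
  have t: "0 \<le> t" using st by simp
  have [measurable]: "V \<in> borel_measurable P" using F_meas_P[OF st(1) V(1)] .
  have bH: "\<bar>V \<omega> * H u \<omega>\<bar> \<le> K" if "\<omega> \<in> space P" for \<omega> u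
    using V(2)[OF that] H_01[of u \<omega>] by auto
  note [measurable] = H_meas_P
  have iH: "integrable P (\<lambda>\<omega>. V \<omega> * H u \<omega>)" for u by (rule c.integrable_bounded[OF _ bH]) measurable
  have cm[measurable]: "comp t \<in> borel_measurable P" "comp s \<in> borel_measurable P"
    using G_meas_P[OF t comp_meas_G[OF t]] G_meas_P[OF st(1) comp_meas_G[OF st(1)]] by auto
  have iC: "integrable P (\<lambda>\<omega>. V \<omega> * (comp t \<omega> - comp s \<omega>))"
  proof (rule c.integrable_bounded[of _ "K * (norm h * (t - s))"])
    fix \<omega> assume \<omega>: "\<omega> \<in> space P"
    show "\<bar>V \<omega> * (comp t \<omega> - comp s \<omega>)\<bar> \<le> K * (norm h * (t - s))"
      unfolding abs_mult using V(2)[OF \<omega>] comp_increment(3)[OF \<omega> st] by (intro mult_mono) auto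
  qed measurable
  have lam[measurable]: "\<Lambda> t \<in> borel_measurable P" "\<Lambda> s \<in> borel_measurable P"
    using F_meas_P[OF t \<Lambda>_meas[OF t]] F_meas_P[OF st(1) \<Lambda>_meas[OF st(1)]] by auto
  have iE: "integrable P (\<lambda>\<omega>. V \<omega> * (1 - exp (- \<Lambda> u \<omega>)))" if u: "u = s \<or> u = t" for u
  proof (rule c.integrable_bounded[of _ K])
    show "(\<lambda>\<omega>. V \<omega> * (1 - exp (- \<Lambda> u \<omega>))) \<in> borel_measurable P" using u lam by auto
    fix \<omega> assume \<omega>: "\<omega> \<in> space P"
    have "\<Lambda> u \<omega> \<ge> 0" using \<Lambda>_mono[OF \<omega>, of 0 u] \<Lambda>_0[OF \<omega>] u st by auto
    then have "\<bar>1 - exp (- \<Lambda> u \<omega>)\<bar> \<le> 1" by (simp add: abs_le_iff)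
    then have "\<bar>V \<omega>\<bar> * \<bar>1 - exp (- \<Lambda> u \<omega>)\<bar> \<le> K * 1" using V(2)[OF \<omega>] by (intro mult_mono) auto
    then show "\<bar>V \<omega> * (1 - exp (- \<Lambda> u \<omega>))\<bar> \<le> K" by (simp add: abs_mult)
  qed
  have "expectation (\<lambda>\<omega>. V \<omega> * (default_mart h X H t \<omega> - default_mart h X H s \<omega>)) =
    expectation (\<lambda>\<omega>. V \<omega> * H t \<omega> - V \<omega> * H s \<omega> - V \<omega> * (comp t \<omega> - comp s \<omega>))"
    by (intro Bochner_Integration.integral_cong) (auto simp: default_mart_eq algebra_simps)
  also have "\<dots> = expectation (\<lambda>\<omega>. V \<omega> * H t \<omega>) - expectation (\<lambda>\<omega>. V \<omega> * H s \<omega>) - expectation (\<lambda>\<omega>. V \<omega> * (comp t \<omega> - comp s \<omega>))"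
    using iH iC by simp
  also have "\<dots> = 0"
  proof -
    have "expectation (\<lambda>\<omega>. V \<omega> * (exp (- \<Lambda> s \<omega>) - exp (- \<Lambda> t \<omega>))) =
      expectation (\<lambda>\<omega>. V \<omega> * (1 - exp (- \<Lambda> t \<omega>)) - V \<omega> * (1 - exp (- \<Lambda> s \<omega>)))"
      by (intro Bochner_Integration.integral_cong) (auto simp: algebra_simps)
    also have "\<dots> = expectation (\<lambda>\<omega>. V \<omega> * (1 - exp (- \<Lambda> t \<omega>))) - expectation (\<lambda>\<omega>. V \<omega> * (1 - exp (- \<Lambda> s \<omega>)))"
      by (rule Bochner_Integration.integral_diff[OF iE iE]) auto
    finally show ?thesis
      using expectation_comp_increment expectation_H[OF t st(1) V] expectation_H[OF st(1) st(1) V] by linarith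
  qed
  finally show ?thesis .
qed

end

lemma default_mart_meas_G: "0 \<le> t \<Longrightarrow> default_mart h X H t \<in> borel_measurable (G t)"
proof -
  assume t: "0 \<le> t"
  have "(\<lambda>\<omega>. H t \<omega> - comp t \<omega>) \<in> borel_measurable (G t)"
    using H_meas_G[OF t, of t] comp_meas_G[OF t] t by (intro borel_measurable_diff) auto
  then show ?thesis by (simp add: default_mart_eq[abs_def])
qed

lemma default_mart_bound: "\<omega> \<in> space P \<Longrightarrow> 0 \<le> t \<Longrightarrow> \<bar>default_mart h X H t \<omega>\<bar> \<le> 1 + norm h * t"
  using comp_bound[of \<omega> t] H_01[of t \<omega>] by (auto simp: default_mart_eq)

lemma integrable_default_mart: "0 \<le> t \<Longrightarrow> integrable P (default_mart h X H t)"
  by (rule integrable_const_bound[of _ "1 + norm h * t"])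
    (use default_mart_bound G_meas_P[OF _ default_mart_meas_G] in \<open>auto intro!: AE_I2\<close>)

lemma default_mart_right:
  assumes \<omega>: "\<omega> \<in> space P" and s: "0 \<le> s" and S: "S \<longlonglongrightarrow> s" "\<And>n. s < S n"
  shows "(\<lambda>n. default_mart h X H (S n) \<omega>) \<longlonglongrightarrow> default_mart h X H s \<omega>"
proof -
  have "filterlim S (at_right s) sequentially" using S by (simp add: filterlim_at less_imp_neq[symmetric])
  then have "(\<lambda>n. H (S n) \<omega>) \<longlonglongrightarrow> H s \<omega>" using H_right by (rule filterlim_compose[rotated])
  moreover have "(\<lambda>n. comp (S n) \<omega> - comp s \<omega>) \<longlonglongrightarrow> 0"
  proof (rule Lim_null_comparison)
    show "eventually (\<lambda>n. norm (comp (S n) \<omega> - comp s \<omega>) \<le> norm h * (S n - s)) sequentially"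
      using comp_increment(3)[OF \<omega> s] S(2) by (auto simp: less_imp_le)
    have "(\<lambda>n. norm h * (S n - s)) \<longlonglongrightarrow> norm h * (s - s)" by (intro tendsto_intros S)
    then show "(\<lambda>n. norm h * (S n - s)) \<longlonglongrightarrow> 0" by simp
  qed
  then have "(\<lambda>n. comp (S n) \<omega>) \<longlonglongrightarrow> comp s \<omega>" by (rule LIM_zero_cancel)
  ultimately show ?thesis unfolding default_mart_eq by (intro tendsto_diff)
qed

text \<open>Take \<open>s' > s\<close>. Where \<open>s' < \<tau> \<omega>\<close>, the event
  \<open>B2\<close> is trivial; where \<open>\<tau> \<omega> \<le> s'\<close>, the process no longer
  moves after \<open>s'\<close>. So for increments from \<open>s'\<close> on a test from
  \<open>F\<close> suffices, and right-continuity lets \<open>s'\<close> decrease to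
  \<open>s\<close>.\<close>

lemma default_mart_basic:
  assumes st: "0 \<le> s" "s \<le> t" and B1: "B1 \<in> sets (F s)" and B2: "B2 \<in> sets (default_filtration P H s)"
  shows "expectation (\<lambda>\<omega>. indicator (B1 \<inter> B2) \<omega> * default_mart h X H t \<omega>) = expectation (\<lambda>\<omega>. indicator (B1 \<inter> B2) \<omega> * default_mart h X H s \<omega>)"
proof (cases "s = t")
  case False
  then have "s < t" using st by simp
  let ?\<xi> = "default_mart h X H"
  let ?B = "B1 \<inter> B2"
  have t: "0 \<le> t" using st by simp
  have Bm[measurable]: "B1 \<in> sets P" "B2 \<in> sets P" using B1 B2 sub_F[OF st(1)] sets_DF_P by (auto simp: subalgebra_def)
  have \<xi>m[measurable]: "?\<xi> u \<in> borel_measurable P" if "0 \<le> u" for u using G_meas_P[OF that default_mart_meas_G[OF that]] .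
  have i: "integrable P (\<lambda>\<omega>. indicator ?B \<omega> * ?\<xi> u \<omega>)" if "0 \<le> u" for u
    using integrable_real_mult_indicator[OF _ integrable_default_mart[OF that], of ?B] by (simp add: mult.commute)
  have mid: "expectation (\<lambda>\<omega>. indicator ?B \<omega> * ?\<xi> t \<omega>) = expectation (\<lambda>\<omega>. indicator ?B \<omega> * ?\<xi> s' \<omega>)"
    if s': "s < s'" "s' \<le> t" for s'
  proof -
    have s'0: "0 \<le> s'" using s' st by simp
    obtain c :: bool where c: "AE \<omega> in P. s' < \<tau> \<omega> \<longrightarrow> (\<omega> \<in> B2 \<longleftrightarrow> c)" using DF_atom[OF B2 s'(1)] by blast
    have "expectation (\<lambda>\<omega>. indicator ?B \<omega> * ?\<xi> t \<omega>) - expectation (\<lambda>\<omega>. indicator ?B \<omega> * ?\<xi> s' \<omega>) =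
      expectation (\<lambda>\<omega>. indicator ?B \<omega> * ?\<xi> t \<omega> - indicator ?B \<omega> * ?\<xi> s' \<omega>)"
      using i[OF t] i[OF s'0] by simp
    also have "\<dots> = expectation (\<lambda>\<omega>. (if c then 1 else 0) * (indicator B1 \<omega> * (?\<xi> t \<omega> - ?\<xi> s' \<omega>)))"
    proof (rule integral_cong_AE)
      show "AE \<omega> in P. indicator ?B \<omega> * ?\<xi> t \<omega> - indicator ?B \<omega> * ?\<xi> s' \<omega> = (if c then 1 else 0) * (indicator B1 \<omega> * (?\<xi> t \<omega> - ?\<xi> s' \<omega>))"
        using c AE_space
      proof eventually_elim
        case (elim \<omega>)
        show ?case
        proof (cases "s' < \<tau> \<omega>")
          case True
          then show ?thesis using elim by (auto simp: indicator_def)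
        next
          case False
          then have "?\<xi> t \<omega> = ?\<xi> s' \<omega>"
            using comp_increment(4)[OF elim(2) s'0 s'(2)] s' by (simp add: default_mart_eq default_ind_def)
          then show ?thesis by simp
        qed
      qed
    qed (use \<xi>m[OF t] \<xi>m[OF s'0] in measurable)
    also have "\<dots> = (if c then 1 else 0) * expectation (\<lambda>\<omega>. indicator B1 \<omega> * (?\<xi> t \<omega> - ?\<xi> s' \<omega>))"
      by simp
    also have "expectation (\<lambda>\<omega>. indicator B1 \<omega> * (?\<xi> t \<omega> - ?\<xi> s' \<omega>)) = 0"
    proof (rule expectation_default_mart_increment[OF s'0 s'(2), of _ 1])
      have "B1 \<in> sets (F s')" using B1 mono_F[of s s'] st s' by auto
      then show "indicator B1 \<in> borel_measurable (F s')" by measurable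
    qed (auto simp: indicator_def)
    finally show ?thesis by simp
  qed
  define S where "S n = s + (t - s) / real (Suc n)" for n
  have S: "s < S n" "S n \<le> t" for n
  proof -
    show "s < S n" using \<open>s < t\<close> by (simp add: S_def)
    have "(t - s) / real (Suc n) \<le> (t - s) / 1" using \<open>s < t\<close> by (intro divide_left_mono) auto
    then show "S n \<le> t" by (simp add: S_def)
  qed
  have "(\<lambda>n. s + (t - s) * inverse (real (Suc n))) \<longlonglongrightarrow> s + (t - s) * 0"
    by (intro tendsto_intros LIMSEQ_inverse_real_of_nat)
  then have S_lim: "S \<longlonglongrightarrow> s" by (simp add: S_def[abs_def] divide_inverse)
  have "(\<lambda>n. expectation (\<lambda>\<omega>. indicator ?B \<omega> * ?\<xi> (S n) \<omega>)) \<longlonglongrightarrow> expectation (\<lambda>\<omega>. indicator ?B \<omega> * ?\<xi> s \<omega>)"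
  proof (rule integral_dominated_convergence[where w="\<lambda>_. 1 + norm h * t"])
    show "(\<lambda>\<omega>. indicator ?B \<omega> * ?\<xi> s \<omega>) \<in> borel_measurable P" using \<xi>m[OF st(1)] by measurable
    show "(\<lambda>\<omega>. indicator ?B \<omega> * ?\<xi> (S n) \<omega>) \<in> borel_measurable P" for n
    proof -
      have "0 \<le> S n" using S(1)[of n] st by simp
      note [measurable] = \<xi>m[OF this]
      show ?thesis by measurable
    qed
    show "AE \<omega> in P. (\<lambda>n. indicator ?B \<omega> * ?\<xi> (S n) \<omega>) \<longlonglongrightarrow> indicator ?B \<omega> * ?\<xi> s \<omega>"
      using AE_space by eventually_elim (intro tendsto_mult tendsto_const default_mart_right st S_lim S)
    show "AE \<omega> in P. norm (indicator ?B \<omega> * ?\<xi> (S n) \<omega>) \<le> 1 + norm h * t" for n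
      using AE_space
    proof eventually_elim
      case (elim \<omega>)
      have "\<bar>?\<xi> (S n) \<omega>\<bar> \<le> 1 + norm h * S n" using S[of n] st by (intro default_mart_bound elim) auto
      also have "\<dots> \<le> 1 + norm h * t" using S[of n] by (simp add: mult_left_mono)
      finally show ?case using t by (auto simp: indicator_def)
    qed
  qed simp
  moreover have "expectation (\<lambda>\<omega>. indicator ?B \<omega> * ?\<xi> (S n) \<omega>) = expectation (\<lambda>\<omega>. indicator ?B \<omega> * ?\<xi> t \<omega>)" for n
    using mid[OF S] by simp
  ultimately show ?thesis by (simp add: LIMSEQ_const_iff)
qed simp

text \<open>The intersections of events of the two filtrations are stable under intersection and
  generate \<open>G s\<close>; Dynkin's argument carries the identity from them to all of
  \<open>G s\<close>.\<close>

lemma martingale_default_mart: "martingale P G (default_mart h X H)"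
proof (rule martingaleI[OF prob_space_axioms])
  let ?\<xi> = "default_mart h X H"
  fix s t :: real and B assume st: "0 \<le> s" "s \<le> t" and B: "B \<in> sets (G s)"
  have t: "0 \<le> t" using st by simp
  define E where "E = {B1 \<inter> B2 |B1 B2. B1 \<in> sets (F s) \<and> B2 \<in> sets (default_filtration P H s)}"
  have spD: "space (default_filtration P H s) = space P" by (simp add: default_filtration_def space_measure_of_conv)
  have EP: "E \<subseteq> sets P" using sub_F[OF st(1)] sets_DF_P[of s] by (auto simp: E_def subalgebra_def)
  have "sets (F s) \<union> sets (default_filtration P H s) \<subseteq> E"
  proof
    fix A assume "A \<in> sets (F s) \<union> sets (default_filtration P H s)"
    then show "A \<in> E"
    proof
      assume A: "A \<in> sets (F s)"
      moreover have "A = A \<inter> space P" using sets.sets_into_space[OF A] space_Ft[OF st(1)] by auto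
      moreover have "space P \<in> sets (default_filtration P H s)" using sets.top[of "default_filtration P H s"] by (simp add: spD)
      ultimately show ?thesis unfolding E_def by blast
    next
      assume A: "A \<in> sets (default_filtration P H s)"
      moreover have "A = space P \<inter> A" using sets.sets_into_space[OF A] spD by auto
      moreover have "space P \<in> sets (F s)" using sets.top[of "F s"] by (simp add: space_Ft[OF st(1)])
      ultimately show ?thesis unfolding E_def by blast
    qed
  qed
  then have "sets (G s) \<subseteq> sigma_sets (space P) E" unfolding sets_G[OF st(1)] by (rule sigma_sets_mono')
  then have "B \<in> sigma_sets (space P) E" using B by auto
  moreover have "Int_stable E"
  proof (rule Int_stableI)
    fix a b assume "a \<in> E" "b \<in> E"
    then obtain a1 a2 b1 b2 where ab: "a = a1 \<inter> a2" "b = b1 \<inter> b2" "a1 \<in> sets (F s)" "b1 \<in> sets (F s)"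
      "a2 \<in> sets (default_filtration P H s)" "b2 \<in> sets (default_filtration P H s)" by (auto simp: E_def)
    then have "a \<inter> b = (a1 \<inter> b1) \<inter> (a2 \<inter> b2)" "a1 \<inter> b1 \<in> sets (F s)" "a2 \<inter> b2 \<in> sets (default_filtration P H s)" by auto
    then show "a \<inter> b \<in> E" unfolding E_def by blast
  qed
  moreover have "E \<subseteq> Pow (space P)" using EP sets.space_closed[of P] by blast
  ultimately have BP: "B \<in> sigma_sets (space P) E" "Int_stable E" "E \<subseteq> Pow (space P)" by blast+
  have sE: "A \<in> sets P" if "A \<in> sigma_sets (space P) E" for A using that sets.sigma_sets_subset[OF EP] by auto
  have si: "set_integrable P A (?\<xi> u)" if "A \<in> sets P" "0 \<le> u" for A u
    unfolding set_integrable_def using integrable_mult_indicator[OF that(1) integrable_default_mart[OF that(2)]] .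
  have "(LINT \<omega>:B|P. ?\<xi> t \<omega>) = (LINT \<omega>:B|P. ?\<xi> s \<omega>)"
    using BP(2,3,1)
  proof (induction rule: sigma_sets_induct_disjoint)
    case (basic A)
    then obtain B1 B2 where "A = B1 \<inter> B2" "B1 \<in> sets (F s)" "B2 \<in> sets (default_filtration P H s)" by (auto simp: E_def)
    then show ?case using default_mart_basic[OF st] by (simp add: set_lebesgue_integral_def)
  next
    case empty
    then show ?case by (simp add: set_lebesgue_integral_def)
  next
    case (compl A)
    have full: "(LINT \<omega>:space P|P. ?\<xi> t \<omega>) = (LINT \<omega>:space P|P. ?\<xi> s \<omega>)"
      using default_mart_basic[OF st, of "space P" "space P"] sets.top[of "F s"] sets.top[of "default_filtration P H s"]
      by (simp add: set_lebesgue_integral_def spD space_Ft[OF st(1)])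
    have A: "A \<in> sets P" using compl sE by auto
    have "(LINT \<omega>:space P - A|P. ?\<xi> u \<omega>) = (LINT \<omega>:space P|P. ?\<xi> u \<omega>) - (LINT \<omega>:A|P. ?\<xi> u \<omega>)" if "0 \<le> u" for u
    proof -
      have "(LINT \<omega>:(space P - A) \<union> A|P. ?\<xi> u \<omega>) = (LINT \<omega>:space P - A|P. ?\<xi> u \<omega>) + (LINT \<omega>:A|P. ?\<xi> u \<omega>)"
        by (rule set_integral_Un) (use A that in \<open>auto intro!: si\<close>)
      moreover have "(space P - A) \<union> A = space P" using sets.sets_into_space[OF A] by auto
      ultimately show ?thesis by simp
    qed
    then show ?case using compl full t st by simp
  next
    case (union A)
    have A: "A i \<in> sets P" for i using union sE by auto
    have "(LINT \<omega>:(\<Union>i. A i)|P. ?\<xi> u \<omega>) = (\<Sum>i. LINT \<omega>:A i|P. ?\<xi> u \<omega>)" if "0 \<le> u" for u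
      by (rule lebesgue_integral_countable_add) (use A union that in \<open>auto intro!: si simp: disjoint_family_on_def\<close>)
    then show ?case using union t st by simp
  qed
  then show "expectation (\<lambda>\<omega>. indicator B \<omega> * ?\<xi> t \<omega>) = expectation (\<lambda>\<omega>. indicator B \<omega> * ?\<xi> s \<omega>)"
    by (simp add: set_lebesgue_integral_def)
qed (auto intro: sub_G default_mart_meas_G integrable_default_mart)

end

context default_model
begin

text \<open>
  Conditionally on \<open>F\<^sub>\<infinity>\<close> the default time has a bounded density, so on a grid of mesh \<open>T / n\<close> the
  probability of default in a cell where the chain moves is \<open>O(N / n)\<close> with \<open>N\<close> the number of jumps.
\<close>

lemma no_jump_at_default:
  assumes T: "T > 0"
  shows "AE \<omega> in P. 0 < \<tau> \<omega> \<longrightarrow> \<tau> \<omega> \<le> T \<longrightarrow> left_lim (\<lambda>v. X v \<omega>) (\<tau> \<omega>) = X (\<tau> \<omega>) \<omega>"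
proof -
  interpret c: markov_chain P F X T by (rule mc[OF T])
  define g where "g n k = T * real k / real (Suc n)" for n k
  have g0: "0 \<le> g n k" for n k using T by (simp add: g_def)
  have gT: "g n k \<le> T" if "k \<le> Suc n" for n k
    using T that by (simp add: g_def divide_le_eq mult_left_mono del: of_nat_Suc)
  have gg: "g n (Suc k) = g n k + T / real (Suc n)" for n k by (simp add: g_def field_simps del: of_nat_Suc) (simp add: algebra_simps)
  have gmono: "g n k \<le> g n l" if "k \<le> l" for n k l using T that by (auto simp: g_def intro!: divide_right_mono mult_left_mono)
  \<comment> \<open>Indicates that the chain differs between the two ends of cell \<open>k\<close>.
    It is known at the right end, so at the left end \<open>expectation_H\<close> is applied with a
    test variable from a later time.\<close>
  define V where "V n k \<omega> = (if X (g n k) \<omega> \<noteq> X (g n (Suc k)) \<omega> then 1 else 0 :: real)" for n k \<omega>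
  have Vm: "V n k \<in> borel_measurable (F (g n (Suc k)))" if k: "k < Suc n" for n k
  proof -
    have T2: "g n k \<in> {0..T}" "g n (Suc k) \<in> {0..T}" using g0 gT k by auto
    have m: "(\<lambda>\<omega>. X (g n k) \<omega> $ i) \<in> borel_measurable (F (g n (Suc k)))" for i
      by (rule c.measurable_F_mono[OF c.X_nth_meas[OF T2(1)]]) (use T2 gmono[of k "Suc k" n] in auto)
    note [measurable] = m c.X_nth_meas[OF T2(2)]
    have "(\<lambda>\<omega>. if \<exists>i. X (g n k) \<omega> $ i \<noteq> X (g n (Suc k)) \<omega> $ i then 1 else 0 :: real) \<in> borel_measurable (F (g n (Suc k)))"
      by measurable
    then show ?thesis by (simp add: V_def[abs_def] vec_eq_iff)
  qed
  have VP: "V n k \<in> borel_measurable P" if "k < Suc n" for n k using F_meas_P[OF g0 Vm[OF that]] .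
  have V1: "\<bar>V n k \<omega>\<bar> \<le> 1" "0 \<le> V n k \<omega>" for n k \<omega> by (auto simp: V_def)
  define C where "C = norm h * T"
  have C: "C \<ge> 0" using T by (simp add: C_def)
  define E where "E n = {\<omega>\<in>space P. \<exists>k<Suc n. g n k < \<tau> \<omega> \<and> \<tau> \<omega> \<le> g n (Suc k) \<and> V n k \<omega> = 1}" for n
  have Em: "E n \<in> sets P" for n
  proof -
    have "{\<omega>\<in>space P. g n k < \<tau> \<omega> \<and> \<tau> \<omega> \<le> g n (Suc k) \<and> V n k \<omega> = 1} \<in> sets P" if "k < Suc n" for k
    proof -
      note [measurable] = VP[OF that] \<tau>_set
      have "{\<omega>\<in>space P. g n k < \<tau> \<omega> \<and> \<tau> \<omega> \<le> g n (Suc k) \<and> V n k \<omega> = 1} =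
        ({\<omega>\<in>space P. \<tau> \<omega> \<le> g n (Suc k)} - {\<omega>\<in>space P. \<tau> \<omega> \<le> g n k}) \<inter> {\<omega>\<in>space P. V n k \<omega> = 1}" by auto
      also have "\<dots> \<in> sets P" by measurable
      finally show ?thesis .
    qed
    then have "(\<Union>k\<in>{..<Suc n}. {\<omega>\<in>space P. g n k < \<tau> \<omega> \<and> \<tau> \<omega> \<le> g n (Suc k) \<and> V n k \<omega> = 1}) \<in> sets P"
      by (intro sets.finite_UN) auto
    also have "(\<Union>k\<in>{..<Suc n}. {\<omega>\<in>space P. g n k < \<tau> \<omega> \<and> \<tau> \<omega> \<le> g n (Suc k) \<and> V n k \<omega> = 1}) = E n" by (auto simp: E_def)
    finally show ?thesis .
  qed
  have cell: "expectation (\<lambda>\<omega>. V n k \<omega> * (H (g n (Suc k)) \<omega> - H (g n k) \<omega>)) \<le> expectation (\<lambda>\<omega>. C * (V n k \<omega> / real (Suc n)))"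
    if k: "k < Suc n" for n k
  proof -
    let ?a = "g n k" and ?b = "g n (Suc k)"
    have ab: "?a \<le> ?b" by (rule gmono) simp
    note [measurable] = VP[OF k] H_meas_P F_meas_P[OF g0 \<Lambda>_meas[OF g0]]
    have iH: "integrable P (\<lambda>\<omega>. V n k \<omega> * H u \<omega>)" for u
    proof (rule c.integrable_bounded[of _ 1])
      show "\<bar>V n k \<omega> * H u \<omega>\<bar> \<le> 1" for \<omega> using V1[of n k \<omega>] H_01[of u \<omega>] by auto
    qed measurable
    have iE: "integrable P (\<lambda>\<omega>. V n k \<omega> * (1 - exp (- \<Lambda> (g n l) \<omega>)))" for l
    proof (rule c.integrable_bounded[of _ 1])
      fix \<omega> assume \<omega>: "\<omega> \<in> space P"
      have "\<Lambda> (g n l) \<omega> \<ge> 0" using \<Lambda>_mono[OF \<omega>, of 0 "g n l"] \<Lambda>_0[OF \<omega>] g0 by simp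
      then have "\<bar>1 - exp (- \<Lambda> (g n l) \<omega>)\<bar> \<le> 1" by (simp add: abs_le_iff)
      then show "\<bar>V n k \<omega> * (1 - exp (- \<Lambda> (g n l) \<omega>))\<bar> \<le> 1" by (auto simp: V_def)
    qed measurable
    have "expectation (\<lambda>\<omega>. V n k \<omega> * (H ?b \<omega> - H ?a \<omega>)) = expectation (\<lambda>\<omega>. V n k \<omega> * H ?b \<omega> - V n k \<omega> * H ?a \<omega>)"
      by (simp add: right_diff_distrib)
    also have "\<dots> = expectation (\<lambda>\<omega>. V n k \<omega> * H ?b \<omega>) - expectation (\<lambda>\<omega>. V n k \<omega> * H ?a \<omega>)"
      using iH by simp
    also have "\<dots> = expectation (\<lambda>\<omega>. V n k \<omega> * (1 - exp (- \<Lambda> ?b \<omega>))) - expectation (\<lambda>\<omega>. V n k \<omega> * (1 - exp (- \<Lambda> ?a \<omega>)))"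
      using expectation_H[OF g0 g0 Vm[OF k] V1(1), of n "Suc k"] expectation_H[OF g0 g0 Vm[OF k] V1(1), of n k] by linarith
    also have "\<dots> = expectation (\<lambda>\<omega>. V n k \<omega> * (1 - exp (- \<Lambda> ?b \<omega>)) - V n k \<omega> * (1 - exp (- \<Lambda> ?a \<omega>)))"
      by (rule Bochner_Integration.integral_diff[OF iE iE, symmetric])
    also have "\<dots> \<le> expectation (\<lambda>\<omega>. C * (V n k \<omega> / real (Suc n)))"
    proof (rule integral_mono)
      show "integrable P (\<lambda>\<omega>. V n k \<omega> * (1 - exp (- \<Lambda> ?b \<omega>)) - V n k \<omega> * (1 - exp (- \<Lambda> ?a \<omega>)))"
        by (rule Bochner_Integration.integrable_diff[OF iE iE])
      have "integrable P (V n k)" by (rule c.integrable_bounded[OF _ V1(1)]) measurable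
      then show "integrable P (\<lambda>\<omega>. C * (V n k \<omega> / real (Suc n)))" by simp
      fix \<omega> assume \<omega>: "\<omega> \<in> space P"
      have 0: "\<Lambda> ?a \<omega> \<ge> 0" using \<Lambda>_mono[OF \<omega>, of 0 ?a] \<Lambda>_0[OF \<omega>] g0 by simp
      define d where "d = \<Lambda> ?b \<omega> - \<Lambda> ?a \<omega>"
      have d0: "0 \<le> d" using \<Lambda>_mono[OF \<omega> g0 ab] by (simp add: d_def)
      \<comment> \<open>The hazard is Lipschitz with constant \<open>norm h\<close>, which bounds
        the conditional probability of default in one cell by \<open>C / Suc n\<close> and explains
        \<open>C = norm h * T\<close>.\<close>
      have "exp (- \<Lambda> ?a \<omega>) - exp (- \<Lambda> ?b \<omega>) = exp (- \<Lambda> ?a \<omega>) * (1 - exp (- d))"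
        by (simp add: d_def right_diff_distrib exp_add[symmetric])
      also have "\<dots> \<le> 1 * d"
        using 0 d0 exp_ge_add_one_self[of "- d"] by (intro mult_mono) auto
      also have "d \<le> norm h * (?b - ?a)" unfolding d_def by (rule \<Lambda>_increment(3)[OF \<omega> g0 ab])
      also have "\<dots> = C / real (Suc n)" by (simp add: gg C_def)
      finally have "exp (- \<Lambda> ?a \<omega>) - exp (- \<Lambda> ?b \<omega>) \<le> C / real (Suc n)" by simp
      then have "V n k \<omega> * (exp (- \<Lambda> ?a \<omega>) - exp (- \<Lambda> ?b \<omega>)) \<le> V n k \<omega> * (C / real (Suc n))"
        by (rule mult_left_mono[OF _ V1(2)])
      then show "V n k \<omega> * (1 - exp (- \<Lambda> ?b \<omega>)) - V n k \<omega> * (1 - exp (- \<Lambda> ?a \<omega>)) \<le> C * (V n k \<omega> / real (Suc n))"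
        by (simp add: algebra_simps)
    qed
    finally show ?thesis .
  qed
  define N where "N n \<omega> = (\<Sum>k<Suc n. V n k \<omega>)" for n \<omega>
  have PE: "prob (E n) \<le> expectation (\<lambda>\<omega>. C * (N n \<omega> / real (Suc n)))" for n
  proof -
    have iH: "integrable P (\<lambda>\<omega>. V n k \<omega> * (H (g n (Suc k)) \<omega> - H (g n k) \<omega>))" if "k < Suc n" for k
    proof (rule c.integrable_bounded[of _ 1])
      note [measurable] = VP[OF that] H_meas_P
      show "(\<lambda>\<omega>. V n k \<omega> * (H (g n (Suc k)) \<omega> - H (g n k) \<omega>)) \<in> borel_measurable P" by measurable
      show "\<bar>V n k \<omega> * (H (g n (Suc k)) \<omega> - H (g n k) \<omega>)\<bar> \<le> 1" for \<omega>
        by (auto simp: V_def default_ind_def)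
    qed
    have iV: "integrable P (\<lambda>\<omega>. C * (V n k \<omega> / real (Suc n)))" if "k < Suc n" for k
    proof -
      have "integrable P (V n k)" by (rule c.integrable_bounded[OF VP[OF that] V1(1)])
      then show ?thesis by simp
    qed
    have "prob (E n) = expectation (indicator (E n))" using Em by simp
    also have "\<dots> \<le> expectation (\<lambda>\<omega>. \<Sum>k<Suc n. V n k \<omega> * (H (g n (Suc k)) \<omega> - H (g n k) \<omega>))"
    proof (rule integral_mono)
      show "integrable P (indicator (E n) :: _ \<Rightarrow> real)" using Em by (simp add: less_top[symmetric])
      show "integrable P (\<lambda>\<omega>. \<Sum>k<Suc n. V n k \<omega> * (H (g n (Suc k)) \<omega> - H (g n k) \<omega>))"
        using iH by (intro Bochner_Integration.integrable_sum) auto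
      fix \<omega> assume "\<omega> \<in> space P"
      have nn: "0 \<le> V n k \<omega> * (H (g n (Suc k)) \<omega> - H (g n k) \<omega>)" for k
        using gmono[of k "Suc k" n] V1(2) by (auto simp: default_ind_def)
      show "indicator (E n) \<omega> \<le> (\<Sum>k<Suc n. V n k \<omega> * (H (g n (Suc k)) \<omega> - H (g n k) \<omega>))"
      proof (cases "\<omega> \<in> E n")
        case True
        then obtain k where k: "k < Suc n" "g n k < \<tau> \<omega>" "\<tau> \<omega> \<le> g n (Suc k)" "V n k \<omega> = 1" by (auto simp: E_def)
        then have "1 = V n k \<omega> * (H (g n (Suc k)) \<omega> - H (g n k) \<omega>)" by (simp add: default_ind_def)
        also have "\<dots> \<le> (\<Sum>k<Suc n. V n k \<omega> * (H (g n (Suc k)) \<omega> - H (g n k) \<omega>))"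
          using k(1) nn by (intro member_le_sum) auto
        finally show ?thesis using True by simp
      next
        case False
        then show ?thesis using nn by (simp add: sum_nonneg del: sum.lessThan_Suc)
      qed
    qed
    also have "\<dots> = (\<Sum>k<Suc n. expectation (\<lambda>\<omega>. V n k \<omega> * (H (g n (Suc k)) \<omega> - H (g n k) \<omega>)))"
      using iH by (intro Bochner_Integration.integral_sum) auto
    also have "\<dots> \<le> (\<Sum>k<Suc n. expectation (\<lambda>\<omega>. C * (V n k \<omega> / real (Suc n))))"
      by (intro sum_mono cell) auto
    also have "\<dots> = expectation (\<lambda>\<omega>. \<Sum>k<Suc n. C * (V n k \<omega> / real (Suc n)))"
      using iV by (intro Bochner_Integration.integral_sum[symmetric]) auto
    also have "\<dots> = expectation (\<lambda>\<omega>. C * (N n \<omega> / real (Suc n)))"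
      by (simp only: N_def sum_distrib_left sum_divide_distrib)
    finally show ?thesis .
  qed
  have Nm: "N n \<in> borel_measurable P" for n
    unfolding N_def[abs_def] by (intro borel_measurable_sum VP) auto
  \<comment> \<open>A cell over which the chain moves contains a jump time, and half-open cells are
    disjoint; choosing one jump per cell is therefore injective.\<close>
  have NJ: "N n \<omega> \<le> real (card (jump_times (\<lambda>v. X v \<omega>) T))" if \<omega>: "\<omega> \<in> space P" for n \<omega>
  proof -
    let ?x = "\<lambda>v. X v \<omega>"
    let ?J = "jump_times ?x T"
    note xp = c.X_cadlag[OF \<omega>] c.X_range[OF \<omega>] T
    define Kn where "Kn = {k. k < Suc n \<and> X (g n k) \<omega> \<noteq> X (g n (Suc k)) \<omega>}"
    have "N n \<omega> = real (card Kn)"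
    proof -
      have "N n \<omega> = (\<Sum>k\<in>{k\<in>{..<Suc n}. X (g n k) \<omega> \<noteq> X (g n (Suc k)) \<omega>}. 1)"
        unfolding N_def V_def by (rule sum.inter_filter[symmetric]) simp
      then show ?thesis by (simp add: Kn_def)
    qed
    moreover have "\<exists>s\<in>?J. g n k < s \<and> s \<le> g n (Suc k)" if k: "k \<in> Kn" for k
    proof (rule ccontr)
      assume no: "\<not> ?thesis"
      have kT: "g n k \<in> {0..T}" "g n (Suc k) \<in> {0..T}" using k g0 gT by (auto simp: Kn_def)
      have "s \<le> g n k \<longleftrightarrow> s \<le> g n (Suc k)" if "s \<in> ?J" for s
        using no that gmono[of k "Suc k" n] by force
      then have "X (g n k) \<omega> = X (g n (Suc k)) \<omega>"
        using state_path_eq_sum_jumps[OF xp kT(1)] state_path_eq_sum_jumps[OF xp kT(2)] by (simp cong: sum.cong)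
      then show False using k by (simp add: Kn_def)
    qed
    then obtain f where f: "\<And>k. k \<in> Kn \<Longrightarrow> f k \<in> ?J \<and> g n k < f k \<and> f k \<le> g n (Suc k)" by metis
    have "inj_on f Kn"
    proof (rule inj_onI)
      fix k l assume kl: "k \<in> Kn" "l \<in> Kn" "f k = f l"
      show "k = l"
      proof (rule ccontr)
        assume "k \<noteq> l"
        then consider "Suc k \<le> l" | "Suc l \<le> k" by linarith
        then show False
        proof cases
          case 1
          then show False using f[OF kl(1)] f[OF kl(2)] kl(3) gmono[of "Suc k" l n] by simp
        next
          case 2
          then show False using f[OF kl(1)] f[OF kl(2)] kl(3) gmono[of "Suc l" k n] by simp
        qed
      qed
    qed
    then have "card Kn \<le> card ?J" using f finite_jump_times[OF xp] by (intro card_inj_on_le) auto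
    ultimately show ?thesis by simp
  qed
  \<comment> \<open>For a fixed path the number of its jumps bounds \<open>N n\<close> and gives the
    limit; the trivial bound \<open>N n \<omega> \<le> Suc n\<close> gives the dominating constant
    \<open>C\<close>, so the expected number of jumps never has to be estimated.\<close>
  have "(\<lambda>n. expectation (\<lambda>\<omega>. C * (N n \<omega> / real (Suc n)))) \<longlonglongrightarrow> expectation (\<lambda>\<omega>. 0)"
  proof (rule integral_dominated_convergence[where w="\<lambda>_. C"])
    show "(\<lambda>\<omega>. C * (N n \<omega> / real (Suc n))) \<in> borel_measurable P" for n using Nm by measurable
    have N0: "0 \<le> N n \<omega>" for n \<omega> unfolding N_def by (intro sum_nonneg V1)
    show "AE \<omega> in P. (\<lambda>n. C * (N n \<omega> / real (Suc n))) \<longlonglongrightarrow> 0"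
      using AE_space
    proof eventually_elim
      case (elim \<omega>)
      define J where "J = real (card (jump_times (\<lambda>v. X v \<omega>) T))"
      have "(\<lambda>n. N n \<omega> / real (Suc n)) \<longlonglongrightarrow> 0"
      proof (rule tendsto_sandwich[where f="\<lambda>_. 0" and h="\<lambda>n. J * inverse (real (Suc n))"])
        show "eventually (\<lambda>n. N n \<omega> / real (Suc n) \<le> J * inverse (real (Suc n))) sequentially"
          using NJ[OF elim] by (intro always_eventually) (simp add: J_def divide_inverse mult_right_mono del: of_nat_Suc)
        have "(\<lambda>n. J * inverse (real (Suc n))) \<longlonglongrightarrow> J * 0" by (intro tendsto_intros LIMSEQ_inverse_real_of_nat)
        then show "(\<lambda>n. J * inverse (real (Suc n))) \<longlonglongrightarrow> 0" by simp
      qed (use N0 in auto)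
      then have "(\<lambda>n. C * (N n \<omega> / real (Suc n))) \<longlonglongrightarrow> C * 0" by (intro tendsto_intros)
      then show ?case by simp
    qed
    show "AE \<omega> in P. norm (C * (N n \<omega> / real (Suc n))) \<le> C" for n
    proof (rule AE_I2)
      fix \<omega>
      have "N n \<omega> \<le> (\<Sum>k<Suc n. 1)" unfolding N_def using V1(1) by (intro sum_mono) (simp add: abs_le_iff)
      then have "N n \<omega> / real (Suc n) \<le> 1" by (simp add: divide_le_eq)
      then have "C * (N n \<omega> / real (Suc n)) \<le> C * 1" using C by (rule mult_left_mono)
      moreover have "0 \<le> C * (N n \<omega> / real (Suc n))" using C N0[of n \<omega>] by simp
      ultimately show "norm (C * (N n \<omega> / real (Suc n))) \<le> C" by simp
    qed
  qed auto
  then have EN: "(\<lambda>n. expectation (\<lambda>\<omega>. C * (N n \<omega> / real (Suc n)))) \<longlonglongrightarrow> 0" by simp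
  have lim0: "(\<lambda>n. prob (E n)) \<longlonglongrightarrow> 0"
    by (rule tendsto_sandwich[OF always_eventually always_eventually tendsto_const EN]) (simp_all only: PE measure_nonneg simp_thms)
  \<comment> \<open>A path with a jump at default lies in \<open>E n\<close> for all large
    \<open>n\<close>, so it suffices that each tail intersection is null.\<close>
  have null: "(\<Inter>n\<in>{m..}. E n) \<in> null_sets P" for m
  proof -
    have sets: "(\<Inter>n\<in>{m..}. E n) \<in> sets P" by (rule sets.countable_INT') (use Em in auto)
    have "prob (\<Inter>n\<in>{m..}. E n) \<le> prob (E n)" if "n \<ge> m" for n
      using that Em by (intro finite_measure_mono) auto
    then have "prob (\<Inter>n\<in>{m..}. E n) \<le> 0"
      by (intro tendsto_lowerbound[OF lim0]) (auto simp: eventually_sequentially)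
    then have "prob (\<Inter>n\<in>{m..}. E n) = 0" by (simp add: measure_le_0_iff)
    then show ?thesis using sets by (simp add: null_sets_def emeasure_eq_measure)
  qed
  have "AE \<omega> in P. \<omega> \<notin> (\<Union>m. \<Inter>n\<in>{m..}. E n)"
    by (intro AE_not_in null_sets_UN null)
  then show ?thesis
    using AE_space
  proof eventually_elim
    case (elim \<omega>)
    show ?case
    proof (intro impI, rule ccontr)
      assume \<tau>: "0 < \<tau> \<omega>" "\<tau> \<omega> \<le> T" and ne: "left_lim (\<lambda>v. X v \<omega>) (\<tau> \<omega>) \<noteq> X (\<tau> \<omega>) \<omega>"
      define s where "s = \<tau> \<omega>"
      have s: "0 < s" "s \<le> T" "s \<in> {0..T}" using \<tau> by (auto simp: s_def)
      obtain d where d: "d > 0" "\<And>v. v \<in> {0..T} \<Longrightarrow> s \<le> v \<Longrightarrow> v < s + d \<Longrightarrow> X v \<omega> = X s \<omega>"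
        "\<And>v. v \<in> {0..T} \<Longrightarrow> s - d < v \<Longrightarrow> v < s \<Longrightarrow> X v \<omega> = left_lim (\<lambda>v. X v \<omega>) s"
        using state_path_local[OF c.X_cadlag[OF elim(2)] c.X_range[OF elim(2)] s(3)] by metis
      obtain m :: nat where m: "T / d < real m" using reals_Archimedean2 by blast
      \<comment> \<open>Once the mesh is below \<open>d\<close>, the left end of the cell containing
        \<open>s\<close> sees the left limit of the path and the right end sees its value at
        \<open>s\<close>.\<close>
      have "\<omega> \<in> E n" if n: "n \<ge> m" for n
      proof -
        have mesh: "T / real (Suc n) < d"
        proof -
          have "T < d * real m" using m d(1) by (simp add: divide_less_eq mult.commute)
          also have "\<dots> \<le> d * real (Suc n)" using n d(1) by (intro mult_left_mono) auto
          finally show ?thesis by (simp add: divide_less_eq del: of_nat_Suc)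
        qed
        \<comment> \<open>\<open>s\<close> measured in cells. With \<open>k\<close> one less than
          the ceiling, \<open>s\<close> falls into the half-open cell from \<open>g n k\<close> to
          \<open>g n (Suc k)\<close> even when it is a grid point.\<close>
        define z where "z = s * real (Suc n) / T"
        have z: "0 < z" "z \<le> real (Suc n)" using s T by (auto simp: z_def divide_le_eq mult.commute intro!: mult_left_mono)
        define k where "k = nat (\<lceil>z\<rceil> - 1)"
        have rk: "real k = of_int \<lceil>z\<rceil> - 1" using z by (simp add: k_def)
        have k: "real k < z" "z \<le> real k + 1" using rk by linarith+
        have kn: "k < Suc n" using k z by linarith
        have sz: "s = T * z / real (Suc n)" using T by (simp add: z_def)
        have a: "g n k < s" unfolding g_def sz using T k by (intro divide_strict_right_mono mult_strict_left_mono) auto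
        have b: "s \<le> g n (Suc k)" unfolding g_def sz using T k by (intro divide_right_mono mult_left_mono) auto
        have kT: "g n k \<in> {0..T}" "g n (Suc k) \<in> {0..T}" using kn g0 gT by auto
        have "X (g n (Suc k)) \<omega> = X s \<omega>" using b a gg[of n k] mesh by (intro d(2) kT) auto
        moreover have "X (g n k) \<omega> = left_lim (\<lambda>v. X v \<omega>) s" using b a gg[of n k] mesh by (intro d(3) kT) auto
        ultimately have "V n k \<omega> = 1" using ne by (simp add: V_def s_def)
        then show ?thesis unfolding E_def using kn a b elim(2) by (auto simp: s_def)
      qed
      then show False using elim(1) by auto
    qed
  qed
qed

end

lemma has_ls_integral_measurable:
  assumes "has_ls_integral f g y a b"
  shows "set_borel_measurable borel {a<..b} f"
  using assms unfolding has_ls_integral_def set_integrable_def set_borel_measurable_def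
  by (auto dest!: borel_measurable_integrable)

lemma jump_count_eq:
  fixes X :: "real \<Rightarrow> 'a \<Rightarrow> real^'n"
  assumes c: "cadlag_on {0..T} (\<lambda>t. X t \<omega>)" and r: "\<And>t. t \<in> {0..T} \<Longrightarrow> X t \<omega> \<in> range state" and T: "T > 0"
    and ij: "i \<noteq> j" and u: "u \<in> {0..T}"
  shows "jump_count X i j u \<omega> = (\<Sum>s\<in>jump_times (\<lambda>v. X v \<omega>) T.
     if s \<le> u then (if left_lim (\<lambda>v. X v \<omega>) s = state i \<and> X s \<omega> = state j then 1 else 0) else 0)"
proof -
  let ?J = "jump_times (\<lambda>v. X v \<omega>) T"
  let ?Q = "\<lambda>s. s \<le> u \<and> left_lim (\<lambda>v. X v \<omega>) s = state i \<and> X s \<omega> = state j"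
  have "(\<Sum>s\<in>?J. if s \<le> u then (if left_lim (\<lambda>v. X v \<omega>) s = state i \<and> X s \<omega> = state j then 1 else 0) else 0) = (\<Sum>s\<in>?J. if ?Q s then 1 else 0 :: real)"
    by (rule sum.cong) auto
  also have "\<dots> = real (card {s\<in>?J. ?Q s})"
    using finite_jump_times[OF c r T] by (simp add: sum.inter_filter[symmetric])
  also have "{s\<in>?J. ?Q s} = {s. 0 < s \<and> s \<le> u \<and> left_lim (\<lambda>v. X v \<omega>) s = state i \<and> X s \<omega> = state j}"
    using ij u by (auto simp: jump_times_def axis_eq_axis)
  finally show ?thesis by (simp add: jump_count_def)
qed

section \<open>The density process\<close>

lemma state_path_nth_integrable:
  fixes x :: "real \<Rightarrow> real^'n"
  assumes c: "cadlag_on {0..T} x" and r: "\<And>t. t \<in> {0..T} \<Longrightarrow> x t \<in> range state" and T: "T > 0"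
    and f: "set_integrable lborel {0..T} f"
  shows "set_integrable lborel {0..T} (\<lambda>u. f u * x u $ i)"
proof -
  have "(\<lambda>u. (indicator {0..T} u *\<^sub>R x u) $ i) \<in> borel_measurable borel"
    by (rule borel_measurable_continuous_on[OF _ borel_measurable_state_path[OF c r T]]) (intro continuous_intros)
  then have m: "set_borel_measurable borel {0..T} (\<lambda>u. x u $ i)" by (simp add: set_borel_measurable_def)
  have "\<bar>x u $ i\<bar> \<le> 1" if u: "u \<in> {0..T}" for u
  proof -
    obtain j where "x u = axis j 1" using r[OF u] by blast
    then show ?thesis by (simp add: axis_def)
  qed
  then have "set_integrable lborel {0..T} (\<lambda>u. x u $ i * f u)" by (rule set_integrable_bounded_mult[OF m _ f])
  then show ?thesis by (simp add: mult.commute)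
qed

text \<open>Uniqueness of the integral identifies the given \<open>y\<close> with the explicit
  value. Measurability of \<open>f\<close> is read off from the existence of \<open>y\<close>, and
  its bound makes it integrable against the compensator.\<close>

lemma jump_mart_integral:
  fixes X :: "real \<Rightarrow> 'a \<Rightarrow> real^'n" and f :: "real \<Rightarrow> real"
  assumes c: "cadlag_on {0..T} (\<lambda>t. X t \<omega>)" and r: "\<And>t. t \<in> {0..T} \<Longrightarrow> X t \<omega> \<in> range state" and T: "T > 0"
    and ij: "i \<noteq> j" and t: "t \<in> {0..T}"
    and A: "set_integrable lborel {0..T} (\<lambda>u. A u $ i $ j)"
    and fb: "\<And>u. u \<in> {0<..t} \<Longrightarrow> \<bar>f u\<bar> \<le> B"
    and y: "has_ls_integral f (\<lambda>u. jump_mart X A i j u \<omega>) y 0 t"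
  shows "set_integrable lborel {0..t} (\<lambda>u. f u * (A u $ i $ j * state_ind X i u \<omega>))"
    "y = (\<Sum>s\<in>jump_times (\<lambda>v. X v \<omega>) T. if s \<le> t then
        f s * (if left_lim (\<lambda>v. X v \<omega>) s = state i \<and> X s \<omega> = state j then 1 else 0) else 0)
      - (LBINT u:{0..t}. f u * (A u $ i $ j * state_ind X i u \<omega>))"
proof -
  let ?J = "jump_times (\<lambda>v. X v \<omega>) T"
  define d where "d s = (if left_lim (\<lambda>v. X v \<omega>) s = state i \<and> X s \<omega> = state j then 1 else 0 :: real)" for s
  define w where "w u = A u $ i $ j * state_ind X i u \<omega>" for u
  have fin: "finite ?J" by (rule finite_jump_times[OF c r T])
  have si: "state_ind X i u \<omega> = X u \<omega> $ i" if u: "u \<in> {0..T}" for u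
  proof -
    obtain k where k: "X u \<omega> = axis k 1" using r[OF u] by blast
    show ?thesis by (auto simp: state_ind_def k axis_eq_axis) (auto simp: axis_def)
  qed
  have "set_integrable lborel {0..T} (\<lambda>u. A u $ i $ j * X u \<omega> $ i)"
    by (rule state_path_nth_integrable[OF c r T A])
  then have "set_integrable lborel {0..T} w"
    by (rule set_integrable_cong[THEN iffD1, rotated -1]) (auto simp: w_def si)
  then have wt: "set_integrable lborel {0..t} w" by (rule set_integrable_subset) (use t in auto)
  have fm: "set_borel_measurable borel {0<..t} f" by (rule has_ls_integral_measurable[OF y])
  have "set_integrable lborel {0<..t} w" by (rule set_integrable_subset[OF wt]) auto
  then have fw: "set_integrable lborel {0<..t} (\<lambda>u. f u * w u)" by (rule set_integrable_bounded_mult[OF fm fb, rotated])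
  then show "set_integrable lborel {0..t} (\<lambda>u. f u * (A u $ i $ j * state_ind X i u \<omega>))"
    unfolding w_def by (simp only: set_integral_Ioc_Icc)
  have "has_ls_integral f (\<lambda>u. jump_mart X A i j u \<omega>) ((LBINT u:{0<..t}. f u * (- w u)) + (\<Sum>s\<in>{s\<in>?J. s \<le> t}. f s * d s)) 0 t"
  proof (rule has_ls_integral_AC_jumps[OF _ _ fm, where C=0])
    show "set_integrable lborel {0..t} (\<lambda>u. - w u)" "set_integrable lborel {0<..t} (\<lambda>u. f u * (- w u))"
      using wt fw by (auto simp: set_integrable_def)
    fix u assume u: "u \<in> {0..t}"
    then have uT: "u \<in> {0..T}" using t by auto
    have jc: "jump_count X i j u \<omega> = (\<Sum>s\<in>?J. if s \<le> u then d s else 0)"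
      unfolding d_def by (rule jump_count_eq[where X=X and \<omega>=\<omega>, OF c r T ij uT])
    have "(\<Sum>s\<in>{s\<in>?J. s \<le> t}. if s \<le> u then d s else 0) = (\<Sum>s\<in>?J. if s \<le> u then d s else 0)"
      using fin u by (intro sum.mono_neutral_left) auto
    then show "jump_mart X A i j u \<omega> = 0 + (LBINT s:{0..u}. - w s) + (\<Sum>s\<in>{s\<in>?J. s \<le> t}. if s \<le> u then d s else 0)"
      using jc by (simp add: jump_mart_def w_def set_lebesgue_integral_def)
  next
    show "finite {s\<in>?J. s \<le> t}" using fin by simp
    show "{s\<in>?J. s \<le> t} \<subseteq> {0<..t}" by (auto simp: jump_times_def)
  qed (use t in auto)
  from has_ls_integral_unique[OF y this]
  have "y = (LBINT u:{0<..t}. f u * (- w u)) + (\<Sum>s\<in>{s\<in>?J. s \<le> t}. f s * d s)" .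
  moreover have "(LBINT u:{0<..t}. f u * (- w u)) = - (LBINT u:{0..t}. f u * w u)"
    unfolding set_integral_Ioc_Icc by (simp add: set_lebesgue_integral_def)
  moreover have "(\<Sum>s\<in>{s\<in>?J. s \<le> t}. f s * d s) = (\<Sum>s\<in>?J. if s \<le> t then f s * d s else 0)"
    using fin by (simp add: sum.inter_filter)
  ultimately show "y = (\<Sum>s\<in>?J. if s \<le> t then f s * (if left_lim (\<lambda>v. X v \<omega>) s = state i \<and> X s \<omega> = state j then 1 else 0) else 0)
      - (LBINT u:{0..t}. f u * (A u $ i $ j * state_ind X i u \<omega>))"
    unfolding d_def w_def by simp
qed

text \<open>Path by path the density equation is linear with finitely many jumps. A jump from
  \<open>i\<close> to \<open>j\<close> multiplies by one plus the entry of \<kappa> at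
  \<open>(i, j)\<close>, a positive number, and the drift is at most the left limit times an
  integrable function.\<close>

lemma density_process_pos:
  fixes X :: "real \<Rightarrow> 'a \<Rightarrow> real^'n" and \<eta> :: "real \<Rightarrow> 'a \<Rightarrow> real"
  assumes T: "T > 0" and c: "\<And>\<omega>. \<omega> \<in> space P \<Longrightarrow> cadlag_on {0..T} (\<lambda>t. X t \<omega>)"
    and r: "\<And>\<omega> t. \<omega> \<in> space P \<Longrightarrow> t \<in> {0..T} \<Longrightarrow> X t \<omega> \<in> range state"
    and A: "generator_matrices A" and \<kappa>: "kappa_admissible \<kappa>" and \<eta>: "density_process P F X A \<kappa> \<eta>"
  shows "AE \<omega> in P. \<forall>t\<in>{0..T}. \<eta> t \<omega> > 0"
proof -
  have "AE \<omega> in P. \<forall>t\<ge>0. \<exists>c.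
        (\<forall>i j. i \<noteq> j \<longrightarrow> has_ls_integral (\<lambda>u. left_lim (\<lambda>v. \<eta> v \<omega>) u * \<kappa> u $ i $ j)
                          (\<lambda>u. jump_mart X A i j u \<omega>) (c i j) 0 t) \<and>
        \<eta> t \<omega> = 1 + (\<Sum>i\<in>UNIV. \<Sum>j\<in>UNIV - {i}. c i j)"
    using \<eta> by (simp add: density_process_def)
  then show ?thesis
    using AE_space
  proof eventually_elim
    case (elim \<omega>)
    note c' = c[OF elim(2)] and r' = r[OF elim(2)]
    define E where "E t = \<eta> t \<omega>" for t
    define J where "J = jump_times (\<lambda>v. X v \<omega>) T"
    define d where "d i j s = (if left_lim (\<lambda>v. X v \<omega>) s = state i \<and> X s \<omega> = state j then 1 else 0 :: real)" for i j s
    define b where "b i j u = A u $ i $ j * state_ind X i u \<omega>" for i j u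
    have Ai: "set_integrable lborel {0..T} (\<lambda>u. A u $ i $ j)" for i j
      using A T by (simp add: generator_matrices_def)
    have A0: "0 \<le> A u $ i $ j" if "i \<noteq> j" "0 \<le> u" for u i j
      using A that by (auto simp: generator_matrices_def)
    have "\<exists>B. \<forall>t\<ge>0. \<bar>\<kappa> t $ i $ j\<bar> \<le> B" for i j
    proof -
      have "bounded ((\<lambda>t. \<kappa> t $ i $ j) ` {0..})" using \<kappa> by (simp add: kappa_admissible_def)
      then show ?thesis by (auto simp: bounded_iff)
    qed
    then obtain Bk where Bk: "\<And>t i j. 0 \<le> t \<Longrightarrow> \<bar>\<kappa> t $ i $ j\<bar> \<le> Bk i j" by metis
    have Bk0: "0 \<le> Bk i j" for i j using Bk[of 0 i j] by simp
    have Ec0: "cadlag_on {0..} E" using \<eta> elim(2) by (auto simp: density_process_def E_def[abs_def])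
    have Ec: "cadlag_on {0..T} E" by (rule cadlag_on_subset[OF Ec0]) auto
    obtain B where B: "B > 0" "\<And>t. t \<in> {0..T} \<Longrightarrow> \<bar>E t\<bar> \<le> B" using cadlag_on_bounded[OF Ec] T by auto
    have lB: "\<bar>left_lim E u\<bar> \<le> B" if u: "u \<in> {0<..T}" for u
    proof -
      have "(E \<longlongrightarrow> left_lim E u) (at_left u)" using u by (intro cadlag_on_left_lim[OF Ec]) auto
      then have l: "((\<lambda>v. \<bar>E v\<bar>) \<longlongrightarrow> \<bar>left_lim E u\<bar>) (at_left u)" by (rule tendsto_rabs)
      have "eventually (\<lambda>v. \<bar>E v\<bar> \<le> B) (at_left u)"
        by (rule eventually_at_leftI[of 0]) (use u B in auto)
      then show ?thesis by (rule tendsto_upperbound[OF l]) simp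
    qed
    define f where "f i j u = left_lim E u * \<kappa> u $ i $ j" for i j u
    have fb: "\<bar>f i j u\<bar> \<le> B * Bk i j" if u: "u \<in> {0<..T}" for i j u
      unfolding f_def abs_mult using lB[OF u] Bk[of u i j] u B by (intro mult_mono) auto
    have repr: "\<exists>y. (\<forall>i j. i \<noteq> j \<longrightarrow> set_integrable lborel {0..t} (\<lambda>u. f i j u * b i j u) \<and>
        y i j = (\<Sum>s\<in>J. if s \<le> t then f i j s * d i j s else 0) - (LBINT u:{0..t}. f i j u * b i j u)) \<and>
        E t = 1 + (\<Sum>i\<in>UNIV. \<Sum>j\<in>UNIV - {i}. y i j)" if t: "t \<in> {0..T}" for t
    proof -
      have "0 \<le> t" using t by simp
      then obtain y where y0: "\<forall>i j. i \<noteq> j \<longrightarrow> has_ls_integral (\<lambda>u. left_lim (\<lambda>v. \<eta> v \<omega>) u * \<kappa> u $ i $ j)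
          (\<lambda>u. jump_mart X A i j u \<omega>) (y i j) 0 t"
        "\<eta> t \<omega> = 1 + (\<Sum>i\<in>UNIV. \<Sum>j\<in>UNIV - {i}. y i j)"
        using elim(1) by (elim allE[of _ t]) blast
      have "f i j = (\<lambda>u. left_lim (\<lambda>v. \<eta> v \<omega>) u * \<kappa> u $ i $ j)" for i j
        by (simp add: f_def[abs_def] E_def[abs_def])
      then have y: "\<And>i j. i \<noteq> j \<Longrightarrow> has_ls_integral (f i j) (\<lambda>u. jump_mart X A i j u \<omega>) (y i j) 0 t"
        "E t = 1 + (\<Sum>i\<in>UNIV. \<Sum>j\<in>UNIV - {i}. y i j)"
        using y0 by (simp_all only: E_def not_False_eq_True simp_thms)
      have "set_integrable lborel {0..t} (\<lambda>u. f i j u * b i j u) \<and>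
        y i j = (\<Sum>s\<in>J. if s \<le> t then f i j s * d i j s else 0) - (LBINT u:{0..t}. f i j u * b i j u)" if "i \<noteq> j" for i j
      proof -
        have fb': "\<bar>f i j u\<bar> \<le> B * Bk i j" if "u \<in> {0<..t}" for u using fb that t by auto
        show ?thesis
          using jump_mart_integral[where X=X and \<omega>=\<omega>, OF c' r' T \<open>i \<noteq> j\<close> t Ai fb' y(1)[OF \<open>i \<noteq> j\<close>]]
          unfolding b_def d_def J_def by blast
      qed
      then show ?thesis using y(2) by blast
    qed
    \<comment> \<open>The data of \<open>linear_equation_positive\<close>: \<open>v\<close> is the
      drift, \<open>k s\<close> the relative jump at \<open>s\<close>, and \<open>w\<close> the
      integrable bound of the drift per unit of left limit.\<close>
    define v where "v u = (\<Sum>i\<in>UNIV. \<Sum>j\<in>UNIV - {i}. f i j u * b i j u)" for u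
    define k where "k s = (\<Sum>i\<in>UNIV. \<Sum>j\<in>UNIV - {i}. \<kappa> s $ i $ j * d i j s)" for s
    define w where "w u = (\<Sum>i\<in>UNIV. \<Sum>j\<in>UNIV - {i}. Bk i j * A u $ i $ j)" for u
    have fbi: "set_integrable lborel {0..t} (\<lambda>u. f i j u * b i j u)" if "t \<in> {0..T}" "i \<noteq> j" for t i j
      using repr[OF that(1)] that(2) by blast
    have Epos: "E t > 0" if t: "t \<in> {0..T}" for t
    proof (rule linear_equation_positive[OF Ec, where J=J and k=k and w=w and v=v])
      show "finite J" unfolding J_def by (rule finite_jump_times[OF c' r' T])
      show "J \<subseteq> {0<..T}" by (auto simp: J_def jump_times_def)
      show "k s > -1" if s: "s \<in> J" for s
      proof -
        have s': "s \<in> {0<..T}" "left_lim (\<lambda>v. X v \<omega>) s \<noteq> X s \<omega>" using s by (auto simp: J_def jump_times_def)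
        obtain i0 where i0: "left_lim (\<lambda>v. X v \<omega>) s = axis i0 1"
          using state_path_left_lim_range[OF c' r' T s'(1)] by blast
        obtain j0 where j0: "X s \<omega> = axis j0 1" using r'[of s] s'(1) by auto
        have ne: "i0 \<noteq> j0" using s'(2) i0 j0 by auto
        \<comment> \<open>At a jump time exactly one pair of states contributes, so the double sum
          collapses to a single entry of \<kappa>.\<close>
        have dij: "d i j s = (if j = j0 then if i = i0 then 1 else 0 else 0)" for i j
          by (auto simp: d_def i0 j0 axis_eq_axis)
        have "(\<Sum>j\<in>UNIV - {i}. \<kappa> s $ i $ j * d i j s) = (if i = i0 then \<kappa> s $ i0 $ j0 else 0)" for i
        proof -
          have "(\<Sum>j\<in>UNIV - {i}. \<kappa> s $ i $ j * d i j s) = (\<Sum>j\<in>UNIV - {i}. if j = j0 then \<kappa> s $ i $ j0 * (if i = i0 then 1 else 0) else 0)"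
            by (rule sum.cong) (auto simp: dij)
          also have "\<dots> = (if j0 \<in> UNIV - {i} then \<kappa> s $ i $ j0 * (if i = i0 then 1 else 0) else 0)"
            by (rule sum.delta) simp
          finally show ?thesis using ne by auto
        qed
        then have "k s = (\<Sum>i\<in>UNIV. if i = i0 then \<kappa> s $ i0 $ j0 else 0)" by (simp only: k_def)
        also have "\<dots> = \<kappa> s $ i0 $ j0" by simp
        also have "\<dots> > -1" using \<kappa> s'(1) by (auto simp: kappa_admissible_def)
        finally show ?thesis .
      qed
      show "set_integrable lborel {0..T} w" unfolding w_def
        by (intro set_integral_finite_sum set_integrable_mult_right impI Ai)
      show "0 \<le> w u" if "u \<in> {0..T}" for u
        unfolding w_def using that by (intro sum_nonneg mult_nonneg_nonneg Bk0 A0) auto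
      show "set_integrable lborel {0..T} v" unfolding v_def
        using T by (intro set_integral_finite_sum fbi) auto
      show "\<bar>v u\<bar> \<le> \<bar>left_lim E u\<bar> * w u" if u: "u \<in> {0<..T}" for u
      proof -
        have "\<bar>v u\<bar> \<le> (\<Sum>i\<in>UNIV. \<Sum>j\<in>UNIV - {i}. \<bar>f i j u * b i j u\<bar>)"
          unfolding v_def by (intro order_trans[OF sum_abs] sum_mono sum_abs)
        also have "\<dots> \<le> (\<Sum>i\<in>UNIV. \<Sum>j\<in>UNIV - {i}. \<bar>left_lim E u\<bar> * (Bk i j * A u $ i $ j))"
        proof (intro sum_mono)
          fix i j :: 'n assume "j \<in> UNIV - {i}"
          then have a0: "0 \<le> A u $ i $ j" using A0[of i j u] u by auto
          have "\<bar>b i j u\<bar> \<le> A u $ i $ j" using a0 by (simp add: b_def state_ind_def)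
          then have "\<bar>\<kappa> u $ i $ j\<bar> * \<bar>b i j u\<bar> \<le> Bk i j * A u $ i $ j"
            using Bk[of u i j] u Bk0 by (intro mult_mono) auto
          then have "\<bar>left_lim E u\<bar> * (\<bar>\<kappa> u $ i $ j\<bar> * \<bar>b i j u\<bar>) \<le> \<bar>left_lim E u\<bar> * (Bk i j * A u $ i $ j)"
            by (intro mult_left_mono) auto
          then show "\<bar>f i j u * b i j u\<bar> \<le> \<bar>left_lim E u\<bar> * (Bk i j * A u $ i $ j)"
            by (simp add: f_def abs_mult mult.assoc)
        qed
        also have "\<dots> = \<bar>left_lim E u\<bar> * w u" by (simp add: w_def sum_distrib_left)
        finally show ?thesis .
      qed
      show "E t = 1 + (\<Sum>s\<in>J. if s \<le> t then left_lim E s * k s else 0) - (LBINT u:{0..t}. v u)" if t: "t \<in> {0..T}" for t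
      proof -
        obtain y where y: "\<And>i j. i \<noteq> j \<Longrightarrow> y i j = (\<Sum>s\<in>J. if s \<le> t then f i j s * d i j s else 0) - (LBINT u:{0..t}. f i j u * b i j u)"
          "E t = 1 + (\<Sum>i\<in>UNIV. \<Sum>j\<in>UNIV - {i}. y i j)"
          using repr[OF t] by blast
        have "(\<Sum>i\<in>UNIV. \<Sum>j\<in>UNIV - {i}. y i j) =
           (\<Sum>i\<in>UNIV. \<Sum>j\<in>UNIV - {i}. (\<Sum>s\<in>J. if s \<le> t then f i j s * d i j s else 0) - (LBINT u:{0..t}. f i j u * b i j u))"
          by (intro sum.cong refl y(1)) auto
        also have "\<dots> = (\<Sum>i\<in>UNIV. \<Sum>j\<in>UNIV - {i}. \<Sum>s\<in>J. if s \<le> t then f i j s * d i j s else 0)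
            - (\<Sum>i\<in>UNIV. \<Sum>j\<in>UNIV - {i}. LBINT u:{0..t}. f i j u * b i j u)"
          by (simp add: sum_subtractf)
        also have "(\<Sum>i\<in>UNIV. \<Sum>j\<in>UNIV - {i}. LBINT u:{0..t}. f i j u * b i j u) = (LBINT u:{0..t}. v u)"
        proof -
          have "(LBINT u:{0..t}. v u) = (\<Sum>i\<in>UNIV. LBINT u:{0..t}. \<Sum>j\<in>UNIV - {i}. f i j u * b i j u)"
            unfolding v_def by (intro set_integral_finite_sum fbi t) auto
          also have "\<dots> = (\<Sum>i\<in>UNIV. \<Sum>j\<in>UNIV - {i}. LBINT u:{0..t}. f i j u * b i j u)"
            by (intro sum.cong refl set_integral_finite_sum fbi t) auto
          finally show ?thesis by simp
        qed
        also have "(\<Sum>i\<in>UNIV. \<Sum>j\<in>UNIV - {i}. \<Sum>s\<in>J. if s \<le> t then f i j s * d i j s else 0) =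
           (\<Sum>i\<in>UNIV. \<Sum>s\<in>J. \<Sum>j\<in>UNIV - {i}. if s \<le> t then f i j s * d i j s else 0)"
          by (intro sum.cong refl sum.swap)
        also have "\<dots> = (\<Sum>s\<in>J. \<Sum>i\<in>UNIV. \<Sum>j\<in>UNIV - {i}. if s \<le> t then f i j s * d i j s else 0)"
          by (rule sum.swap)
        also have "\<dots> = (\<Sum>s\<in>J. if s \<le> t then left_lim E s * k s else 0)"
          by (intro sum.cong refl) (simp add: k_def f_def sum_distrib_left mult.assoc)
        finally show ?thesis using y(2) by simp
      qed
    qed (rule t)
    then show ?case by (simp add: E_def)
  qed
qed

section \<open>Price dynamics\<close>

text \<open>By time \<open>t\<close> a jump \<open>d s\<close> of the step function has contributed
  \<open>f t * d s\<close>: of this \<open>f s * d s\<close> at once and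
  \<open>(f t - f s) * d s\<close> through the integral. As \<open>f\<close> has no jumps, its value
  at \<open>s\<close> serves as left limit.\<close>

lemma AC_times_step:
  fixes f w y d :: "real \<Rightarrow> real"
  assumes w: "set_integrable lborel {0..T} w" and f: "\<And>t. t \<in> {0..T} \<Longrightarrow> f t = f 0 + (LBINT u:{0..t}. w u)"
    and J: "finite J" "J \<subseteq> {0<..T}" and y: "\<And>u. u \<in> {0..T} \<Longrightarrow> y u = y 0 + (\<Sum>s\<in>J. if s \<le> u then d s else 0)"
    and t: "t \<in> {0..T}"
  shows "f t * y t = f 0 * y 0 + (LBINT u:{0..t}. w u * y u) + (\<Sum>s\<in>J. if s \<le> t then f s * d s else 0)"
proof -
  have wi: "set_integrable lborel {a..b} w" if "0 \<le> a" "b \<le> T" for a b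
    using that by (intro set_integrable_subset[OF w]) auto
  have ind: "set_integrable lborel {0..t} (\<lambda>u. if s \<le> u then w u * d s else 0)"
    "(LBINT u:{0..t}. if s \<le> u then w u * d s else 0) = (if s \<le> t then (f t - f s) * d s else 0)" if s: "s \<in> J" for s
  proof -
    have s0: "0 < s" "s \<le> T" using s J by auto
    have eq: "(\<lambda>u. indicator {0..t} u *\<^sub>R (if s \<le> u then w u * d s else 0)) = (\<lambda>u. (indicator {s..t} u *\<^sub>R w u) * d s)"
      using s0 by (auto simp: fun_eq_iff indicator_def)
    have i: "set_integrable lborel {s..t} w" using s0 t by (intro wi) auto
    show "set_integrable lborel {0..t} (\<lambda>u. if s \<le> u then w u * d s else 0)"
      using i unfolding set_integrable_def eq by (rule integrable_mult_left)
    have "(LBINT u:{0..t}. if s \<le> u then w u * d s else 0) = (LBINT u:{s..t}. w u) * d s"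
      unfolding set_lebesgue_integral_def eq by simp
    also have "(LBINT u:{s..t}. w u) = (if s \<le> t then f t - f s else 0)"
    proof (cases "s \<le> t")
      case True
      have sT: "s \<in> {0..T}" using s0 by auto
      have "(LBINT u:{0..t}. w u) = (LBINT u:{0..s}. w u) + (LBINT u:{s..t}. w u)"
        using s0 t True by (intro set_integral_Icc_split wi) auto
      then show ?thesis using f[OF t] f[OF sT] True by simp
    qed (simp add: set_lebesgue_integral_def)
    finally show "(LBINT u:{0..t}. if s \<le> u then w u * d s else 0) = (if s \<le> t then (f t - f s) * d s else 0)" by simp
  qed
  have i0: "set_integrable lborel {0..t} (\<lambda>u. w u * y 0)"
    using t by (intro set_integrable_mult_left impI wi) auto
  have "(LBINT u:{0..t}. w u * y u) = (LBINT u:{0..t}. w u * y 0 + (\<Sum>s\<in>J. if s \<le> u then w u * d s else 0))"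
  proof (intro set_lebesgue_integral_cong allI impI)
    fix u assume "u \<in> {0..t}"
    then have uT: "u \<in> {0..T}" using t by auto
    have "w u * y u = w u * (y 0 + (\<Sum>s\<in>J. if s \<le> u then d s else 0))" by (simp only: y[OF uT, symmetric])
    also have "\<dots> = w u * y 0 + (\<Sum>s\<in>J. if s \<le> u then w u * d s else 0)"
      unfolding distrib_left sum_distrib_left by (intro arg_cong2[where f="(+)"] sum.cong refl) simp
    finally show "w u * y u = w u * y 0 + (\<Sum>s\<in>J. if s \<le> u then w u * d s else 0)" .
  qed simp
  also have "\<dots> = (LBINT u:{0..t}. w u * y 0) + (LBINT u:{0..t}. \<Sum>s\<in>J. if s \<le> u then w u * d s else 0)"
    by (intro set_integral_add i0 set_integral_finite_sum ind)
  also have "(LBINT u:{0..t}. w u * y 0) = (f t - f 0) * y 0" using f[OF t] by simp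
  also have "(LBINT u:{0..t}. \<Sum>s\<in>J. if s \<le> u then w u * d s else 0) = (\<Sum>s\<in>J. if s \<le> t then (f t - f s) * d s else 0)"
    by (subst set_integral_finite_sum(2)) (auto simp: ind)
  finally have "(LBINT u:{0..t}. w u * y u) = (f t - f 0) * y 0 + (\<Sum>s\<in>J. if s \<le> t then (f t - f s) * d s else 0)" .
  moreover have "(\<Sum>s\<in>J. if s \<le> t then (f t - f s) * d s else 0) + (\<Sum>s\<in>J. if s \<le> t then f s * d s else 0) =
      f t * (\<Sum>s\<in>J. if s \<le> t then d s else 0)"
    unfolding sum.distrib[symmetric] sum_distrib_left by (intro sum.cong refl) (simp add: algebra_simps)
  ultimately show ?thesis using y[OF t] by (simp add: algebra_simps)
qed

text \<open>At a basis vector the product of two linear forms is linear again, with coordinatewise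
  products as coefficients. So the whole discount rate becomes one linear form in the state.\<close>

definition rmv_rate :: "real^'n \<Rightarrow> real^'n \<Rightarrow> real^'n \<Rightarrow> real^'n" where
  "rmv_rate r h L = (\<chi> i. r $ i + h $ i * L $ i)"

section \<open>The pre-default price as a function of the current state\<close>

context markov_chain
begin

lemma rmv_discount_eq:
  assumes "\<omega> \<in> space M" "0 \<le> t" "t \<le> T"
  shows "rmv_discount r h L X T t \<omega> = discount (rmv_rate r h L) t T \<omega>"
proof -
  have "(LBINT s:{t..T}. r \<bullet> X s \<omega> + (h \<bullet> X s \<omega>) * (L \<bullet> X s \<omega>)) = (LBINT s:{t..T}. rmv_rate r h L \<bullet> X s \<omega>)"
  proof (intro set_lebesgue_integral_cong allI impI)
    fix s assume "s \<in> {t..T}"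
    then obtain i where "X s \<omega> = axis i 1" using X_range[of \<omega> s] assms by auto
    then show "r \<bullet> X s \<omega> + (h \<bullet> X s \<omega>) * (L \<bullet> X s \<omega>) = rmv_rate r h L \<bullet> X s \<omega>"
      by (simp add: inner_axis rmv_rate_def)
  qed simp
  then show ?thesis by (simp add: rmv_discount_def discount_def)
qed

context
  fixes A :: "real \<Rightarrow> real^'n^'n" and \<phi> :: "real \<Rightarrow> real^'n" and r h L :: "real^'n"
  assumes gen: "\<And>u. 0 < u \<Longrightarrow> u < T \<Longrightarrow> has_generator_at M X A u"
    and \<phi>: "continuous_on {0..T} \<phi>" "\<phi> T = (\<chi> i. 1)"
      "\<And>u i. 0 < u \<Longrightarrow> u < T \<Longrightarrow> ((\<lambda>t. \<phi> t $ i) has_real_derivative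
         rmv_rate r h L $ i * \<phi> u $ i - (\<Sum>j\<in>UNIV. A u $ i $ j * \<phi> u $ j)) (at u)"
begin

lemma expectation_rmv_discount:
  fixes K :: real
  assumes t: "0 \<le> t" "t \<le> T" and V: "V \<in> borel_measurable (F t)" "\<And>\<omega>. \<omega> \<in> space M \<Longrightarrow> \<bar>V \<omega>\<bar> \<le> K"
  shows "expectation (\<lambda>\<omega>. V \<omega> * rmv_discount r h L X T t \<omega>) = expectation (\<lambda>\<omega>. V \<omega> * (\<phi> t \<bullet> X t \<omega>))"
proof -
  have "expectation (\<lambda>\<omega>. V \<omega> * rmv_discount r h L X T t \<omega>) = expectation (\<lambda>\<omega>. V \<omega> * discount (rmv_rate r h L) t T \<omega>)"
    by (intro Bochner_Integration.integral_cong refl) (simp add: rmv_discount_eq t)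
  also have "\<dots> = expectation (\<lambda>\<omega>. V \<omega> * (\<phi> t \<bullet> X t \<omega>))"
    by (rule feynman_kac[OF gen \<phi> t V])
  finally show ?thesis .
qed

lemma rmv_discount_measurable: "0 \<le> t \<Longrightarrow> t \<le> T \<Longrightarrow> rmv_discount r h L X T t \<in> borel_measurable M"
proof -
  assume t: "0 \<le> t" "t \<le> T"
  have "discount (rmv_rate r h L) t T \<in> borel_measurable M"
    using measurable_F_M[OF discount_measurable[OF t order_refl]] T by simp
  then show ?thesis
    by (rule measurable_cong[THEN iffD1, rotated]) (simp add: rmv_discount_eq t)
qed

text \<open>Testing with the indicator of state \<open>i\<close> expresses the discounted mass as
  \<open>\<phi> t $ i\<close> times the probability of that state. Positivity is read off from this
  formula, the discount factor being bounded below, and not from the differential equation.\<close>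

lemma psi_eq_solution:
  assumes t: "t \<in> {0..T}" and pos: "\<P>(\<omega> in M. X t \<omega> = state i) > 0"
  shows "psi M r h L X T t $ i = \<phi> t $ i" "\<phi> t $ i \<ge> exp (- (norm (rmv_rate r h L) * T))"
proof -
  have t0: "0 \<le> t" "t \<le> T" using t by auto
  let ?B = "{\<omega>\<in>space M. X t \<omega> = state i}"
  let ?e = "exp (- (norm (rmv_rate r h L) * T))"
  have VM: "(\<lambda>\<omega>. X t \<omega> $ i) \<in> borel_measurable M" using measurable_F_M[OF X_nth_meas[OF t] t] .
  have iX: "integrable M (\<lambda>\<omega>. X t \<omega> $ i)" by (rule integrable_bounded[OF VM X_nth_bound[OF _ t]])
  have "(LINT \<omega>:?B|M. rmv_discount r h L X T t \<omega>) = expectation (\<lambda>\<omega>. X t \<omega> $ i * rmv_discount r h L X T t \<omega>)"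
    unfolding set_lebesgue_integral_def
    by (intro Bochner_Integration.integral_cong refl) (simp add: X_nth[OF _ t])
  also have "\<dots> = expectation (\<lambda>\<omega>. X t \<omega> $ i * (\<phi> t \<bullet> X t \<omega>))"
    by (rule expectation_rmv_discount[OF t0 X_nth_meas[OF t] X_nth_bound[OF _ t]])
  also have "\<dots> = expectation (\<lambda>\<omega>. \<phi> t $ i * X t \<omega> $ i)"
    by (intro Bochner_Integration.integral_cong refl) (use inner_X_mult[OF _ t] in \<open>simp add: mult.commute\<close>)
  also have "\<dots> = \<phi> t $ i * \<P>(\<omega> in M. X t \<omega> = state i)" by (simp add: prob_state_eq[OF t])
  finally have eq: "(LINT \<omega>:?B|M. rmv_discount r h L X T t \<omega>) = \<phi> t $ i * measure M ?B" .
  then show "psi M r h L X T t $ i = \<phi> t $ i"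
    using pos by (simp add: psi_def cond_exp_event_def)
  have "?e * \<P>(\<omega> in M. X t \<omega> = state i) = expectation (\<lambda>\<omega>. ?e * X t \<omega> $ i)" by (simp add: prob_state_eq[OF t])
  also have "\<dots> \<le> expectation (\<lambda>\<omega>. X t \<omega> $ i * rmv_discount r h L X T t \<omega>)"
  proof (rule integral_mono)
    show "integrable M (\<lambda>\<omega>. ?e * X t \<omega> $ i)" using iX by simp
    show "integrable M (\<lambda>\<omega>. X t \<omega> $ i * rmv_discount r h L X T t \<omega>)"
    proof (rule integrable_bounded[of _ "exp (norm (rmv_rate r h L) * T)"])
      show "(\<lambda>\<omega>. X t \<omega> $ i * rmv_discount r h L X T t \<omega>) \<in> borel_measurable M"
        using VM rmv_discount_measurable[OF t0] by (rule borel_measurable_times)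
      show "\<bar>X t \<omega> $ i * rmv_discount r h L X T t \<omega>\<bar> \<le> exp (norm (rmv_rate r h L) * T)" if "\<omega> \<in> space M" for \<omega>
        using discount_bound(1)[OF that t0 order_refl, of "rmv_rate r h L"] discount_pos[of "rmv_rate r h L" t T \<omega>]
        by (simp add: X_nth[OF that t] rmv_discount_eq[OF that t0])
    qed
    show "?e * X t \<omega> $ i \<le> X t \<omega> $ i * rmv_discount r h L X T t \<omega>" if "\<omega> \<in> space M" for \<omega>
      using discount_bound(2)[OF that t0 order_refl, of "rmv_rate r h L"]
      by (simp add: X_nth[OF that t] rmv_discount_eq[OF that t0])
  qed
  also have "\<dots> = \<phi> t $ i * \<P>(\<omega> in M. X t \<omega> = state i)"
    using eq unfolding set_lebesgue_integral_def
    by (subst Bochner_Integration.integral_cong[OF refl, of _ _ "\<lambda>\<omega>. indicator ?B \<omega> *\<^sub>R rmv_discount r h L X T t \<omega>"])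
      (simp_all add: X_nth[OF _ t])
  finally show "\<phi> t $ i \<ge> ?e" using pos by simp
qed

lemma cond_exp_rmv_discount:
  assumes t: "t \<in> {0..T}"
  shows "AE \<omega> in M. real_cond_exp M (F t) (rmv_discount r h L X T t) \<omega> = \<phi> t \<bullet> X t \<omega>"
proof -
  have t0: "0 \<le> t" "t \<le> T" using t by auto
  interpret f: finite_measure_subalgebra M "F t" by unfold_locales (rule sub[OF t])
  have m: "(\<lambda>\<omega>. \<phi> t \<bullet> X t \<omega>) \<in> borel_measurable (F t)"
    by (rule borel_measurable_continuous_on[OF _ X_meas[OF t]]) (intro continuous_intros)
  show ?thesis
  proof (rule f.real_cond_exp_charact)
    fix B assume B: "B \<in> sets (F t)"
    show "(LINT \<omega>:B|M. rmv_discount r h L X T t \<omega>) = (LINT \<omega>:B|M. \<phi> t \<bullet> X t \<omega>)"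
      using expectation_rmv_discount[OF t0, of "indicator B" 1] B
      by (simp add: set_lebesgue_integral_def indicator_def)
  next
    show "integrable M (rmv_discount r h L X T t)"
    proof (rule integrable_bounded[OF rmv_discount_measurable[OF t0]])
      show "\<bar>rmv_discount r h L X T t \<omega>\<bar> \<le> exp (norm (rmv_rate r h L) * T)" if "\<omega> \<in> space M" for \<omega>
        using discount_bound(1)[OF that t0 order_refl, of "rmv_rate r h L"] discount_pos[of "rmv_rate r h L" t T \<omega>]
        by (simp add: rmv_discount_eq[OF that t0])
    qed
    show "integrable M (\<lambda>\<omega>. \<phi> t \<bullet> X t \<omega>)"
      by (rule integrable_bounded[OF measurable_F_M[OF m t] inner_X_bound[OF _ t]])
  qed (rule m)
qed

end

end

text \<open>State by state, \<phi> is integrated by parts against the coordinate of the chain; its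
  own drift brings the discount rate and \<open>AQ\<close>. Adding and subtracting the terms with
  \<open>A\<close> completes the jumps to the chain martingale and leaves \<open>A - AQ\<close> in
  the drift; the intensity is shifted between the drift and the default martingale in the same
  way.\<close>

lemma (in markov_chain) price_path_dynamics:
  fixes A AQ :: "real \<Rightarrow> real^'n^'n" and \<phi> \<psi> :: "real \<Rightarrow> real^'n" and r h L :: "real^'n" and p :: "real \<Rightarrow> 'a \<Rightarrow> real"
  assumes \<omega>: "\<omega> \<in> space M"
    and A: "\<And>i j. set_integrable lborel {0..T} (\<lambda>u. A u $ i $ j)" and AQ: "\<And>i j. set_integrable lborel {0..T} (\<lambda>u. AQ u $ i $ j)"
    and \<phi>c: "continuous_on {0..T} \<phi>"
    and \<phi>d: "\<And>u i. 0 < u \<Longrightarrow> u < T \<Longrightarrow> ((\<lambda>t. \<phi> t $ i) has_real_derivative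
         rmv_rate r h L $ i * \<phi> u $ i - (\<Sum>j\<in>UNIV. AQ u $ i $ j * \<phi> u $ j)) (at u)"
    and \<phi>0: "\<And>u i. 0 < u \<Longrightarrow> u \<le> T \<Longrightarrow> 0 < \<phi> u $ i" and \<psi>: "\<And>u. 0 < u \<Longrightarrow> u \<le> T \<Longrightarrow> \<psi> u = \<phi> u"
    and \<tau>0: "0 \<le> \<tau> \<omega>" and nj: "0 < \<tau> \<omega> \<Longrightarrow> \<tau> \<omega> \<le> T \<Longrightarrow> left_lim (\<lambda>v. X v \<omega>) (\<tau> \<omega>) = X (\<tau> \<omega>) \<omega>"
    and p: "\<And>u. u \<in> {0..T} \<Longrightarrow> p u \<omega> = (1 - default_ind \<tau> u \<omega>) * (\<phi> u \<bullet> X u \<omega>)"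
    and t: "t \<in> {0..T}" "t \<le> \<tau> \<omega>"
  shows "set_integrable lborel {0..t} (\<lambda>u. left_lim (\<lambda>v. p v \<omega>) u *
           (r \<bullet> X u \<omega> + (h \<bullet> X u \<omega>) * (L \<bullet> X u \<omega> - 1) + drift_correction A AQ \<psi> u \<bullet> X u \<omega>)) \<and>
       (\<exists>chain_int default_int.
          has_inner_ls_integral
            (\<lambda>u. (left_lim (\<lambda>v. p v \<omega>) u / (\<psi> u \<bullet> left_lim (\<lambda>v. X v \<omega>) u)) *\<^sub>R \<psi> u)
            (\<lambda>u. chain_mart X A u \<omega>) chain_int 0 t \<and>
          has_ls_integral (\<lambda>u. left_lim (\<lambda>v. p v \<omega>) u) (\<lambda>u. default_mart h X (default_ind \<tau>) u \<omega>) default_int 0 t \<and>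
          p t \<omega> = p 0 \<omega>
            + (LBINT u:{0..t}. left_lim (\<lambda>v. p v \<omega>) u *
                (r \<bullet> X u \<omega> + (h \<bullet> X u \<omega>) * (L \<bullet> X u \<omega> - 1) + drift_correction A AQ \<psi> u \<bullet> X u \<omega>))
            + chain_int - default_int)"
proof -
  define x where "x u = X u \<omega>" for u
  define lx where "lx u = left_lim (\<lambda>v. X v \<omega>) u" for u
  define J where "J = jump_times (\<lambda>v. X v \<omega>) T"
  define c where "c = rmv_rate r h L"
  define lp where "lp u = left_lim (\<lambda>v. p v \<omega>) u" for u
  note xp = X_cadlag[OF \<omega>] X_range[OF \<omega>] T
  have J: "finite J" "J \<subseteq> {0<..T}" using finite_jump_times[OF xp] by (auto simp: J_def jump_times_def)
  have xJ: "x u $ i = x 0 $ i + (\<Sum>s\<in>J. if s \<le> u then (x s - lx s) $ i else 0)" if "u \<in> {0..T}" for u i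
    using arg_cong[OF state_path_eq_sum_jumps[OF xp that], of "\<lambda>v. v $ i"]
    by (simp add: x_def lx_def J_def if_distrib[of "\<lambda>v. v $ i"] cong: if_cong)
  have lxx: "lx u = x u" if "u \<in> {0<..T}" "u \<notin> J" for u using that by (auto simp: J_def jump_times_def lx_def x_def)
  have lxr: "lx u \<in> range state" if "u \<in> {0<..T}" for u unfolding lx_def by (rule state_path_left_lim_range[OF xp that])
  have xr: "x u \<in> range state" if "u \<in> {0..T}" for u unfolding x_def by (rule X_range[OF \<omega> that])
  have tT: "0 \<le> t" "t \<le> T" using t by auto
  have \<phi>ic: "continuous_on {0..b} (\<lambda>u. \<phi> u $ i)" if "b \<le> T" for i b
    by (intro continuous_on_component continuous_on_subset[OF \<phi>c]) (use that in auto)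
  \<comment> \<open>Because \<open>u \<le> t \<le> \<tau> \<omega>\<close>, no default has happened
    strictly before \<open>u\<close>, so the left limit of the price sees only that of the
    chain.\<close>
  have lp: "lp u = \<phi> u \<bullet> lx u" if u: "0 < u" "u \<le> t" for u
  proof -
    have "(\<phi> \<longlongrightarrow> \<phi> u) (at u within {0..T})" using \<phi>c u tT by (auto simp: continuous_on)
    then have "(\<phi> \<longlongrightarrow> \<phi> u) (at u within {0..u})" by (rule tendsto_within_subset) (use u tT in auto)
    then have "(\<phi> \<longlongrightarrow> \<phi> u) (at_left u)" using u by (simp add: at_within_Icc_at_left)
    moreover have "((\<lambda>v. X v \<omega>) \<longlongrightarrow> lx u) (at_left u)"
      unfolding lx_def using u tT by (intro cadlag_on_left_lim[OF X_cadlag[OF \<omega>]]) auto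
    ultimately have "((\<lambda>v. \<phi> v \<bullet> X v \<omega>) \<longlongrightarrow> \<phi> u \<bullet> lx u) (at_left u)" by (rule tendsto_inner)
    then show ?thesis unfolding lp_def
      by (rule left_lim_cong[where a=0]) (use u t in \<open>auto simp: p default_ind_def\<close>)
  qed
  have pos: "\<phi> u \<bullet> y > 0" if "0 < u" "u \<le> T" "y \<in> range state" for u y
    using that \<phi>0 by (auto simp: inner_axis)
  define \<phi>' where "\<phi>' i u = c $ i * \<phi> u $ i - (\<Sum>j\<in>UNIV. AQ u $ i $ j * \<phi> u $ j)" for i u
  have ci: "set_integrable lborel {0..b} (\<lambda>u. k :: real)" for b k :: real by (rule const_path_integrable)
  have sub: "set_integrable lborel {0..b} f" if "set_integrable lborel {0..T} f" "b \<le> T" for f :: "real \<Rightarrow> real" and b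
    by (rule set_integrable_subset[OF that(1)]) (use that(2) in auto)
  have \<phi>i: "set_integrable lborel {0..T} (\<lambda>u. \<phi> u $ i)" for i
    by (rule borel_integrable_atLeastAtMost'[OF \<phi>ic[OF order_refl]])
  have A\<phi>: "set_integrable lborel {0..T} (\<lambda>u. A u $ i $ j * \<phi> u $ k)" "set_integrable lborel {0..T} (\<lambda>u. AQ u $ i $ j * \<phi> u $ k)" for i j k
    using set_integrable_continuous_mult[OF \<phi>ic[OF order_refl] A] set_integrable_continuous_mult[OF \<phi>ic[OF order_refl] AQ]
    by (simp_all add: mult.commute)
  have \<phi>'i: "set_integrable lborel {0..T} (\<phi>' i)" for i
    unfolding \<phi>'_def by (intro set_integral_diff set_integral_finite_sum set_integrable_mult_right impI \<phi>i A\<phi>)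
  have \<phi>int: "\<phi> u $ i = \<phi> 0 $ i + (LBINT v:{0..u}. \<phi>' i v)" if u: "u \<in> {0..T}" for u i
  proof -
    have "\<phi> u $ i - \<phi> 0 $ i = (LBINT v:{0..u}. \<phi>' i v)"
    proof (rule right_deriv_eq_integral)
      show "((\<lambda>t. \<phi> t $ i) has_real_derivative \<phi>' i v) (at_right v)" if "0 < v" "v < u" for v
        unfolding \<phi>'_def c_def by (rule has_field_derivative_at_within[OF \<phi>d]) (use that u in auto)
      show "continuous_on {0..u} (\<lambda>t. \<phi> t $ i)" using u by (intro \<phi>ic) auto
      show "set_integrable lborel {0..u} (\<phi>' i)" by (rule sub[OF \<phi>'i]) (use u in auto)
    qed (use u in auto)
    then show ?thesis by simp
  qed
  have xi: "set_integrable lborel {0..t} (\<lambda>u. f u * x u $ i)" if "set_integrable lborel {0..T} f" for f i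
    using sub[OF state_path_nth_integrable[OF xp that] tT(2)] by (simp add: x_def)
  \<comment> \<open>All integrals reduce to four kinds: \<open>I\<close> for discount and intensity,
    \<open>a\<close> and \<open>b\<close> for the two generators, \<open>K\<close> for the jumps.
    The final identity is linear in them.\<close>
  define I where "I i = (LBINT u:{0..t}. \<phi> u $ i * x u $ i)" for i
  define a where "a i j = (LBINT u:{0..t}. A u $ i $ j * \<phi> u $ j * x u $ i)" for i j
  define b where "b i j = (LBINT u:{0..t}. AQ u $ i $ j * \<phi> u $ j * x u $ i)" for i j
  define K where "K i = (\<Sum>s\<in>J. if s \<le> t then \<phi> s $ i * (x s - lx s) $ i else 0)" for i
  note int1 = xi[OF \<phi>i] and int2 = xi[OF A\<phi>(1)] and int3 = xi[OF A\<phi>(2)]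
  have prod: "\<phi> t $ i * x t $ i = \<phi> 0 $ i * x 0 $ i + (c $ i * I i - (\<Sum>j\<in>UNIV. b i j)) + K i" for i
  proof -
    have "\<phi> t $ i * x t $ i = \<phi> 0 $ i * x 0 $ i + (LBINT u:{0..t}. \<phi>' i u * x u $ i) + K i"
      unfolding K_def by (rule AC_times_step[OF \<phi>'i \<phi>int J xJ t(1)])
    also have "(LBINT u:{0..t}. \<phi>' i u * x u $ i) = (LBINT u:{0..t}. c $ i * (\<phi> u $ i * x u $ i) - (\<Sum>j\<in>UNIV. AQ u $ i $ j * \<phi> u $ j * x u $ i))"
      by (intro set_lebesgue_integral_cong) (auto simp: \<phi>'_def left_diff_distrib sum_distrib_right mult.assoc)
    also have "\<dots> = (LBINT u:{0..t}. c $ i * (\<phi> u $ i * x u $ i)) - (LBINT u:{0..t}. \<Sum>j\<in>UNIV. AQ u $ i $ j * \<phi> u $ j * x u $ i)"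
      by (intro set_integral_diff set_integral_finite_sum set_integrable_mult_right impI int1 int3)
    also have "\<dots> = c $ i * I i - (\<Sum>j\<in>UNIV. b i j)"
      unfolding I_def b_def by (subst set_integral_finite_sum(2)) (auto intro: int3)
    finally show ?thesis .
  qed
  \<comment> \<open>The drift with its quotients cancelled: in state \<open>i\<close> the price
    supplies the factor \<open>\<phi> u $ i\<close>. In this form integrability is visible.\<close>
  define q where "q u = (\<Sum>i\<in>UNIV. (c $ i - h $ i) * (\<phi> u $ i * x u $ i) +
     (\<Sum>j\<in>UNIV. A u $ i $ j * \<phi> u $ j * x u $ i - AQ u $ i $ j * \<phi> u $ j * x u $ i))" for u
  define dr where "dr u = lp u * (r \<bullet> X u \<omega> + (h \<bullet> X u \<omega>) * (L \<bullet> X u \<omega> - 1) + drift_correction A AQ \<psi> u \<bullet> X u \<omega>)" for u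
  have q: "set_integrable lborel {0..t} q" "(LBINT u:{0..t}. q u) = (\<Sum>i\<in>UNIV. (c $ i - h $ i) * I i + (\<Sum>j\<in>UNIV. a i j - b i j))"
  proof -
    have i: "set_integrable lborel {0..t} (\<lambda>u. \<Sum>j\<in>UNIV. A u $ i $ j * \<phi> u $ j * x u $ i - AQ u $ i $ j * \<phi> u $ j * x u $ i)" for i
      by (intro set_integral_diff set_integral_finite_sum int2 int3)
    have i': "set_integrable lborel {0..t} (\<lambda>u. (c $ i - h $ i) * (\<phi> u $ i * x u $ i) +
     (\<Sum>j\<in>UNIV. A u $ i $ j * \<phi> u $ j * x u $ i - AQ u $ i $ j * \<phi> u $ j * x u $ i))" for i
      by (intro set_integral_add set_integrable_mult_right impI int1 i)
    show "set_integrable lborel {0..t} q" unfolding q_def by (intro set_integral_finite_sum i')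
    have "(LBINT u:{0..t}. q u) = (\<Sum>i\<in>UNIV. LBINT u:{0..t}. (c $ i - h $ i) * (\<phi> u $ i * x u $ i) +
     (\<Sum>j\<in>UNIV. A u $ i $ j * \<phi> u $ j * x u $ i - AQ u $ i $ j * \<phi> u $ j * x u $ i))"
      unfolding q_def by (intro set_integral_finite_sum i')
    also have "\<dots> = (\<Sum>i\<in>UNIV. (c $ i - h $ i) * I i + (\<Sum>j\<in>UNIV. a i j - b i j))"
    proof (intro sum.cong refl)
      fix i :: 'n
      have "(LBINT u:{0..t}. (c $ i - h $ i) * (\<phi> u $ i * x u $ i) +
         (\<Sum>j\<in>UNIV. A u $ i $ j * \<phi> u $ j * x u $ i - AQ u $ i $ j * \<phi> u $ j * x u $ i)) =
         (LBINT u:{0..t}. (c $ i - h $ i) * (\<phi> u $ i * x u $ i)) + (LBINT u:{0..t}. \<Sum>j\<in>UNIV. A u $ i $ j * \<phi> u $ j * x u $ i - AQ u $ i $ j * \<phi> u $ j * x u $ i)"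
        by (intro set_integral_add set_integrable_mult_right impI int1 i)
      also have "(LBINT u:{0..t}. \<Sum>j\<in>UNIV. A u $ i $ j * \<phi> u $ j * x u $ i - AQ u $ i $ j * \<phi> u $ j * x u $ i) =
         (\<Sum>j\<in>UNIV. LBINT u:{0..t}. A u $ i $ j * \<phi> u $ j * x u $ i - AQ u $ i $ j * \<phi> u $ j * x u $ i)"
        by (intro set_integral_finite_sum set_integral_diff int2 int3)
      also have "\<dots> = (\<Sum>j\<in>UNIV. a i j - b i j)"
        unfolding a_def b_def by (intro sum.cong refl set_integral_diff int2 int3)
      finally show "(LBINT u:{0..t}. (c $ i - h $ i) * (\<phi> u $ i * x u $ i) +
         (\<Sum>j\<in>UNIV. A u $ i $ j * \<phi> u $ j * x u $ i - AQ u $ i $ j * \<phi> u $ j * x u $ i)) = (c $ i - h $ i) * I i + (\<Sum>j\<in>UNIV. a i j - b i j)"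
        by (simp add: I_def)
    qed
    finally show "(LBINT u:{0..t}. q u) = (\<Sum>i\<in>UNIV. (c $ i - h $ i) * I i + (\<Sum>j\<in>UNIV. a i j - b i j))" .
  qed
  \<comment> \<open>Excluded are time \<open>0\<close>, where \<open>psi\<close> and the left limit
    of the price may be arbitrary, and the jump times, where that left limit belongs to a state
    other than \<open>X u \<omega>\<close>.\<close>
  have off: "indicator {0..t} u *\<^sub>R dr u = indicator {0..t} u *\<^sub>R q u" if "u \<notin> insert 0 J" for u
  proof (cases "u \<in> {0..t}")
    case True
    then have u: "0 < u" "u \<le> t" "u \<le> T" "u \<notin> J" using that tT by auto
    obtain i where i: "x u = axis i 1" using xr[of u] u by auto
    have xi: "X u \<omega> = axis i 1" using i by (simp add: x_def)
    have lpu: "lp u = \<phi> u $ i" using lp[OF u(1,2)] lxx[of u] u i by (simp add: inner_axis)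
    have d: "drift_correction A AQ \<psi> u \<bullet> X u \<omega> = (\<Sum>j\<in>UNIV. (A u $ i $ j - AQ u $ i $ j) * (\<phi> u $ j / \<phi> u $ i))"
      by (simp add: drift_correction_def xi inner_axis \<psi>[OF u(1,3)])
    have "\<phi> u $ i * (\<Sum>j\<in>UNIV. (A u $ i $ j - AQ u $ i $ j) * (\<phi> u $ j / \<phi> u $ i)) = (\<Sum>j\<in>UNIV. (A u $ i $ j - AQ u $ i $ j) * \<phi> u $ j)"
      unfolding sum_distrib_left using \<phi>0[OF u(1,3), of i] by (intro sum.cong refl) simp
    then have "dr u = (c $ i - h $ i) * \<phi> u $ i + (\<Sum>j\<in>UNIV. (A u $ i $ j - AQ u $ i $ j) * \<phi> u $ j)"
      unfolding dr_def lpu d unfolding xi by (simp add: inner_axis c_def rmv_rate_def algebra_simps)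
    also have "\<dots> = q u"
    proof -
      have "q u = (\<Sum>k\<in>UNIV. if k = i then (c $ i - h $ i) * \<phi> u $ i + (\<Sum>j\<in>UNIV. (A u $ i $ j - AQ u $ i $ j) * \<phi> u $ j) else 0)"
        unfolding q_def i by (intro sum.cong refl) (simp add: axis_def left_diff_distrib)
      then show ?thesis by simp
    qed
    finally show ?thesis by simp
  qed simp
  have fin: "finite (insert 0 J)" using J by simp
  have dri: "set_integrable lborel {0..t} dr" "(LBINT u:{0..t}. dr u) = (LBINT u:{0..t}. q u)"
    using lborel_integral_cong_off_finite[OF fin off] q(1) by (simp_all add: set_integrable_def set_lebesgue_integral_def)
  \<comment> \<open>The scalar factor in the integrand equals \<open>1\<close>, as the left limit of
    the price is its denominator; what is integrated is \<phi> itself.\<close>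
  have chain: "has_ls_integral (\<lambda>u. ((lp u / (\<psi> u \<bullet> lx u)) *\<^sub>R \<psi> u) $ i) (\<lambda>u. chain_mart X A u \<omega> $ i) (K i - (\<Sum>k\<in>UNIV. a k i)) 0 t" for i
  proof -
    define w where "w u = (\<Sum>k\<in>UNIV. A u $ k $ i * x u $ k)" for u
    have Axi: "set_integrable lborel {0..t} (\<lambda>u. A u $ k $ i * x u $ k)" for k by (rule xi[OF A])
    have wi: "set_integrable lborel {0..t} w" unfolding w_def by (intro set_integral_finite_sum Axi)
    have fw: "set_integrable lborel {0..t} (\<lambda>u. \<phi> u $ i * w u)"
      by (rule set_integrable_continuous_mult[OF \<phi>ic[OF tT(2)] wi])
    have "has_ls_integral (\<lambda>u. \<phi> u $ i) (\<lambda>u. chain_mart X A u \<omega> $ i) ((LBINT u:{0<..t}. \<phi> u $ i * (- w u)) + (\<Sum>s\<in>{s\<in>J. s \<le> t}. \<phi> s $ i * (x s - lx s) $ i)) 0 t"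
    proof (rule has_ls_integral_AC_jumps[OF tT(1), where C=0])
      show "set_integrable lborel {0..t} (\<lambda>u. - w u)" using wi by (simp add: set_integrable_def)
      show "set_borel_measurable borel {0<..t} (\<lambda>u. \<phi> u $ i)"
        unfolding set_borel_measurable_def
        by (rule borel_measurable_continuous_on_indicator) (use \<phi>ic[OF tT(2), of i] in \<open>auto intro: continuous_on_subset\<close>)
      show "set_integrable lborel {0<..t} (\<lambda>u. \<phi> u $ i * - w u)"
        unfolding set_integral_Ioc_Icc using fw by (simp add: set_integrable_def)
      show "finite {s\<in>J. s \<le> t}" using J by simp
      show "{s\<in>J. s \<le> t} \<subseteq> {0<..t}" using J by auto
      fix u assume u: "u \<in> {0..t}"
      then have uT: "u \<in> {0..T}" using tT by auto
      have 1: "(\<Sum>s\<in>{s\<in>J. s \<le> t}. if s \<le> u then (x s - lx s) $ i else 0) = (\<Sum>s\<in>J. if s \<le> u then (x s - lx s) $ i else 0)"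
        using J u by (intro sum.mono_neutral_left) auto
      have "(LBINT v:{0..u}. - w v) = - (LBINT v:{0..u}. w v)" by (simp add: set_lebesgue_integral_def)
      also have "(LBINT v:{0..u}. w v) = (\<Sum>k\<in>UNIV. LBINT v:{0..u}. A v $ k $ i * x v $ k)"
        unfolding w_def by (intro set_integral_finite_sum set_integrable_subset[OF Axi]) (use u in auto)
      finally show "chain_mart X A u \<omega> $ i = 0 + (LBINT v:{0..u}. - w v) + (\<Sum>s\<in>{s\<in>J. s \<le> t}. if s \<le> u then (x s - lx s) $ i else 0)"
        unfolding 1 using xJ[OF uT, of i] chain_mart_nth[OF A uT \<omega>, of i] by (simp add: x_def)
    qed
    also have "(LBINT u:{0<..t}. \<phi> u $ i * (- w u)) = - (\<Sum>k\<in>UNIV. a k i)"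
    proof -
      have "(LBINT u:{0<..t}. \<phi> u $ i * (- w u)) = - (LBINT u:{0..t}. \<phi> u $ i * w u)"
        unfolding set_integral_Ioc_Icc by (simp add: set_lebesgue_integral_def)
      also have "(LBINT u:{0..t}. \<phi> u $ i * w u) = (LBINT u:{0..t}. \<Sum>k\<in>UNIV. A u $ k $ i * \<phi> u $ i * x u $ k)"
        by (intro set_lebesgue_integral_cong) (auto simp: w_def sum_distrib_left mult_ac)
      also have "\<dots> = (\<Sum>k\<in>UNIV. a k i)" unfolding a_def by (intro set_integral_finite_sum int2)
      finally show ?thesis .
    qed
    also have "(\<Sum>s\<in>{s\<in>J. s \<le> t}. \<phi> s $ i * (x s - lx s) $ i) = K i" unfolding K_def by (rule sum.inter_filter[OF J(1)])
    finally have "has_ls_integral (\<lambda>u. \<phi> u $ i) (\<lambda>u. chain_mart X A u \<omega> $ i) (- (\<Sum>k\<in>UNIV. a k i) + K i) 0 t" .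
    then have "has_ls_integral (\<lambda>u. \<phi> u $ i) (\<lambda>u. chain_mart X A u \<omega> $ i) (K i - (\<Sum>k\<in>UNIV. a k i)) 0 t" by simp
    then show ?thesis
    proof (rule has_ls_integral_cong)
      fix u assume "u \<in> {0<..t}"
      then have u: "0 < u" "u \<le> t" "u \<le> T" using tT by auto
      have "\<phi> u \<bullet> lx u > 0" using lxr[of u] u by (intro pos) auto
      then show "\<phi> u $ i = ((lp u / (\<psi> u \<bullet> lx u)) *\<^sub>R \<psi> u) $ i" by (simp add: lp[OF u(1,2)] \<psi>[OF u(1,3)])
    qed simp
  qed
  \<comment> \<open>Since \<open>t \<le> \<tau> \<omega>\<close>, a default jump can only sit at the
    end, with \<open>\<tau> \<omega> = t\<close>; a default at time \<open>0\<close> is no jump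
    inside the half-open interval.\<close>
  define Jd where "Jd = (if 0 < \<tau> \<omega> \<and> \<tau> \<omega> \<le> t then {\<tau> \<omega>} else {})"
  have def: "has_ls_integral lp (\<lambda>u. default_mart h X (default_ind \<tau>) u \<omega>) ((\<Sum>s\<in>Jd. lp s) - (\<Sum>i\<in>UNIV. h $ i * I i)) 0 t"
  proof -
    define g where "g u = (\<Sum>i\<in>UNIV. \<phi> u $ i * x u $ i)" for u
    have gi: "set_integrable lborel {0..t} g" unfolding g_def by (intro set_integral_finite_sum int1)
    have offg: "indicator {0..t} u *\<^sub>R lp u = indicator {0..t} u *\<^sub>R g u" if "u \<notin> insert 0 J" for u
    proof (cases "u \<in> {0..t}")
      case True
      then show ?thesis using that tT lp[of u] lxx[of u] by (simp add: g_def inner_vec_def)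
    qed simp
    have lpi: "set_integrable lborel {0..t} lp"
      using lborel_integral_cong_off_finite(2)[OF fin offg] gi by (simp add: set_integrable_def)
    then have "set_integrable lborel {0<..t} lp" by (rule set_integrable_subset) auto
    then have lpm: "set_borel_measurable borel {0<..t} lp"
      by (auto simp: set_integrable_def set_borel_measurable_def dest: borel_measurable_integrable)
    have k: "set_integrable lborel {0..t} (\<lambda>u. \<Sum>i\<in>UNIV. h $ i * (\<phi> u $ i * x u $ i))"
      by (intro set_integral_finite_sum set_integrable_mult_right impI int1)
    have offk: "indicator {0..t} u *\<^sub>R (lp u * - (h \<bullet> x u)) = indicator {0..t} u *\<^sub>R (- (\<Sum>i\<in>UNIV. h $ i * (\<phi> u $ i * x u $ i)))" if "u \<notin> insert 0 J" for u
    proof (cases "u \<in> {0..t}")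
      case True
      then have u: "0 < u" "u \<le> t" "u \<le> T" "u \<notin> J" using that tT by auto
      obtain i where i: "x u = axis i 1" using xr[of u] u by auto
      have "lp u = \<phi> u $ i" using lp[OF u(1,2)] lxx[of u] u i by (simp add: inner_axis)
      moreover have "(\<Sum>k\<in>UNIV. h $ k * (\<phi> u $ k * x u $ k)) = (\<Sum>k\<in>UNIV. if k = i then h $ i * \<phi> u $ i else 0)"
        by (intro sum.cong refl) (simp add: i axis_def)
      ultimately show ?thesis by (simp add: i inner_axis)
    qed simp
    have ki: "set_integrable lborel {0..t} (\<lambda>u. lp u * - (h \<bullet> x u))"
      using lborel_integral_cong_off_finite(2)[OF fin offk] k by (simp add: set_integrable_def)
    have kv: "(LBINT u:{0..t}. lp u * - (h \<bullet> x u)) = - (\<Sum>i\<in>UNIV. h $ i * I i)"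
    proof -
      have "(LBINT u:{0..t}. lp u * - (h \<bullet> x u)) = - (LBINT u:{0..t}. \<Sum>i\<in>UNIV. h $ i * (\<phi> u $ i * x u $ i))"
        using lborel_integral_cong_off_finite(1)[OF fin offk] by (simp add: set_lebesgue_integral_def)
      also have "(LBINT u:{0..t}. \<Sum>i\<in>UNIV. h $ i * (\<phi> u $ i * x u $ i)) = (\<Sum>i\<in>UNIV. LBINT u:{0..t}. h $ i * (\<phi> u $ i * x u $ i))"
        by (intro set_integral_finite_sum set_integrable_mult_right impI int1)
      finally show ?thesis by (simp add: I_def)
    qed
    have Hl: "left_lim (\<lambda>v. default_ind \<tau> v \<omega>) u = 0" if "u \<le> \<tau> \<omega>" for u
      by (rule left_lim_eqI[of "u - 1"]) (use that in \<open>auto simp: default_ind_def\<close>)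
    have "has_ls_integral lp (\<lambda>u. default_mart h X (default_ind \<tau>) u \<omega>) ((LBINT u:{0<..t}. lp u * - (h \<bullet> x u)) + (\<Sum>s\<in>Jd. lp s * 1)) 0 t"
    \<comment> \<open>With default at time \<open>0\<close> the indicator equals \<open>1\<close>
      from the start, which is absorbed by the constant.\<close>
    proof (rule has_ls_integral_AC_jumps[OF tT(1), where C="if \<tau> \<omega> = 0 then 1 else 0"])
      have "set_integrable lborel {0..t} (\<lambda>u. h \<bullet> x u)"
        using inner_path_integrable[OF \<omega> order_refl tT(2), of h] by (simp add: x_def)
      then show "set_integrable lborel {0..t} (\<lambda>u. - (h \<bullet> x u))" by (simp add: set_integrable_def)
      show "set_integrable lborel {0<..t} (\<lambda>u. lp u * - (h \<bullet> x u))" unfolding set_integral_Ioc_Icc by (rule ki)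
      show "finite Jd" "Jd \<subseteq> {0<..t}" by (auto simp: Jd_def)
      fix u assume u: "u \<in> {0..t}"
      have "(LBINT v:{0..u}. (1 - left_lim (\<lambda>v. default_ind \<tau> v \<omega>) v) * (h \<bullet> X v \<omega>)) = (LBINT v:{0..u}. h \<bullet> x v)"
        by (intro set_lebesgue_integral_cong) (use u t Hl in \<open>auto simp: x_def\<close>)
      then show "default_mart h X (default_ind \<tau>) u \<omega> = (if \<tau> \<omega> = 0 then 1 else 0) + (LBINT s:{0..u}. - (h \<bullet> x s)) + (\<Sum>s\<in>Jd. if s \<le> u then 1 else 0)"
        using u t \<tau>0 by (auto simp: default_mart_def default_ind_def Jd_def set_lebesgue_integral_def)
    qed (rule lpm)
    then show ?thesis unfolding set_integral_Ioc_Icc kv by simp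
  qed
  have final: "p t \<omega> = p 0 \<omega> + (LBINT u:{0..t}. dr u) + (\<Sum>i\<in>UNIV. K i - (\<Sum>k\<in>UNIV. a k i)) - ((\<Sum>s\<in>Jd. lp s) - (\<Sum>i\<in>UNIV. h $ i * I i))"
  \<comment> \<open>At \<open>t = 0\<close> all integrals vanish and the claim is trivial even after
    an immediate default. For \<open>t > 0\<close> default is later than \<open>0\<close>, which
    gives the formula for \<open>p 0 \<omega>\<close>.\<close>
  proof (cases "t = 0")
    case True
    have z: "(LBINT u:{0}. f u) = 0" for f :: "real \<Rightarrow> real"
    proof -
      have "(LBINT u:{0}. f u) = integral\<^sup>L lborel (\<lambda>u::real. 0)"
        unfolding set_lebesgue_integral_def by (rule lborel_integral_cong_off_finite(1)[of "{0}"]) auto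
      then show ?thesis by simp
    qed
    have "K i = 0" for i unfolding K_def True using J by (intro sum.neutral) auto
    moreover have "Jd = {}" by (simp add: Jd_def True)
    ultimately show ?thesis unfolding I_def a_def True by (simp add: z)
  next
    case False
    then have t0: "0 < t" "0 < \<tau> \<omega>" using tT t by auto
    have p0: "p 0 \<omega> = (\<Sum>i\<in>UNIV. \<phi> 0 $ i * x 0 $ i)"
      using p[of 0] T t0 by (simp add: default_ind_def x_def inner_vec_def)
    have Yt: "\<phi> t \<bullet> x t = p 0 \<omega> + (\<Sum>i\<in>UNIV. c $ i * I i - (\<Sum>j\<in>UNIV. b i j)) + (\<Sum>i\<in>UNIV. K i)"
      unfolding p0 by (simp add: inner_vec_def prod sum.distrib)
    have swap: "(\<Sum>i\<in>UNIV. \<Sum>k\<in>UNIV. a k i) = (\<Sum>i\<in>UNIV. \<Sum>k\<in>UNIV. a i k)" by (rule sum.swap)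
    have "p 0 \<omega> + (LBINT u:{0..t}. dr u) + (\<Sum>i\<in>UNIV. K i - (\<Sum>k\<in>UNIV. a k i)) + (\<Sum>i\<in>UNIV. h $ i * I i) = \<phi> t \<bullet> x t"
      unfolding dri(2) q(2) Yt by (simp add: sum.distrib sum_subtractf left_diff_distrib swap)
    \<comment> \<open>At default the price falls to \<open>0\<close>. What is subtracted is its left
      limit, and this equals \<open>\<phi> t \<bullet> x t\<close> because the chain does not jump
      at that time.\<close>
    moreover have "p t \<omega> = \<phi> t \<bullet> x t - (\<Sum>s\<in>Jd. lp s)"
    proof (cases "\<tau> \<omega> = t")
      case True
      have "lx t = x t" using nj t0 tT by (simp add: True lx_def x_def)
      then show ?thesis using p[OF t(1)] t0 tT lp[of t] by (simp add: Jd_def True default_ind_def)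
    next
      case False
      then show ?thesis using p[OF t(1)] t by (simp add: Jd_def default_ind_def x_def)
    qed
    ultimately show ?thesis by linarith
  qed
  have inner: "has_inner_ls_integral (\<lambda>u. (lp u / (\<psi> u \<bullet> lx u)) *\<^sub>R \<psi> u) (\<lambda>u. chain_mart X A u \<omega>) (\<Sum>i\<in>UNIV. K i - (\<Sum>k\<in>UNIV. a k i)) 0 t"
    unfolding has_inner_ls_integral_def
    by (rule exI[of _ "\<lambda>i. K i - (\<Sum>k\<in>UNIV. a k i)"]) (use chain in simp)
  show ?thesis
    by (intro conjI exI; rule dri(1)[unfolded dr_def lp_def] inner[unfolded lp_def lx_def] def[unfolded lp_def] final[unfolded dr_def lp_def])
qed

text \<open>On a \<open>Q\<close>-null event \<eta> has \<open>P\<close>-integral zero, and strict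
  positivity of \<eta> makes the event \<open>P\<close>-null. The event must belong to
  \<open>G\<close>, as only there is \<eta> the density.\<close>

lemma AE_density_transfer:
  assumes sub: "subalgebra P G" "subalgebra Q G"
    and eq: "restr_to_subalg Q G = density (restr_to_subalg P G) (\<lambda>\<omega>. ennreal (\<eta> \<omega>))"
    and \<eta>: "\<eta> \<in> borel_measurable G" and pos: "AE \<omega> in P. \<eta> \<omega> > 0"
    and B: "B \<in> sets G" and Q: "AE \<omega> in Q. \<omega> \<notin> B"
  shows "AE \<omega> in P. \<omega> \<notin> B"
proof -
  have m: "\<eta> \<in> borel_measurable (restr_to_subalg P G)" "B \<in> sets (restr_to_subalg P G)"
    using \<eta> B sets_restr_to_subalg[OF sub(1)] by (auto cong: measurable_cong_sets)
  have "B \<in> sets Q" using B sub(2) by (auto simp: subalgebra_def)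
  then have "emeasure Q B = 0" using Q by (simp add: AE_iff_measurable[OF _ refl])
      (metis AE_iff_null_sets Q null_setsD1)
  then have "emeasure (restr_to_subalg Q G) B = 0" using emeasure_restr_to_subalg[OF sub(2) B] by simp
  then have "(\<integral>\<^sup>+\<omega>. ennreal (\<eta> \<omega>) * indicator B \<omega> \<partial>(restr_to_subalg P G)) = 0"
    unfolding eq using m by (subst (asm) emeasure_density) auto
  then have "AE \<omega> in restr_to_subalg P G. ennreal (\<eta> \<omega>) * indicator B \<omega> = 0"
    using m by (subst (asm) nn_integral_0_iff_AE) auto
  then have "AE \<omega> in P. ennreal (\<eta> \<omega>) * indicator B \<omega> = 0" by (rule AE_restr_to_subalg[OF sub(1)])
  then show ?thesis using pos by eventually_elim (auto simp: indicator_def split: if_splits)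
qed

lemma set_integrable_bounded_continuous_Ioo:
  fixes f :: "real \<Rightarrow> real"
  assumes c: "continuous_on {a<..<b} f" and b: "\<And>x. x \<in> {a<..<b} \<Longrightarrow> \<bar>f x\<bar> \<le> C"
  shows "set_integrable lborel {a..b} f"
proof -
  have "set_integrable lborel {a<..<b} (\<lambda>_. 1 :: real)" by (cases "a \<le> b") (auto simp: set_integrable_def)
  then have "set_integrable lborel {a<..<b} (\<lambda>x. f x * 1)"
    using borel_measurable_continuous_on_indicator[OF _ c] b
    by (intro set_integrable_bounded_mult[of _ f C]) (auto simp: set_borel_measurable_def)
  then show ?thesis unfolding set_integrable_def
    by (rule lborel_integral_cong_off_finite(2)[THEN iffD1, of "{a, b}", rotated -1]) (auto simp: indicator_def)
qed

text \<open>Rational times accumulate from the right at every time before \<open>T\<close>, so a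
  nonzero difference at \<open>t\<close> would persist at some of them.\<close>

lemma right_continuous_eq:
  fixes f g :: "real \<Rightarrow> real"
  assumes f: "(f \<longlongrightarrow> f t) (at_right t)" and g: "(g \<longlongrightarrow> g t) (at_right t)" and tT: "t < T"
    and eq: "\<And>q. q \<in> \<rat> \<Longrightarrow> t < q \<Longrightarrow> q < T \<Longrightarrow> f q = g q"
  shows "f t = g t"
proof (rule ccontr)
  assume "f t \<noteq> g t"
  then have "f t - g t \<noteq> 0" by simp
  moreover have "((\<lambda>v. f v - g v) \<longlongrightarrow> f t - g t) (at_right t)" by (intro tendsto_diff f g)
  ultimately have "eventually (\<lambda>v. f v - g v \<noteq> 0) (at_right t)" by (intro tendsto_imp_eventually_ne)
  then obtain b where b: "b > t" "\<And>v. t < v \<Longrightarrow> v < b \<Longrightarrow> f v - g v \<noteq> 0"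
    unfolding eventually_at_right[OF tT] by blast
  obtain q where "q \<in> \<rat>" "t < q" "q < min b T" using Rats_dense_in_real[of t "min b T"] b tT by auto
  then show False using b(2)[of q] eq[of q] by auto
qed

lemma rn_generator_nth:
  "i \<noteq> j \<Longrightarrow> rn_generator A \<kappa> t $ i $ j = A t $ i $ j * (1 + \<kappa> t $ i $ j)"
  "rn_generator A \<kappa> t $ i $ i = - (\<Sum>k\<in>UNIV - {i}. rn_generator A \<kappa> t $ i $ k)"
proof -
  show 1: "rn_generator A \<kappa> t $ i $ j = A t $ i $ j * (1 + \<kappa> t $ i $ j)" if "i \<noteq> j" for i j
    using that by (simp add: rn_generator_def)
  have "(\<Sum>k\<in>UNIV - {i}. rn_generator A \<kappa> t $ i $ k) = (\<Sum>k\<in>UNIV - {i}. A t $ i $ k * (1 + \<kappa> t $ i $ k))"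
    by (intro sum.cong refl 1) auto
  then show "rn_generator A \<kappa> t $ i $ i = - (\<Sum>k\<in>UNIV - {i}. rn_generator A \<kappa> t $ i $ k)"
    by (simp add: rn_generator_def)
qed

text \<open>The rows of both generators sum to zero, so \<open>1\<close> may be subtracted from
  every quotient. This needs the diagonal quotient to be \<open>1\<close> and not the
  \<open>0\<close> that division by zero would give.\<close>

lemma drift_correction_alt:
  assumes A: "A t $ i $ i = - (\<Sum>j\<in>UNIV - {i}. A t $ i $ j)" and AQ: "AQ t $ i $ i = - (\<Sum>j\<in>UNIV - {i}. AQ t $ i $ j)"
    and \<psi>: "\<psi> t $ i \<noteq> 0"
  shows "drift_correction A AQ \<psi> t $ i = (\<Sum>j\<in>UNIV - {i}. (A t $ i $ j - AQ t $ i $ j) * (\<psi> t $ j / \<psi> t $ i - 1))"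
proof -
  have "drift_correction A AQ \<psi> t $ i = (A t $ i $ i - AQ t $ i $ i) * (\<psi> t $ i / \<psi> t $ i)
      + (\<Sum>j\<in>UNIV - {i}. (A t $ i $ j - AQ t $ i $ j) * (\<psi> t $ j / \<psi> t $ i))"
    unfolding drift_correction_def by (simp add: sum.remove[of UNIV i])
  also have "(A t $ i $ i - AQ t $ i $ i) * (\<psi> t $ i / \<psi> t $ i) = - (\<Sum>j\<in>UNIV - {i}. A t $ i $ j - AQ t $ i $ j)"
    using \<psi> unfolding A AQ by (simp add: sum_subtractf)
  finally show ?thesis by (simp add: right_diff_distrib sum_subtractf)
qed

text \<open>The function \<open>\<phi>\<close> below is \<open>\<psi>\<close> without its junk values in states of probability zero at time \<open>0\<close>.\<close>

lemma (in markov_chain) psi_backward_equation: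
  fixes AQ :: "real \<Rightarrow> real^'n^'n" and r h L :: "real^'n"
  assumes gen: "\<And>t. t \<in> {0..<T} \<Longrightarrow> continuous (at_right t) AQ \<Longrightarrow> has_generator_at M X AQ t"
    and cont: "\<And>i j. i \<noteq> j \<Longrightarrow> continuous_on {0<..<T} (\<lambda>s. AQ s $ i $ j)"
    and diag: "\<And>t i. AQ t $ i $ i = - (\<Sum>k\<in>UNIV - {i}. AQ t $ i $ k)"
    and nonneg: "\<And>t i j. i \<noteq> j \<Longrightarrow> t \<in> {0..T} \<Longrightarrow> 0 \<le> AQ t $ i $ j"
    and inf: "\<And>i j. i \<noteq> j \<Longrightarrow> 0 < (INF s\<in>{0..T}. \<bar>AQ s $ i $ j\<bar>)"
    and sup: "\<And>i j. i \<noteq> j \<Longrightarrow> bdd_above ((\<lambda>s. \<bar>AQ s $ i $ j\<bar>) ` {0..T})"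
  obtains \<phi> :: "real \<Rightarrow> real^'n"
    where "continuous_on {0..T} \<phi>" "\<phi> T = (\<chi> i. 1)"
      "\<And>u i. 0 < u \<Longrightarrow> u < T \<Longrightarrow> ((\<lambda>t. \<phi> t $ i) has_real_derivative
         rmv_rate r h L $ i * \<phi> u $ i - (\<Sum>j\<in>UNIV. AQ u $ i $ j * \<phi> u $ j)) (at u)"
      "\<And>i j. set_integrable lborel {0..T} (\<lambda>u. AQ u $ i $ j)"
      "\<And>u. 0 < u \<Longrightarrow> u < T \<Longrightarrow> has_generator_at M X AQ u"
      "\<And>t i. 0 < t \<Longrightarrow> t \<le> T \<Longrightarrow> \<P>(\<omega> in M. X t \<omega> = state i) > 0"
proof -
  define c where "c = rmv_rate r h L"
  have "\<exists>K. \<forall>s\<in>{0..T}. \<bar>AQ s $ i $ j\<bar> \<le> K" if "i \<noteq> j" for i j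
    using sup[OF that] by (auto simp: bdd_above_def)
  then obtain Kf where Kf: "\<And>i j s. i \<noteq> j \<Longrightarrow> s \<in> {0..T} \<Longrightarrow> \<bar>AQ s $ i $ j\<bar> \<le> Kf i j" by metis
  \<comment> \<open>One bound for all entries: it dominates the sum over every row, hence also the
    diagonal, which is minus the rest of its row.\<close>
  define K where "K = (\<Sum>i\<in>UNIV. \<Sum>j\<in>UNIV. \<bar>Kf i j\<bar>)"
  have Kr: "(\<Sum>j\<in>S. \<bar>Kf i j\<bar>) \<le> K" for i S
  proof -
    have "(\<Sum>j\<in>S. \<bar>Kf i j\<bar>) \<le> (\<Sum>j\<in>UNIV. \<bar>Kf i j\<bar>)" by (intro sum_mono2) auto
    also have "\<dots> \<le> K" unfolding K_def by (intro member_le_sum[of i]) (auto intro: sum_nonneg)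
    finally show ?thesis .
  qed
  have AK: "\<bar>AQ s $ i $ j\<bar> \<le> K" if s: "s \<in> {0..T}" for s i j
  proof (cases "i = j")
    case True
    have "\<bar>AQ s $ i $ i\<bar> \<le> (\<Sum>k\<in>UNIV - {i}. \<bar>AQ s $ i $ k\<bar>)" unfolding diag by (simp add: sum_abs)
    also have "\<dots> \<le> (\<Sum>k\<in>UNIV - {i}. \<bar>Kf i k\<bar>)" using Kf s by (intro sum_mono) (auto intro: order_trans[OF _ abs_ge_self])
    also have "\<dots> \<le> K" by (rule Kr)
    finally show ?thesis using True by simp
  next
    case False
    then show ?thesis using Kf[OF False s] Kr[of i "{j}"] by simp
  qed
  have AQc: "continuous_on {0<..<T} (\<lambda>s. AQ s $ i $ j)" for i j
  proof (cases "i = j")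
    case True
    have "continuous_on {0<..<T} (\<lambda>s. - (\<Sum>k\<in>UNIV - {i}. AQ s $ i $ k))"
      by (intro continuous_on_minus continuous_on_sum cont) auto
    then show ?thesis using True diag by simp
  qed (rule cont)
  have AQi: "set_integrable lborel {0..T} (\<lambda>u. AQ u $ i $ j)" for i j
    by (rule set_integrable_bounded_continuous_Ioo[OF AQc, where C=K]) (use AK in auto)
  \<comment> \<open>The generator clause under \<open>Q\<close> asks for right-continuity of
    \<open>AQ\<close>, which inside the interval follows from continuity of the entries.\<close>
  have gen': "has_generator_at M X AQ u" if u: "0 < u" "u < T" for u
  proof (rule gen)
    have "((\<lambda>s. AQ s $ i $ j) \<longlongrightarrow> AQ u $ i $ j) (at_right u)" for i j
    proof -
      have "isCont (\<lambda>s. AQ s $ i $ j) u" using AQc[of i j] u by (simp add: continuous_on_eq_continuous_at)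
      then show ?thesis unfolding isCont_def by (rule Lim_at_imp_Lim_at_within)
    qed
    then show "continuous (at_right u) AQ" unfolding continuous_within by (intro vec_tendstoI) auto
  qed (use u in auto)
  \<comment> \<open>The inserted \<open>1\<close> keeps the minimum defined when there is only one
    state.\<close>
  define m where "m = Min (insert 1 ((\<lambda>(i, j). INF s\<in>{0..T}. \<bar>AQ s $ i $ j\<bar>) ` {(i, j). i \<noteq> j}))"
  have fin: "finite (insert 1 ((\<lambda>(i, j). INF s\<in>{0..T}. \<bar>AQ s $ i $ j\<bar>) ` {(i, j). i \<noteq> j}))" by simp
  have m0: "m > 0" unfolding m_def using inf by (subst Min_gr_iff[OF fin]) auto
  have lo: "m \<le> AQ u $ i $ j" if "i \<noteq> j" "0 < u" "u < T" for u i j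
  proof -
    have u: "u \<in> {0..T}" using that by auto
    have "m \<le> (INF s\<in>{0..T}. \<bar>AQ s $ i $ j\<bar>)" unfolding m_def using that(1) by (intro Min_le[OF fin]) auto
    also have "\<dots> \<le> \<bar>AQ u $ i $ j\<bar>" by (rule cINF_lower[OF _ u]) (auto intro: bdd_belowI[of _ 0])
    also have "\<dots> = AQ u $ i $ j" using nonneg[OF that(1) u] by simp
    finally show ?thesis .
  qed
  have K0: "K \<ge> 0" unfolding K_def by (intro sum_nonneg) auto
  have pos: "\<P>(\<omega> in M. X t \<omega> = state i) > 0" if "0 < t" "t \<le> T" for t i
  proof (rule state_prob_pos[OF gen' lo m0 _ K0 that])
    show "- K \<le> AQ u $ i $ i" if "0 < u" "u < T" for u i using AK[of u i i] that by auto
  qed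
  \<comment> \<open>Generator minus the discount rates on the diagonal, so that minus
    \<open>B t *v \<phi> t\<close> is the right side of the backward equation with killing.\<close>
  define B where "B t = (\<chi> i j. AQ t $ i $ j - (if i = j then c $ i else 0))" for t
  obtain \<phi> where \<phi>: "continuous_on {0..T} \<phi>" "\<phi> T = (\<chi> i. 1)"
    "\<And>t. t \<in> {0<..<T} \<Longrightarrow> (\<phi> has_vector_derivative - (B t *v \<phi> t)) (at t)"
  proof (rule linear_terminal_value_problem[of T B "K + norm c" "\<chi> i. 1"])
    show "0 \<le> T" using T by simp
    show "continuous_on {0<..<T} (\<lambda>t. B t $ i $ j)" for i j unfolding B_def by (simp add: continuous_intros AQc)
    show "\<bar>B t $ i $ j\<bar> \<le> K + norm c" if "t \<in> {0<..<T}" for t i j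
    proof -
      have "\<bar>B t $ i $ j\<bar> \<le> \<bar>AQ t $ i $ j\<bar> + \<bar>c $ i\<bar>" by (simp add: B_def abs_triangle_ineq4)
      also have "\<dots> \<le> K + norm c" using AK[of t i j] component_le_norm_cart[of c i] that by (intro add_mono) auto
      finally show ?thesis .
    qed
  qed blast
  show ?thesis
  proof (rule that[OF \<phi>(1,2) _ AQi gen' pos])
    fix u i assume u: "0 < u" "u < T"
    have "((\<lambda>t. \<phi> t $ i) has_vector_derivative (- (B u *v \<phi> u)) $ i) (at u)"
      by (rule bounded_linear.has_vector_derivative[OF bounded_linear_vec_nth \<phi>(3)]) (use u in auto)
    also have "(- (B u *v \<phi> u)) $ i = c $ i * \<phi> u $ i - (\<Sum>j\<in>UNIV. AQ u $ i $ j * \<phi> u $ j)"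
      by (simp add: matrix_vector_mult_def B_def left_diff_distrib sum_subtractf if_distrib[of "\<lambda>x. x * _"] cong: if_cong)
    finally show "((\<lambda>t. \<phi> t $ i) has_real_derivative rmv_rate r h L $ i * \<phi> u $ i - (\<Sum>j\<in>UNIV. AQ u $ i $ j * \<phi> u $ j)) (at u)"
      unfolding c_def by (simp add: has_real_derivative_iff_has_vector_derivative)
  qed
qed

text \<open>The differential is read in integrated form, with one null set for all times; admitting
  \<open>t = \<tau> \<omega>\<close> includes the jump at default. At time \<open>0\<close> the
  second form of the drift correction is tied to states charged by \<open>Q\<close>, because
  \<open>psi\<close> is otherwise \<open>0\<close> through division by zero.\<close>

theorem proposition3p2:
  fixes P Q :: "'a measure"
    and F G :: "real \<Rightarrow> 'a measure"
    and W \<eta> H p \<xi> D :: "real \<Rightarrow> 'a \<Rightarrow> real"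
    and X M :: "real \<Rightarrow> 'a \<Rightarrow> real^'n"
    and A AQ \<kappa> :: "real \<Rightarrow> real^'n^'n"
    and r h L :: "real^'n"
    and Z \<tau> :: "'a \<Rightarrow> real"
    and \<psi> :: "real \<Rightarrow> real^'n"
    and T :: real
  assumes T_pos: "T > 0"
    and market: "historical_market P F W X A"
    and r_pos: "\<And>i. r $ i > 0" and h_pos: "\<And>i. h $ i > 0"
    and default: "default_construction P F X h Z"
    and tau_eq: "\<tau> = default_time h X Z"
    and H_eq: "H = default_ind \<tau>"
    and G_eq: "G = enlarged_filtration P F H"
    and kappa: "kappa_admissible \<kappa>"
    and AQ_eq: "AQ = rn_generator A \<kappa>"
    and eta: "density_process P F X A \<kappa> \<eta>"
    and rn: "risk_neutral P Q F G W X AQ \<eta> T"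
    and price: "bond_price Q F G r h L X H T p"
    and psi_eq: "\<psi> = psi Q r h L X T"
    and D_eq: "D = (\<lambda>t \<omega>. drift_correction A AQ \<psi> t \<bullet> X t \<omega>)"
    and M_eq: "M = chain_mart X A"
    and xi_eq: "\<xi> = default_mart h X H"
    and AQ_C1: "\<And>i j. i \<noteq> j \<Longrightarrow> (\<lambda>s. AQ s $ i $ j) C1_differentiable_on {0<..<T}"
    and AQ_inf: "\<And>i j. i \<noteq> j \<Longrightarrow> 0 < (INF s\<in>{0..T}. \<bar>AQ s $ i $ j\<bar>)"
    and AQ_sup: "\<And>i j. i \<noteq> j \<Longrightarrow> bdd_above ((\<lambda>s. \<bar>AQ s $ i $ j\<bar>) ` {0..T})"
    and AQ_deriv_sup:
      "\<And>i j. i \<noteq> j \<Longrightarrow> bdd_above ((\<lambda>s. \<bar>deriv (\<lambda>u. AQ u $ i $ j) s\<bar>) ` {0<..<T})"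
  shows "(\<forall>i. martingale P F (\<lambda>t \<omega>. M t \<omega> $ i)) \<and>
    martingale P G \<xi> \<and>
    (\<forall>t\<in>{0..T}. \<forall>i. (t = 0 \<longrightarrow> \<P>(\<omega> in Q. X 0 \<omega> = state i) > 0) \<longrightarrow>
       drift_correction A AQ \<psi> t $ i =
         (\<Sum>j\<in>UNIV - {i}. (A t $ i $ j - AQ t $ i $ j) * (\<psi> t $ j / \<psi> t $ i - 1))) \<and>
    (AE \<omega> in P. \<forall>t\<in>{0..T}. t \<le> \<tau> \<omega> \<longrightarrow>
       set_integrable lborel {0..t} (\<lambda>u. left_lim (\<lambda>v. p v \<omega>) u *
           (r \<bullet> X u \<omega> + (h \<bullet> X u \<omega>) * (L \<bullet> X u \<omega> - 1) + D u \<omega>)) \<and>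
       (\<exists>chain_int default_int.
          has_inner_ls_integral
            (\<lambda>u. (left_lim (\<lambda>v. p v \<omega>) u / (\<psi> u \<bullet> left_lim (\<lambda>v. X v \<omega>) u)) *\<^sub>R \<psi> u)
            (\<lambda>u. M u \<omega>) chain_int 0 t \<and>
          has_ls_integral (\<lambda>u. left_lim (\<lambda>v. p v \<omega>) u) (\<lambda>u. \<xi> u \<omega>) default_int 0 t \<and>
          p t \<omega> = p 0 \<omega>
            + (LBINT u:{0..t}. left_lim (\<lambda>v. p v \<omega>) u *
                (r \<bullet> X u \<omega> + (h \<bullet> X u \<omega>) * (L \<bullet> X u \<omega> - 1) + D u \<omega>))
            + chain_int - default_int))"
proof -
  have P: "prob_space P" "usual_filtration P F" "markov_chain_on P F {0..} X" "generator_matrices A"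
    "\<And>t. 0 \<le> t \<Longrightarrow> has_generator_at P X A t"
    using market by (simp_all only: historical_market_def simp_thms)
  interpret dm: default_model P F X h Z
    unfolding default_model_def default_model_axioms_def using P h_pos default by blast
  interpret cP: markov_chain P F X T by (rule markov_chain_restrict[OF P(1-3) T_pos])
  have Hd: "H = default_ind (default_time h X Z)" using H_eq tau_eq by simp
  have Gd: "G = enlarged_filtration P F (default_ind (default_time h X Z))" using G_eq Hd by simp
  have Q: "prob_space Q" "sets Q = sets P"
    "\<And>t. t \<in> {0..T} \<Longrightarrow> restr_to_subalg Q (G t) = density (restr_to_subalg P (G t)) (\<lambda>\<omega>. ennreal (\<eta> t \<omega>))"
    "markov_chain_on Q F {0..T} X"
    "\<And>t. t \<in> {0..<T} \<Longrightarrow> continuous (at_right t) AQ \<Longrightarrow> has_generator_at Q X AQ t"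
    using rn unfolding risk_neutral_def by auto
  have spQ: "space Q = space P" using sets_eq_imp_space_eq[OF Q(2)] .
  have cQ': "markov_chain Q F X T"
    unfolding markov_chain_def markov_chain_axioms_def
    using Q(1,4) T_pos dm.mono_F cP.sub by (auto simp: subalgebra_def spQ Q(2))
  interpret cQ: markov_chain Q F X T by (rule cQ')
  have Adiag: "A t $ i $ i = - (\<Sum>j\<in>UNIV - {i}. A t $ i $ j)" and A0: "j \<noteq> i \<Longrightarrow> 0 \<le> A t $ i $ j" if "0 \<le> t" for t i j
    using P(4) that unfolding generator_matrices_def by blast+
  have Ai: "set_integrable lborel {0..T} (\<lambda>u. A u $ i $ j)" for i j
    using P(4) T_pos unfolding generator_matrices_def by auto
  have AQdiag: "AQ t $ i $ i = - (\<Sum>k\<in>UNIV - {i}. AQ t $ i $ k)" for t i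
    unfolding AQ_eq by (rule rn_generator_nth)
  have AQ0: "0 \<le> AQ t $ i $ j" if "i \<noteq> j" "t \<in> {0..T}" for t i j
  proof -
    have "\<kappa> t $ i $ j > -1" using kappa that by (auto simp: kappa_admissible_def)
    then show ?thesis using A0[of t j i] that unfolding AQ_eq by (simp add: rn_generator_nth)
  qed
  obtain \<phi> where \<phi>: "continuous_on {0..T} \<phi>" "\<phi> T = (\<chi> i. 1)"
    "\<And>u i. 0 < u \<Longrightarrow> u < T \<Longrightarrow> ((\<lambda>t. \<phi> t $ i) has_real_derivative
         rmv_rate r h L $ i * \<phi> u $ i - (\<Sum>j\<in>UNIV. AQ u $ i $ j * \<phi> u $ j)) (at u)"
    and AQi: "\<And>i j. set_integrable lborel {0..T} (\<lambda>u. AQ u $ i $ j)"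
    and gen: "\<And>u. 0 < u \<Longrightarrow> u < T \<Longrightarrow> has_generator_at Q X AQ u"
    and Qpos: "\<And>t i. 0 < t \<Longrightarrow> t \<le> T \<Longrightarrow> \<P>(\<omega> in Q. X t \<omega> = state i) > 0"
  proof (rule cQ.psi_backward_equation[of AQ r h L])
    show "has_generator_at Q X AQ t" if "t \<in> {0..<T}" "continuous (at_right t) AQ" for t using that by (rule Q(5))
    show "continuous_on {0<..<T} (\<lambda>s. AQ s $ i $ j)" if "i \<noteq> j" for i j
      by (rule C1_differentiable_imp_continuous_on[OF AQ_C1[OF that]])
    show "AQ t $ i $ i = - (\<Sum>k\<in>UNIV - {i}. AQ t $ i $ k)" for t i by (rule AQdiag)
    show "0 \<le> AQ t $ i $ j" if "i \<noteq> j" "t \<in> {0..T}" for t i j using that by (rule AQ0)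
    show "0 < (INF s\<in>{0..T}. \<bar>AQ s $ i $ j\<bar>)" if "i \<noteq> j" for i j using that by (rule AQ_inf)
    show "bdd_above ((\<lambda>s. \<bar>AQ s $ i $ j\<bar>) ` {0..T})" if "i \<noteq> j" for i j using that by (rule AQ_sup)
  qed (rule that)
  have \<psi>\<phi>: "\<psi> t $ i = \<phi> t $ i" "0 < \<phi> t $ i"
    if "t \<in> {0..T}" "t = 0 \<Longrightarrow> \<P>(\<omega> in Q. X 0 \<omega> = state i) > 0" for t i
  proof -
    have pos: "\<P>(\<omega> in Q. X t \<omega> = state i) > 0" using that Qpos[of t i] by (cases "t = 0") auto
    show "\<psi> t $ i = \<phi> t $ i" unfolding psi_eq by (rule cQ.psi_eq_solution(1)[OF gen \<phi> that(1) pos])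
    have "exp (- (norm (rmv_rate r h L) * T)) \<le> \<phi> t $ i" by (rule cQ.psi_eq_solution(2)[OF gen \<phi> that(1) pos])
    then show "0 < \<phi> t $ i" by (rule less_le_trans[OF exp_gt_zero])
  qed
  have drift: "drift_correction A AQ \<psi> t $ i = (\<Sum>j\<in>UNIV - {i}. (A t $ i $ j - AQ t $ i $ j) * (\<psi> t $ j / \<psi> t $ i - 1))"
    if "t \<in> {0..T}" "t = 0 \<longrightarrow> \<P>(\<omega> in Q. X 0 \<omega> = state i) > 0" for t i
  proof -
    have "\<psi> t $ i \<noteq> 0" using \<psi>\<phi>[of t i] that by auto
    then show ?thesis using that(1) by (intro drift_correction_alt Adiag AQdiag) auto
  qed
  have \<eta>pos: "AE \<omega> in P. \<forall>t\<in>{0..T}. \<eta> t \<omega> > 0"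
    by (rule density_process_pos[OF T_pos cP.X_cadlag cP.X_range P(4) kappa eta])
  \<comment> \<open>The representation of the price holds \<open>Q\<close>-almost surely. Its
    exceptional event lies in \<open>G t\<close>, where the positive \<eta> is the density, so it is
    also \<open>P\<close>-null.\<close>
  have pt: "AE \<omega> in P. p t \<omega> = (1 - H t \<omega>) * (\<phi> t \<bullet> X t \<omega>)" if t: "t \<in> {0..T}" for t
  proof -
    have t0: "0 \<le> t" using t by simp
    have subP: "subalgebra P (G t)" unfolding Gd by (rule dm.sub_G[OF t0])
    have subQ: "subalgebra Q (G t)" using subP by (simp add: subalgebra_def spQ Q(2))
    have FG: "f \<in> borel_measurable (G t)" if "f \<in> borel_measurable (F t)" for f :: "'a \<Rightarrow> real"
      unfolding Gd by (rule dm.F_meas_G[OF t0 order_refl that])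
    have [measurable]: "p t \<in> borel_measurable (G t)"
      using price t by (auto simp: bond_price_def adapted_on_def)
    have [measurable]: "H t \<in> borel_measurable (G t)" unfolding Gd Hd using t by (intro dm.H_meas_G) auto
    have "(\<lambda>\<omega>. \<phi> t \<bullet> X t \<omega>) \<in> borel_measurable (F t)"
      by (rule borel_measurable_continuous_on[OF _ cP.X_meas[OF t]]) (intro continuous_intros)
    then have [measurable]: "(\<lambda>\<omega>. \<phi> t \<bullet> X t \<omega>) \<in> borel_measurable (G t)" by (rule FG)
    have spG: "space (G t) = space P" using subP by (simp add: subalgebra_def)
    define B where "B = {\<omega>\<in>space (G t). p t \<omega> \<noteq> (1 - H t \<omega>) * (\<phi> t \<bullet> X t \<omega>)}"
    have B: "B \<in> sets (G t)" unfolding B_def by measurable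
    have "AE \<omega> in Q. p t \<omega> = (1 - H t \<omega>) * real_cond_exp Q (F t) (rmv_discount r h L X T t) \<omega>"
      using price t by (auto simp: bond_price_def)
    moreover have "AE \<omega> in Q. real_cond_exp Q (F t) (rmv_discount r h L X T t) \<omega> = \<phi> t \<bullet> X t \<omega>"
      by (rule cQ.cond_exp_rmv_discount[OF gen \<phi> t])
    ultimately have "AE \<omega> in Q. \<omega> \<notin> B" by eventually_elim (simp add: B_def)
    moreover have "\<eta> t \<in> borel_measurable (G t)"
      using eta t by (intro FG) (auto simp: density_process_def adapted_on_def)
    moreover have "AE \<omega> in P. \<eta> t \<omega> > 0" using \<eta>pos t by (auto elim: eventually_mono)
    ultimately have "AE \<omega> in P. \<omega> \<notin> B" using AE_density_transfer[OF subP subQ Q(3)[OF t] _ _ B] by blast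
    then show ?thesis using AE_space by eventually_elim (auto simp: B_def spG)
  qed
  \<comment> \<open>Rational times suffice by right-continuity, except at \<open>T\<close>, to the
    right of which no times are available.\<close>
  have "countable (({0..T} \<inter> \<rat>) \<union> {T})" by (simp add: countable_rat countable_Int2)
  then have "AE \<omega> in P. \<forall>t\<in>({0..T} \<inter> \<rat>) \<union> {T}. p t \<omega> = (1 - H t \<omega>) * (\<phi> t \<bullet> X t \<omega>)"
    by (subst AE_ball_countable) (use pt T_pos in auto)
  then have pall: "AE \<omega> in P. \<forall>t\<in>{0..T}. p t \<omega> = (1 - H t \<omega>) * (\<phi> t \<bullet> X t \<omega>)"
    using AE_space
  proof eventually_elim
    case (elim \<omega>)
    show ?case
    proof
      fix t assume t: "t \<in> {0..T}"
      show "p t \<omega> = (1 - H t \<omega>) * (\<phi> t \<bullet> X t \<omega>)"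
      proof (cases "t = T")
        case False
        then have tT: "0 \<le> t" "t < T" using t by auto
        show ?thesis
        proof (rule right_continuous_eq[OF _ _ tT(2)])
          have "cadlag_on {0..T} (\<lambda>t. p t \<omega>)" using price elim(2) by (auto simp: bond_price_def spQ)
          then show "((\<lambda>t. p t \<omega>) \<longlongrightarrow> p t \<omega>) (at_right t)" using tT by (rule cadlag_on_right)
          have "(\<phi> \<longlongrightarrow> \<phi> t) (at t within {0..T})" using \<phi>(1) t by (auto simp: continuous_on)
          then have "(\<phi> \<longlongrightarrow> \<phi> t) (at t within {t..T})" by (rule tendsto_within_subset) (use tT in auto)
          then have "(\<phi> \<longlongrightarrow> \<phi> t) (at_right t)" using tT by (simp add: at_within_Icc_at_right)
          moreover have "((\<lambda>t. X t \<omega>) \<longlongrightarrow> X t \<omega>) (at_right t)"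
            using cP.X_cadlag[OF elim(2)] tT by (rule cadlag_on_right)
          ultimately show "((\<lambda>t. (1 - H t \<omega>) * (\<phi> t \<bullet> X t \<omega>)) \<longlongrightarrow> (1 - H t \<omega>) * (\<phi> t \<bullet> X t \<omega>)) (at_right t)"
            unfolding Hd by (intro tendsto_intros dm.H_right)
          show "p q \<omega> = (1 - H q \<omega>) * (\<phi> q \<bullet> X q \<omega>)" if "q \<in> \<rat>" "t < q" "q < T" for q
            using elim(1) that tT by auto
        qed
      qed (use elim(1) in auto)
    qed
  qed
  have dyn: "AE \<omega> in P. \<forall>t\<in>{0..T}. t \<le> \<tau> \<omega> \<longrightarrow>
       set_integrable lborel {0..t} (\<lambda>u. left_lim (\<lambda>v. p v \<omega>) u *
           (r \<bullet> X u \<omega> + (h \<bullet> X u \<omega>) * (L \<bullet> X u \<omega> - 1) + D u \<omega>)) \<and>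
       (\<exists>chain_int default_int.
          has_inner_ls_integral
            (\<lambda>u. (left_lim (\<lambda>v. p v \<omega>) u / (\<psi> u \<bullet> left_lim (\<lambda>v. X v \<omega>) u)) *\<^sub>R \<psi> u)
            (\<lambda>u. M u \<omega>) chain_int 0 t \<and>
          has_ls_integral (\<lambda>u. left_lim (\<lambda>v. p v \<omega>) u) (\<lambda>u. \<xi> u \<omega>) default_int 0 t \<and>
          p t \<omega> = p 0 \<omega>
            + (LBINT u:{0..t}. left_lim (\<lambda>v. p v \<omega>) u *
                (r \<bullet> X u \<omega> + (h \<bullet> X u \<omega>) * (L \<bullet> X u \<omega> - 1) + D u \<omega>))
            + chain_int - default_int)"
    using pall dm.no_jump_at_default[OF T_pos] AE_space
  proof eventually_elim
    case (elim \<omega>)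
    show ?case unfolding D_eq M_eq xi_eq H_eq
    proof (intro ballI impI)
      fix t assume t: "t \<in> {0..T}" "t \<le> \<tau> \<omega>"
      show "set_integrable lborel {0..t} (\<lambda>u. left_lim (\<lambda>v. p v \<omega>) u *
           (r \<bullet> X u \<omega> + (h \<bullet> X u \<omega>) * (L \<bullet> X u \<omega> - 1) + drift_correction A AQ \<psi> u \<bullet> X u \<omega>)) \<and>
       (\<exists>chain_int default_int.
          has_inner_ls_integral
            (\<lambda>u. (left_lim (\<lambda>v. p v \<omega>) u / (\<psi> u \<bullet> left_lim (\<lambda>v. X v \<omega>) u)) *\<^sub>R \<psi> u)
            (\<lambda>u. chain_mart X A u \<omega>) chain_int 0 t \<and>
          has_ls_integral (\<lambda>u. left_lim (\<lambda>v. p v \<omega>) u) (\<lambda>u. default_mart h X (default_ind \<tau>) u \<omega>) default_int 0 t \<and>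
          p t \<omega> = p 0 \<omega>
            + (LBINT u:{0..t}. left_lim (\<lambda>v. p v \<omega>) u *
                (r \<bullet> X u \<omega> + (h \<bullet> X u \<omega>) * (L \<bullet> X u \<omega> - 1) + drift_correction A AQ \<psi> u \<bullet> X u \<omega>))
            + chain_int - default_int)"
      proof (rule cP.price_path_dynamics[OF elim(3) Ai AQi \<phi>(1,3)])
        show "0 < \<phi> u $ i" if "0 < u" "u \<le> T" for u i using \<psi>\<phi>(2)[of u i] that by auto
        show "\<psi> u = \<phi> u" if "0 < u" "u \<le> T" for u using \<psi>\<phi>(1)[of u] that by (auto simp: vec_eq_iff)
        show "0 \<le> \<tau> \<omega>" unfolding tau_eq by (rule dm.\<tau>_props(1)[OF elim(3)])
        show "left_lim (\<lambda>v. X v \<omega>) (\<tau> \<omega>) = X (\<tau> \<omega>) \<omega>" if "0 < \<tau> \<omega>" "\<tau> \<omega> \<le> T"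
          using elim(2) that unfolding tau_eq by blast
        show "p u \<omega> = (1 - default_ind \<tau> u \<omega>) * (\<phi> u \<bullet> X u \<omega>)" if "u \<in> {0..T}" for u
          using elim(1) that unfolding H_eq by blast
      qed (use t in auto)
    qed
  qed
  have "martingale P F (\<lambda>t \<omega>. M t \<omega> $ i)" for i
    unfolding M_eq by (rule martingale_chain_mart[OF P])
  moreover have "martingale P G \<xi>"
    unfolding Gd xi_eq Hd by (rule dm.martingale_default_mart)
  ultimately show ?thesis using drift dyn by blast
qed

end
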